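(* Let $X$ be a scheme over $(\mathbf C,\otimes,1)$ such that there exists a Zariski covering $\{U_i\longrightarrow X\}_{i\in I}$ with each $U_i=Spec(A_i)$ affine and each monoid $A_i$ Noetherian. Then $X$ is a Noetherian scheme.
   Context: Standing assumptions: $(\mathbf C,\otimes,1)$ is an abelian symmetric monoidal category with small limits and small colimits such that for every object $X$ the functor $-\otimes X$ preserves colimits. $Comm(\mathbf C)$ is the category of unital commutative monoid objects in $\mathbf C$ (all monoids are unital and commutative), and $A\text{-}Mod$ is the category of modules over $A\in Comm(\mathbf C)$. For every monoid $A$, filtered colimits commute with finite limits in $A\text{-}Mod$. Moreover: (C1) $Hom_{\mathbf C}(1,-)$ preserves filtered colimits, and for every monoid $A$ and every finite (not necessarily filtered) system of $A$-modules of the form $\{A^{r_i}\}_{i\in I}$, $r_i\ge 0$, the canonical map $colim_{i}\,Hom_{A-Mod}(A,A^{r_i})\to Hom_{A-Mod}(A,colim_i A^{r_i})$ is an isomorphism. (C2) For every monoid $A$, every object of $A\text{-}Mod$ is a directed colimit of finitely presented objects, where $M$ is finitely presented if $Hom_{A-Mod}(M,-)$ preserves directed colimits. Schemes (Toën–Vaquié): $Aff_{\mathbf C}:=Comm(\mathbf C)^{op}$, with $Spec(A)$ the object corresponding to $A$. A morphism $Spec(B)\to Spec(A)$ given by $f:A\to B$ is a Zariski open immersion if $f$ is flat ($-\otimes_AB:A\text{-}Mod\to B\text{-}Mod$ preserves finite limits), an epimorphism in $Comm(\mathbf C)$, and of finite presentation (for every filtered system $\{A'_i\}$ in $A/Comm(\mathbf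 C)$ the natural map $colim_i Hom_{A/Comm(\mathbf C)}(B,A'_i)\to Hom_{A/Comm(\mathbf C)}(B,colim_iA'_i)$ is an isomorphism). A family of Zariski open immersions $\{Spec(B_i)\to Spec(A)\}_{i\in I}$ is a Zariski cover if for some finite $I'\subseteq I$ the functors $\{-\otimes_AB_i\}_{i\in I'}$ are conservative ($M=0$ iff all $M\otimes_AB_i=0$, $i\in I'$). These covers define a subcanonical Grothendieck topology on $Aff_{\mathbf C}$; $Sh(Aff_{\mathbf C})$ denotes sheaves of sets, and affine schemes are identified with the sheaves they represent. A subsheaf $F\subseteq Z$ of an affine scheme $Z$ is a Zariski open of $Z$ if it is the image of a morphism $\coprod_i Z_i\to Z$ with each $Z_i\to Z$ a Zariski open immersion of affine schemes; a morphism $F\to G$ in $Sh(Aff_{\mathbf C})$ is a Zariski open immersion if for each affine $Z$ and each $Z\to G$ the morphism $F\times_GZ\to Z$ is a monomorphism whose image is a Zariski open of $Z$. A sheaf $X$ is a scheme over $(\mathbf C,\otimes,1)$ if there are affine schemes $X_i$ and an epimorphism $\coprod_iX_i\to X$ in $Sh(Aff_{\mathbf C})$ with each $X_i\to X$ a Zariski open immersion. A (Zariski) covering of a scheme $X$ is a family of Zariski open immersions $U_i\to X$ with $\coprod_i U_i\to X$ an epimorphism of sheaves. Noetherian: an object $N$ of $A\text{-}Mod$ is finitely generated if for every filtered inductive system $\{M_i\}_{i}$ in $A\text{-}Mod$ connected by monomorphisms, with $M=colim_iM_i$, the canonical map $colim_i Hom_{A-Mod}(N,M_i)\to Hom_{A-Mod}(N,M)$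 is a bijection. The monoid $A$ is Noetherian if every subobject of $A$ in $A\text{-}Mod$ is finitely generated. A scheme $X$ over $(\mathbf C,\otimes,1)$ is Noetherian if for every Zariski open immersion $U\to X$ with $U=Spec(A)$ affine, $A$ is a Noetherian monoid. *)

theory Defs
  imports "HOL-Algebra.Product_Groups" "HOL-Algebra.Coset" "HOL-Algebra.FiniteProduct" "HOL-Library.Equipollence"
begin

section \<open>Categories\<close>

text \<open>Categories are given by hom-sets, which need not be disjoint: in the categories of monoids
  and modules below an arrow of the ambient category is a morphism between all pairs of objects
  for which it is compatible with the structure.\<close>

record ('o, 'a) cat =
  Ob  :: "'o set"
  Hom :: "'o \<Rightarrow> 'o \<Rightarrow> 'a set"
  idt :: "'o \<Rightarrow> 'a"
  cmp :: "'a \<Rightarrow> 'a \<Rightarrow> 'a"  (infixr "\<cdot>\<index>" 70)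

locale category =
  fixes K :: "('o, 'a, 'z) cat_scheme" (structure)
  assumes idt_Hom: "x \<in> Ob K \<Longrightarrow> idt K x \<in> Hom K x x"
    and cmp_Hom: "\<lbrakk>x \<in> Ob K; y \<in> Ob K; z \<in> Ob K; f \<in> Hom K x y; g \<in> Hom K y z\<rbrakk>
      \<Longrightarrow> g \<cdot> f \<in> Hom K x z"
    and idt_left: "\<lbrakk>x \<in> Ob K; y \<in> Ob K; f \<in> Hom K x y\<rbrakk> \<Longrightarrow> idt K y \<cdot> f = f"
    and idt_right: "\<lbrakk>x \<in> Ob K; y \<in> Ob K; f \<in> Hom K x y\<rbrakk> \<Longrightarrow> f \<cdot> idt K x = f"
    and cmp_assoc: "\<lbrakk>w \<in> Ob K; x \<in> Ob K; y \<in> Ob K; z \<in> Ob K;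
        f \<in> Hom K w x; g \<in> Hom K x y; h \<in> Hom K y z\<rbrakk> \<Longrightarrow> (h \<cdot> g) \<cdot> f = h \<cdot> (g \<cdot> f)"

text \<open>As hom-sets may overlap, the arrow part of a functor also takes source and target.\<close>

definition is_functor ::
  "('j, 'k, 'y) cat_scheme \<Rightarrow> ('o, 'a, 'z) cat_scheme \<Rightarrow> ('j \<Rightarrow> 'o) \<Rightarrow> ('j \<Rightarrow> 'j \<Rightarrow> 'k \<Rightarrow> 'a) \<Rightarrow> bool"
where
  "is_functor J K Fo Fa \<longleftrightarrow>
    (\<forall>i\<in>Ob J. Fo i \<in> Ob K) \<and>
    (\<forall>i\<in>Ob J. \<forall>j\<in>Ob J. \<forall>u\<in>Hom J i j. Fa i j u \<in> Hom K (Fo i) (Fo j)) \<and>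
    (\<forall>i\<in>Ob J. Fa i i (idt J i) = idt K (Fo i)) \<and>
    (\<forall>i\<in>Ob J. \<forall>j\<in>Ob J. \<forall>k\<in>Ob J. \<forall>u\<in>Hom J i j. \<forall>v\<in>Hom J j k.
       Fa i k (v \<cdot>\<^bsub>J\<^esub> u) = Fa j k v \<cdot>\<^bsub>K\<^esub> Fa i j u)"

definition is_iso :: "('o, 'a, 'z) cat_scheme \<Rightarrow> 'o \<Rightarrow> 'o \<Rightarrow> 'a \<Rightarrow> bool" where
  "is_iso K x y f \<longleftrightarrow> f \<in> Hom K x y \<and>
    (\<exists>g\<in>Hom K y x. g \<cdot>\<^bsub>K\<^esub> f = idt K x \<and> f \<cdot>\<^bsub>K\<^esub> g = idt K y)"

definition is_mono :: "('o, 'a, 'z) cat_scheme \<Rightarrow> 'o \<Rightarrow> 'o \<Rightarrow> 'a \<Rightarrow> bool" where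
  "is_mono K x y f \<longleftrightarrow> f \<in> Hom K x y \<and>
    (\<forall>t\<in>Ob K. \<forall>g\<in>Hom K t x. \<forall>h\<in>Hom K t x. f \<cdot>\<^bsub>K\<^esub> g = f \<cdot>\<^bsub>K\<^esub> h \<longrightarrow> g = h)"

definition is_epi :: "('o, 'a, 'z) cat_scheme \<Rightarrow> 'o \<Rightarrow> 'o \<Rightarrow> 'a \<Rightarrow> bool" where
  "is_epi K x y f \<longleftrightarrow> f \<in> Hom K x y \<and>
    (\<forall>t\<in>Ob K. \<forall>g\<in>Hom K y t. \<forall>h\<in>Hom K y t. g \<cdot>\<^bsub>K\<^esub> f = h \<cdot>\<^bsub>K\<^esub> f \<longrightarrow> g = h)"


subsection \<open>Limits and colimits\<close>

definition is_cone :: "('o, 'a, 'z) cat_scheme \<Rightarrow> ('j, 'k, 'y) cat_scheme \<Rightarrow> ('j \<Rightarrow> 'o)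
    \<Rightarrow> ('j \<Rightarrow> 'j \<Rightarrow> 'k \<Rightarrow> 'a) \<Rightarrow> 'o \<Rightarrow> ('j \<Rightarrow> 'a) \<Rightarrow> bool" where
  "is_cone K J Fo Fa l p \<longleftrightarrow> l \<in> Ob K \<and> (\<forall>i\<in>Ob J. p i \<in> Hom K l (Fo i)) \<and>
    (\<forall>i\<in>Ob J. \<forall>j\<in>Ob J. \<forall>u\<in>Hom J i j. Fa i j u \<cdot>\<^bsub>K\<^esub> p i = p j)"

definition is_limit :: "('o, 'a, 'z) cat_scheme \<Rightarrow> ('j, 'k, 'y) cat_scheme \<Rightarrow> ('j \<Rightarrow> 'o)
    \<Rightarrow> ('j \<Rightarrow> 'j \<Rightarrow> 'k \<Rightarrow> 'a) \<Rightarrow> 'o \<Rightarrow> ('j \<Rightarrow> 'a) \<Rightarrow> bool" where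
  "is_limit K J Fo Fa l p \<longleftrightarrow> is_cone K J Fo Fa l p \<and>
    (\<forall>m q. is_cone K J Fo Fa m q \<longrightarrow>
      (\<exists>!h. h \<in> Hom K m l \<and> (\<forall>i\<in>Ob J. p i \<cdot>\<^bsub>K\<^esub> h = q i)))"

definition is_cocone :: "('o, 'a, 'z) cat_scheme \<Rightarrow> ('j, 'k, 'y) cat_scheme \<Rightarrow> ('j \<Rightarrow> 'o)
    \<Rightarrow> ('j \<Rightarrow> 'j \<Rightarrow> 'k \<Rightarrow> 'a) \<Rightarrow> 'o \<Rightarrow> ('j \<Rightarrow> 'a) \<Rightarrow> bool" where
  "is_cocone K J Fo Fa l c \<longleftrightarrow> l \<in> Ob K \<and> (\<forall>i\<in>Ob J. c i \<in> Hom K (Fo i) l) \<and>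
    (\<forall>i\<in>Ob J. \<forall>j\<in>Ob J. \<forall>u\<in>Hom J i j. c j \<cdot>\<^bsub>K\<^esub> Fa i j u = c i)"

definition is_colimit :: "('o, 'a, 'z) cat_scheme \<Rightarrow> ('j, 'k, 'y) cat_scheme \<Rightarrow> ('j \<Rightarrow> 'o)
    \<Rightarrow> ('j \<Rightarrow> 'j \<Rightarrow> 'k \<Rightarrow> 'a) \<Rightarrow> 'o \<Rightarrow> ('j \<Rightarrow> 'a) \<Rightarrow> bool" where
  "is_colimit K J Fo Fa l c \<longleftrightarrow> is_cocone K J Fo Fa l c \<and>
    (\<forall>m d. is_cocone K J Fo Fa m d \<longrightarrow>
      (\<exists>!h. h \<in> Hom K l m \<and> (\<forall>i\<in>Ob J. h \<cdot>\<^bsub>K\<^esub> c i = d i)))"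

definition is_product ::
  "('o, 'a, 'z) cat_scheme \<Rightarrow> 'i set \<Rightarrow> ('i \<Rightarrow> 'o) \<Rightarrow> 'o \<Rightarrow> ('i \<Rightarrow> 'a) \<Rightarrow> bool" where
  "is_product K I X l p \<longleftrightarrow> l \<in> Ob K \<and> (\<forall>i\<in>I. p i \<in> Hom K l (X i)) \<and>
    (\<forall>m\<in>Ob K. \<forall>q. (\<forall>i\<in>I. q i \<in> Hom K m (X i)) \<longrightarrow>
      (\<exists>!h. h \<in> Hom K m l \<and> (\<forall>i\<in>I. p i \<cdot>\<^bsub>K\<^esub> h = q i)))"

definition is_coproduct ::
  "('o, 'a, 'z) cat_scheme \<Rightarrow> 'i set \<Rightarrow> ('i \<Rightarrow> 'o) \<Rightarrow> 'o \<Rightarrow> ('i \<Rightarrow> 'a) \<Rightarrow> bool" where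
  "is_coproduct K I X l c \<longleftrightarrow> l \<in> Ob K \<and> (\<forall>i\<in>I. c i \<in> Hom K (X i) l) \<and>
    (\<forall>m\<in>Ob K. \<forall>d. (\<forall>i\<in>I. d i \<in> Hom K (X i) m) \<longrightarrow>
      (\<exists>!h. h \<in> Hom K l m \<and> (\<forall>i\<in>I. h \<cdot>\<^bsub>K\<^esub> c i = d i)))"

definition is_coequalizer ::
  "('o, 'a, 'z) cat_scheme \<Rightarrow> 'o \<Rightarrow> 'o \<Rightarrow> 'a \<Rightarrow> 'a \<Rightarrow> 'o \<Rightarrow> 'a \<Rightarrow> bool" where
  "is_coequalizer K x y f g c q \<longleftrightarrow> c \<in> Ob K \<and> q \<in> Hom K y c \<and> q \<cdot>\<^bsub>K\<^esub> f = q \<cdot>\<^bsub>K\<^esub> g \<and>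
    (\<forall>m\<in>Ob K. \<forall>r\<in>Hom K y m. r \<cdot>\<^bsub>K\<^esub> f = r \<cdot>\<^bsub>K\<^esub> g \<longrightarrow>
      (\<exists>!h. h \<in> Hom K c m \<and> h \<cdot>\<^bsub>K\<^esub> q = r))"


subsection \<open>Universes and kinds of index categories\<close>

text \<open>Smallness is relative to a universe \<open>U\<close>. Only the cardinality of \<open>U\<close> matters, so the
  closure properties of a Grothendieck universe containing an infinite set amount to \<open>|U|\<close> being
  an inaccessible cardinal.\<close>

definition small :: "'u set \<Rightarrow> 'b set \<Rightarrow> bool" where
  "small U S \<longleftrightarrow> S \<prec> U"

definition universe :: "'u set \<Rightarrow> bool" where
  "universe U \<longleftrightarrow>
    small U (UNIV :: nat set) \<and>
    (\<forall>S \<subseteq> U. small U S \<longrightarrow> small U (Pow S)) \<and>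
    (\<forall>\<S> :: 'u set set. small U \<S> \<longrightarrow> (\<forall>S\<in>\<S>. S \<subseteq> U \<and> small U S) \<longrightarrow> small U (\<Union>\<S>))"

text \<open>Every category with small sets of objects and arrows is isomorphic to one whose objects
  and arrows are elements of \<open>U\<close>, and every finite category to one on natural numbers.\<close>

definition small_cat :: "'u set \<Rightarrow> ('u, 'u) cat \<Rightarrow> bool" where
  "small_cat U J \<longleftrightarrow> category J \<and> Ob J \<subseteq> U \<and> small U (Ob J) \<and>
    (\<forall>i\<in>Ob J. \<forall>j\<in>Ob J. Hom J i j \<subseteq> U \<and> small U (Hom J i j))"

definition finite_cat :: "(nat, nat) cat \<Rightarrow> bool" where
  "finite_cat J \<longleftrightarrow> category J \<and> finite (Ob J) \<and> (\<forall>i\<in>Ob J. \<forall>j\<in>Ob J. finite (Hom J i j))"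

definition filtered_cat :: "('j, 'k, 'y) cat_scheme \<Rightarrow> bool" where
  "filtered_cat J \<longleftrightarrow> Ob J \<noteq> {} \<and>
    (\<forall>i\<in>Ob J. \<forall>j\<in>Ob J. \<exists>k\<in>Ob J. Hom J i k \<noteq> {} \<and> Hom J j k \<noteq> {}) \<and>
    (\<forall>i\<in>Ob J. \<forall>j\<in>Ob J. \<forall>u\<in>Hom J i j. \<forall>v\<in>Hom J i j.
       \<exists>k\<in>Ob J. \<exists>w\<in>Hom J j k. w \<cdot>\<^bsub>J\<^esub> u = w \<cdot>\<^bsub>J\<^esub> v)"

text \<open>A directed (pre)ordered set, regarded as a category.\<close>

definition directed_cat :: "('j, 'k, 'y) cat_scheme \<Rightarrow> bool" where
  "directed_cat J \<longleftrightarrow> Ob J \<noteq> {} \<and>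
    (\<forall>i\<in>Ob J. \<forall>j\<in>Ob J. \<forall>u\<in>Hom J i j. \<forall>v\<in>Hom J i j. u = v) \<and>
    (\<forall>i\<in>Ob J. \<forall>j\<in>Ob J. \<exists>k\<in>Ob J. Hom J i k \<noteq> {} \<and> Hom J j k \<noteq> {})"

definition has_small_limits :: "'u set \<Rightarrow> ('o, 'a, 'z) cat_scheme \<Rightarrow> bool" where
  "has_small_limits U K \<longleftrightarrow>
    (\<forall>J Fo Fa. small_cat U J \<longrightarrow> is_functor J K Fo Fa \<longrightarrow> (\<exists>l p. is_limit K J Fo Fa l p))"

definition has_small_colimits :: "'u set \<Rightarrow> ('o, 'a, 'z) cat_scheme \<Rightarrow> bool" where
  "has_small_colimits U K \<longleftrightarrow>
    (\<forall>J Fo Fa. small_cat U J \<longrightarrow> is_functor J K Fo Fa \<longrightarrow> (\<exists>l c. is_colimit K J Fo Fa l c))"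

definition locally_small :: "'u set \<Rightarrow> ('o, 'a, 'z) cat_scheme \<Rightarrow> bool" where
  "locally_small U K \<longleftrightarrow> (\<forall>x\<in>Ob K. \<forall>y\<in>Ob K. small U (Hom K x y))"

definition prod_cat ::
  "('i, 'k, 'y) cat_scheme \<Rightarrow> ('j, 'l, 'z) cat_scheme \<Rightarrow> ('i \<times> 'j, 'k \<times> 'l) cat" where
  "prod_cat I J = \<lparr>Ob = Ob I \<times> Ob J,
     Hom = (\<lambda>x y. Hom I (fst x) (fst y) \<times> Hom J (snd x) (snd y)),
     idt = (\<lambda>x. (idt I (fst x), idt J (snd x))),
     cmp = (\<lambda>g f. (fst g \<cdot>\<^bsub>I\<^esub> fst f, snd g \<cdot>\<^bsub>J\<^esub> snd f))\<rparr>"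

text \<open>The arrow \<open>c\<close> below is the canonical map \<open>colim\<^sub>i lim\<^sub>j F(i,j) \<rightarrow> lim\<^sub>j colim\<^sub>i F(i,j)\<close>;
  \<open>La\<close> and \<open>Ca\<close> are the induced maps between the limits, respectively colimits.\<close>

definition filtered_colimits_commute_with_finite_limits ::
  "'u set \<Rightarrow> ('o, 'a, 'z) cat_scheme \<Rightarrow> bool" where
  "filtered_colimits_commute_with_finite_limits U K \<longleftrightarrow>
    (\<forall>I J Fo Fa L La \<pi> C Ca \<iota> P \<kappa> Q \<rho> c.
      small_cat U I \<longrightarrow> filtered_cat I \<longrightarrow> finite_cat J \<longrightarrow>
      is_functor (prod_cat I J) K Fo Fa \<longrightarrow>
      (\<forall>i\<in>Ob I. is_limit K J (\<lambda>j. Fo (i, j)) (\<lambda>j j' v. Fa (i, j) (i, j') (idt I i, v)) (L i) (\<pi> i)) \<longrightarrow>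
      is_functor I K L La \<longrightarrow>
      (\<forall>i\<in>Ob I. \<forall>i'\<in>Ob I. \<forall>u\<in>Hom I i i'. \<forall>j\<in>Ob J.
         \<pi> i' j \<cdot>\<^bsub>K\<^esub> La i i' u = Fa (i, j) (i', j) (u, idt J j) \<cdot>\<^bsub>K\<^esub> \<pi> i j) \<longrightarrow>
      (\<forall>j\<in>Ob J. is_colimit K I (\<lambda>i. Fo (i, j)) (\<lambda>i i' u. Fa (i, j) (i', j) (u, idt J j)) (C j)
         (\<lambda>i. \<iota> i j)) \<longrightarrow>
      is_functor J K C Ca \<longrightarrow>
      (\<forall>i\<in>Ob I. \<forall>j\<in>Ob J. \<forall>j'\<in>Ob J. \<forall>v\<in>Hom J j j'.
         Ca j j' v \<cdot>\<^bsub>K\<^esub> \<iota> i j = \<iota> i j' \<cdot>\<^bsub>K\<^esub> Fa (i, j) (i, j') (idt I i, v)) \<longrightarrow>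
      is_colimit K I L La P \<kappa> \<longrightarrow> is_limit K J C Ca Q \<rho> \<longrightarrow>
      c \<in> Hom K P Q \<longrightarrow>
      (\<forall>i\<in>Ob I. \<forall>j\<in>Ob J. \<rho> j \<cdot>\<^bsub>K\<^esub> (c \<cdot>\<^bsub>K\<^esub> \<kappa> i) = \<iota> i j \<cdot>\<^bsub>K\<^esub> \<pi> i j) \<longrightarrow>
      is_iso K P Q c)"


subsection \<open>Colimits of hom-sets and the canonical comparison map\<close>

text \<open>The colimit in the category of sets of a functor with object part \<open>S\<close> and arrow part \<open>T\<close>:
  the disjoint union modulo the equivalence relation generated by \<open>(i, x) \<sim> (j, T i j u x)\<close>.\<close>

definition set_colimit ::
  "('j, 'k, 'y) cat_scheme \<Rightarrow> ('j \<Rightarrow> 'x set) \<Rightarrow> ('j \<Rightarrow> 'j \<Rightarrow> 'k \<Rightarrow> 'x \<Rightarrow> 'x) \<Rightarrow> ('j \<times> 'x) set set" where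
  "set_colimit J S T =
    (let R = {((i, x), (j, T i j u x)) | i j u x. i \<in> Ob J \<and> j \<in> Ob J \<and> u \<in> Hom J i j \<and> x \<in> S i}
     in (SIGMA i:Ob J. S i) // (R \<union> R\<inverse>)\<^sup>*)"

text \<open>The canonical map \<open>colim\<^sub>i Hom(n, F i) \<rightarrow> Hom(n, l)\<close> is a bijection, where \<open>(l, c)\<close> is a
  cocone on \<open>F\<close>.\<close>

definition hom_comparison_bij :: "('o, 'a, 'z) cat_scheme \<Rightarrow> 'o \<Rightarrow> ('j, 'k, 'y) cat_scheme
    \<Rightarrow> ('j \<Rightarrow> 'o) \<Rightarrow> ('j \<Rightarrow> 'j \<Rightarrow> 'k \<Rightarrow> 'a) \<Rightarrow> 'o \<Rightarrow> ('j \<Rightarrow> 'a) \<Rightarrow> bool" where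
  "hom_comparison_bij K n J Fo Fa l c \<longleftrightarrow>
    bij_betw (\<lambda>X. the_elem ((\<lambda>(i, x). c i \<cdot>\<^bsub>K\<^esub> x) ` X))
      (set_colimit J (\<lambda>i. Hom K n (Fo i)) (\<lambda>i j u x. Fa i j u \<cdot>\<^bsub>K\<^esub> x)) (Hom K n l)"

definition hom_preserves_filtered_colimits ::
  "'u set \<Rightarrow> ('o, 'a, 'z) cat_scheme \<Rightarrow> 'o \<Rightarrow> bool" where
  "hom_preserves_filtered_colimits U K n \<longleftrightarrow>
    (\<forall>J Fo Fa l c. small_cat U J \<longrightarrow> filtered_cat J \<longrightarrow> is_functor J K Fo Fa \<longrightarrow>
      is_colimit K J Fo Fa l c \<longrightarrow> hom_comparison_bij K n J Fo Fa l c)"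

definition finitely_presented :: "'u set \<Rightarrow> ('o, 'a, 'z) cat_scheme \<Rightarrow> 'o \<Rightarrow> bool" where
  "finitely_presented U K n \<longleftrightarrow> n \<in> Ob K \<and>
    (\<forall>J Fo Fa l c. small_cat U J \<longrightarrow> directed_cat J \<longrightarrow> is_functor J K Fo Fa \<longrightarrow>
      is_colimit K J Fo Fa l c \<longrightarrow> hom_comparison_bij K n J Fo Fa l c)"

definition finitely_generated :: "'u set \<Rightarrow> ('o, 'a, 'z) cat_scheme \<Rightarrow> 'o \<Rightarrow> bool" where
  "finitely_generated U K n \<longleftrightarrow> n \<in> Ob K \<and>
    (\<forall>J Fo Fa l c. small_cat U J \<longrightarrow> filtered_cat J \<longrightarrow> is_functor J K Fo Fa \<longrightarrow>
      (\<forall>i\<in>Ob J. \<forall>j\<in>Ob J. \<forall>u\<in>Hom J i j. is_mono K (Fo i) (Fo j) (Fa i j u)) \<longrightarrow>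
      is_colimit K J Fo Fa l c \<longrightarrow> hom_comparison_bij K n J Fo Fa l c)"


subsection \<open>Abelian categories\<close>

definition is_zero :: "('o, 'a, 'z) cat_scheme \<Rightarrow> 'o \<Rightarrow> bool" where
  "is_zero K z \<longleftrightarrow> z \<in> Ob K \<and> (\<forall>x\<in>Ob K. (\<exists>!f. f \<in> Hom K x z) \<and> (\<exists>!f. f \<in> Hom K z x))"

definition is_zero_arrow :: "('o, 'a, 'z) cat_scheme \<Rightarrow> 'o \<Rightarrow> 'o \<Rightarrow> 'a \<Rightarrow> bool" where
  "is_zero_arrow K x y f \<longleftrightarrow>
    (\<exists>z g h. is_zero K z \<and> g \<in> Hom K x z \<and> h \<in> Hom K z y \<and> f = h \<cdot>\<^bsub>K\<^esub> g)"

definition is_kernel :: "('o, 'a, 'z) cat_scheme \<Rightarrow> 'o \<Rightarrow> 'o \<Rightarrow> 'a \<Rightarrow> 'o \<Rightarrow> 'a \<Rightarrow> bool" where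
  "is_kernel K x y f k i \<longleftrightarrow> k \<in> Ob K \<and> i \<in> Hom K k x \<and> is_zero_arrow K k y (f \<cdot>\<^bsub>K\<^esub> i) \<and>
    (\<forall>m\<in>Ob K. \<forall>r\<in>Hom K m x. is_zero_arrow K m y (f \<cdot>\<^bsub>K\<^esub> r) \<longrightarrow>
      (\<exists>!h. h \<in> Hom K m k \<and> i \<cdot>\<^bsub>K\<^esub> h = r))"

definition is_cokernel :: "('o, 'a, 'z) cat_scheme \<Rightarrow> 'o \<Rightarrow> 'o \<Rightarrow> 'a \<Rightarrow> 'o \<Rightarrow> 'a \<Rightarrow> bool" where
  "is_cokernel K x y f c q \<longleftrightarrow> c \<in> Ob K \<and> q \<in> Hom K y c \<and> is_zero_arrow K x c (q \<cdot>\<^bsub>K\<^esub> f) \<and>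
    (\<forall>m\<in>Ob K. \<forall>r\<in>Hom K y m. is_zero_arrow K x m (r \<cdot>\<^bsub>K\<^esub> f) \<longrightarrow>
      (\<exists>!h. h \<in> Hom K c m \<and> h \<cdot>\<^bsub>K\<^esub> q = r))"

text \<open>Freyd's definition, in which the additive structure is not part of the data.\<close>

locale abelian_category = category K for K :: "('o, 'a, 'z) cat_scheme" (structure) +
  assumes zero_ex: "\<exists>z. is_zero K z"
    and product_ex: "\<lbrakk>x \<in> Ob K; y \<in> Ob K\<rbrakk>
      \<Longrightarrow> \<exists>l p. is_product K UNIV (\<lambda>b. if b then x else y) l p"
    and coproduct_ex: "\<lbrakk>x \<in> Ob K; y \<in> Ob K\<rbrakk>
      \<Longrightarrow> \<exists>l c. is_coproduct K UNIV (\<lambda>b. if b then x else y) l c"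
    and kernel_ex: "\<lbrakk>x \<in> Ob K; y \<in> Ob K; f \<in> Hom K x y\<rbrakk> \<Longrightarrow> \<exists>k i. is_kernel K x y f k i"
    and cokernel_ex: "\<lbrakk>x \<in> Ob K; y \<in> Ob K; f \<in> Hom K x y\<rbrakk> \<Longrightarrow> \<exists>c q. is_cokernel K x y f c q"
    and mono_normal: "\<lbrakk>x \<in> Ob K; y \<in> Ob K; is_mono K x y f\<rbrakk>
      \<Longrightarrow> \<exists>w g. w \<in> Ob K \<and> g \<in> Hom K y w \<and> is_kernel K y w g x f"
    and epi_normal: "\<lbrakk>x \<in> Ob K; y \<in> Ob K; is_epi K x y f\<rbrakk>
      \<Longrightarrow> \<exists>w g. w \<in> Ob K \<and> g \<in> Hom K w x \<and> is_cokernel K w x g y f"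

text \<open>The intrinsic addition on \<open>Hom(x, y)\<close> in an abelian category: \<open>f + g\<close> is the composite of
  \<open>(f, g) : x \<rightarrow> y \<oplus> y\<close> with the codiagonal \<open>y \<oplus> y \<rightarrow> y\<close>. Hom-groups are written
  multiplicatively, as everywhere in HOL-Algebra.\<close>

definition is_hom_sum :: "('o, 'a, 'z) cat_scheme \<Rightarrow> 'o \<Rightarrow> 'o \<Rightarrow> 'a \<Rightarrow> 'a \<Rightarrow> 'a \<Rightarrow> bool" where
  "is_hom_sum K x y f g s \<longleftrightarrow>
    (\<exists>b p c d e. is_product K (UNIV :: bool set) (\<lambda>_. y) b p \<and>
      is_coproduct K (UNIV :: bool set) (\<lambda>_. y) b c \<and>
      (\<forall>i j. if i = j then p i \<cdot>\<^bsub>K\<^esub> c j = idt K y else is_zero_arrow K y y (p i \<cdot>\<^bsub>K\<^esub> c j)) \<and>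
      d \<in> Hom K x b \<and> p True \<cdot>\<^bsub>K\<^esub> d = f \<and> p False \<cdot>\<^bsub>K\<^esub> d = g \<and>
      e \<in> Hom K b y \<and> (\<forall>i. e \<cdot>\<^bsub>K\<^esub> c i = idt K y) \<and>
      s = e \<cdot>\<^bsub>K\<^esub> d)"

definition hom_group :: "('o, 'a, 'z) cat_scheme \<Rightarrow> 'o \<Rightarrow> 'o \<Rightarrow> 'a monoid" where
  "hom_group K x y = \<lparr>carrier = Hom K x y,
     mult = (\<lambda>f g. THE s. is_hom_sum K x y f g s),
     one = (THE f. is_zero_arrow K x y f)\<rparr>"

text \<open>The colimit in the category of abelian groups: the direct sum of the groups \<open>G i\<close> modulo
  the subgroup generated by the differences of \<open>x\<close> in the summand \<open>i\<close> and \<open>T i j u x\<close> in the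
  summand \<open>j\<close>.\<close>

definition sum_injection :: "'j set \<Rightarrow> ('j \<Rightarrow> ('x, 'y) monoid_scheme) \<Rightarrow> 'j \<Rightarrow> 'x \<Rightarrow> 'j \<Rightarrow> 'x" where
  "sum_injection I G i x = (\<lambda>k\<in>I. if k = i then x else \<one>\<^bsub>G k\<^esub>)"

definition ab_colimit_relations ::
  "('j, 'k, 'y) cat_scheme \<Rightarrow> ('j \<Rightarrow> 'x monoid) \<Rightarrow> ('j \<Rightarrow> 'j \<Rightarrow> 'k \<Rightarrow> 'x \<Rightarrow> 'x) \<Rightarrow> ('j \<Rightarrow> 'x) set" where
  "ab_colimit_relations J G T =
    {sum_injection (Ob J) G i x \<otimes>\<^bsub>sum_group (Ob J) G\<^esub>
       inv\<^bsub>sum_group (Ob J) G\<^esub> (sum_injection (Ob J) G j (T i j u x)) | i j u x.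
     i \<in> Ob J \<and> j \<in> Ob J \<and> u \<in> Hom J i j \<and> x \<in> carrier (G i)}"

definition ab_colimit ::
  "('j, 'k, 'y) cat_scheme \<Rightarrow> ('j \<Rightarrow> 'x monoid) \<Rightarrow> ('j \<Rightarrow> 'j \<Rightarrow> 'k \<Rightarrow> 'x \<Rightarrow> 'x)
    \<Rightarrow> ('j \<Rightarrow> 'x) set monoid" where
  "ab_colimit J G T =
    sum_group (Ob J) G Mod generate (sum_group (Ob J) G) (ab_colimit_relations J G T)"

text \<open>For a finite index category \<open>J\<close>: the canonical map \<open>colim\<^sub>i Hom(n, F i) \<rightarrow> Hom(n, l)\<close>, which
  sends the class of a family \<open>x\<close> to the sum of the \<open>c i \<cdot> x i\<close>, is an isomorphism of abelian groups.\<close>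

definition hom_comparison_group_iso :: "('o, 'a, 'z) cat_scheme \<Rightarrow> 'o \<Rightarrow> ('j, 'k, 'y) cat_scheme
    \<Rightarrow> ('j \<Rightarrow> 'o) \<Rightarrow> ('j \<Rightarrow> 'j \<Rightarrow> 'k \<Rightarrow> 'a) \<Rightarrow> 'o \<Rightarrow> ('j \<Rightarrow> 'a) \<Rightarrow> bool" where
  "hom_comparison_group_iso K n J Fo Fa l c \<longleftrightarrow>
    (\<lambda>X. the_elem ((\<lambda>x. \<Otimes>\<^bsub>hom_group K n l\<^esub>i\<in>Ob J. c i \<cdot>\<^bsub>K\<^esub> x i) ` X))
      \<in> iso (ab_colimit J (\<lambda>i. hom_group K n (Fo i)) (\<lambda>i j u x. Fa i j u \<cdot>\<^bsub>K\<^esub> x)) (hom_group K n l)"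


section \<open>Symmetric monoidal categories, monoids and modules\<close>

record ('o, 'a) moncat = "('o, 'a) cat" +
  tens  :: "'o \<Rightarrow> 'o \<Rightarrow> 'o"  (infixr "\<boxtimes>\<index>" 75)
  tensA :: "'a \<Rightarrow> 'a \<Rightarrow> 'a"  (infixr "\<boxdot>\<index>" 75)
  tunit :: 'o
  assoc :: "'o \<Rightarrow> 'o \<Rightarrow> 'o \<Rightarrow> 'a"
  lunit :: "'o \<Rightarrow> 'a"
  runit :: "'o \<Rightarrow> 'a"
  braid :: "'o \<Rightarrow> 'o \<Rightarrow> 'a"

locale symmetric_monoidal_category = category C for C :: "('o, 'a) moncat" (structure) +
  assumes tens_Ob: "\<lbrakk>x \<in> Ob C; y \<in> Ob C\<rbrakk> \<Longrightarrow> x \<boxtimes> y \<in> Ob C"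
    and tunit_Ob: "tunit C \<in> Ob C"
    and tensA_Hom: "\<lbrakk>x \<in> Ob C; x' \<in> Ob C; y \<in> Ob C; y' \<in> Ob C; f \<in> Hom C x x'; g \<in> Hom C y y'\<rbrakk>
      \<Longrightarrow> f \<boxdot> g \<in> Hom C (x \<boxtimes> y) (x' \<boxtimes> y')"
    and tensA_idt: "\<lbrakk>x \<in> Ob C; y \<in> Ob C\<rbrakk> \<Longrightarrow> idt C x \<boxdot> idt C y = idt C (x \<boxtimes> y)"
    and tensA_cmp: "\<lbrakk>x \<in> Ob C; x' \<in> Ob C; x'' \<in> Ob C; y \<in> Ob C; y' \<in> Ob C; y'' \<in> Ob C;
        f \<in> Hom C x x'; f' \<in> Hom C x' x''; g \<in> Hom C y y'; g' \<in> Hom C y' y''\<rbrakk>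
      \<Longrightarrow> (f' \<cdot> f) \<boxdot> (g' \<cdot> g) = (f' \<boxdot> g') \<cdot> (f \<boxdot> g)"
    and assoc_iso: "\<lbrakk>x \<in> Ob C; y \<in> Ob C; z \<in> Ob C\<rbrakk>
      \<Longrightarrow> is_iso C ((x \<boxtimes> y) \<boxtimes> z) (x \<boxtimes> (y \<boxtimes> z)) (assoc C x y z)"
    and lunit_iso: "x \<in> Ob C \<Longrightarrow> is_iso C (tunit C \<boxtimes> x) x (lunit C x)"
    and runit_iso: "x \<in> Ob C \<Longrightarrow> is_iso C (x \<boxtimes> tunit C) x (runit C x)"
    and braid_Hom: "\<lbrakk>x \<in> Ob C; y \<in> Ob C\<rbrakk> \<Longrightarrow> braid C x y \<in> Hom C (x \<boxtimes> y) (y \<boxtimes> x)"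
    and braid_involution: "\<lbrakk>x \<in> Ob C; y \<in> Ob C\<rbrakk> \<Longrightarrow> braid C y x \<cdot> braid C x y = idt C (x \<boxtimes> y)"
    and assoc_natural: "\<lbrakk>x \<in> Ob C; x' \<in> Ob C; y \<in> Ob C; y' \<in> Ob C; z \<in> Ob C; z' \<in> Ob C;
        f \<in> Hom C x x'; g \<in> Hom C y y'; h \<in> Hom C z z'\<rbrakk>
      \<Longrightarrow> assoc C x' y' z' \<cdot> ((f \<boxdot> g) \<boxdot> h) = (f \<boxdot> (g \<boxdot> h)) \<cdot> assoc C x y z"
    and lunit_natural: "\<lbrakk>x \<in> Ob C; y \<in> Ob C; f \<in> Hom C x y\<rbrakk>
      \<Longrightarrow> lunit C y \<cdot> (idt C (tunit C) \<boxdot> f) = f \<cdot> lunit C x"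
    and runit_natural: "\<lbrakk>x \<in> Ob C; y \<in> Ob C; f \<in> Hom C x y\<rbrakk>
      \<Longrightarrow> runit C y \<cdot> (f \<boxdot> idt C (tunit C)) = f \<cdot> runit C x"
    and braid_natural: "\<lbrakk>x \<in> Ob C; x' \<in> Ob C; y \<in> Ob C; y' \<in> Ob C; f \<in> Hom C x x'; g \<in> Hom C y y'\<rbrakk>
      \<Longrightarrow> braid C x' y' \<cdot> (f \<boxdot> g) = (g \<boxdot> f) \<cdot> braid C x y"
    and pentagon: "\<lbrakk>w \<in> Ob C; x \<in> Ob C; y \<in> Ob C; z \<in> Ob C\<rbrakk>
      \<Longrightarrow> assoc C w x (y \<boxtimes> z) \<cdot> assoc C (w \<boxtimes> x) y z
        = (idt C w \<boxdot> assoc C x y z) \<cdot> (assoc C w (x \<boxtimes> y) z \<cdot> (assoc C w x y \<boxdot> idt C z))"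
    and triangle: "\<lbrakk>x \<in> Ob C; y \<in> Ob C\<rbrakk>
      \<Longrightarrow> (idt C x \<boxdot> lunit C y) \<cdot> assoc C x (tunit C) y = runit C x \<boxdot> idt C y"
    and hexagon: "\<lbrakk>x \<in> Ob C; y \<in> Ob C; z \<in> Ob C\<rbrakk>
      \<Longrightarrow> assoc C y z x \<cdot> (braid C x (y \<boxtimes> z) \<cdot> assoc C x y z)
        = (idt C y \<boxdot> braid C x z) \<cdot> (assoc C y x z \<cdot> (braid C x y \<boxdot> idt C z))"

definition tensor_preserves_small_colimits :: "'u set \<Rightarrow> ('o, 'a) moncat \<Rightarrow> bool" where
  "tensor_preserves_small_colimits U C \<longleftrightarrow>
    (\<forall>x\<in>Ob C. \<forall>J Fo Fa l c. small_cat U J \<longrightarrow> is_functor J C Fo Fa \<longrightarrow> is_colimit C J Fo Fa l c \<longrightarrow>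
      is_colimit C J (\<lambda>i. Fo i \<boxtimes>\<^bsub>C\<^esub> x) (\<lambda>i j u. Fa i j u \<boxdot>\<^bsub>C\<^esub> idt C x)
        (l \<boxtimes>\<^bsub>C\<^esub> x) (\<lambda>i. c i \<boxdot>\<^bsub>C\<^esub> idt C x))"


subsection \<open>Commutative monoids\<close>

record ('o, 'a) mon =
  mcar :: 'o
  mmul :: 'a
  muni :: 'a

definition comm_mon :: "('o, 'a) moncat \<Rightarrow> ('o, 'a) mon \<Rightarrow> bool" where
  "comm_mon C A \<longleftrightarrow>
    (let a = mcar A; \<mu> = mmul A; \<eta> = muni A in
      a \<in> Ob C \<and> \<mu> \<in> Hom C (a \<boxtimes>\<^bsub>C\<^esub> a) a \<and> \<eta> \<in> Hom C (tunit C) a \<and>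
      \<mu> \<cdot>\<^bsub>C\<^esub> (\<mu> \<boxdot>\<^bsub>C\<^esub> idt C a) = \<mu> \<cdot>\<^bsub>C\<^esub> ((idt C a \<boxdot>\<^bsub>C\<^esub> \<mu>) \<cdot>\<^bsub>C\<^esub> assoc C a a a) \<and>
      \<mu> \<cdot>\<^bsub>C\<^esub> (\<eta> \<boxdot>\<^bsub>C\<^esub> idt C a) = lunit C a \<and>
      \<mu> \<cdot>\<^bsub>C\<^esub> (idt C a \<boxdot>\<^bsub>C\<^esub> \<eta>) = runit C a \<and>
      \<mu> \<cdot>\<^bsub>C\<^esub> braid C a a = \<mu>)"

definition Comm :: "('o, 'a) moncat \<Rightarrow> (('o, 'a) mon, 'a) cat" where
  "Comm C = \<lparr>Ob = {A. comm_mon C A},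
     Hom = (\<lambda>A B. {f \<in> Hom C (mcar A) (mcar B).
        f \<cdot>\<^bsub>C\<^esub> mmul A = mmul B \<cdot>\<^bsub>C\<^esub> (f \<boxdot>\<^bsub>C\<^esub> f) \<and> f \<cdot>\<^bsub>C\<^esub> muni A = muni B}),
     idt = (\<lambda>A. idt C (mcar A)),
     cmp = cmp C\<rparr>"

definition under_cat :: "('o, 'a, 'z) cat_scheme \<Rightarrow> 'o \<Rightarrow> ('o \<times> 'a, 'a) cat" where
  "under_cat K x = \<lparr>Ob = {(y, g). y \<in> Ob K \<and> g \<in> Hom K x y},
     Hom = (\<lambda>(y, g) (z, h). {f \<in> Hom K y z. f \<cdot>\<^bsub>K\<^esub> g = h}),
     idt = (\<lambda>(y, g). idt K y),
     cmp = cmp K\<rparr>"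


subsection \<open>Modules and base change\<close>

record ('o, 'a) mdl =
  ucar :: 'o
  uact :: 'a

definition is_module :: "('o, 'a) moncat \<Rightarrow> ('o, 'a) mon \<Rightarrow> ('o, 'a) mdl \<Rightarrow> bool" where
  "is_module C A M \<longleftrightarrow>
    (let a = mcar A; m = ucar M; \<alpha> = uact M in
      m \<in> Ob C \<and> \<alpha> \<in> Hom C (m \<boxtimes>\<^bsub>C\<^esub> a) m \<and>
      \<alpha> \<cdot>\<^bsub>C\<^esub> (\<alpha> \<boxdot>\<^bsub>C\<^esub> idt C a) = \<alpha> \<cdot>\<^bsub>C\<^esub> ((idt C m \<boxdot>\<^bsub>C\<^esub> mmul A) \<cdot>\<^bsub>C\<^esub> assoc C m a a) \<and>
      \<alpha> \<cdot>\<^bsub>C\<^esub> (idt C m \<boxdot>\<^bsub>C\<^esub> muni A) = runit C m)"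

definition Mod_cat :: "('o, 'a) moncat \<Rightarrow> ('o, 'a) mon \<Rightarrow> (('o, 'a) mdl, 'a) cat" where
  "Mod_cat C A = \<lparr>Ob = {M. is_module C A M},
     Hom = (\<lambda>M N. {f \<in> Hom C (ucar M) (ucar N).
        f \<cdot>\<^bsub>C\<^esub> uact M = uact N \<cdot>\<^bsub>C\<^esub> (f \<boxdot>\<^bsub>C\<^esub> idt C (mcar A))}),
     idt = (\<lambda>M. idt C (ucar M)),
     cmp = cmp C\<rparr>"

definition self_mdl :: "('o, 'a) mon \<Rightarrow> ('o, 'a) mdl" where
  "self_mdl A = \<lparr>ucar = mcar A, uact = mmul A\<rparr>"

text \<open>For \<open>f : A \<rightarrow> B\<close>, \<open>M \<otimes>\<^sub>A B\<close> is a (chosen) coequalizer of the two maps from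
  \<open>(M \<otimes> A) \<otimes> B\<close> to \<open>M \<otimes> B\<close> given by the action of \<open>A\<close> on \<open>M\<close> and on \<open>B\<close>. The action of \<open>B\<close> and the
  action on arrows are the ones induced by the universal property.\<close>

definition bc_tensor :: "('o, 'a) moncat \<Rightarrow> ('o, 'a) mon \<Rightarrow> ('o, 'a) mon \<Rightarrow> 'a \<Rightarrow> ('o, 'a) mdl
    \<Rightarrow> 'o \<times> 'a" where
  "bc_tensor C A B f M =
    (let a = mcar A; b = mcar B; m = ucar M in
      SOME (t, q). is_coequalizer C ((m \<boxtimes>\<^bsub>C\<^esub> a) \<boxtimes>\<^bsub>C\<^esub> b) (m \<boxtimes>\<^bsub>C\<^esub> b)
        (uact M \<boxdot>\<^bsub>C\<^esub> idt C b)
        ((idt C m \<boxdot>\<^bsub>C\<^esub> (mmul B \<cdot>\<^bsub>C\<^esub> (f \<boxdot>\<^bsub>C\<^esub> idt C b))) \<cdot>\<^bsub>C\<^esub> assoc C m a b) t q)"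

abbreviation bc_proj :: "('o, 'a) moncat \<Rightarrow> ('o, 'a) mon \<Rightarrow> ('o, 'a) mon \<Rightarrow> 'a \<Rightarrow> ('o, 'a) mdl \<Rightarrow> 'a"
  where "bc_proj C A B f M \<equiv> snd (bc_tensor C A B f M)"

definition bc_ob :: "('o, 'a) moncat \<Rightarrow> ('o, 'a) mon \<Rightarrow> ('o, 'a) mon \<Rightarrow> 'a \<Rightarrow> ('o, 'a) mdl
    \<Rightarrow> ('o, 'a) mdl" where
  "bc_ob C A B f M =
    (let b = mcar B; m = ucar M; t = fst (bc_tensor C A B f M); q = bc_proj C A B f M in
      \<lparr>ucar = t,
       uact = (THE \<alpha>. \<alpha> \<in> Hom C (t \<boxtimes>\<^bsub>C\<^esub> b) t \<and>
         \<alpha> \<cdot>\<^bsub>C\<^esub> (q \<boxdot>\<^bsub>C\<^esub> idt C b)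
           = q \<cdot>\<^bsub>C\<^esub> ((idt C m \<boxdot>\<^bsub>C\<^esub> mmul B) \<cdot>\<^bsub>C\<^esub> assoc C m b b))\<rparr>)"

definition bc_arr :: "('o, 'a) moncat \<Rightarrow> ('o, 'a) mon \<Rightarrow> ('o, 'a) mon \<Rightarrow> 'a
    \<Rightarrow> ('o, 'a) mdl \<Rightarrow> ('o, 'a) mdl \<Rightarrow> 'a \<Rightarrow> 'a" where
  "bc_arr C A B f M N h =
    (THE k. k \<in> Hom C (ucar (bc_ob C A B f M)) (ucar (bc_ob C A B f N)) \<and>
      k \<cdot>\<^bsub>C\<^esub> bc_proj C A B f M = bc_proj C A B f N \<cdot>\<^bsub>C\<^esub> (h \<boxdot>\<^bsub>C\<^esub> idt C (mcar B)))"


subsection \<open>The standing assumptions\<close>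

definition cond_C1 :: "'u set \<Rightarrow> ('o, 'a) moncat \<Rightarrow> bool" where
  "cond_C1 U C \<longleftrightarrow>
    hom_preserves_filtered_colimits U C (tunit C) \<and>
    (\<forall>A J Fo Fa l c. comm_mon C A \<longrightarrow> finite_cat J \<longrightarrow> is_functor J (Mod_cat C A) Fo Fa \<longrightarrow>
      (\<forall>i\<in>Ob J. \<exists>(r::nat) e. is_coproduct (Mod_cat C A) {..<r} (\<lambda>_. self_mdl A) (Fo i) e) \<longrightarrow>
      is_colimit (Mod_cat C A) J Fo Fa l c \<longrightarrow>
      hom_comparison_group_iso (Mod_cat C A) (self_mdl A) J Fo Fa l c)"

definition cond_C2 :: "'u set \<Rightarrow> ('o, 'a) moncat \<Rightarrow> bool" where
  "cond_C2 U C \<longleftrightarrow>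
    (\<forall>A M. comm_mon C A \<longrightarrow> is_module C A M \<longrightarrow>
      (\<exists>J Fo Fa c. small_cat U J \<and> directed_cat J \<and> is_functor J (Mod_cat C A) Fo Fa \<and>
        (\<forall>i\<in>Ob J. finitely_presented U (Mod_cat C A) (Fo i)) \<and>
        is_colimit (Mod_cat C A) J Fo Fa M c))"

locale relative_geometry_setting =
  fixes U :: "'u set" and C :: "('o, 'a) moncat"
  assumes universe: "universe U"
    and symmetric_monoidal: "symmetric_monoidal_category C"
    and abelian: "abelian_category C"
    and locally_small: "locally_small U C"
    and small_limits: "has_small_limits U C"
    and small_colimits: "has_small_colimits U C"
    and tensor_colimits: "tensor_preserves_small_colimits U C"
    and filtered_exact: "comm_mon C A
      \<Longrightarrow> filtered_colimits_commute_with_finite_limits U (Mod_cat C A)"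
    and C1: "cond_C1 U C"
    and C2: "cond_C2 U C"


section \<open>The Zariski topology on affine schemes\<close>

text \<open>A morphism \<open>Spec B \<rightarrow> Spec A\<close> is represented by the corresponding arrow \<open>f : A \<rightarrow> B\<close> of
  commutative monoids.\<close>

definition flat :: "('o, 'a) moncat \<Rightarrow> ('o, 'a) mon \<Rightarrow> ('o, 'a) mon \<Rightarrow> 'a \<Rightarrow> bool" where
  "flat C A B f \<longleftrightarrow>
    (\<forall>J Fo Fa l p. finite_cat J \<longrightarrow> is_functor J (Mod_cat C A) Fo Fa \<longrightarrow>
      is_limit (Mod_cat C A) J Fo Fa l p \<longrightarrow>
      is_limit (Mod_cat C B) J (\<lambda>i. bc_ob C A B f (Fo i))
        (\<lambda>i j u. bc_arr C A B f (Fo i) (Fo j) (Fa i j u))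
        (bc_ob C A B f l) (\<lambda>i. bc_arr C A B f l (Fo i) (p i)))"

definition of_finite_presentation ::
  "'u set \<Rightarrow> ('o, 'a) moncat \<Rightarrow> ('o, 'a) mon \<Rightarrow> ('o, 'a) mon \<Rightarrow> 'a \<Rightarrow> bool" where
  "of_finite_presentation U C A B f \<longleftrightarrow>
    hom_preserves_filtered_colimits U (under_cat (Comm C) A) (B, f)"

definition zariski_immersion ::
  "'u set \<Rightarrow> ('o, 'a) moncat \<Rightarrow> ('o, 'a) mon \<Rightarrow> ('o, 'a) mon \<Rightarrow> 'a \<Rightarrow> bool" where
  "zariski_immersion U C A B f \<longleftrightarrow> A \<in> Ob (Comm C) \<and> B \<in> Ob (Comm C) \<and> f \<in> Hom (Comm C) A B \<and>
    flat C A B f \<and> is_epi (Comm C) A B f \<and> of_finite_presentation U C A B f"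

text \<open>A family \<open>{Spec B \<rightarrow> Spec A}\<close> is given by the set of its members \<open>(B, f)\<close>.\<close>

definition conservative_family ::
  "('o, 'a) moncat \<Rightarrow> ('o, 'a) mon \<Rightarrow> (('o, 'a) mon \<times> 'a) set \<Rightarrow> bool" where
  "conservative_family C A W \<longleftrightarrow>
    (\<forall>M\<in>Ob (Mod_cat C A). is_zero (Mod_cat C A) M \<longleftrightarrow>
      (\<forall>(B, f)\<in>W. is_zero (Mod_cat C B) (bc_ob C A B f M)))"

definition zariski_cover ::
  "'u set \<Rightarrow> ('o, 'a) moncat \<Rightarrow> ('o, 'a) mon \<Rightarrow> (('o, 'a) mon \<times> 'a) set \<Rightarrow> bool" where
  "zariski_cover U C A W \<longleftrightarrow> A \<in> Ob (Comm C) \<and> (\<forall>(B, f)\<in>W. zariski_immersion U C A B f) \<and>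
    (\<exists>W'\<subseteq>W. finite W' \<and> conservative_family C A W')"


section \<open>Sheaves\<close>

text \<open>A presheaf of sets on \<open>Aff = Comm(C)\<^sup>o\<^sup>p\<close>, i.e. a covariant functor from \<open>Comm(C)\<close> to sets:
  sections and restriction maps \<open>res A B f : sec A \<rightarrow> sec B\<close> for \<open>f : A \<rightarrow> B\<close>.\<close>

record ('c, 'a, 'x) psh =
  sec :: "'c \<Rightarrow> 'x set"
  res :: "'c \<Rightarrow> 'c \<Rightarrow> 'a \<Rightarrow> 'x \<Rightarrow> 'x"

definition is_presheaf :: "('o, 'a) moncat \<Rightarrow> (('o, 'a) mon, 'a, 'x) psh \<Rightarrow> bool" where
  "is_presheaf C F \<longleftrightarrow>
    (\<forall>A\<in>Ob (Comm C). \<forall>B\<in>Ob (Comm C). \<forall>f\<in>Hom (Comm C) A B. \<forall>s\<in>sec F A. res F A B f s \<in> sec F B) \<and>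
    (\<forall>A\<in>Ob (Comm C). \<forall>s\<in>sec F A. res F A A (idt (Comm C) A) s = s) \<and>
    (\<forall>A\<in>Ob (Comm C). \<forall>B\<in>Ob (Comm C). \<forall>D\<in>Ob (Comm C).
      \<forall>f\<in>Hom (Comm C) A B. \<forall>g\<in>Hom (Comm C) B D. \<forall>s\<in>sec F A.
        res F A D (g \<cdot>\<^bsub>Comm C\<^esub> f) s = res F B D g (res F A B f s))"

definition matching_family :: "('o, 'a) moncat \<Rightarrow> (('o, 'a) mon, 'a, 'x) psh
    \<Rightarrow> (('o, 'a) mon \<times> 'a) set \<Rightarrow> (('o, 'a) mon \<times> 'a \<Rightarrow> 'x) \<Rightarrow> bool" where
  "matching_family C F W x \<longleftrightarrow>
    (\<forall>(B, f)\<in>W. x (B, f) \<in> sec F B) \<and>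
    (\<forall>(B, f)\<in>W. \<forall>(B', f')\<in>W. \<forall>D\<in>Ob (Comm C). \<forall>g\<in>Hom (Comm C) B D. \<forall>g'\<in>Hom (Comm C) B' D.
      g \<cdot>\<^bsub>Comm C\<^esub> f = g' \<cdot>\<^bsub>Comm C\<^esub> f' \<longrightarrow> res F B D g (x (B, f)) = res F B' D g' (x (B', f')))"

definition is_sheaf :: "'u set \<Rightarrow> ('o, 'a) moncat \<Rightarrow> (('o, 'a) mon, 'a, 'x) psh \<Rightarrow> bool" where
  "is_sheaf U C F \<longleftrightarrow> is_presheaf C F \<and>
    (\<forall>A W x. zariski_cover U C A W \<longrightarrow> matching_family C F W x \<longrightarrow>
      (\<exists>!s. s \<in> sec F A \<and> (\<forall>(B, f)\<in>W. res F A B f s = x (B, f))))"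

definition sheaf_mor :: "'u set \<Rightarrow> ('o, 'a) moncat \<Rightarrow> (('o, 'a) mon, 'a, 'x) psh
    \<Rightarrow> (('o, 'a) mon, 'a, 'y) psh \<Rightarrow> (('o, 'a) mon \<Rightarrow> 'x \<Rightarrow> 'y) \<Rightarrow> bool" where
  "sheaf_mor U C F G \<phi> \<longleftrightarrow> is_sheaf U C F \<and> is_sheaf U C G \<and>
    (\<forall>A\<in>Ob (Comm C). \<forall>s\<in>sec F A. \<phi> A s \<in> sec G A) \<and>
    (\<forall>A\<in>Ob (Comm C). \<forall>B\<in>Ob (Comm C). \<forall>f\<in>Hom (Comm C) A B. \<forall>s\<in>sec F A.
      \<phi> B (res F A B f s) = res G A B f (\<phi> A s))"

text \<open>Equality of morphisms of sheaves with source \<open>F\<close>; values outside the sections are junk.\<close>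

definition mor_eq :: "('o, 'a) moncat \<Rightarrow> (('o, 'a) mon, 'a, 'x) psh
    \<Rightarrow> (('o, 'a) mon \<Rightarrow> 'x \<Rightarrow> 'y) \<Rightarrow> (('o, 'a) mon \<Rightarrow> 'x \<Rightarrow> 'y) \<Rightarrow> bool" where
  "mor_eq C F \<phi> \<psi> \<longleftrightarrow> (\<forall>A\<in>Ob (Comm C). \<forall>s\<in>sec F A. \<phi> A s = \<psi> A s)"

text \<open>Monomorphisms and epimorphisms are tested against sheaves whose sections are sets of pairs
  \<open>(B, f)\<close>. Up to isomorphism these include the representable sheaves (as singletons), which detect
  monomorphisms, and the sheaf of closed sieves (the subobject classifier), which detects
  epimorphisms; so the restriction on the values of the test sheaf does not change the notions.\<close>

type_synonym ('o, 'a) test_sheaf = "(('o, 'a) mon, 'a, (('o, 'a) mon \<times> 'a) set) psh"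

definition sheaf_mono :: "'u set \<Rightarrow> ('o, 'a) moncat \<Rightarrow> (('o, 'a) mon, 'a, 'x) psh
    \<Rightarrow> (('o, 'a) mon, 'a, 'y) psh \<Rightarrow> (('o, 'a) mon \<Rightarrow> 'x \<Rightarrow> 'y) \<Rightarrow> bool" where
  "sheaf_mono U C F G \<phi> \<longleftrightarrow> sheaf_mor U C F G \<phi> \<and>
    (\<forall>(T :: ('o, 'a) test_sheaf) g h. sheaf_mor U C T F g \<longrightarrow> sheaf_mor U C T F h \<longrightarrow>
      mor_eq C T (\<lambda>A s. \<phi> A (g A s)) (\<lambda>A s. \<phi> A (h A s)) \<longrightarrow> mor_eq C T g h)"

text \<open>A morphism out of a coproduct of sheaves is the same as a family of morphisms out of the
  summands. Hence \<open>\<Coprod>\<^sub>i F\<^sub>i \<rightarrow> G\<close> is an epimorphism iff the family \<open>F\<^sub>i \<rightarrow> G\<close> is jointly right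
  cancellable, and the image of \<open>\<Coprod>\<^sub>i F\<^sub>i \<rightarrow> G\<close> is the smallest subsheaf of \<open>G\<close> through which
  all \<open>F\<^sub>i \<rightarrow> G\<close> factor.\<close>

definition coproduct_epi :: "'u set \<Rightarrow> ('o, 'a) moncat \<Rightarrow> 'i set
    \<Rightarrow> ('i \<Rightarrow> (('o, 'a) mon, 'a, 'x) psh) \<Rightarrow> ('i \<Rightarrow> ('o, 'a) mon \<Rightarrow> 'x \<Rightarrow> 'y)
    \<Rightarrow> (('o, 'a) mon, 'a, 'y) psh \<Rightarrow> bool" where
  "coproduct_epi U C I Fs \<phi>s G \<longleftrightarrow> (\<forall>i\<in>I. sheaf_mor U C (Fs i) G (\<phi>s i)) \<and>
    (\<forall>(T :: ('o, 'a) test_sheaf) g h. sheaf_mor U C G T g \<longrightarrow> sheaf_mor U C G T h \<longrightarrow>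
      (\<forall>i\<in>I. mor_eq C (Fs i) (\<lambda>A s. g A (\<phi>s i A s)) (\<lambda>A s. h A (\<phi>s i A s))) \<longrightarrow> mor_eq C G g h)"

definition subsheaf :: "'u set \<Rightarrow> ('o, 'a) moncat \<Rightarrow> (('o, 'a) mon, 'a, 'x) psh
    \<Rightarrow> (('o, 'a) mon \<Rightarrow> 'x set) \<Rightarrow> bool" where
  "subsheaf U C G S \<longleftrightarrow> (\<forall>A\<in>Ob (Comm C). S A \<subseteq> sec G A) \<and> is_sheaf U C \<lparr>sec = S, res = res G\<rparr>"

definition coproduct_image :: "'u set \<Rightarrow> ('o, 'a) moncat \<Rightarrow> 'i set
    \<Rightarrow> ('i \<Rightarrow> (('o, 'a) mon, 'a, 'x) psh) \<Rightarrow> ('i \<Rightarrow> ('o, 'a) mon \<Rightarrow> 'x \<Rightarrow> 'y)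
    \<Rightarrow> (('o, 'a) mon, 'a, 'y) psh \<Rightarrow> (('o, 'a) mon \<Rightarrow> 'y set) \<Rightarrow> bool" where
  "coproduct_image U C I Fs \<phi>s G S \<longleftrightarrow> (\<forall>i\<in>I. sheaf_mor U C (Fs i) G (\<phi>s i)) \<and>
    subsheaf U C G S \<and> (\<forall>i\<in>I. \<forall>D\<in>Ob (Comm C). \<phi>s i D ` sec (Fs i) D \<subseteq> S D) \<and>
    (\<forall>S'. subsheaf U C G S' \<longrightarrow> (\<forall>i\<in>I. \<forall>D\<in>Ob (Comm C). \<phi>s i D ` sec (Fs i) D \<subseteq> S' D) \<longrightarrow>
      (\<forall>D\<in>Ob (Comm C). S D \<subseteq> S' D))"

abbreviation sheaf_image :: "'u set \<Rightarrow> ('o, 'a) moncat \<Rightarrow> (('o, 'a) mon, 'a, 'x) psh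
    \<Rightarrow> (('o, 'a) mon, 'a, 'y) psh \<Rightarrow> (('o, 'a) mon \<Rightarrow> 'x \<Rightarrow> 'y) \<Rightarrow> (('o, 'a) mon \<Rightarrow> 'y set) \<Rightarrow> bool" where
  "sheaf_image U C F G \<phi> S \<equiv> coproduct_image U C {()} (\<lambda>_. F) (\<lambda>_. \<phi>) G S"

definition fibre_product :: "(('o, 'a) mon, 'a, 'x) psh \<Rightarrow> (('o, 'a) mon, 'a, 'y) psh
    \<Rightarrow> (('o, 'a) mon \<Rightarrow> 'x \<Rightarrow> 'w) \<Rightarrow> (('o, 'a) mon \<Rightarrow> 'y \<Rightarrow> 'w) \<Rightarrow> (('o, 'a) mon, 'a, 'x \<times> 'y) psh" where
  "fibre_product F H \<phi> \<psi> =
    \<lparr>sec = (\<lambda>A. {(s, t). s \<in> sec F A \<and> t \<in> sec H A \<and> \<phi> A s = \<psi> A t}),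
     res = (\<lambda>A B f. map_prod (res F A B f) (res H A B f))\<rparr>"


section \<open>Schemes\<close>

definition Spec :: "('o, 'a) moncat \<Rightarrow> ('o, 'a) mon \<Rightarrow> (('o, 'a) mon, 'a, 'a) psh" where
  "Spec C A = \<lparr>sec = (\<lambda>B. Hom (Comm C) A B), res = (\<lambda>B D g s. g \<cdot>\<^bsub>Comm C\<^esub> s)\<rparr>"

definition Spec_mor :: "('o, 'a) moncat \<Rightarrow> 'a \<Rightarrow> ('o, 'a) mon \<Rightarrow> 'a \<Rightarrow> 'a" where
  "Spec_mor C f = (\<lambda>D g. g \<cdot>\<^bsub>Comm C\<^esub> f)"

definition zariski_open_of_affine ::
  "'u set \<Rightarrow> ('o, 'a) moncat \<Rightarrow> ('o, 'a) mon \<Rightarrow> (('o, 'a) mon \<Rightarrow> 'a set) \<Rightarrow> bool" where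
  "zariski_open_of_affine U C A S \<longleftrightarrow>
    (\<exists>W. (\<forall>(B, f)\<in>W. zariski_immersion U C A B f) \<and>
      coproduct_image U C W (\<lambda>(B, f). Spec C B) (\<lambda>(B, f). Spec_mor C f) (Spec C A) S)"

definition open_immersion :: "'u set \<Rightarrow> ('o, 'a) moncat \<Rightarrow> (('o, 'a) mon, 'a, 'x) psh
    \<Rightarrow> (('o, 'a) mon, 'a, 'y) psh \<Rightarrow> (('o, 'a) mon \<Rightarrow> 'x \<Rightarrow> 'y) \<Rightarrow> bool" where
  "open_immersion U C F G \<phi> \<longleftrightarrow> sheaf_mor U C F G \<phi> \<and>
    (\<forall>A\<in>Ob (Comm C). \<forall>\<psi>. sheaf_mor U C (Spec C A) G \<psi> \<longrightarrow>
      (let P = fibre_product F (Spec C A) \<phi> \<psi>; pr = (\<lambda>_. snd) in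
        sheaf_mono U C P (Spec C A) pr \<and>
        (\<exists>S. sheaf_image U C P (Spec C A) pr S \<and> zariski_open_of_affine U C A S)))"

definition zariski_covering :: "'u set \<Rightarrow> ('o, 'a) moncat \<Rightarrow> 'i set
    \<Rightarrow> ('i \<Rightarrow> (('o, 'a) mon, 'a, 'x) psh) \<Rightarrow> ('i \<Rightarrow> ('o, 'a) mon \<Rightarrow> 'x \<Rightarrow> 'y)
    \<Rightarrow> (('o, 'a) mon, 'a, 'y) psh \<Rightarrow> bool" where
  "zariski_covering U C I Fs \<phi>s X \<longleftrightarrow>
    (\<forall>i\<in>I. open_immersion U C (Fs i) X (\<phi>s i)) \<and> coproduct_epi U C I Fs \<phi>s X"

definition is_scheme :: "'u set \<Rightarrow> ('o, 'a) moncat \<Rightarrow> (('o, 'a) mon, 'a, 'x) psh \<Rightarrow> bool" where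
  "is_scheme U C X \<longleftrightarrow> is_sheaf U C X \<and>
    (\<exists>W. (\<forall>(A, \<phi>)\<in>W. A \<in> Ob (Comm C) \<and> open_immersion U C (Spec C A) X \<phi>) \<and>
      coproduct_epi U C W (\<lambda>(A, \<phi>). Spec C A) (\<lambda>(A, \<phi>). \<phi>) X)"

definition noetherian_monoid :: "'u set \<Rightarrow> ('o, 'a) moncat \<Rightarrow> ('o, 'a) mon \<Rightarrow> bool" where
  "noetherian_monoid U C A \<longleftrightarrow> comm_mon C A \<and>
    (\<forall>N\<in>Ob (Mod_cat C A). \<forall>m. is_mono (Mod_cat C A) N (self_mdl A) m \<longrightarrow>
      finitely_generated U (Mod_cat C A) N)"

definition noetherian_scheme :: "'u set \<Rightarrow> ('o, 'a) moncat \<Rightarrow> (('o, 'a) mon, 'a, 'x) psh \<Rightarrow> bool" where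
  "noetherian_scheme U C X \<longleftrightarrow> is_scheme U C X \<and>
    (\<forall>A\<in>Ob (Comm C). \<forall>\<phi>. open_immersion U C (Spec C A) X \<phi> \<longrightarrow> noetherian_monoid U C A)"

end

theory Submission
  imports Defs
begin

text \<open>
  Noetherianness passes along a flat epimorphism \<open>A \<rightarrow> B\<close>, since every ideal of \<open>B\<close> is the base change
  of its preimage in \<open>A\<close>. It also descends along a finite family of flat morphisms \<open>B \<rightarrow> E\<^sub>k\<close> that jointly
  detect zero modules.

  Let \<open>Spec B\<close> be an affine open subscheme of \<open>X\<close>. As \<open>Spec A\<^sub>i \<rightarrow> X\<close> is open, finitely many affine opens
  \<open>Spec B'\<close> of \<open>Spec B\<close>, each mapping to some \<open>Spec A\<^sub>i\<close> over \<open>X\<close>, jointly detect zero modules. As \<open>Spec B \<rightarrow> X\<close> is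
  open, the same holds for finitely many pushouts \<open>P = B' \<otimes> D\<close> over \<open>A\<^sub>i\<close>, with \<open>Spec D\<close> an affine open of
  \<open>Spec A\<^sub>i\<close> that maps to \<open>Spec B\<close>. Then \<open>D\<close> is Noetherian because \<open>A\<^sub>i\<close> is. Open immersions being monomorphisms,
  \<open>P\<close> is also the pushout of \<open>B'\<close> and \<open>D\<close> over \<open>B\<close>, so \<open>D \<rightarrow> P\<close> is a flat epimorphism and \<open>P\<close> is
  Noetherian. By descent \<open>B'\<close> and then \<open>B\<close> are Noetherian.

  Epimorphisms of sheaves are turned into covering sieves by testing them against the sheaf of closed
  sieves for a topology finer than the Zariski topology.
\<close>

section \<open>Arrows with source and target\<close>

text \<open>Most of the algebra rests on one comparison: for a pushout \<open>P\<close> of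
  \<open>E\<close> and \<open>F\<close> over \<open>D\<close> and an \<open>E\<close>-module
  \<open>N\<close>, the base change of \<open>N\<close> along \<open>E\<close> -> \<open>P\<close>
  and that of its restriction along \<open>D\<close> -> \<open>F\<close> have the same underlying
  object. Flatness and the detection of zero modules pass to \<open>P\<close> through it, and it
  makes restriction along an epimorphism full. Two obstacles shape the rest. Finite generation asks
  for a bijection; its injectivity becomes automatic once the coprojections of a filtered system of
  monomorphisms are known to be monomorphisms, and there the exactness of filtered colimits enters.
  Epimorphisms of sheaves may be tested only against sheaves of sets of pairs, so no amalgam of
  \<open>X\<close> with itself is at hand as a target; closed sieves are, and they form a Zariski
  sheaf for every topology that contains the Zariski covers. The topology is therefore chosen so
  that stability and transitivity are formal, and so that the fact wanted later, a finite family
  detecting zero modules, is its very definition.\<close>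

text \<open>Hom-sets may overlap, so arrows are tagged with source and target. With the junk value \<open>Null\<close> for
  ill-typed composites, composition becomes total and associative.\<close>

datatype ('o, 'a) ar = Null | Ar (adom: 'o) (aarr: 'a) (acod: 'o)

context category
begin

definition arr :: "('o, 'a) ar \<Rightarrow> bool" where
  "arr t \<longleftrightarrow> (\<exists>x\<in>Ob K. \<exists>y\<in>Ob K. \<exists>f\<in>Hom K x y. t = Ar x f y)"

definition comp :: "('o, 'a) ar \<Rightarrow> ('o, 'a) ar \<Rightarrow> ('o, 'a) ar"  (infixr "\<bullet>" 70) where
  "g \<bullet> f = (if arr g \<and> arr f \<and> adom g = acod f
     then Ar (adom f) (aarr g \<cdot> aarr f) (acod g) else Null)"

definition ide :: "'o \<Rightarrow> ('o, 'a) ar" where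
  "ide x = Ar x (idt K x) x"

lemma arr_Ar [simp]: "arr (Ar x f y) \<longleftrightarrow> x \<in> Ob K \<and> y \<in> Ob K \<and> f \<in> Hom K x y"
  by (auto simp: arr_def)

lemma arr_Null [simp]: "\<not> arr Null"
  by (auto simp: arr_def)

lemma arrE: "arr t \<Longrightarrow> (\<And>x f y. \<lbrakk>t = Ar x f y; x \<in> Ob K; y \<in> Ob K; f \<in> Hom K x y\<rbrakk> \<Longrightarrow> P) \<Longrightarrow> P"
  by (auto simp: arr_def)

lemma arr_Ob [simp]: "arr t \<Longrightarrow> adom t \<in> Ob K" "arr t \<Longrightarrow> acod t \<in> Ob K"
  by (auto elim: arrE)

lemma arr_Hom: "arr t \<Longrightarrow> aarr t \<in> Hom K (adom t) (acod t)"
  by (auto elim: arrE)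

lemma arr_eta: "arr t \<Longrightarrow> Ar (adom t) (aarr t) (acod t) = t"
  by (auto elim: arrE)

lemma arr_comp [simp]: "arr (g \<bullet> f) \<longleftrightarrow> arr g \<and> arr f \<and> adom g = acod f"
  by (auto simp: comp_def intro: cmp_Hom elim!: arrE)

lemma comp_Null [simp]: "Null \<bullet> f = Null" "f \<bullet> Null = Null"
  by (auto simp: comp_def)

lemma adom_comp [simp]: "\<lbrakk>arr g; arr f; adom g = acod f\<rbrakk> \<Longrightarrow> adom (g \<bullet> f) = adom f"
  and acod_comp [simp]: "\<lbrakk>arr g; arr f; adom g = acod f\<rbrakk> \<Longrightarrow> acod (g \<bullet> f) = acod g"
  by (auto simp: comp_def)

lemma aarr_comp: "\<lbrakk>arr g; arr f; adom g = acod f\<rbrakk> \<Longrightarrow> aarr (g \<bullet> f) = aarr g \<cdot> aarr f"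
  by (auto simp: comp_def)

lemma ar_eqI: "\<lbrakk>arr f; arr g; adom f = adom g; acod f = acod g; aarr f = aarr g\<rbrakk> \<Longrightarrow> f = g"
  by (auto elim!: arrE)

lemma not_arr_comp: "\<not> arr (g \<bullet> f) \<Longrightarrow> g \<bullet> f = Null"
  by (auto simp: comp_def intro: cmp_Hom elim!: arrE)

text \<open>If some pair of ends does not match, both bracketings are \<open>Null\<close>. Hence
  there are no typing hypotheses, and the simplifier can keep every composite bracketed to the
  right.\<close>

lemma comp_assoc [simp]: "(h \<bullet> g) \<bullet> f = h \<bullet> (g \<bullet> f)"
proof (cases "arr h \<and> arr g \<and> arr f \<and> adom h = acod g \<and> adom g = acod f")
  case True
  then have "arr h" "arr g" "arr f" "adom h = acod g" "adom g = acod f" by auto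
  then show ?thesis
    by (elim arrE) (auto simp: comp_def cmp_Hom cmp_assoc)
next
  case False
  then have "\<not> arr ((h \<bullet> g) \<bullet> f)" "\<not> arr (h \<bullet> (g \<bullet> f))" by auto
  then show ?thesis by (metis not_arr_comp)
qed

lemma arr_ide [simp]: "arr (ide x) \<longleftrightarrow> x \<in> Ob K"
  and adom_ide [simp]: "adom (ide x) = x"
  and acod_ide [simp]: "acod (ide x) = x"
  by (auto simp: ide_def idt_Hom)

lemma comp_ide_right [simp]: "\<lbrakk>arr f; adom f = x\<rbrakk> \<Longrightarrow> f \<bullet> ide x = f"
  and comp_ide_left [simp]: "\<lbrakk>arr f; acod f = x\<rbrakk> \<Longrightarrow> ide x \<bullet> f = f"
  by (auto simp: comp_def ide_def idt_Hom idt_left idt_right elim!: arrE)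

text \<open>Bracketing to the right hides the left side of an equation for a twofold composite
  behind the next factor. This variant rewrites it there and is the main way in which hypotheses are
  applied.\<close>

lemma comp_reduce: "g \<bullet> f = h \<Longrightarrow> g \<bullet> (f \<bullet> k) = h \<bullet> k"
  by (metis comp_assoc)

lemma comp_Ar [simp]:
  "\<lbrakk>x \<in> Ob K; y \<in> Ob K; z \<in> Ob K; f \<in> Hom K x y; g \<in> Hom K y z\<rbrakk> \<Longrightarrow> Ar y g z \<bullet> Ar x f y = Ar x (g \<cdot> f) z"
  by (auto simp: comp_def)

section \<open>Isomorphisms and cancellation\<close>

definition inverses :: "('o, 'a) ar \<Rightarrow> ('o, 'a) ar \<Rightarrow> bool" where
  "inverses f g \<longleftrightarrow> arr f \<and> arr g \<and> adom f = acod g \<and> adom g = acod f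
     \<and> f \<bullet> g = ide (acod f) \<and> g \<bullet> f = ide (adom f)"

definition ainv :: "('o, 'a) ar \<Rightarrow> ('o, 'a) ar" where
  "ainv f = (SOME g. inverses f g)"

definition iso_ar :: "('o, 'a) ar \<Rightarrow> bool" where
  "iso_ar f \<longleftrightarrow> (\<exists>g. inverses f g)"

lemma is_iso_iso_ar: "x \<in> Ob K \<Longrightarrow> y \<in> Ob K \<Longrightarrow> is_iso K x y f \<longleftrightarrow> iso_ar (Ar x f y)"
  unfolding is_iso_def iso_ar_def
proof
  assume "x \<in> Ob K" "y \<in> Ob K" "f \<in> Hom K x y \<and> (\<exists>g\<in>Hom K y x. g \<cdot> f = idt K x \<and> f \<cdot> g = idt K y)"
  then have "\<exists>g. inverses (Ar x f y) (Ar y g x)" by (auto simp: inverses_def ide_def)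
  then obtain g where "inverses (Ar x f y) (Ar y g x)" by blast
  then show "\<exists>g. inverses (Ar x f y) g" ..
next
  assume *: "x \<in> Ob K" "y \<in> Ob K" "\<exists>g. inverses (Ar x f y) g"
  then obtain g where "inverses (Ar x f y) g" by blast
  with * show "f \<in> Hom K x y \<and> (\<exists>g\<in>Hom K y x. g \<cdot> f = idt K x \<and> f \<cdot> g = idt K y)"
    unfolding inverses_def by (cases g) (auto simp: ide_def)
qed

lemma ainv_inverses: "iso_ar f \<Longrightarrow> inverses f (ainv f)"
  unfolding ainv_def iso_ar_def by (rule someI_ex)

lemma ainv_simps:
  assumes "iso_ar f"
  shows "arr f" "arr (ainv f)" "adom (ainv f) = acod f" "acod (ainv f) = adom f"
    "f \<bullet> ainv f = ide (acod f)" "ainv f \<bullet> f = ide (adom f)"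
  using ainv_inverses[OF assms] unfolding inverses_def by auto

lemma iso_arI: "inverses f g \<Longrightarrow> iso_ar f"
  by (auto simp: iso_ar_def)

lemma iso_ar_ainv: "iso_ar f \<Longrightarrow> iso_ar (ainv f)"
  by (drule ainv_inverses, auto simp: iso_ar_def inverses_def)

lemma iso_cancel_left:
  assumes "iso_ar f" "f \<bullet> g = f \<bullet> h" "arr g" "acod g = adom f" "arr h" "acod h = adom f"
  shows "g = h"
proof -
  have "ainv f \<bullet> (f \<bullet> g) = ainv f \<bullet> (f \<bullet> h)" using assms by simp
  then show ?thesis using assms ainv_simps[OF assms(1)]
    by (metis comp_assoc comp_ide_left)
qed

lemma iso_cancel_right:
  assumes "iso_ar f" "g \<bullet> f = h \<bullet> f" "arr g" "adom g = acod f" "arr h" "adom h = acod f"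
  shows "g = h"
proof -
  have "(g \<bullet> f) \<bullet> ainv f = (h \<bullet> f) \<bullet> ainv f" using assms by simp
  then show ?thesis using assms ainv_simps[OF assms(1)]
    by (metis comp_assoc comp_ide_right)
qed

lemma iso_ar_comp: 
  assumes "iso_ar f" "iso_ar g" "adom f = acod g"
  shows "iso_ar (f \<bullet> g)"
proof (rule iso_arI)
  note i = ainv_simps[OF assms(1)] ainv_simps[OF assms(2)]
  have "ainv f \<bullet> (f \<bullet> g) = g" "g \<bullet> (ainv g \<bullet> ainv f) = ainv f"
    using i assms by (metis comp_assoc comp_ide_left)+
  then show "inverses (f \<bullet> g) (ainv g \<bullet> ainv f)"
    using i assms unfolding inverses_def by (simp)
qed

end

section \<open>Symmetric monoidal categories\<close>

context symmetric_monoidal_category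
begin

notation comp (infixr "\<bullet>" 70)

definition tns :: "('o, 'a) ar \<Rightarrow> ('o, 'a) ar \<Rightarrow> ('o, 'a) ar"  (infixr "**" 75) where
  "f ** g = (if arr f \<and> arr g
     then Ar (adom f \<boxtimes> adom g) (aarr f \<boxdot> aarr g) (acod f \<boxtimes> acod g) else Null)"

declare tens_Ob [simp] tunit_Ob [simp]

lemma arr_tns [simp]: "arr (f ** g) \<longleftrightarrow> arr f \<and> arr g"
  by (auto simp: tns_def intro!: tensA_Hom elim!: arrE)

lemma tns_Null [simp]: "Null ** f = Null" "f ** Null = Null"
  by (auto simp: tns_def)

lemma adom_tns [simp]: "\<lbrakk>arr f; arr g\<rbrakk> \<Longrightarrow> adom (f ** g) = adom f \<boxtimes> adom g"
  and acod_tns [simp]: "\<lbrakk>arr f; arr g\<rbrakk> \<Longrightarrow> acod (f ** g) = acod f \<boxtimes> acod g"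
  by (auto simp: tns_def)

lemma aarr_tns: "\<lbrakk>arr f; arr g\<rbrakk> \<Longrightarrow> aarr (f ** g) = aarr f \<boxdot> aarr g"
  by (auto simp: tns_def)

lemma tns_comp [simp]: "\<lbrakk>arr f; arr f'; arr g; arr g'; adom f' = acod f; adom g' = acod g\<rbrakk>
    \<Longrightarrow> (f' ** g') \<bullet> (f ** g) = (f' \<bullet> f) ** (g' \<bullet> g)"
proof (rule ar_eqI)
  assume *: "arr f" "arr f'" "arr g" "arr g'" "adom f' = acod f" "adom g' = acod g"
  from * show "aarr ((f' ** g') \<bullet> (f ** g)) = aarr ((f' \<bullet> f) ** (g' \<bullet> g))"
    using tensA_cmp[of "adom f" "acod f" "acod f'" "adom g" "acod g" "acod g'" "aarr f" "aarr f'" "aarr g" "aarr g'"]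
      arr_Hom[of f] arr_Hom[of f'] arr_Hom[of g] arr_Hom[of g']
    by (simp add: aarr_comp aarr_tns)
qed simp_all

text \<open>The interchange law in the position in which right bracketing leaves it.\<close>

lemma tns_comp' [simp]: "\<lbrakk>arr f; arr f'; arr g; arr g'; adom f' = acod f; adom g' = acod g\<rbrakk>
    \<Longrightarrow> (f' ** g') \<bullet> ((f ** g) \<bullet> h) = ((f' \<bullet> f) ** (g' \<bullet> g)) \<bullet> h"
  by (metis comp_assoc tns_comp)

lemma tns_ide [simp]: "\<lbrakk>x \<in> Ob C; y \<in> Ob C\<rbrakk> \<Longrightarrow> ide x ** ide y = ide (x \<boxtimes> y)"
  by (auto simp: tns_def ide_def idt_Hom tensA_idt)

lemma tns_Ar: "\<lbrakk>x \<in> Ob C; y \<in> Ob C; f \<in> Hom C x y; x' \<in> Ob C; y' \<in> Ob C; f' \<in> Hom C x' y'\<rbrakk>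
   \<Longrightarrow> Ar x f y ** Ar x' f' y' = Ar (x \<boxtimes> x') (f \<boxdot> f') (y \<boxtimes> y')"
  by (auto simp: tns_def)

lemma iso_ar_tns: assumes "iso_ar f" "iso_ar g" shows "iso_ar (f ** g)"
  by (rule iso_arI[of _ "ainv f ** ainv g"])
    (use ainv_simps[OF assms(1)] ainv_simps[OF assms(2)] in \<open>simp add: inverses_def\<close>)

lemma iso_ar_ide [simp]: "x \<in> Ob C \<Longrightarrow> iso_ar (ide x)"
  by (rule iso_arI[of _ "ide x"]) (simp add: inverses_def)

section \<open>The structure isomorphisms as tagged arrows\<close>

definition as :: "'o \<Rightarrow> 'o \<Rightarrow> 'o \<Rightarrow> ('o, 'a) ar" where
  "as x y z = Ar ((x \<boxtimes> y) \<boxtimes> z) (assoc C x y z) (x \<boxtimes> (y \<boxtimes> z))"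
definition as' :: "'o \<Rightarrow> 'o \<Rightarrow> 'o \<Rightarrow> ('o, 'a) ar" where
  "as' x y z = ainv (as x y z)"
definition lu :: "'o \<Rightarrow> ('o, 'a) ar" where "lu x = Ar (tunit C \<boxtimes> x) (lunit C x) x"
definition lu' :: "'o \<Rightarrow> ('o, 'a) ar" where "lu' x = ainv (lu x)"
definition ru :: "'o \<Rightarrow> ('o, 'a) ar" where "ru x = Ar (x \<boxtimes> tunit C) (runit C x) x"
definition ru' :: "'o \<Rightarrow> ('o, 'a) ar" where "ru' x = ainv (ru x)"
definition br :: "'o \<Rightarrow> 'o \<Rightarrow> ('o, 'a) ar" where "br x y = Ar (x \<boxtimes> y) (braid C x y) (y \<boxtimes> x)"

lemma iso_as: "\<lbrakk>x \<in> Ob C; y \<in> Ob C; z \<in> Ob C\<rbrakk> \<Longrightarrow> iso_ar (as x y z)"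
  using assoc_iso by (simp add: as_def is_iso_iso_ar)
lemma iso_lu: "x \<in> Ob C \<Longrightarrow> iso_ar (lu x)"
  using lunit_iso by (simp add: lu_def is_iso_iso_ar)
lemma iso_ru: "x \<in> Ob C \<Longrightarrow> iso_ar (ru x)"
  using runit_iso by (simp add: ru_def is_iso_iso_ar)

lemma adom_as [simp]: "adom (as x y z) = (x \<boxtimes> y) \<boxtimes> z"
  and acod_as [simp]: "acod (as x y z) = x \<boxtimes> (y \<boxtimes> z)"
  and adom_lu [simp]: "adom (lu x) = tunit C \<boxtimes> x" and acod_lu [simp]: "acod (lu x) = x"
  and adom_ru [simp]: "adom (ru x) = x \<boxtimes> tunit C" and acod_ru [simp]: "acod (ru x) = x"
  and adom_br [simp]: "adom (br x y) = x \<boxtimes> y" and acod_br [simp]: "acod (br x y) = y \<boxtimes> x"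
  by (auto simp: as_def lu_def ru_def br_def)

lemma aarr_structure: "aarr (as x y z) = assoc C x y z" "aarr (lu x) = lunit C x"
  "aarr (ru x) = runit C x" "aarr (br x y) = braid C x y" "aarr (ide x) = idt C x"
  by (auto simp: as_def lu_def ru_def br_def ide_def)

lemma arr_structure [simp]:
  "\<lbrakk>x \<in> Ob C; y \<in> Ob C; z \<in> Ob C\<rbrakk> \<Longrightarrow> arr (as x y z)"
  "x \<in> Ob C \<Longrightarrow> arr (lu x)" "x \<in> Ob C \<Longrightarrow> arr (ru x)"
  "\<lbrakk>x \<in> Ob C; y \<in> Ob C\<rbrakk> \<Longrightarrow> arr (br x y)"
  using iso_as iso_lu iso_ru ainv_simps(1) braid_Hom by (auto simp: br_def)

lemma arr_structure' [simp]:
  "\<lbrakk>x \<in> Ob C; y \<in> Ob C; z \<in> Ob C\<rbrakk> \<Longrightarrow> arr (as' x y z)"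
  "x \<in> Ob C \<Longrightarrow> arr (lu' x)" "x \<in> Ob C \<Longrightarrow> arr (ru' x)"
  "\<lbrakk>x \<in> Ob C; y \<in> Ob C; z \<in> Ob C\<rbrakk> \<Longrightarrow> adom (as' x y z) = x \<boxtimes> (y \<boxtimes> z)"
  "\<lbrakk>x \<in> Ob C; y \<in> Ob C; z \<in> Ob C\<rbrakk> \<Longrightarrow> acod (as' x y z) = (x \<boxtimes> y) \<boxtimes> z"
  "x \<in> Ob C \<Longrightarrow> adom (lu' x) = x" "x \<in> Ob C \<Longrightarrow> acod (lu' x) = tunit C \<boxtimes> x"
  "x \<in> Ob C \<Longrightarrow> adom (ru' x) = x" "x \<in> Ob C \<Longrightarrow> acod (ru' x) = x \<boxtimes> tunit C"
  using iso_as iso_lu iso_ru by (simp_all add: as'_def lu'_def ru'_def ainv_simps)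

lemma structure_inverse [simp]:
  "\<lbrakk>x \<in> Ob C; y \<in> Ob C; z \<in> Ob C\<rbrakk> \<Longrightarrow> as x y z \<bullet> as' x y z = ide (x \<boxtimes> (y \<boxtimes> z))"
  "\<lbrakk>x \<in> Ob C; y \<in> Ob C; z \<in> Ob C\<rbrakk> \<Longrightarrow> as' x y z \<bullet> as x y z = ide ((x \<boxtimes> y) \<boxtimes> z)"
  "x \<in> Ob C \<Longrightarrow> lu x \<bullet> lu' x = ide x" "x \<in> Ob C \<Longrightarrow> lu' x \<bullet> lu x = ide (tunit C \<boxtimes> x)"
  "x \<in> Ob C \<Longrightarrow> ru x \<bullet> ru' x = ide x" "x \<in> Ob C \<Longrightarrow> ru' x \<bullet> ru x = ide (x \<boxtimes> tunit C)"
  "\<lbrakk>x \<in> Ob C; y \<in> Ob C\<rbrakk> \<Longrightarrow> br y x \<bullet> br x y = ide (x \<boxtimes> y)"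
  using iso_as iso_lu iso_ru
  by (simp_all add: as'_def lu'_def ru'_def ainv_simps br_def ide_def braid_involution braid_Hom)

lemma structure_inverse' [simp]:
  "\<lbrakk>x \<in> Ob C; y \<in> Ob C; z \<in> Ob C; arr f; acod f = x \<boxtimes> (y \<boxtimes> z)\<rbrakk> \<Longrightarrow> as x y z \<bullet> (as' x y z \<bullet> f) = f"
  "\<lbrakk>x \<in> Ob C; y \<in> Ob C; z \<in> Ob C; arr f; acod f = (x \<boxtimes> y) \<boxtimes> z\<rbrakk> \<Longrightarrow> as' x y z \<bullet> (as x y z \<bullet> f) = f"
  "\<lbrakk>x \<in> Ob C; arr f; acod f = x\<rbrakk> \<Longrightarrow> lu x \<bullet> (lu' x \<bullet> f) = f"
  "\<lbrakk>x \<in> Ob C; arr f; acod f = tunit C \<boxtimes> x\<rbrakk> \<Longrightarrow> lu' x \<bullet> (lu x \<bullet> f) = f"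
  "\<lbrakk>x \<in> Ob C; arr f; acod f = x\<rbrakk> \<Longrightarrow> ru x \<bullet> (ru' x \<bullet> f) = f"
  "\<lbrakk>x \<in> Ob C; arr f; acod f = x \<boxtimes> tunit C\<rbrakk> \<Longrightarrow> ru' x \<bullet> (ru x \<bullet> f) = f"
  "\<lbrakk>x \<in> Ob C; y \<in> Ob C; arr f; acod f = x \<boxtimes> y\<rbrakk> \<Longrightarrow> br y x \<bullet> (br x y \<bullet> f) = f"
  by (simp_all flip: comp_assoc)

lemma iso_structure [simp]:
  "\<lbrakk>x \<in> Ob C; y \<in> Ob C; z \<in> Ob C\<rbrakk> \<Longrightarrow> iso_ar (as x y z)"
  "\<lbrakk>x \<in> Ob C; y \<in> Ob C; z \<in> Ob C\<rbrakk> \<Longrightarrow> iso_ar (as' x y z)"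
  "x \<in> Ob C \<Longrightarrow> iso_ar (lu x)" "x \<in> Ob C \<Longrightarrow> iso_ar (lu' x)"
  "x \<in> Ob C \<Longrightarrow> iso_ar (ru x)" "x \<in> Ob C \<Longrightarrow> iso_ar (ru' x)"
  "\<lbrakk>x \<in> Ob C; y \<in> Ob C\<rbrakk> \<Longrightarrow> iso_ar (br x y)"
  by (auto simp: iso_as iso_lu iso_ru as'_def lu'_def ru'_def iso_ar_ainv inverses_def
      intro: iso_arI[of "br x y" "br y x"])

lemma as_natural: "\<lbrakk>arr f; arr g; arr h; adom f = x; adom g = y; adom h = z\<rbrakk>
    \<Longrightarrow> (f ** (g ** h)) \<bullet> as x y z = as (acod f) (acod g) (acod h) \<bullet> ((f ** g) ** h)"
  by (elim arrE) (use ainv_simps(1)[OF iso_as] in \<open>auto simp: as_def tns_Ar tensA_Hom assoc_natural\<close>)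

lemma lu_natural: "\<lbrakk>arr f; adom f = x\<rbrakk> \<Longrightarrow> f \<bullet> lu x = lu (acod f) \<bullet> (ide (tunit C) ** f)"
  by (elim arrE) (use ainv_simps(1)[OF iso_lu] in
    \<open>auto simp: lu_def tns_Ar tensA_Hom lunit_natural ide_def idt_Hom\<close>)

lemma ru_natural: "\<lbrakk>arr f; adom f = x\<rbrakk> \<Longrightarrow> f \<bullet> ru x = ru (acod f) \<bullet> (f ** ide (tunit C))"
  by (elim arrE) (use ainv_simps(1)[OF iso_ru] in
    \<open>auto simp: ru_def tns_Ar tensA_Hom runit_natural ide_def idt_Hom\<close>)

lemma br_natural: "\<lbrakk>arr f; arr g; adom f = x; adom g = y\<rbrakk>
    \<Longrightarrow> (g ** f) \<bullet> br x y = br (acod f) (acod g) \<bullet> (f ** g)"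
  by (elim arrE) (auto simp: br_def tns_Ar tensA_Hom braid_natural braid_Hom)

lemma as'_natural: "\<lbrakk>arr f; arr g; arr h; adom f = x; adom g = y; adom h = z\<rbrakk>
    \<Longrightarrow> ((f ** g) ** h) \<bullet> as' x y z = as' (acod f) (acod g) (acod h) \<bullet> (f ** (g ** h))"
  by (insert arr_Ob(1)[of f] arr_Ob(1)[of g] arr_Ob(1)[of h], rule iso_cancel_left[of "as (acod f) (acod g) (acod h)"],
      simp_all add: comp_reduce[OF as_natural[symmetric]])

lemma lu'_natural: "\<lbrakk>arr f; adom f = x\<rbrakk> \<Longrightarrow> lu' (acod f) \<bullet> f = (ide (tunit C) ** f) \<bullet> lu' x"
  by (insert arr_Ob(1)[of f], rule iso_cancel_left[of "lu (acod f)"],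
      simp_all add: comp_reduce[OF lu_natural[symmetric]])

lemma ru'_natural: "\<lbrakk>arr f; adom f = x\<rbrakk> \<Longrightarrow> ru' (acod f) \<bullet> f = (f ** ide (tunit C)) \<bullet> ru' x"
  by (insert arr_Ob(1)[of f], rule iso_cancel_left[of "ru (acod f)"],
      simp_all add: comp_reduce[OF ru_natural[symmetric]])

lemma pentagon_ar: "\<lbrakk>w \<in> Ob C; x \<in> Ob C; y \<in> Ob C; z \<in> Ob C\<rbrakk>
   \<Longrightarrow> as w x (y \<boxtimes> z) \<bullet> as (w \<boxtimes> x) y z = (ide w ** as x y z) \<bullet> (as w (x \<boxtimes> y) z \<bullet> (as w x y ** ide z))"
  by (rule ar_eqI) (simp_all add: aarr_comp aarr_tns aarr_structure pentagon)

lemma triangle_ar: "\<lbrakk>x \<in> Ob C; y \<in> Ob C\<rbrakk> \<Longrightarrow> (ide x ** lu y) \<bullet> as x (tunit C) y = ru x ** ide y"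
  by (rule ar_eqI) (simp_all add: aarr_comp aarr_tns aarr_structure triangle)

lemma hexagon_ar: "\<lbrakk>x \<in> Ob C; y \<in> Ob C; z \<in> Ob C\<rbrakk>
   \<Longrightarrow> as y z x \<bullet> (br x (y \<boxtimes> z) \<bullet> as x y z) = (ide y ** br x z) \<bullet> (as y x z \<bullet> (br x y ** ide z))"
  by (rule ar_eqI) (simp_all add: aarr_comp aarr_tns aarr_structure hexagon)

end

lemma (in category) iso_cancel_right_iff:
  "\<lbrakk>iso_ar f; arr g; adom g = acod f; arr h; adom h = acod f\<rbrakk> \<Longrightarrow> comp g f = comp h f \<longleftrightarrow> g = h"
  using iso_cancel_right by blast

subsection \<open>Coherence\<close>

context symmetric_monoidal_category
begin

notation comp (infixr "\<bullet>" 70)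
notation tns (infixr "**" 75)

text \<open>Naturality of \<open>lu\<close> makes tensoring with the unit isomorphic to the
  identity, hence faithful. Coherence identities can therefore be proved after such a
  tensoring.\<close>

lemma tns_tunit_cancel_left:
  assumes "ide (tunit C) ** f = ide (tunit C) ** g" "arr f" "arr g" "adom f = adom g" "acod f = acod g"
  shows "f = g"
proof -
  have "f \<bullet> lu (adom f) = g \<bullet> lu (adom g)" using assms by (simp add: lu_natural)
  then show ?thesis using assms by (metis iso_cancel_right acod_lu arr_Ob(1) iso_structure(3))
qed

lemma tns_tunit_cancel_right:
  assumes "f ** ide (tunit C) = g ** ide (tunit C)" "arr f" "arr g" "adom f = adom g" "acod f = acod g"
  shows "f = g"
proof -
  have "f \<bullet> ru (adom f) = g \<bullet> ru (adom g)" using assms by (simp add: ru_natural)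
  then show ?thesis using assms by (metis iso_cancel_right acod_ru arr_Ob(1) iso_structure(5))
qed

text \<open>Kelly's argument: after tensoring with the unit, the pentagon, the triangle used twice
  and naturality turn the left side into the right side, up to associators that cancel at the
  end.\<close>

lemma lu_tens:
  assumes [simp]: "x \<in> Ob C" "y \<in> Ob C"
  shows "lu (x \<boxtimes> y) \<bullet> as (tunit C) x y = lu x ** ide y"
proof (rule tns_tunit_cancel_left)
  let ?i = "tunit C"
  let ?k = "as ?i (?i \<boxtimes> x) y \<bullet> (as ?i ?i x ** ide y)"
  have k: "iso_ar ?k" by (intro iso_ar_comp iso_ar_tns) simp_all
  have "(ide ?i ** (lu (x \<boxtimes> y) \<bullet> as ?i x y)) \<bullet> ?k
      = (ide ?i ** lu (x \<boxtimes> y)) \<bullet> ((ide ?i ** as ?i x y) \<bullet> ?k)" by simp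
  also have "\<dots> = (ide ?i ** lu (x \<boxtimes> y)) \<bullet> (as ?i ?i (x \<boxtimes> y) \<bullet> as (?i \<boxtimes> ?i) x y)"
    by (simp only: pentagon_ar assms tunit_Ob)
  also have "\<dots> = (ru ?i ** (ide x ** ide y)) \<bullet> as (?i \<boxtimes> ?i) x y"
    by (simp add: comp_reduce[OF triangle_ar])
  also have "\<dots> = as ?i x y \<bullet> ((ru ?i ** ide x) ** ide y)"
    by (subst as_natural) simp_all
  also have "\<dots> = as ?i x y \<bullet> (((ide ?i ** lu x) \<bullet> as ?i ?i x) ** ide y)"
    by (simp add: triangle_ar)
  also have "\<dots> = (as ?i x y \<bullet> ((ide ?i ** lu x) ** ide y)) \<bullet> (as ?i ?i x ** ide y)"
    by simp
  also have "\<dots> = (ide ?i ** (lu x ** ide y)) \<bullet> ?k"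
    using as_natural[of "ide ?i" "lu x" "ide y" ?i "?i \<boxtimes> x" y] by (simp add: comp_assoc[symmetric] del: comp_assoc)
  finally show "ide ?i ** (lu (x \<boxtimes> y) \<bullet> as ?i x y) = ide ?i ** (lu x ** ide y)"
    by (rule iso_cancel_right[OF k]) simp_all
qed simp_all

lemma ru_tens:
  assumes [simp]: "x \<in> Ob C" "y \<in> Ob C"
  shows "(ide x ** ru y) \<bullet> as x y (tunit C) = ru (x \<boxtimes> y)"
proof (rule tns_tunit_cancel_right)
  let ?i = "tunit C"
  have "as x y ?i \<bullet> (((ide x ** ru y) \<bullet> as x y ?i) ** ide ?i)
      = (as x y ?i \<bullet> ((ide x ** ru y) ** ide ?i)) \<bullet> (as x y ?i ** ide ?i)" by simp
  also have "\<dots> = ((ide x ** (ru y ** ide ?i)) \<bullet> as x (y \<boxtimes> ?i) ?i) \<bullet> (as x y ?i ** ide ?i)"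
    by (subst as_natural) simp_all
  also have "\<dots> = (ide x ** (ide y ** lu ?i)) \<bullet> ((ide x ** as y ?i ?i) \<bullet> (as x (y \<boxtimes> ?i) ?i \<bullet> (as x y ?i ** ide ?i)))"
    by (simp add: triangle_ar)
  also have "\<dots> = (ide x ** (ide y ** lu ?i)) \<bullet> (as x y (?i \<boxtimes> ?i) \<bullet> as (x \<boxtimes> y) ?i ?i)"
    by (simp only: pentagon_ar assms tunit_Ob)
  also have "\<dots> = as x y ?i \<bullet> ((ide (x \<boxtimes> y) ** lu ?i) \<bullet> as (x \<boxtimes> y) ?i ?i)"
    using as_natural[of "ide x" "ide y" "lu ?i" x y "?i \<boxtimes> ?i"] by (simp add: comp_assoc[symmetric] del: comp_assoc)
  also have "\<dots> = as x y ?i \<bullet> (ru (x \<boxtimes> y) ** ide ?i)"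
    by (simp add: triangle_ar)
  finally show "((ide x ** ru y) \<bullet> as x y ?i) ** ide ?i = ru (x \<boxtimes> y) ** ide ?i"
    by (rule iso_cancel_left[rotated]) simp_all
qed simp_all

text \<open>Write \<open>u\<close> for the left side. The hexagon with two unit factors and
  naturality give \<open>ru x \<bullet> (u ** 1) = u \<bullet> (u ** 1)\<close>, and the isomorphism
  \<open>u ** 1\<close> cancels.\<close>

lemma lu_br:
  assumes [simp]: "x \<in> Ob C"
  shows "lu x \<bullet> br x (tunit C) = ru x"
proof -
  let ?i = "tunit C"
  let ?u = "lu x \<bullet> br x ?i"
  have "ru x \<bullet> (?u ** ide ?i) = ?u \<bullet> ru (x \<boxtimes> ?i)"
    by (subst ru_natural[of ?u]) simp_all
  also have "\<dots> = lu x \<bullet> ((br x ?i \<bullet> (ide x ** ru ?i)) \<bullet> as x ?i ?i)"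
    by (simp add: ru_tens)
  also have "\<dots> = lu x \<bullet> ((ru ?i ** ide x) \<bullet> (br x (?i \<boxtimes> ?i) \<bullet> as x ?i ?i))"
    using br_natural[of "ide x" "ru ?i" x "?i \<boxtimes> ?i"] by (simp add: comp_assoc[symmetric] del: comp_assoc)
  also have "\<dots> = lu x \<bullet> ((ide ?i ** lu x) \<bullet> (as ?i ?i x \<bullet> (br x (?i \<boxtimes> ?i) \<bullet> as x ?i ?i)))"
    by (simp add: triangle_ar[symmetric])
  also have "\<dots> = lu x \<bullet> ((ide ?i ** lu x) \<bullet> ((ide ?i ** br x ?i) \<bullet> (as ?i x ?i \<bullet> (br x ?i ** ide ?i))))"
    by (simp only: hexagon_ar assms tunit_Ob)
  also have "\<dots> = (lu x \<bullet> (ide ?i ** ?u)) \<bullet> (as ?i x ?i \<bullet> (br x ?i ** ide ?i))"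
    by simp
  also have "\<dots> = (?u \<bullet> lu (x \<boxtimes> ?i)) \<bullet> (as ?i x ?i \<bullet> (br x ?i ** ide ?i))"
    by (subst lu_natural[of ?u]) simp_all
  also have "\<dots> = ?u \<bullet> (?u ** ide ?i)"
    by (simp add: comp_reduce[OF lu_tens])
  finally have "ru x \<bullet> (?u ** ide ?i) = ?u \<bullet> (?u ** ide ?i)" .
  moreover have "iso_ar (?u ** ide ?i)" by (intro iso_ar_tns iso_ar_comp) simp_all
  ultimately show ?thesis by (intro iso_cancel_right[of "?u ** ide ?i" ?u "ru x"]) simp_all
qed

lemma ru_br: "x \<in> Ob C \<Longrightarrow> ru x \<bullet> br (tunit C) x = lu x"
  by (simp add: lu_br[symmetric])

text \<open>The hexagon for the inverse braiding. By symmetry the inverse of a braiding is again a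
  braiding, so this is the given hexagon read backwards.\<close>

lemma hexagon2:
  assumes [simp]: "x \<in> Ob C" "y \<in> Ob C" "z \<in> Ob C"
  shows "br (x \<boxtimes> y) z
    = as z x y \<bullet> ((br x z ** ide y) \<bullet> (as' x z y \<bullet> ((ide x ** br y z) \<bullet> as x y z)))" (is "_ = ?r")
proof (rule iso_cancel_left)
  let ?h = "as x y z \<bullet> br z (x \<boxtimes> y)"
  show "iso_ar ?h" by (intro iso_ar_comp) simp_all
  have "?h \<bullet> ?r = (as x y z \<bullet> (br z (x \<boxtimes> y) \<bullet> as z x y))
      \<bullet> ((br x z ** ide y) \<bullet> (as' x z y \<bullet> ((ide x ** br y z) \<bullet> as x y z)))" by simp
  also have "\<dots> = ((ide x ** br z y) \<bullet> (as x z y \<bullet> (br z x ** ide y)))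
      \<bullet> ((br x z ** ide y) \<bullet> (as' x z y \<bullet> ((ide x ** br y z) \<bullet> as x y z)))"
    by (simp only: hexagon_ar assms)
  also have "\<dots> = ?h \<bullet> br (x \<boxtimes> y) z"
    by simp
  finally show "?h \<bullet> br (x \<boxtimes> y) z = ?h \<bullet> ?r" by simp
qed simp_all

text \<open>The exchange of the first two factors of a triple product. A left action on the last
  factor needs it to pass an inert factor \<open>x\<close>.\<close>

definition sw :: "'o \<Rightarrow> 'o \<Rightarrow> 'o \<Rightarrow> ('o, 'a) ar" where
  "sw a x m = as x a m \<bullet> ((br a x ** ide m) \<bullet> as' a x m)"

lemma sw_simps [simp]:
  "\<lbrakk>a \<in> Ob C; x \<in> Ob C; m \<in> Ob C\<rbrakk> \<Longrightarrow> arr (sw a x m)"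
  "\<lbrakk>a \<in> Ob C; x \<in> Ob C; m \<in> Ob C\<rbrakk> \<Longrightarrow> adom (sw a x m) = a \<boxtimes> (x \<boxtimes> m)"
  "\<lbrakk>a \<in> Ob C; x \<in> Ob C; m \<in> Ob C\<rbrakk> \<Longrightarrow> acod (sw a x m) = x \<boxtimes> (a \<boxtimes> m)"
  by (simp_all add: sw_def)

lemma sw_hexagon: "\<lbrakk>a \<in> Ob C; x \<in> Ob C; m \<in> Ob C\<rbrakk>
   \<Longrightarrow> as x m a \<bullet> br a (x \<boxtimes> m) = (ide x ** br a m) \<bullet> sw a x m"
  by (rule iso_cancel_right[of "as a x m"]) (simp_all add: hexagon_ar sw_def)

end

section \<open>Modules over commutative monoids\<close>

context symmetric_monoidal_category
begin

definition mu :: "('o, 'a) mon \<Rightarrow> ('o, 'a) ar" where "mu A = Ar (mcar A \<boxtimes> mcar A) (mmul A) (mcar A)"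
definition et :: "('o, 'a) mon \<Rightarrow> ('o, 'a) ar" where "et A = Ar (tunit C) (muni A) (mcar A)"
definition ac :: "('o, 'a) mon \<Rightarrow> ('o, 'a) mdl \<Rightarrow> ('o, 'a) ar" where
  "ac A M = Ar (ucar M \<boxtimes> mcar A) (uact M) (ucar M)"

text \<open>Modules carry right actions. With a left action at hand, a second monoid can act while
  the right action of the first one is kept.\<close>

definition la :: "('o, 'a) mon \<Rightarrow> ('o, 'a) mdl \<Rightarrow> ('o, 'a) ar" where
  "la A M = ac A M \<bullet> br (mcar A) (ucar M)"

lemma dom_cod_mu_et [simp]: "adom (mu A) = mcar A \<boxtimes> mcar A" "acod (mu A) = mcar A"
  "adom (et A) = tunit C" "acod (et A) = mcar A"
  "adom (ac A M) = ucar M \<boxtimes> mcar A" "acod (ac A M) = ucar M"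
  by (auto simp: mu_def et_def ac_def)

lemma aarr_mu: "aarr (mu A) = mmul A" "aarr (et A) = muni A" "aarr (ac A M) = uact M"
  by (auto simp: mu_def et_def ac_def)

lemma ar_eq_iff: "\<lbrakk>arr f; arr g; adom f = adom g; acod f = acod g\<rbrakk> \<Longrightarrow> f = g \<longleftrightarrow> aarr f = aarr g"
  using ar_eqI by blast

lemma comm_mon_ar: "comm_mon C A \<longleftrightarrow> mcar A \<in> Ob C \<and> arr (mu A) \<and> arr (et A) \<and>
   mu A \<bullet> (mu A ** ide (mcar A)) = mu A \<bullet> ((ide (mcar A) ** mu A) \<bullet> as (mcar A) (mcar A) (mcar A)) \<and>
   mu A \<bullet> (et A ** ide (mcar A)) = lu (mcar A) \<and>
   mu A \<bullet> (ide (mcar A) ** et A) = ru (mcar A) \<and>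
   mu A \<bullet> br (mcar A) (mcar A) = mu A"
proof (cases "mcar A \<in> Ob C \<and> arr (mu A) \<and> arr (et A)")
  case True
  then have [simp]: "mcar A \<in> Ob C" "arr (mu A)" "arr (et A)" by auto
  then show ?thesis unfolding comm_mon_def Let_def
    by (simp add: ar_eq_iff aarr_comp aarr_tns aarr_structure aarr_mu) (insert True, auto simp: mu_def et_def)
next
  case False
  then show ?thesis by (auto simp: comm_mon_def Let_def mu_def et_def)
qed

lemma comm_mon_simps [simp]:
  assumes "comm_mon C A"
  shows "mcar A \<in> Ob C" "arr (mu A)" "arr (et A)"
    "mu A \<bullet> (et A ** ide (mcar A)) = lu (mcar A)"
    "mu A \<bullet> (ide (mcar A) ** et A) = ru (mcar A)"
    "mu A \<bullet> br (mcar A) (mcar A) = mu A"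
  using assms unfolding comm_mon_ar by auto

lemma mu_assoc: "comm_mon C A \<Longrightarrow>
    mu A \<bullet> (mu A ** ide (mcar A)) = mu A \<bullet> ((ide (mcar A) ** mu A) \<bullet> as (mcar A) (mcar A) (mcar A))"
  unfolding comm_mon_ar by auto

lemma is_module_ar: "comm_mon C A \<Longrightarrow> is_module C A M \<longleftrightarrow> ucar M \<in> Ob C \<and> arr (ac A M) \<and>
   ac A M \<bullet> (ac A M ** ide (mcar A)) = ac A M \<bullet> ((ide (ucar M) ** mu A) \<bullet> as (ucar M) (mcar A) (mcar A)) \<and>
   ac A M \<bullet> (ide (ucar M) ** et A) = ru (ucar M)"
proof (cases "ucar M \<in> Ob C \<and> arr (ac A M)")
  case True
  then have [simp]: "ucar M \<in> Ob C" "arr (ac A M)" by auto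
  assume "comm_mon C A"
  then show ?thesis unfolding is_module_def Let_def
    by (simp add: ar_eq_iff aarr_comp aarr_tns aarr_structure aarr_mu) (insert True, auto simp: ac_def)
next
  case False
  assume "comm_mon C A"
  with False show ?thesis by (auto simp: is_module_def Let_def ac_def)
qed

text \<open>The monoid axioms are included so that a single hypothesis types every arrow built from
  a module.\<close>

definition md :: "('o, 'a) mon \<Rightarrow> ('o, 'a) mdl \<Rightarrow> bool" where
  "md A M \<longleftrightarrow> comm_mon C A \<and> is_module C A M"

lemma md_simps:
  assumes "md A M"
  shows "comm_mon C A" "mcar A \<in> Ob C" "ucar M \<in> Ob C" "arr (ac A M)"
    "ac A M \<bullet> (ide (ucar M) ** et A) = ru (ucar M)"
  using assms comm_mon_simps(1)[of A] unfolding md_def by (auto simp: is_module_ar)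

lemma ac_assoc: "md A M \<Longrightarrow> ac A M \<bullet> (ac A M ** ide (mcar A))
   = ac A M \<bullet> ((ide (ucar M) ** mu A) \<bullet> as (ucar M) (mcar A) (mcar A))"
  by (auto simp: is_module_ar md_def)

lemma la_simps [simp]: assumes "md A M"
  shows "arr (la A M)" "adom (la A M) = mcar A \<boxtimes> ucar M" "acod (la A M) = ucar M"
  using assms md_simps[OF assms] by (simp_all add: la_def)

definition lin :: "('o, 'a) mon \<Rightarrow> ('o, 'a) mdl \<Rightarrow> ('o, 'a) mdl \<Rightarrow> ('o, 'a) ar \<Rightarrow> bool" where
  "lin A M N f \<longleftrightarrow> arr f \<and> adom f = ucar M \<and> acod f = ucar N \<and>
     f \<bullet> ac A M = ac A N \<bullet> (f ** ide (mcar A))"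

lemma linD: "lin A M N f \<Longrightarrow> arr f" "lin A M N f \<Longrightarrow> adom f = ucar M" "lin A M N f \<Longrightarrow> acod f = ucar N"
  "lin A M N f \<Longrightarrow> f \<bullet> ac A M = ac A N \<bullet> (f ** ide (mcar A))"
  by (auto simp: lin_def)

lemma lin_comp: assumes "lin A M N f" "lin A N P g" "md A M" "md A N" "md A P"
  shows "lin A M P (g \<bullet> f)"
proof -
  note [simp] = md_simps[OF assms(3)] md_simps[OF assms(4)] md_simps[OF assms(5)]
  note [simp] = assms(3-5) linD[OF assms(1)] linD[OF assms(2)]
  show ?thesis unfolding lin_def by (simp add: comp_reduce[OF linD(4)[OF assms(2)]])
qed

lemma lin_ide: "md A M \<Longrightarrow> lin A M M (ide (ucar M))"
  by (frule md_simps(2), frule md_simps(3), frule md_simps(4)) (auto simp: lin_def)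

lemma lin_Hom: assumes "md A M" "md A N" shows "f \<in> Hom (Mod_cat C A) M N \<longleftrightarrow> lin A M N (Ar (ucar M) f (ucar N))"
proof (cases "f \<in> Hom C (ucar M) (ucar N)")
  case True
  note [simp] = md_simps[OF assms(1)] md_simps[OF assms(2)]
  have "arr (Ar (ucar M) f (ucar N))" using True by simp
  then show ?thesis using True
    by (simp add: Mod_cat_def lin_def ar_eq_iff aarr_comp aarr_tns aarr_structure aarr_mu del: arr_Ar) 
next
  case False
  then show ?thesis by (auto simp: lin_def Mod_cat_def)
qed

lemma lin_ainv: assumes "lin A M N f" "md A M" "md A N" "iso_ar f"
  shows "lin A N M (ainv f)"
proof -
  note [simp] = md_simps[OF assms(2)] md_simps[OF assms(3)]
  note [simp] = assms(2-4) ainv_simps[OF assms(4)] linD(1-3)[OF assms(1)]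
  have "f \<bullet> (ainv f \<bullet> ac A N) = f \<bullet> (ac A M \<bullet> (ainv f ** ide (mcar A)))"
    by (simp add: comp_reduce[OF linD(4)[OF assms(1)]] comp_reduce[OF ainv_simps(5)[OF assms(4)]])
  then show ?thesis unfolding lin_def
    by (auto intro!: iso_cancel_left[OF assms(4)])
qed

text \<open>The factor \<open>x\<close> is inert and \<open>A\<close> acts on \<open>M\<close>; if
  \<open>M\<close> is the monoid itself, this is the free module on \<open>x\<close>.\<close>

definition tm :: "('o, 'a) mon \<Rightarrow> 'o \<Rightarrow> ('o, 'a) mdl \<Rightarrow> ('o, 'a) mdl" where
  "tm A x M = \<lparr>ucar = x \<boxtimes> ucar M, uact = (idt C x \<boxdot> uact M) \<cdot> assoc C x (ucar M) (mcar A)\<rparr>"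

lemma ucar_tm [simp]: "ucar (tm A x M) = x \<boxtimes> ucar M" by (simp add: tm_def)

lemma uact_tm: "uact (tm A x M) = (idt C x \<boxdot> uact M) \<cdot> assoc C x (ucar M) (mcar A)" by (simp add: tm_def)

lemma ac_tm: "\<lbrakk>x \<in> Ob C; md A M\<rbrakk> \<Longrightarrow> ac A (tm A x M) = (ide x ** ac A M) \<bullet> as x (ucar M) (mcar A)"
proof -
  assume [simp]: "x \<in> Ob C" "md A M"
  note [simp] = md_simps[OF this(2)]
  have "ac A (tm A x M) = Ar ((x \<boxtimes> ucar M) \<boxtimes> mcar A) (aarr ((ide x ** ac A M) \<bullet> as x (ucar M) (mcar A))) (x \<boxtimes> ucar M)"
    by (simp add: ac_def[of A "tm A x M"] aarr_comp aarr_tns aarr_structure aarr_mu uact_tm)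
  also have "\<dots> = (ide x ** ac A M) \<bullet> as x (ucar M) (mcar A)"
    using arr_eta[of "(ide x ** ac A M) \<bullet> as x (ucar M) (mcar A)"] by simp
  finally show ?thesis .
qed

text \<open>Associativity of the new action is the pentagon around associativity of the old one; the
  unit law is \<open>ru_tens\<close>.\<close>

lemma md_tm [simp]: assumes [simp]: "x \<in> Ob C" "md A M" shows "md A (tm A x M)"
proof -
  note [simp] = md_simps[OF assms(2)]
  let ?a = "mcar A" and ?m = "ucar M" and ?\<rho> = "ac A M"
  have "((ide x ** ?\<rho>) \<bullet> as x ?m ?a) \<bullet> (((ide x ** ?\<rho>) \<bullet> as x ?m ?a) ** ide ?a)
      = (ide x ** ?\<rho>) \<bullet> ((as x ?m ?a \<bullet> ((ide x ** ?\<rho>) ** ide ?a)) \<bullet> (as x ?m ?a ** ide ?a))"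
    by simp
  also have "\<dots> = (ide x ** ?\<rho>) \<bullet> (((ide x ** (?\<rho> ** ide ?a)) \<bullet> as x (?m \<boxtimes> ?a) ?a) \<bullet> (as x ?m ?a ** ide ?a))"
    by (subst as_natural) simp_all
  also have "\<dots> = (ide x ** (?\<rho> \<bullet> (ide ?m ** mu A))) \<bullet> ((ide x ** as ?m ?a ?a) \<bullet> (as x (?m \<boxtimes> ?a) ?a \<bullet> (as x ?m ?a ** ide ?a)))"
    by (simp add: ac_assoc)
  also have "\<dots> = (ide x ** (?\<rho> \<bullet> (ide ?m ** mu A))) \<bullet> (as x ?m (?a \<boxtimes> ?a) \<bullet> as (x \<boxtimes> ?m) ?a ?a)"
    by (simp only: pentagon_ar assms md_simps[OF assms(2)])
  also have "\<dots> = (ide x ** ?\<rho>) \<bullet> (((ide x ** (ide ?m ** mu A)) \<bullet> as x ?m (?a \<boxtimes> ?a)) \<bullet> as (x \<boxtimes> ?m) ?a ?a)"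
    by simp
  also have "\<dots> = (ide x ** ?\<rho>) \<bullet> ((as x ?m ?a \<bullet> ((ide x ** ide ?m) ** mu A)) \<bullet> as (x \<boxtimes> ?m) ?a ?a)"
    by (subst as_natural) simp_all
  finally have 1: "((ide x ** ?\<rho>) \<bullet> as x ?m ?a) \<bullet> (((ide x ** ?\<rho>) \<bullet> as x ?m ?a) ** ide ?a)
    = (ide x ** ?\<rho>) \<bullet> (as x ?m ?a \<bullet> ((ide (x \<boxtimes> ?m) ** mu A) \<bullet> as (x \<boxtimes> ?m) ?a ?a))"
    by simp
  have "((ide x ** ?\<rho>) \<bullet> as x ?m ?a) \<bullet> (ide (x \<boxtimes> ?m) ** et A)
    = (ide x ** ?\<rho>) \<bullet> (as x ?m ?a \<bullet> ((ide x ** ide ?m) ** et A))" by simp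
  also have "\<dots> = (ide x ** ?\<rho>) \<bullet> ((ide x ** (ide ?m ** et A)) \<bullet> as x ?m (tunit C))"
    by (subst as_natural) simp_all
  also have "\<dots> = ru (x \<boxtimes> ?m)" by (simp add: ru_tens)
  finally show ?thesis using 1 unfolding md_def by (simp add: is_module_ar ac_tm)
qed

lemma lin_tm_right: assumes "lin A M N h" and [simp]: "x \<in> Ob C" "md A M" "md A N"
  shows "lin A (tm A x M) (tm A x N) (ide x ** h)"
proof -
  note [simp] = md_simps[OF assms(3)] md_simps[OF assms(4)]
  note [simp] = linD(1-3)[OF assms(1)]
  have "(ide x ** (h \<bullet> ac A M)) \<bullet> as x (ucar M) (mcar A)
      = (ide x ** ac A N) \<bullet> ((ide x ** (h ** ide (mcar A))) \<bullet> as x (ucar M) (mcar A))"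
    by (simp add: linD(4)[OF assms(1)])
  also have "\<dots> = (ide x ** ac A N) \<bullet> (as x (ucar N) (mcar A) \<bullet> ((ide x ** h) ** ide (mcar A)))"
    by (subst as_natural) simp_all
  finally show ?thesis by (simp add: lin_def ac_tm)
qed

lemma lin_tm_left: assumes [simp]: "arr g" "md A M"
  shows "lin A (tm A (adom g) M) (tm A (acod g) M) (g ** ide (ucar M))"
proof -
  note [simp] = md_simps[OF assms(2)]
  have "(g ** ac A M) \<bullet> as (adom g) (ucar M) (mcar A)
     = (ide (acod g) ** ac A M) \<bullet> ((g ** (ide (ucar M) ** ide (mcar A))) \<bullet> as (adom g) (ucar M) (mcar A))"
    by simp
  also have "\<dots> = (ide (acod g) ** ac A M) \<bullet> (as (acod g) (ucar M) (mcar A) \<bullet> ((g ** ide (ucar M)) ** ide (mcar A)))"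
    by (subst as_natural) simp_all
  finally show ?thesis by (simp add: lin_def ac_tm)
qed

lemma lin_as: assumes [simp]: "x \<in> Ob C" "y \<in> Ob C" "md A M"
  shows "lin A (tm A (x \<boxtimes> y) M) (tm A x (tm A y M)) (as x y (ucar M))"
proof -
  note [simp] = md_simps[OF assms(3)]
  let ?a = "mcar A" and ?m = "ucar M" and ?\<rho> = "ac A M"
  have "as x y ?m \<bullet> ((ide (x \<boxtimes> y) ** ?\<rho>) \<bullet> as (x \<boxtimes> y) ?m ?a)
    = (as x y ?m \<bullet> ((ide x ** ide y) ** ?\<rho>)) \<bullet> as (x \<boxtimes> y) ?m ?a" by simp
  also have "\<dots> = (ide x ** (ide y ** ?\<rho>)) \<bullet> (as x y (?m \<boxtimes> ?a) \<bullet> as (x \<boxtimes> y) ?m ?a)"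
    using as_natural[of "ide x" "ide y" ?\<rho> x y "?m \<boxtimes> ?a"] by (simp add: comp_assoc[symmetric] del: comp_assoc)
  also have "\<dots> = (ide x ** (ide y ** ?\<rho>)) \<bullet> ((ide x ** as y ?m ?a) \<bullet> (as x (y \<boxtimes> ?m) ?a \<bullet> (as x y ?m ** ide ?a)))"
    by (simp only: pentagon_ar assms md_simps[OF assms(3)])
  finally show ?thesis by (simp add: lin_def ac_tm)
qed

lemma lin_lu: assumes [simp]: "md A M" shows "lin A (tm A (tunit C) M) M (lu (ucar M))"
proof -
  note [simp] = md_simps[OF assms(1)]
  have "lu (ucar M) \<bullet> ((ide (tunit C) ** ac A M) \<bullet> as (tunit C) (ucar M) (mcar A))
    = (lu (ucar M) \<bullet> (ide (tunit C) ** ac A M)) \<bullet> as (tunit C) (ucar M) (mcar A)" by simp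
  also have "\<dots> = (ac A M \<bullet> lu (ucar M \<boxtimes> mcar A)) \<bullet> as (tunit C) (ucar M) (mcar A)"
    by (subst lu_natural) simp_all
  also have "\<dots> = ac A M \<bullet> (lu (ucar M) ** ide (mcar A))" by (simp add: lu_tens)
  finally show ?thesis by (simp add: lin_def ac_tm)
qed

text \<open>Precomposition with the braiding, an isomorphism, turns the condition on right actions
  into one on left actions; the hexagon produces \<open>sw\<close>.\<close>

lemma lin_iff_left:
  assumes [simp]: "x \<in> Ob C" "md A M" "md A Z" "arr h" "adom h = x \<boxtimes> ucar M" "acod h = ucar Z"
  shows "lin A (tm A x M) Z h
    \<longleftrightarrow> h \<bullet> ((ide x ** la A M) \<bullet> sw (mcar A) x (ucar M)) = la A Z \<bullet> (ide (mcar A) ** h)"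
proof -
  note [simp] = md_simps[OF assms(2)] md_simps[OF assms(3)]
  let ?a = "mcar A" and ?m = "ucar M" and ?b = "br (mcar A) (x \<boxtimes> ucar M)"
  have 1: "(ac A Z \<bullet> (h ** ide ?a)) \<bullet> ?b = la A Z \<bullet> (ide ?a ** h)"
    using br_natural[of "ide ?a" h ?a "x \<boxtimes> ?m"] by (simp add: la_def)
  have 2: "(h \<bullet> ac A (tm A x M)) \<bullet> ?b = h \<bullet> ((ide x ** la A M) \<bullet> sw ?a x ?m)"
    by (simp add: ac_tm la_def sw_hexagon)
  have "iso_ar ?b" by simp
  then have "h \<bullet> ac A (tm A x M) = ac A Z \<bullet> (h ** ide ?a)
      \<longleftrightarrow> (h \<bullet> ac A (tm A x M)) \<bullet> ?b = (ac A Z \<bullet> (h ** ide ?a)) \<bullet> ?b"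
    by (subst iso_cancel_right_iff) (simp_all add: ac_tm)
  then show ?thesis unfolding lin_def using 1 2 by simp
qed

lemma lin_iff_la:
  assumes [simp]: "md A M" "md A Z" "arr h" "adom h = ucar M" "acod h = ucar Z"
  shows "lin A M Z h \<longleftrightarrow> h \<bullet> la A M = la A Z \<bullet> (ide (mcar A) ** h)"
proof -
  note [simp] = md_simps[OF assms(1)] md_simps[OF assms(2)]
  let ?a = "mcar A" and ?m = "ucar M" and ?b = "br (mcar A) (ucar M)"
  have 1: "(ac A Z \<bullet> (h ** ide ?a)) \<bullet> ?b = la A Z \<bullet> (ide ?a ** h)"
    using br_natural[of "ide ?a" h ?a "?m"] by (simp add: la_def)
  have "iso_ar ?b" by simp
  then have "h \<bullet> ac A M = ac A Z \<bullet> (h ** ide ?a)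
      \<longleftrightarrow> (h \<bullet> ac A M) \<bullet> ?b = (ac A Z \<bullet> (h ** ide ?a)) \<bullet> ?b"
    by (subst iso_cancel_right_iff) simp_all
  then show ?thesis unfolding lin_def using 1 by (simp add: la_def)
qed

lemma la_unit: assumes [simp]: "md A M" shows "la A M \<bullet> (et A ** ide (ucar M)) = lu (ucar M)"
proof -
  note [simp] = md_simps[OF assms(1)]
  have "la A M \<bullet> (et A ** ide (ucar M)) = ac A M \<bullet> ((ide (ucar M) ** et A) \<bullet> br (tunit C) (ucar M))"
    by (subst br_natural) (simp_all add: la_def)
  also have "\<dots> = ru (ucar M) \<bullet> br (tunit C) (ucar M)"
    by (simp only: comp_reduce[OF md_simps(5)[OF assms]])
  finally show ?thesis by (simp add: ru_br)
qed

text \<open>In elements, a(bm) is (mb)a = m(ba), and commutativity of the multiplication turns this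
  into (ab)m. The braidings are collected into one by \<open>hexagon2\<close>.\<close>

lemma la_assoc: assumes [simp]: "md A M"
  shows "la A M \<bullet> (mu A ** ide (ucar M)) = la A M \<bullet> ((ide (mcar A) ** la A M) \<bullet> as (mcar A) (mcar A) (ucar M))"
proof -
  note [simp] = md_simps[OF assms(1)]
  let ?a = "mcar A" and ?m = "ucar M" and ?\<rho> = "ac A M"
  let ?k = "as' ?a ?m ?a \<bullet> ((ide ?a ** br ?a ?m) \<bullet> as ?a ?a ?m)"
  have "la A M \<bullet> ((ide ?a ** la A M) \<bullet> as ?a ?a ?m)
    = ?\<rho> \<bullet> ((br ?a ?m \<bullet> (ide ?a ** ?\<rho>)) \<bullet> ((ide ?a ** br ?a ?m) \<bullet> as ?a ?a ?m))"
    by (simp add: la_def)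
  also have "\<dots> = ?\<rho> \<bullet> (((?\<rho> ** ide ?a) \<bullet> br ?a (?m \<boxtimes> ?a)) \<bullet> ((ide ?a ** br ?a ?m) \<bullet> as ?a ?a ?m))"
    by (subst br_natural) simp_all
  also have "\<dots> = ?\<rho> \<bullet> ((ide ?m ** mu A) \<bullet> ((as ?m ?a ?a \<bullet> (br ?a (?m \<boxtimes> ?a) \<bullet> as ?a ?m ?a)) \<bullet> ?k))"
    using comp_reduce[OF ac_assoc[OF assms], of "br ?a (?m \<boxtimes> ?a) \<bullet> ((ide ?a ** br ?a ?m) \<bullet> as ?a ?a ?m)"]
    by simp
  also have "\<dots> = ?\<rho> \<bullet> ((ide ?m ** mu A) \<bullet> (((ide ?m ** br ?a ?a) \<bullet> (as ?m ?a ?a \<bullet> (br ?a ?m ** ide ?a))) \<bullet> ?k))"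
    by (simp only: hexagon_ar assms md_simps[OF assms])
  also have "\<dots> = ?\<rho> \<bullet> ((ide ?m ** mu A) \<bullet> br (?a \<boxtimes> ?a) ?m)"
    by (simp add: hexagon2)
  also have "\<dots> = ?\<rho> \<bullet> (br ?a ?m \<bullet> (mu A ** ide ?m))"
    by (subst br_natural) simp_all
  finally show ?thesis by (simp add: la_def)
qed

text \<open>Both sides multiply by two scalars, in different orders, so commutativity enters
  again.\<close>

lemma lin_la: assumes [simp]: "md A M" shows "lin A (tm A (mcar A) M) M (la A M)"
proof -
  note [simp] = md_simps[OF assms(1)]
  let ?a = "mcar A" and ?m = "ucar M"
  have *: "la A M \<bullet> (ide ?a ** la A M) = la A M \<bullet> ((mu A ** ide ?m) \<bullet> as' ?a ?a ?m)"
    by (simp add: comp_reduce[OF la_assoc])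
  have "la A M \<bullet> ((ide ?a ** la A M) \<bullet> sw ?a ?a ?m) = la A M \<bullet> (ide ?a ** la A M)"
    by (simp add: comp_reduce[OF *] sw_def) (simp add: *)
  then show ?thesis by (simp add: lin_iff_left)
qed

text \<open>The converse of passing to \<open>la\<close>. The action of a second monoid on a base
  change will be built as a left action.\<close>

lemma md_of_left_action:
  assumes [simp]: "comm_mon C A" "t \<in> Ob C" "arr l" "adom l = mcar A \<boxtimes> t" "acod l = t"
    and unit: "l \<bullet> (et A ** ide t) = lu t"
    and assoc: "l \<bullet> (mu A ** ide t) = l \<bullet> ((ide (mcar A) ** l) \<bullet> as (mcar A) (mcar A) t)"
    and M: "M = \<lparr>ucar = t, uact = aarr (l \<bullet> br t (mcar A))\<rparr>"
  shows "md A M" "la A M = l" "ac A M = l \<bullet> br t (mcar A)"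
proof -
  let ?a = "mcar A"
  let ?\<rho> = "l \<bullet> br t ?a"
  have [simp]: "ucar M = t" by (simp add: M)
  show ac: "ac A M = ?\<rho>" using arr_eta[of ?\<rho>] by (simp add: ac_def M)
  then show "la A M = l" by (simp add: la_def)
  have a: "l \<bullet> (ide ?a ** l) = l \<bullet> ((mu A ** ide t) \<bullet> as' ?a ?a t)"
    by (simp add: comp_reduce[OF assoc])
  have "?\<rho> \<bullet> (?\<rho> ** ide ?a) = l \<bullet> ((br t ?a \<bullet> (l ** ide ?a)) \<bullet> (br t ?a ** ide ?a))" by simp
  also have "\<dots> = l \<bullet> (((ide ?a ** l) \<bullet> br (?a \<boxtimes> t) ?a) \<bullet> (br t ?a ** ide ?a))"
    by (subst br_natural) simp_all
  also have "\<dots> = l \<bullet> ((mu A ** ide t) \<bullet> (as' ?a ?a t \<bullet> ((ide ?a ** br t ?a) \<bullet> (as ?a t ?a \<bullet> (br t ?a ** ide ?a)))))"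
    by (simp add: comp_reduce[OF a] hexagon2)
  also have "\<dots> = l \<bullet> ((mu A ** ide t) \<bullet> (as' ?a ?a t \<bullet> (as ?a ?a t \<bullet> (br t (?a \<boxtimes> ?a) \<bullet> as t ?a ?a))))"
    by (simp only: hexagon_ar assms comm_mon_simps)
  also have "\<dots> = l \<bullet> (((mu A ** ide t) \<bullet> br t (?a \<boxtimes> ?a)) \<bullet> as t ?a ?a)"
    by simp
  also have "\<dots> = ?\<rho> \<bullet> ((ide t ** mu A) \<bullet> as t ?a ?a)"
    by (subst br_natural) simp_all
  finally have 1: "?\<rho> \<bullet> (?\<rho> ** ide ?a) = ?\<rho> \<bullet> ((ide t ** mu A) \<bullet> as t ?a ?a)" .
  have "?\<rho> \<bullet> (ide t ** et A) = l \<bullet> ((et A ** ide t) \<bullet> br t (tunit C))"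
    by (subst br_natural) simp_all
  then have 2: "?\<rho> \<bullet> (ide t ** et A) = ru t"
    by (simp add: comp_reduce[OF unit] lu_br)
  show "md A M" using 1 2 ac unfolding md_def by (simp add: is_module_ar)
qed

lemma self_mdl_simps [simp]: "ucar (self_mdl A) = mcar A" "ac A (self_mdl A) = mu A"
  by (auto simp: self_mdl_def ac_def mu_def)

lemma la_self [simp]: "comm_mon C A \<Longrightarrow> la A (self_mdl A) = mu A"
  by (simp add: la_def)

lemma md_self [simp]: "comm_mon C A \<Longrightarrow> md A (self_mdl A)"
  by (simp add: md_def is_module_ar mu_assoc)

text \<open>Linearity of the action map out of the free module on \<open>ucar M\<close> is exactly
  associativity of the action.\<close>

lemma lin_ac: assumes [simp]: "md A M" shows "lin A (tm A (ucar M) (self_mdl A)) M (ac A M)"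
  supply [simp] = md_simps[OF assms(1)]
  by (simp add: lin_def ac_tm ac_assoc)

subsection \<open>Restriction of scalars\<close>

definition mh :: "('o, 'a) mon \<Rightarrow> ('o, 'a) mon \<Rightarrow> ('o, 'a) ar \<Rightarrow> bool" where
  "mh A B f \<longleftrightarrow> comm_mon C A \<and> comm_mon C B \<and> arr f \<and> adom f = mcar A \<and> acod f = mcar B \<and>
    f \<bullet> mu A = mu B \<bullet> (f ** f) \<and> f \<bullet> et A = et B"

lemma mh_simps: assumes "mh A B f"
  shows "comm_mon C A" "comm_mon C B" "arr f" "adom f = mcar A" "acod f = mcar B" "f \<bullet> et A = et B"
  using assms by (auto simp: mh_def)

lemma mh_mu: "mh A B f \<Longrightarrow> f \<bullet> mu A = mu B \<bullet> (f ** f)" by (simp add: mh_def)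

lemma mh_Hom: "\<lbrakk>comm_mon C A; comm_mon C B\<rbrakk> \<Longrightarrow> f \<in> Hom (Comm C) A B \<longleftrightarrow> mh A B (Ar (mcar A) f (mcar B))"
proof (cases "f \<in> Hom C (mcar A) (mcar B)")
  case True
  assume [simp]: "comm_mon C A" "comm_mon C B"
  have "arr (Ar (mcar A) f (mcar B))" using True by simp
  then show ?thesis using True
    by (simp add: Comm_def mh_def ar_eq_iff aarr_comp aarr_tns aarr_structure aarr_mu del: arr_Ar) 
next
  case False
  then show ?thesis by (auto simp: mh_def Comm_def)
qed

lemma mh_comp: assumes "mh A B f" "mh B D g"
  shows "mh A D (g \<bullet> f)"
proof -
  note [simp] = mh_simps[OF assms(1)] mh_simps[OF assms(2)]
  note [simp] = mh_simps[OF assms(1)] mh_simps[OF assms(2)]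
  have "g \<bullet> (f \<bullet> mu A) = mu D \<bullet> ((g \<bullet> f) ** (g \<bullet> f))"
    by (simp add: mh_mu[OF assms(1)] comp_reduce[OF mh_mu[OF assms(2)]])
  then show ?thesis by (simp add: mh_def)
qed

lemma mh_ide: "comm_mon C A \<Longrightarrow> mh A A (ide (mcar A))"
  by (simp add: mh_def)

definition rm :: "('o, 'a) ar \<Rightarrow> ('o, 'a) mdl \<Rightarrow> ('o, 'a) mdl" where
  "rm f Z = \<lparr>ucar = ucar Z, uact = uact Z \<cdot> (idt C (ucar Z) \<boxdot> aarr f)\<rparr>"

lemma ucar_rm [simp]: "ucar (rm f Z) = ucar Z" by (simp add: rm_def)

lemma uact_rm: "uact (rm f Z) = uact Z \<cdot> (idt C (ucar Z) \<boxdot> aarr f)" by (simp add: rm_def)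

lemma ac_rm: assumes "mh A B f" "md B Z" shows "ac A (rm f Z) = ac B Z \<bullet> (ide (ucar Z) ** f)"
proof -
  note [simp] = mh_simps[OF assms(1)] md_simps[OF assms(2)]
  note [simp] = mh_simps[OF assms(1)] assms(2)
  have "ac A (rm f Z) = Ar (ucar Z \<boxtimes> mcar A) (aarr (ac B Z \<bullet> (ide (ucar Z) ** f))) (ucar Z)"
    by (simp add: ac_def[of A "rm f Z"] aarr_comp aarr_tns aarr_structure aarr_mu uact_rm)
  also have "\<dots> = ac B Z \<bullet> (ide (ucar Z) ** f)"
    using arr_eta[of "ac B Z \<bullet> (ide (ucar Z) ** f)"] by simp
  finally show ?thesis .
qed

lemma la_rm: assumes "mh A B f" "md B Z" shows "la A (rm f Z) = la B Z \<bullet> (f ** ide (ucar Z))"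
proof -
  note [simp] = mh_simps[OF assms(1)] md_simps[OF assms(2)]
  note [simp] = mh_simps[OF assms(1)] assms(2)
  show ?thesis using br_natural[of f "ide (ucar Z)" "mcar A" "ucar Z"]
    by (simp add: la_def ac_rm[OF assms])
qed

lemma md_rm: assumes "mh A B f" "md B Z" shows "md A (rm f Z)"
proof -
  note [simp] = mh_simps[OF assms(1)] md_simps[OF assms(2)]
  note [simp] = mh_simps[OF assms(1)] assms(2)
  let ?z = "ucar Z" and ?a = "mcar A" and ?b = "mcar B"
  have "(ac B Z \<bullet> (ide ?z ** f)) \<bullet> ((ac B Z \<bullet> (ide ?z ** f)) ** ide ?a)
      = ac B Z \<bullet> ((ac B Z ** ide ?b) \<bullet> ((ide ?z ** f) ** f))" by simp
  also have "\<dots> = ac B Z \<bullet> ((ide ?z ** mu B) \<bullet> (as ?z ?b ?b \<bullet> ((ide ?z ** f) ** f)))"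
    using comp_reduce[OF ac_assoc[OF assms(2)], of "((ide ?z ** f) ** f)"] by simp
  also have "\<dots> = ac B Z \<bullet> ((ide ?z ** mu B) \<bullet> ((ide ?z ** (f ** f)) \<bullet> as ?z ?a ?a))"
    by (subst as_natural) simp_all
  also have "\<dots> = (ac B Z \<bullet> (ide ?z ** f)) \<bullet> ((ide ?z ** mu A) \<bullet> as ?z ?a ?a)"
    by (simp add: mh_mu[OF assms(1)])
  finally show ?thesis unfolding md_def by (simp add: is_module_ar ac_rm[OF assms])
qed

lemma lin_rm: assumes "mh A B f" "md B M" "md B N" "lin B M N k" shows "lin A (rm f M) (rm f N) k"
proof -
  note [simp] = mh_simps[OF assms(1)] md_simps[OF assms(2)] md_simps[OF assms(3)]
  note [simp] = mh_simps[OF assms(1)] assms(2,3) linD(1-3)[OF assms(4)]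
  show ?thesis using comp_reduce[OF linD(4)[OF assms(4)], of "ide (ucar M) ** f"]
    by (simp add: lin_def ac_rm[OF assms(1)])
qed

lemma mdl_eqI: "\<lbrakk>ac A M = ac A N; ucar M = ucar N\<rbrakk> \<Longrightarrow> M = N"
  by (cases M, cases N) (simp add: ac_def)

text \<open>An equality of modules and not merely an isomorphism, so that it can be used for
  rewriting; the same holds for \<open>rm_comp\<close>.\<close>

lemma rm_tm: assumes "mh A B f" "md B M" and [simp]: "x \<in> Ob C"
  shows "rm f (tm B x M) = tm A x (rm f M)"
proof (rule mdl_eqI[of A])
  note [simp] = mh_simps[OF assms(1)] md_simps[OF assms(2)] assms(2)
  have "ac A (rm f (tm B x M)) = (ide x ** ac B M) \<bullet> (as x (ucar M) (mcar B) \<bullet> ((ide x ** ide (ucar M)) ** f))"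
    by (simp add: ac_rm[OF assms(1)] ac_tm)
  also have "\<dots> = (ide x ** ac B M) \<bullet> ((ide x ** (ide (ucar M) ** f)) \<bullet> as x (ucar M) (mcar A))"
    by (subst as_natural) simp_all
  also have "\<dots> = ac A (tm A x (rm f M))"
    by (simp add: ac_rm[OF assms(1)] ac_tm md_rm[OF assms(1)])
  finally show "ac A (rm f (tm B x M)) = ac A (tm A x (rm f M))" .
qed simp

lemma rm_ide: "md A M \<Longrightarrow> rm (ide (mcar A)) M = M"
  by (rule mdl_eqI[of A]) (simp_all add: ac_rm[OF mh_ide] md_simps)

lemma rm_comp: assumes "mh A B f" "mh B D g" "md D M" shows "rm (g \<bullet> f) M = rm f (rm g M)"
proof (rule mdl_eqI[of A])
  note [simp] = mh_simps[OF assms(1)] mh_simps[OF assms(2)] md_simps[OF assms(3)]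
  note [simp] = mh_simps[OF assms(1)] mh_simps[OF assms(2)] assms(3)
  show "ac A (rm (g \<bullet> f) M) = ac A (rm f (rm g M))"
    by (simp add: ac_rm[OF mh_comp[OF assms(1,2)]] ac_rm[OF assms(1)] ac_rm[OF assms(2)] md_rm[OF assms(2)])
qed simp

end

section \<open>Coequalizers\<close>

text \<open>The objects \<open>s, t\<close> also serve as names of the two parallel arrows.\<close>

definition par :: "'j \<Rightarrow> 'j \<Rightarrow> 'j \<Rightarrow> ('j, 'j) cat" where
  "par e s t = \<lparr>Ob = {s, t}, Hom = (\<lambda>i j. if i = j then {e} else if i = s \<and> j = t then {s, t} else {}),
     idt = (\<lambda>_. e), cmp = (\<lambda>g f. if g = e then f else g)\<rparr>"

lemma category_par: "\<lbrakk>e \<noteq> s; e \<noteq> t; s \<noteq> t\<rbrakk> \<Longrightarrow> category (par e s t)"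
  by unfold_locales (auto simp: par_def split: if_splits)

context category
begin

lemma is_functor_par:
  assumes "e \<noteq> s" "e \<noteq> t" "s \<noteq> t" "x \<in> Ob K" "y \<in> Ob K" "f \<in> Hom K x y" "g \<in> Hom K x y"
  shows "is_functor (par e s t) K (\<lambda>i. if i = s then x else y)
    (\<lambda>i j u. if u = e then idt K (if i = s then x else y) else if u = s then f else g)"
  using assms by (auto simp: is_functor_def par_def idt_Hom idt_left idt_right split: if_splits)

text \<open>A cocone on the parallel pair is determined by its component at \<open>t\<close>; the
  one at \<open>s\<close> is forced.\<close>

lemma is_colimit_par:
  assumes "e \<noteq> s" "e \<noteq> t" "s \<noteq> t" and F: "is_functor (par e s t) K Fo Fa"
  shows "is_colimit K (par e s t) Fo Fa l c \<longleftrightarrow>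
    is_coequalizer K (Fo s) (Fo t) (Fa s t s) (Fa s t t) l (c t) \<and> c s = c t \<cdot> Fa s t s"
proof -
  have ob: "Fo s \<in> Ob K" "Fo t \<in> Ob K" and h: "Fa s t s \<in> Hom K (Fo s) (Fo t)" "Fa s t t \<in> Hom K (Fo s) (Fo t)"
    and i: "Fa s s e = idt K (Fo s)" "Fa t t e = idt K (Fo t)"
    using F assms(1-3) by (auto simp: is_functor_def par_def)
  have coc: "is_cocone K (par e s t) Fo Fa m d \<longleftrightarrow> m \<in> Ob K \<and> d t \<in> Hom K (Fo t) m \<and>
      d t \<cdot> Fa s t s = d t \<cdot> Fa s t t \<and> d s = d t \<cdot> Fa s t s" for m d
    using assms(1-3) ob h i by (auto simp: is_cocone_def par_def idt_right cmp_Hom)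
  have *: "(\<forall>i\<in>Ob (par e s t). h \<cdot> c i = d i) \<longleftrightarrow> h \<cdot> c t = d t"
    if "h \<in> Hom K l m" "is_cocone K (par e s t) Fo Fa l c" "is_cocone K (par e s t) Fo Fa m d" for h m d
    using that ob h by (auto simp: coc) (auto simp: par_def cmp_assoc[of "Fo s" "Fo t" l m, symmetric])
  show ?thesis
  proof
    assume L: "is_colimit K (par e s t) Fo Fa l c"
    then have c: "is_cocone K (par e s t) Fo Fa l c" by (simp add: is_colimit_def)
    have "\<exists>!h. h \<in> Hom K l m \<and> h \<cdot> c t = r"
      if "m \<in> Ob K" "r \<in> Hom K (Fo t) m" "r \<cdot> Fa s t s = r \<cdot> Fa s t t" for m r
    proof -
      define d where "d i = (if i = t then r else r \<cdot> Fa s t s)" for i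
      have d: "is_cocone K (par e s t) Fo Fa m d" using that assms(3) by (simp add: coc d_def)
      then have "\<exists>!h. h \<in> Hom K l m \<and> (\<forall>i\<in>Ob (par e s t). h \<cdot> c i = d i)"
        using L by (simp add: is_colimit_def)
      then show ?thesis using *[OF _ c d] by (simp add: d_def cong: conj_cong)
    qed
    then show "is_coequalizer K (Fo s) (Fo t) (Fa s t s) (Fa s t t) l (c t) \<and> c s = c t \<cdot> Fa s t s"
      using c by (auto simp: coc is_coequalizer_def)
  next
    assume R: "is_coequalizer K (Fo s) (Fo t) (Fa s t s) (Fa s t t) l (c t) \<and> c s = c t \<cdot> Fa s t s"
    then have c: "is_cocone K (par e s t) Fo Fa l c" by (auto simp: coc is_coequalizer_def)
    have "\<exists>!h. h \<in> Hom K l m \<and> (\<forall>i\<in>Ob (par e s t). h \<cdot> c i = d i)"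
      if d: "is_cocone K (par e s t) Fo Fa m d" for m d
    proof -
      have "\<exists>!h. h \<in> Hom K l m \<and> h \<cdot> c t = d t"
        using R d by (simp add: is_coequalizer_def coc)
      then show ?thesis using *[OF _ c d] by (simp cong: conj_cong)
    qed
    then show "is_colimit K (par e s t) Fo Fa l c" using c by (simp add: is_colimit_def)
  qed
qed

section \<open>Coequalizers of tagged arrows\<close>

definition coeq :: "('o, 'a) ar \<Rightarrow> ('o, 'a) ar \<Rightarrow> ('o, 'a) ar \<Rightarrow> bool" where
  "coeq f g q \<longleftrightarrow> arr f \<and> arr g \<and> arr q \<and> adom f = adom g \<and> acod f = acod g \<and> adom q = acod f \<and>
    comp q f = comp q g \<and> (\<forall>r. arr r \<and> adom r = acod f \<and> comp r f = comp r g \<longrightarrow>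
      (\<exists>!h. arr h \<and> adom h = acod q \<and> acod h = acod r \<and> comp h q = r))"

lemma coeqD: "coeq f g q \<Longrightarrow> arr f" "coeq f g q \<Longrightarrow> arr g" "coeq f g q \<Longrightarrow> arr q"
  "coeq f g q \<Longrightarrow> adom f = adom g" "coeq f g q \<Longrightarrow> acod f = acod g" "coeq f g q \<Longrightarrow> adom q = acod f"
  "coeq f g q \<Longrightarrow> comp q f = comp q g"
  by (auto simp: coeq_def)

lemma coeq_ex:
  assumes "coeq f g q" "arr r" "adom r = acod f" "comp r f = comp r g"
  obtains h where "arr h" "adom h = acod q" "acod h = acod r" "comp h q = r"
  using assms unfolding coeq_def by blast

lemma coeq_exD:
  assumes "coeq f g q" "arr r" "adom r = acod f" "comp r f = comp r g"
  shows "\<exists>h. arr h \<and> adom h = acod q \<and> acod h = acod r \<and> comp h q = r"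
  using assms unfolding coeq_def by blast

lemma coeq_epi:
  assumes q: "coeq f g q" and h: "arr h" "adom h = acod q" "arr h'" "adom h' = acod q" "comp h q = comp h' q"
  shows "h = h'"
proof -
  have "acod h = acod h'" using h coeqD[OF q] by (metis acod_comp)
  moreover have "\<exists>!k. arr k \<and> adom k = acod q \<and> acod k = acod (comp h q) \<and> comp k q = comp h q"
    using q h coeqD[OF q] unfolding coeq_def by (metis adom_comp arr_comp comp_assoc)
  ultimately show ?thesis using h coeqD[OF q] by (metis acod_comp)
qed

lemma is_coequalizer_coeq:
  assumes "x \<in> Ob K" "y \<in> Ob K" "f \<in> Hom K x y" "g \<in> Hom K x y"
  shows "is_coequalizer K x y f g l q \<longleftrightarrow> coeq (Ar x f y) (Ar x g y) (Ar y q l)"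
proof
  assume L: "is_coequalizer K x y f g l q"
  then have q: "l \<in> Ob K" "q \<in> Hom K y l" "q \<cdot> f = q \<cdot> g" by (auto simp: is_coequalizer_def)
  have "\<exists>!h. arr h \<and> adom h = l \<and> acod h = acod r \<and> comp h (Ar y q l) = r"
    if r: "arr r" "adom r = y" "comp r (Ar x f y) = comp r (Ar x g y)" for r
  proof -
    obtain r' z where [simp]: "r = Ar y r' z" and r': "z \<in> Ob K" "r' \<in> Hom K y z"
      using r by (auto elim: arrE)
    have "\<exists>!h. h \<in> Hom K l z \<and> h \<cdot> q = r'" using L r r' assms by (auto simp: is_coequalizer_def)
    then obtain h where h: "h \<in> Hom K l z" "h \<cdot> q = r'" and u: "\<And>h'. h' \<in> Hom K l z \<Longrightarrow> h' \<cdot> q = r' \<Longrightarrow> h' = h"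
      by auto
    show ?thesis
    proof (rule ex1I[of _ "Ar l h z"])
      fix k assume k: "arr k \<and> adom k = l \<and> acod k = acod r \<and> comp k (Ar y q l) = r"
      then obtain k' where "k = Ar l k' z" "k' \<in> Hom K l z" by (auto elim: arrE)
      then show "k = Ar l h z" using k u q assms r' by simp
    qed (use h q assms r' in simp)
  qed
  then show "coeq (Ar x f y) (Ar x g y) (Ar y q l)"
    using q assms by (simp add: coeq_def)
next
  assume R: "coeq (Ar x f y) (Ar x g y) (Ar y q l)"
  then have q: "l \<in> Ob K" "q \<in> Hom K y l" "q \<cdot> f = q \<cdot> g" using assms by (auto simp: coeq_def)
  have "\<exists>!h. h \<in> Hom K l m \<and> h \<cdot> q = r"
    if r: "m \<in> Ob K" "r \<in> Hom K y m" "r \<cdot> f = r \<cdot> g" for m r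
  proof -
    obtain h where "arr h" "adom h = l" "acod h = m" "comp h (Ar y q l) = Ar y r m"
      using coeq_ex[OF R, of "Ar y r m"] r assms by auto
    then obtain h' where h': "h' \<in> Hom K l m" "h' \<cdot> q = r" using q assms r by (auto elim!: arrE)
    show ?thesis
    proof (rule ex1I[of _ h'])
      fix k assume "k \<in> Hom K l m \<and> k \<cdot> q = r"
      then have "comp (Ar l k m) (Ar y q l) = comp (Ar l h' m) (Ar y q l)" using h' q assms r by simp
      then have "Ar l k m = Ar l h' m"
        by (rule coeq_epi[OF R, rotated -1]) (use \<open>k \<in> _ \<and> _\<close> h' q assms r in auto)
      then show "k = h'" by simp
    qed (use h' in simp)
  qed
  then show "is_coequalizer K x y f g l q" using q by (auto simp: is_coequalizer_def)
qed

text \<open>The isomorphisms \<open>a\<close> on sources and \<open>b\<close> on targets identify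
  the new parallel pair with the old one, so factorizations are transported through
  \<open>ainv b\<close>.\<close>

lemma coeq_iso:
  assumes q: "coeq f g q" and iso: "iso_ar a" "iso_ar b"
    and f': "arr f'" "acod f' = adom b" "comp b f' = comp f a"
    and g': "arr g'" "acod g' = adom b" "comp b g' = comp g a"
    and a: "acod a = adom f" and b: "acod b = acod f"
  shows "coeq f' g' (comp q b)"
proof -
  note [simp] = coeqD(1-3)[OF q] coeqD(4-5)[OF q,symmetric] coeqD(6)[OF q] ainv_simps[OF iso(1)] ainv_simps[OF iso(2)] f' g' a b
  have d: "adom f' = adom a" "adom g' = adom a"
    using f' g' by (metis adom_comp ainv_simps(1) arr_comp coeqD(1,2,4)[OF q] iso a b)+
  note [simp] = d
  have e: "comp q (comp b f') = comp q (comp b g')"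
    using comp_reduce[OF coeqD(7)[OF q]] by simp
  have "\<exists>!h. arr h \<and> adom h = acod q \<and> acod h = acod r \<and> comp h (comp q b) = r"
    if r: "arr r" "adom r = adom b" "comp r f' = comp r g'" for r
  proof -
    have "comp (ainv b) (comp b f') = f'" "comp (ainv b) (comp b g') = g'"
      by (simp_all only: comp_reduce[OF ainv_simps(6)[OF iso(2)]]) simp_all
    then have fb: "f' = comp (ainv b) (comp f a)" "g' = comp (ainv b) (comp g a)"
      by (simp_all only: f'(3) g'(3))
    have "comp (comp (comp r (ainv b)) f) a = comp (comp (comp r (ainv b)) g) a"
      using r(3) by (simp only: fb comp_assoc)
    then have "comp (comp r (ainv b)) f = comp (comp r (ainv b)) g"
      by (rule iso_cancel_right[OF iso(1)]) (simp_all add: r)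
    then obtain h where h: "arr h" "adom h = acod q" "acod h = acod r" "comp h q = comp r (ainv b)"
      using coeq_exD[OF q, of "comp r (ainv b)"] r by auto
    show ?thesis
    proof (rule ex1I[of _ h])
      show "arr h \<and> adom h = acod q \<and> acod h = acod r \<and> comp h (comp q b) = r"
        using h r by (simp add: comp_reduce[OF h(4)])
      fix k assume k: "arr k \<and> adom k = acod q \<and> acod k = acod r \<and> comp k (comp q b) = r"
      then have "comp (comp k q) b = comp (comp h q) b" using h r by (simp add: comp_reduce[OF h(4)])
      then have "comp k q = comp h q" by (rule iso_cancel_right[OF iso(2)]) (use h k r in simp_all)
      then show "k = h" by (rule coeq_epi[OF q, rotated -1]) (use h k in simp_all)
    qed
  qed
  then show ?thesis unfolding coeq_def using e by simp
qed

lemma coeq_iso_cod: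
  assumes q: "coeq f g q" and k: "iso_ar k" "adom k = acod q"
  shows "coeq f g (comp k q)"
proof -
  note [simp] = coeqD(1-3)[OF q] coeqD(4-5)[OF q,symmetric] coeqD(6)[OF q] ainv_simps[OF k(1)] k(2)
  have "\<exists>!h. arr h \<and> adom h = acod k \<and> acod h = acod r \<and> comp h (comp k q) = r"
    if r: "arr r" "adom r = acod f" "comp r f = comp r g" for r
  proof -
    obtain h where h: "arr h" "adom h = acod q" "acod h = acod r" "comp h q = r"
      by (rule coeq_ex[OF q r])
    show ?thesis
    proof (rule ex1I[of _ "comp h (ainv k)"])
      show "arr (comp h (ainv k)) \<and> adom (comp h (ainv k)) = acod k \<and> acod (comp h (ainv k)) = acod r \<and>
          comp (comp h (ainv k)) (comp k q) = r"
        using h r by (simp add: comp_reduce[OF ainv_simps(6)[OF k(1)]])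
      fix j assume j: "arr j \<and> adom j = acod k \<and> acod j = acod r \<and> comp j (comp k q) = r"
      have "comp (comp j k) q = comp h q" using j h by simp
      then have "comp j k = h" by (rule coeq_epi[OF q, rotated -1]) (use h j in simp_all)
      then have "comp (comp j k) (ainv k) = comp h (ainv k)" by simp
      then show "j = comp h (ainv k)" using j by simp
    qed
  qed
  then show ?thesis unfolding coeq_def using comp_reduce[OF coeqD(7)[OF q]] coeqD(7)[OF q] by simp
qed

end

section \<open>Coequalizers and the tensor product under the standing assumptions\<close>

locale geometry = symmetric_monoidal_category C + relative_geometry_setting U C
  for U :: "'u set" and C :: "('o, 'a) moncat" (structure)
begin

notation comp (infixr "\<bullet>" 70)
notation tns (infixr "**" 75)

lemma infinite_U: "infinite U"
proof -
  have "(UNIV :: nat set) \<lesssim> U" using universe by (simp add: universe_def small_def lesspoll_def)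
  then show ?thesis by (simp add: infinite_le_lepoll)
qed

lemma small_finite: "finite S \<Longrightarrow> small U S"
  unfolding small_def using infinite_U by (simp add: finite_lesspoll_infinite)

text \<open>Small index categories must have their objects and arrows inside \<open>U\<close>; the
  shapes of coequalizers and of pullbacks each need three names.\<close>

lemma three_elements: obtains e s t where "e \<in> U" "s \<in> U" "t \<in> U" "e \<noteq> s" "e \<noteq> t" "s \<noteq> t"
proof -
  obtain T where T: "T \<subseteq> U" "card T = 3" "finite T" using infinite_arbitrarily_large[OF infinite_U] by metis
  then obtain a b c where "T = {a, b, c}" "a \<noteq> b" "b \<noteq> c" "a \<noteq> c" by (auto simp: card_3_iff)
  with T show ?thesis using that by auto
qed

lemma small_cat_par: "\<lbrakk>e \<in> U; s \<in> U; t \<in> U; e \<noteq> s; e \<noteq> t; s \<noteq> t\<rbrakk> \<Longrightarrow> small_cat U (par e s t)"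
  using category_par[of e s t] by (auto simp: small_cat_def small_finite) (auto simp: small_finite par_def split: if_splits)

lemma coeq_exists:
  assumes "arr f" "arr g" "adom f = adom g" "acod f = acod g"
  obtains q where "coeq f g q"
proof -
  obtain x f' y where f: "f = Ar x f' y" "x \<in> Ob C" "y \<in> Ob C" "f' \<in> Hom C x y" using assms(1) by (rule arrE)
  define g' where "g' = aarr g"
  have g: "g = Ar x g' y" "g' \<in> Hom C x y" using assms f arr_eta[of g] arr_Hom[of g] by (simp_all add: g'_def)
  obtain e s t where est: "e \<in> U" "s \<in> U" "t \<in> U" "e \<noteq> s" "e \<noteq> t" "s \<noteq> t" by (rule three_elements)
  note F = is_functor_par[OF est(4-6) f(2-4) g(2)]
  obtain l c where "is_colimit C (par e s t) (\<lambda>i. if i = s then x else y)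
    (\<lambda>i j u. if u = e then idt C (if i = s then x else y) else if u = s then f' else g') l c"
    using small_colimits small_cat_par[OF est] F unfolding has_small_colimits_def by blast
  then have "is_coequalizer C x y f' g' l (c t)"
    unfolding is_colimit_par[OF est(4-6) F] using est by simp
  then have "coeq f g (Ar y (c t) l)" unfolding is_coequalizer_coeq[OF f(2-4) g(2)] f(1) g(1) .
  then show ?thesis by (rule that)
qed

text \<open>The assumption on colimits, read off for the shape \<open>par\<close>; the work lies in
  recognizing the tensored diagram as one of that form.\<close>

lemma coeq_tns_right:
  assumes q: "coeq f g q" and z: "z \<in> Ob C"
  shows "coeq (f ** ide z) (g ** ide z) (q ** ide z)"
proof -
  obtain x f' y where f: "f = Ar x f' y" "x \<in> Ob C" "y \<in> Ob C" "f' \<in> Hom C x y" using coeqD(1)[OF q] by (rule arrE)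
  define g' where "g' = aarr g"
  have g: "g = Ar x g' y" "g' \<in> Hom C x y"
    using coeqD[OF q] f arr_eta[of g] arr_Hom[of g] by (simp_all add: g'_def)
  define q' where "q' = aarr q"
  define l where "l = acod q"
  have l: "q = Ar y q' l" "l \<in> Ob C" "q' \<in> Hom C y l"
    using coeqD[OF q] f arr_eta[of q] arr_Hom[of q] arr_Ob(2)[of q] by (simp_all add: q'_def l_def)
  obtain e s t where est: "e \<in> U" "s \<in> U" "t \<in> U" "e \<noteq> s" "e \<noteq> t" "s \<noteq> t" by (rule three_elements)
  note F = is_functor_par[OF est(4-6) f(2-4) g(2)]
  let ?Fo = "\<lambda>i. if i = s then x else y"
  let ?Fa = "\<lambda>i j u. if u = e then idt C (?Fo i) else if u = s then f' else g'"
  let ?c = "\<lambda>i. if i = t then q' else q' \<cdot> f'"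
  have "is_colimit C (par e s t) ?Fo ?Fa l ?c"
    unfolding is_colimit_par[OF est(4-6) F] using q is_coequalizer_coeq[OF f(2-4) g(2), of l q'] est
    by (simp add: f(1) g(1) l(1))
  then have L: "is_colimit C (par e s t) (\<lambda>i. ?Fo i \<boxtimes> z) (\<lambda>i j u. ?Fa i j u \<boxdot> idt C z) (l \<boxtimes> z) (\<lambda>i. ?c i \<boxdot> idt C z)"
    using tensor_colimits small_cat_par[OF est] F z unfolding tensor_preserves_small_colimits_def by blast
  have "(\<lambda>i. ?Fo i \<boxtimes> z) = (\<lambda>i. if i = s then x \<boxtimes> z else y \<boxtimes> z)"
    "(\<lambda>i j u. ?Fa i j u \<boxdot> idt C z) = (\<lambda>i j u. if u = e then idt C (if i = s then x \<boxtimes> z else y \<boxtimes> z)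
      else if u = s then f' \<boxdot> idt C z else g' \<boxdot> idt C z)"
    using f z by (auto simp: fun_eq_iff tensA_idt)
  note eq = this
  have "f' \<boxdot> idt C z \<in> Hom C (x \<boxtimes> z) (y \<boxtimes> z)" "g' \<boxdot> idt C z \<in> Hom C (x \<boxtimes> z) (y \<boxtimes> z)"
    using f g z by (simp_all add: tensA_Hom idt_Hom)
  then have F': "is_functor (par e s t) C (\<lambda>i. ?Fo i \<boxtimes> z) (\<lambda>i j u. ?Fa i j u \<boxdot> idt C z)"
    unfolding eq using f(2,3) z by (intro is_functor_par[OF est(4-6)] tens_Ob)
  have "is_coequalizer C (x \<boxtimes> z) (y \<boxtimes> z) (f' \<boxdot> idt C z) (g' \<boxdot> idt C z) (l \<boxtimes> z) (q' \<boxdot> idt C z)"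
    using L est unfolding is_colimit_par[OF est(4-6) F'] by simp
  then have "coeq (Ar (x \<boxtimes> z) (f' \<boxdot> idt C z) (y \<boxtimes> z)) (Ar (x \<boxtimes> z) (g' \<boxdot> idt C z) (y \<boxtimes> z)) (Ar (y \<boxtimes> z) (q' \<boxdot> idt C z) (l \<boxtimes> z))"
    by (subst (asm) is_coequalizer_coeq) (auto simp: f g z tensA_Hom idt_Hom)
  then show ?thesis using f g z l by (simp add: tns_Ar ide_def idt_Hom)
qed

lemma coeq_tns_left:
  assumes q: "coeq f g q" and z: "z \<in> Ob C"
  shows "coeq (ide z ** f) (ide z ** g) (ide z ** q)"
proof -
  note [simp] = z coeqD(1-3)[OF q] coeqD(4-5)[OF q,symmetric] coeqD(6)[OF q] 
  have "coeq (ide z ** f) (ide z ** g) ((q ** ide z) \<bullet> br z (acod f))"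
    by (rule coeq_iso[OF coeq_tns_right[OF q z], of "br z (adom f)"]) (simp_all add: br_natural)
  then have "coeq (ide z ** f) (ide z ** g) (br (acod q) z \<bullet> ((q ** ide z) \<bullet> br z (acod f)))"
    by (rule coeq_iso_cod) simp_all
  also have "br (acod q) z \<bullet> ((q ** ide z) \<bullet> br z (acod f)) = ide z ** q"
    by (subst br_natural) simp_all
  finally show ?thesis .
qed

text \<open>The forgetful functor creates coequalizers: \<open>q ** ide (mcar A)\<close> is again a
  coequalizer, so the action of \<open>N\<close> descends, and the axioms hold because they hold
  after precomposition with tensored copies of \<open>q\<close>. The last conclusion serves to
  identify the action that \<open>bc_ob\<close> selects by \<open>THE\<close>.\<close>

lemma coeq_module:
  assumes M: "md A M" and N: "md A N" and f: "lin A M N f" and g: "lin A M N g" and q: "coeq f g q"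
  obtains Q where "md A Q" "ucar Q = acod q" "lin A N Q q"
    "\<And>\<alpha>. \<lbrakk>arr \<alpha>; adom \<alpha> = acod q \<boxtimes> mcar A; \<alpha> \<bullet> (q ** ide (mcar A)) = q \<bullet> ac A N\<rbrakk> \<Longrightarrow> \<alpha> = ac A Q"
proof -
  note [simp] = M N md_simps[OF M] md_simps[OF N] linD(1-3)[OF f] linD(1-3)[OF g] coeqD(3)[OF q]
  let ?a = "mcar A" and ?l = "acod q" and ?n = "ucar N"
  have [simp]: "adom q = ?n" using coeqD(6)[OF q] by simp
  note qa = coeq_tns_right[OF q, of ?a]
  have "q \<bullet> (ac A N \<bullet> (f ** ide ?a)) = q \<bullet> (ac A N \<bullet> (g ** ide ?a))"
    using comp_reduce[OF coeqD(7)[OF q], of "ac A M"] by (simp flip: linD(4)[OF f] linD(4)[OF g])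
  then have "\<exists>\<alpha>. arr \<alpha> \<and> adom \<alpha> = ?l \<boxtimes> ?a \<and> acod \<alpha> = ?l \<and> \<alpha> \<bullet> (q ** ide ?a) = q \<bullet> ac A N"
    using coeq_exD[OF qa, of "q \<bullet> ac A N"] by simp
  then obtain \<alpha> where \<alpha>: "arr \<alpha>" "adom \<alpha> = ?l \<boxtimes> ?a" "acod \<alpha> = ?l" "\<alpha> \<bullet> (q ** ide ?a) = q \<bullet> ac A N"
    by blast
  define Q where "Q = \<lparr>ucar = ?l, uact = aarr \<alpha>\<rparr>"
  have ac: "ac A Q = \<alpha>" using arr_eta[OF \<alpha>(1)] \<alpha> by (simp add: Q_def ac_def)
  have uQ [simp]: "ucar Q = ?l" by (simp add: Q_def)
  note [simp] = \<alpha>(1-3)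
  have qaa: "coeq ((f ** ide ?a) ** ide ?a) ((g ** ide ?a) ** ide ?a) ((q ** ide ?a) ** ide ?a)"
    by (rule coeq_tns_right[OF qa]) simp_all
  have "(\<alpha> \<bullet> (\<alpha> ** ide ?a)) \<bullet> ((q ** ide ?a) ** ide ?a) = \<alpha> \<bullet> ((q ** ide ?a) \<bullet> (ac A N ** ide ?a))"
    by (simp add: \<alpha>(4))
  also have "\<dots> = q \<bullet> (ac A N \<bullet> ((ide ?n ** mu A) \<bullet> as ?n ?a ?a))"
    by (simp only: comp_reduce[OF \<alpha>(4)]) (simp add: ac_assoc[OF N])
  also have "\<dots> = \<alpha> \<bullet> ((ide ?l ** mu A) \<bullet> ((q ** (ide ?a ** ide ?a)) \<bullet> as ?n ?a ?a))"
    using comp_reduce[OF \<alpha>(4), of "(ide ?n ** mu A) \<bullet> as ?n ?a ?a"] by simp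
  also have "\<dots> = (\<alpha> \<bullet> ((ide ?l ** mu A) \<bullet> as ?l ?a ?a)) \<bullet> ((q ** ide ?a) ** ide ?a)"
    by (subst as_natural) simp_all
  finally have 1: "\<alpha> \<bullet> (\<alpha> ** ide ?a) = \<alpha> \<bullet> ((ide ?l ** mu A) \<bullet> as ?l ?a ?a)"
    by (rule coeq_epi[OF qaa, rotated -1]) simp_all
  have "(\<alpha> \<bullet> (ide ?l ** et A)) \<bullet> (q ** ide (tunit C)) = \<alpha> \<bullet> ((q ** ide ?a) \<bullet> (ide ?n ** et A))" by simp
  also have "\<dots> = q \<bullet> ru ?n" by (simp only: comp_reduce[OF \<alpha>(4)]) simp
  also have "\<dots> = ru ?l \<bullet> (q ** ide (tunit C))" by (subst ru_natural) simp_all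
  finally have 2: "\<alpha> \<bullet> (ide ?l ** et A) = ru ?l"
    by (rule coeq_epi[OF coeq_tns_right[OF q tunit_Ob], rotated -1]) simp_all
  have "md A Q" using 1 2 ac unfolding md_def by (simp add: is_module_ar)
  moreover have "lin A N Q q" using \<alpha>(4) ac by (simp add: lin_def)
  moreover have "\<beta> = ac A Q" if "arr \<beta>" "adom \<beta> = acod q \<boxtimes> mcar A" "\<beta> \<bullet> (q ** ide (mcar A)) = q \<bullet> ac A N" for \<beta>
    unfolding ac by (rule coeq_epi[OF qa]) (use that \<alpha>(4) in simp_all)
  ultimately show ?thesis using that uQ by blast
qed

text \<open>Linearity may be tested after the epimorphism \<open>q ** ide (mcar A)\<close>.\<close>

lemma coeq_lin_factor:
  assumes M: "md A M" and N: "md A N" and Q: "md A Q" "lin A N Q q" and q: "coeq f g q" and Z: "md A Z"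
    and k: "arr k" "adom k = acod q" "lin A N Z (k \<bullet> q)"
  shows "lin A Q Z k"
proof -
  note [simp] = M N Q(1) Z md_simps[OF M] md_simps[OF N] md_simps[OF Q(1)] md_simps[OF Z] linD(1-3)[OF Q(2)] k(1,2)
  have [simp]: "acod k = ucar Z" using linD(3)[OF k(3)] by simp
  have "(k \<bullet> ac A Q) \<bullet> (q ** ide (mcar A)) = (k \<bullet> q) \<bullet> ac A N"
    by (simp add: linD(4)[OF Q(2)])
  also have "\<dots> = (ac A Z \<bullet> (k ** ide (mcar A))) \<bullet> (q ** ide (mcar A))"
    unfolding linD(4)[OF k(3)] by simp
  finally have "k \<bullet> ac A Q = ac A Z \<bullet> (k ** ide (mcar A))"
    by (rule coeq_epi[OF coeq_tns_right[OF q, of "mcar A"], rotated -1]) simp_all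
  then show ?thesis by (simp add: lin_def)
qed

end

section \<open>Base change as a universal arrow\<close>

context geometry
begin

notation comp (infixr "\<bullet>" 70)
notation tns (infixr "**" 75)

text \<open>\<open>u : M \<rightarrow> Q\<close> exhibits \<open>Q\<close> as \<open>M \<otimes>\<^sub>A B\<close>.\<close>

definition univ where
  "univ A B f M Q u \<longleftrightarrow> mh A B f \<and> md A M \<and> md B Q \<and> lin A M (rm f Q) u \<and>
    (\<forall>Z h. md B Z \<and> lin A M (rm f Z) h \<longrightarrow> (\<exists>!k. lin B Q Z k \<and> k \<bullet> u = h))"

lemma univD: assumes "univ A B f M Q u"
  shows "mh A B f" "md A M" "md B Q" "lin A M (rm f Q) u"
    "arr u" "adom u = ucar M" "acod u = ucar Q"
  using assms by (auto simp: univ_def dest: linD)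

lemma univ_ex: assumes "univ A B f M Q u" "md B Z" "lin A M (rm f Z) h"
  obtains k where "lin B Q Z k" "k \<bullet> u = h"
  using assms unfolding univ_def by blast

lemma univ_eq: assumes "univ A B f M Q u" "md B Z" "lin B Q Z k" "lin B Q Z k'" "k \<bullet> u = k' \<bullet> u"
  shows "k = k'"
proof -
  note u = univD[OF assms(1)]
  have "lin A M (rm f Z) (k \<bullet> u)"
    by (rule lin_comp[OF u(4) lin_rm[OF u(1,3) assms(2,3)]]) (use u assms(2) in \<open>simp_all add: md_rm\<close>)
  then show ?thesis using assms unfolding univ_def by metis
qed

section \<open>Free modules and the coequalizer presenting a base change\<close>

lemma lin_free: assumes "comm_mon C B" "x \<in> Ob C" "md B Z" "arr h" "adom h = x" "acod h = ucar Z"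
  shows "lin B (tm B x (self_mdl B)) Z (ac B Z \<bullet> (h ** ide (mcar B)))"
proof -
  note [simp] = assms md_simps[OF assms(3)]
  have "lin B (tm B x (self_mdl B)) (tm B (ucar Z) (self_mdl B)) (h ** ide (mcar B))"
    using lin_tm_left[of h B "self_mdl B"] by simp
  from lin_comp[OF this lin_ac] show ?thesis by simp
qed

text \<open>A linear map out of a free module is recovered from its restriction to the generators,
  along x -> x \<otimes> 1 -> x \<otimes> B. This yields uniqueness in the universal property of
  base change.\<close>

lemma lin_free_eq: assumes [simp]: "comm_mon C B" "x \<in> Ob C" "md B Z" and p: "lin B (tm B x (self_mdl B)) Z p"
  shows "p = ac B Z \<bullet> ((p \<bullet> ((ide x ** et B) \<bullet> ru' x)) ** ide (mcar B))"
proof -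
  note [simp] = md_simps[OF assms(3)] linD(1-3)[OF p]
  let ?b = "mcar B"
  have "ac B Z \<bullet> ((p \<bullet> ((ide x ** et B) \<bullet> ru' x)) ** ide ?b)
     = (ac B Z \<bullet> (p ** ide ?b)) \<bullet> (((ide x ** et B) ** ide ?b) \<bullet> (ru' x ** ide ?b))" by simp
  also have "\<dots> = (p \<bullet> ac B (tm B x (self_mdl B))) \<bullet> (((ide x ** et B) ** ide ?b) \<bullet> (ru' x ** ide ?b))"
    unfolding linD(4)[OF p] ..
  also have "\<dots> = p \<bullet> ((ide x ** mu B) \<bullet> ((as x ?b ?b \<bullet> ((ide x ** et B) ** ide ?b)) \<bullet> (ru' x ** ide ?b)))"
    by (simp add: ac_tm)
  also have "\<dots> = p \<bullet> ((ide x ** mu B) \<bullet> (((ide x ** (et B ** ide ?b)) \<bullet> as x (tunit C) ?b) \<bullet> (ru' x ** ide ?b)))"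
    by (subst as_natural) simp_all
  also have "\<dots> = p" by (simp add: comp_reduce[OF triangle_ar])
  finally show ?thesis by simp
qed

text \<open>The two maps \<open>(M \<otimes> A) \<otimes> B \<rightarrow> M \<otimes> B\<close> with coequalizer \<open>M \<otimes>\<^sub>A B\<close>.\<close>

definition bc1 where "bc1 A B M = ac A M ** ide (mcar B)"
definition bc2 where "bc2 A B f M = (ide (ucar M) ** (mu B \<bullet> (f ** ide (mcar B)))) \<bullet> as (ucar M) (mcar A) (mcar B)"

lemma lin_bc: assumes f: "mh A B f" and M: "md A M"
  shows "lin B (tm B (ucar M \<boxtimes> mcar A) (self_mdl B)) (tm B (ucar M) (self_mdl B)) (bc1 A B M)"
    "lin B (tm B (ucar M \<boxtimes> mcar A) (self_mdl B)) (tm B (ucar M) (self_mdl B)) (bc2 A B f M)"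
proof -
  note [simp] = M mh_simps[OF f] md_simps[OF M]
  show "lin B (tm B (ucar M \<boxtimes> mcar A) (self_mdl B)) (tm B (ucar M) (self_mdl B)) (bc1 A B M)"
    using lin_tm_left[of "ac A M" B "self_mdl B"] by (simp add: bc1_def)
  have "lin B (tm B (mcar A) (self_mdl B)) (self_mdl B) (mu B \<bullet> (f ** ide (mcar B)))"
    using lin_free[of B "mcar A" "self_mdl B" f] by simp
  then have "lin B (tm B (ucar M) (tm B (mcar A) (self_mdl B))) (tm B (ucar M) (self_mdl B))
      (ide (ucar M) ** (mu B \<bullet> (f ** ide (mcar B))))"
    by (rule lin_tm_right) simp_all
  from lin_comp[OF lin_as[of "ucar M" "mcar A" B "self_mdl B"]] this
  show "lin B (tm B (ucar M \<boxtimes> mcar A) (self_mdl B)) (tm B (ucar M) (self_mdl B)) (bc2 A B f M)"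
    by (simp add: bc2_def)
qed

text \<open>A map \<open>h\<close> out of \<open>M\<close> extends to the free module on
  \<open>M\<close>, as \<open>h ** ide (mcar B)\<close> followed by the action. The extension
  equalizes \<open>bc1\<close> and \<open>bc2\<close> because \<open>h\<close> is linear, and so
  descends along \<open>q\<close>.\<close>

lemma univ_of_coeq:
  assumes f: "mh A B f" and M: "md A M" and Q: "md B Q" and q: "coeq (bc1 A B M) (bc2 A B f M) q"
    and lq: "lin B (tm B (ucar M) (self_mdl B)) Q q"
  shows "univ A B f M Q (q \<bullet> ((ide (ucar M) ** et B) \<bullet> ru' (ucar M)))"
proof -
  let ?a = "mcar A" and ?b = "mcar B" and ?m = "ucar M" and ?i = "tunit C"
  note [simp] = M Q mh_simps[OF f] md_simps[OF M] md_simps[OF Q] linD(1-3)[OF lq] md_rm[OF f Q]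
  let ?e = "(ide ?m ** et B) \<bullet> ru' ?m"
  let ?u = "q \<bullet> ?e"
  have qf: "q \<bullet> (bc1 A B M \<bullet> k) = q \<bullet> (bc2 A B f M \<bullet> k)" for k
    using comp_reduce[OF coeqD(7)[OF q]] by simp
  \<comment> \<open>Both sides of the linearity of \<open>?u\<close> are reduced to the map that
    sends m \<otimes> a to the class of m \<otimes> f(a). On this side the scalar is moved across
    the tensor sign by \<open>qf\<close>.\<close>
  have "?u \<bullet> ac A M = q \<bullet> ((ide ?m ** et B) \<bullet> (ru' ?m \<bullet> ac A M))" by simp
  also have "\<dots> = q \<bullet> ((ide ?m ** et B) \<bullet> ((ac A M ** ide ?i) \<bullet> ru' (?m \<boxtimes> ?a)))"
    using ru'_natural[of "ac A M"] by simp
  also have "\<dots> = q \<bullet> (bc1 A B M \<bullet> ((ide (?m \<boxtimes> ?a) ** et B) \<bullet> ru' (?m \<boxtimes> ?a)))"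
    by (simp add: bc1_def)
  also have "\<dots> = q \<bullet> ((ide ?m ** (mu B \<bullet> (f ** ide ?b))) \<bullet> ((as ?m ?a ?b \<bullet> ((ide ?m ** ide ?a) ** et B)) \<bullet> ru' (?m \<boxtimes> ?a)))"
    unfolding qf by (simp add: bc2_def)
  also have "\<dots> = q \<bullet> ((ide ?m ** (mu B \<bullet> (f ** ide ?b))) \<bullet> (((ide ?m ** (ide ?a ** et B)) \<bullet> as ?m ?a ?i) \<bullet> ru' (?m \<boxtimes> ?a)))"
    by (subst as_natural) simp_all
  also have "\<dots> = q \<bullet> ((ide ?m ** (mu B \<bullet> ((ide ?b ** et B) \<bullet> (f ** ide ?i)))) \<bullet> (as ?m ?a ?i \<bullet> ru' (?m \<boxtimes> ?a)))"
    by simp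
  also have "\<dots> = q \<bullet> ((ide ?m ** (ru ?b \<bullet> (f ** ide ?i))) \<bullet> (as ?m ?a ?i \<bullet> ru' (?m \<boxtimes> ?a)))"
    by (simp only: comp_reduce[OF comm_mon_simps(5)[OF mh_simps(2)[OF f]]])
  also have "\<dots> = q \<bullet> ((ide ?m ** (f \<bullet> ru ?a)) \<bullet> (as ?m ?a ?i \<bullet> ru' (?m \<boxtimes> ?a)))"
    by (subst ru_natural) simp_all
  also have "\<dots> = q \<bullet> ((ide ?m ** f) \<bullet> (((ide ?m ** ru ?a) \<bullet> as ?m ?a ?i) \<bullet> ru' (?m \<boxtimes> ?a)))"
    by simp
  also have "\<dots> = q \<bullet> (ide ?m ** f)" by (subst ru_tens) simp_all
  finally have 1: "?u \<bullet> ac A M = q \<bullet> (ide ?m ** f)" .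
  have "ac A (rm f Q) \<bullet> (?u ** ide ?a) = (ac B Q \<bullet> (q ** ide ?b)) \<bullet> (?e ** f)"
    by (simp add: ac_rm[OF f Q])
  also have "\<dots> = q \<bullet> ((ide ?m ** mu B) \<bullet> ((as ?m ?b ?b \<bullet> ((ide ?m ** et B) ** ide ?b)) \<bullet> (ru' ?m ** f)))"
    unfolding linD(4)[OF lq,symmetric] by (simp add: ac_tm)
  also have "\<dots> = q \<bullet> ((ide ?m ** mu B) \<bullet> (((ide ?m ** (et B ** ide ?b)) \<bullet> as ?m ?i ?b) \<bullet> (ru' ?m ** f)))"
    by (subst as_natural) simp_all
  also have "\<dots> = q \<bullet> (ide ?m ** f)" by (simp add: comp_reduce[OF triangle_ar])
  finally have lu: "lin A M (rm f Q) ?u" using 1 by (simp add: lin_def)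
  have "\<exists>!k. lin B Q Z k \<and> k \<bullet> ?u = h" if Z [simp]: "md B Z" and h: "lin A M (rm f Z) h" for Z h
  proof -
    note [simp] = md_simps[OF Z] linD(1-3)[OF h, simplified] md_rm[OF f Z]
    let ?k = "ac B Z \<bullet> (h ** ide ?b)"
    have "?k \<bullet> bc1 A B M = ac B Z \<bullet> ((h \<bullet> ac A M) ** ide ?b)" by (simp add: bc1_def)
    also have "\<dots> = (ac B Z \<bullet> (ac B Z ** ide ?b)) \<bullet> ((h ** f) ** ide ?b)"
      by (simp add: linD(4)[OF h] ac_rm[OF f Z])
    also have "\<dots> = ac B Z \<bullet> ((ide (ucar Z) ** mu B) \<bullet> (as (ucar Z) ?b ?b \<bullet> ((h ** f) ** ide ?b)))"
      unfolding ac_assoc[OF Z] by simp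
    also have "\<dots> = ac B Z \<bullet> ((ide (ucar Z) ** mu B) \<bullet> ((h ** (f ** ide ?b)) \<bullet> as ?m ?a ?b))"
      by (subst as_natural) simp_all
    also have "\<dots> = ?k \<bullet> bc2 A B f M" by (simp add: bc2_def)
    finally obtain k where k: "arr k" "adom k = acod q" "k \<bullet> q = ?k"
      using coeq_exD[OF q, of ?k] by (auto simp: bc1_def)
    have lk: "lin B Q Z k"
      by (rule coeq_lin_factor[of B "tm B (ucar M \<boxtimes> mcar A) (self_mdl B)", OF _ _ Q lq q Z k(1,2)])
         (use k(3) lin_free[of B ?m Z h] in simp_all)
    have "k \<bullet> ?u = ?k \<bullet> ?e" by (simp flip: k(3))
    also have "\<dots> = ac B Z \<bullet> ((ide (ucar Z) ** et B) \<bullet> ((h ** ide ?i) \<bullet> ru' ?m))" by simp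
    also have "\<dots> = ru (ucar Z) \<bullet> ((h ** ide ?i) \<bullet> ru' ?m)"
      by (simp only: comp_reduce[OF md_simps(5)[OF Z]])
    also have "\<dots> = (h \<bullet> ru ?m) \<bullet> ru' ?m" by (subst ru_natural) simp_all
    also have "\<dots> = h" by simp
    finally have ku: "k \<bullet> ?u = h" .
    show ?thesis
    proof (rule ex1I[of _ k])
      fix k' assume k': "lin B Q Z k' \<and> k' \<bullet> ?u = h"
      note [simp] = linD(1-3)[OF k'[THEN conjunct1]] linD(1-3)[OF lk]
      \<comment> \<open>Two factorizations agree after \<open>q\<close>, being linear maps out of a
        free module that agree on its generators.\<close>
      have "k' \<bullet> q = ac B Z \<bullet> (((k' \<bullet> q) \<bullet> ?e) ** ide ?b)"
        by (rule lin_free_eq) (use k' in \<open>auto intro: lin_comp[OF lq]\<close>)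
      also have "\<dots> = ac B Z \<bullet> (((k \<bullet> q) \<bullet> ?e) ** ide ?b)" using k' ku by simp
      also have "\<dots> = k \<bullet> q"
        by (rule lin_free_eq[symmetric]) (use lk in \<open>auto intro: lin_comp[OF lq]\<close>)
      finally show "k' = k" by (rule coeq_epi[OF q, rotated -1]) simp_all
    qed (use lk ku in simp)
  qed
  then show ?thesis unfolding univ_def using f M Q lu by blast
qed

definition bcq where "bcq A B f M = Ar (ucar M \<boxtimes> mcar B) (bc_proj C A B (aarr f) M) (fst (bc_tensor C A B (aarr f) M))"
abbreviation bco where "bco A B f M \<equiv> bc_ob C A B (aarr f) M"

text \<open>\<open>bc_tensor\<close> is a \<open>SOME\<close> over untagged data; the existence of
  coequalizers guarantees that the chosen pair has the defining property.\<close>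

lemma bc_coeq:
  assumes f: "mh A B f" and M: "md A M"
  shows "coeq (bc1 A B M) (bc2 A B f M) (bcq A B f M)"
proof -
  note [simp] = M mh_simps[OF f] md_simps[OF M]
  let ?x = "(ucar M \<boxtimes> mcar A) \<boxtimes> mcar B" and ?y = "ucar M \<boxtimes> mcar B"
  have d: "arr (bc1 A B M)" "arr (bc2 A B f M)" "adom (bc1 A B M) = ?x" "adom (bc2 A B f M) = ?x"
    "acod (bc1 A B M) = ?y" "acod (bc2 A B f M) = ?y"
    by (simp_all add: bc1_def bc2_def)
  have a: "aarr (bc1 A B M) = uact M \<boxdot> idt C (mcar B)"
    "aarr (bc2 A B f M) = (idt C (ucar M) \<boxdot> (mmul B \<cdot> (aarr f \<boxdot> idt C (mcar B)))) \<cdot> assoc C (ucar M) (mcar A) (mcar B)"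
    by (simp_all add: bc1_def bc2_def aarr_comp aarr_tns aarr_structure aarr_mu)
  have h: "aarr (bc1 A B M) \<in> Hom C ?x ?y" "aarr (bc2 A B f M) \<in> Hom C ?x ?y"
    using arr_Hom[OF d(1)] arr_Hom[OF d(2)] d by simp_all
  have e: "Ar ?x (aarr (bc1 A B M)) ?y = bc1 A B M" "Ar ?x (aarr (bc2 A B f M)) ?y = bc2 A B f M"
    using arr_eta[OF d(1)] arr_eta[OF d(2)] d by simp_all
  have iff: "is_coequalizer C ?x ?y (aarr (bc1 A B M)) (aarr (bc2 A B f M)) t q \<longleftrightarrow> coeq (bc1 A B M) (bc2 A B f M) (Ar ?y q t)" for t q
    by (subst is_coequalizer_coeq) (use h e in simp_all)
  obtain q where q: "coeq (bc1 A B M) (bc2 A B f M) q" using coeq_exists[OF d(1,2)] d by metis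
  have "Ar ?y (aarr q) (acod q) = q" using arr_eta[OF coeqD(3)[OF q]] coeqD(6)[OF q] d by simp
  with q have "is_coequalizer C ?x ?y (aarr (bc1 A B M)) (aarr (bc2 A B f M)) (acod q) (aarr q)"
    by (simp only: iff)
  then have "case (acod q, aarr q) of (t, q) \<Rightarrow> is_coequalizer C ?x ?y (aarr (bc1 A B M)) (aarr (bc2 A B f M)) t q"
    by simp
  from someI[of "\<lambda>(t, q). is_coequalizer C ?x ?y (aarr (bc1 A B M)) (aarr (bc2 A B f M)) t q", OF this]
  have "case bc_tensor C A B (aarr f) M of (t, q) \<Rightarrow> is_coequalizer C ?x ?y (aarr (bc1 A B M)) (aarr (bc2 A B f M)) t q"
    unfolding bc_tensor_def Let_def a .
  then show ?thesis unfolding bcq_def iff[symmetric] by (simp add: case_prod_beta)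
qed

text \<open>The action in \<open>bc_ob\<close> is a \<open>THE\<close>; \<open>coeq_module\<close>
  supplies an arrow with the required property and its uniqueness.\<close>

lemma bc_module:
  assumes f: "mh A B f" and M: "md A M"
  shows "md B (bco A B f M)" "lin B (tm B (ucar M) (self_mdl B)) (bco A B f M) (bcq A B f M)"
    "ucar (bco A B f M) = acod (bcq A B f M)"
proof -
  note [simp] = M mh_simps[OF f] md_simps[OF M]
  let ?q = "bcq A B f M" and ?t = "fst (bc_tensor C A B (aarr f) M)" and ?b = "mcar B" and ?m = "ucar M"
  note q = bc_coeq[OF f M]
  have dq [simp]: "arr ?q" "adom ?q = ?m \<boxtimes> ?b" "acod ?q = ?t" using coeqD(3)[OF q] by (simp_all add: bcq_def)
  have tO [simp]: "?t \<in> Ob C" using arr_Ob(2)[OF dq(1)] by simp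
  obtain Q where Q: "md B Q" "ucar Q = ?t" "lin B (tm B ?m (self_mdl B)) Q ?q" and
    uQ: "\<And>\<alpha>. \<lbrakk>arr \<alpha>; adom \<alpha> = ?t \<boxtimes> ?b; \<alpha> \<bullet> (?q ** ide ?b) = ?q \<bullet> ac B (tm B ?m (self_mdl B))\<rbrakk> \<Longrightarrow> \<alpha> = ac B Q"
    using coeq_module[OF _ _ lin_bc[OF f M] q] dq(3) by (metis (no_types, lifting) M f md_self md_simps(2,3) md_tm mh_simps(2) tens_Ob)
  have uact_bc: "uact (bco A B f M) = (THE \<alpha>. \<alpha> \<in> Hom C (?t \<boxtimes> ?b) ?t \<and>
         \<alpha> \<cdot> (aarr ?q \<boxdot> idt C ?b) = aarr ?q \<cdot> ((idt C ?m \<boxdot> mmul B) \<cdot> assoc C ?m ?b ?b))"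
    by (simp add: bc_ob_def Let_def bcq_def)
  have char: "\<alpha> \<in> Hom C (?t \<boxtimes> ?b) ?t \<and> \<alpha> \<cdot> (aarr ?q \<boxdot> idt C ?b) = aarr ?q \<cdot> ((idt C ?m \<boxdot> mmul B) \<cdot> assoc C ?m ?b ?b)
      \<longleftrightarrow> \<alpha> = uact Q" (is "?P \<alpha> \<longleftrightarrow> _") for \<alpha>
  proof
    assume P: "?P \<alpha>"
    let ?\<alpha> = "Ar (?t \<boxtimes> ?b) \<alpha> ?t"
    have [simp]: "arr ?\<alpha>" using P by simp
    have "?\<alpha> = ac B Q"
    proof (rule uQ)
      show "?\<alpha> \<bullet> (?q ** ide ?b) = ?q \<bullet> ac B (tm B ?m (self_mdl B))"
        using P by (intro ar_eqI) (simp_all add: ac_tm aarr_comp aarr_tns aarr_structure aarr_mu del: arr_Ar)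
    qed (use P in simp_all)
    then show "\<alpha> = uact Q" by (simp add: ac_def)
  next
    assume \<alpha>: "\<alpha> = uact Q"
    note [simp] = Q(1,2) md_simps[OF Q(1)]
    have 1: "ac B Q \<bullet> (?q ** ide ?b) = ?q \<bullet> ac B (tm B ?m (self_mdl B))" using linD(4)[OF Q(3)] by simp
    have "aarr (ac B Q \<bullet> (?q ** ide ?b)) = aarr (?q \<bullet> ac B (tm B ?m (self_mdl B)))" by (simp only: 1)
    then have "uact Q \<cdot> (aarr ?q \<boxdot> idt C ?b) = aarr ?q \<cdot> ((idt C ?m \<boxdot> mmul B) \<cdot> assoc C ?m ?b ?b)"
      by (simp add: ac_tm aarr_comp aarr_tns aarr_structure aarr_mu)
    moreover have "uact Q \<in> Hom C (?t \<boxtimes> ?b) ?t" using arr_Hom[OF md_simps(4)[OF Q(1)]] by (simp add: aarr_mu)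
    ultimately show "?P \<alpha>" unfolding \<alpha> by simp
  qed
  have "uact (bco A B f M) = uact Q" unfolding uact_bc char by simp
  moreover have "ucar (bco A B f M) = ?t" by (simp add: bc_ob_def Let_def)
  ultimately have "bco A B f M = Q" using Q(2) by (cases "bco A B f M", cases Q) simp
  then show "md B (bco A B f M)" "lin B (tm B ?m (self_mdl B)) (bco A B f M) ?q" "ucar (bco A B f M) = acod ?q"
    using Q by simp_all
qed

text \<open>The map m -> m \<otimes> 1, the unit of the adjunction between base change and
  restriction.\<close>

definition bcu where "bcu A B f M = bcq A B f M \<bullet> ((ide (ucar M) ** et B) \<bullet> ru' (ucar M))"

lemma univ_bc: assumes "mh A B f" "md A M" shows "univ A B f M (bco A B f M) (bcu A B f M)"
  unfolding bcu_def using univ_of_coeq[OF assms bc_module(1)[OF assms] bc_coeq[OF assms] bc_module(2)[OF assms]] .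

text \<open>This holds because \<open>- \<otimes> x\<close> preserves coequalizers.\<close>

lemma univ_tm:
  assumes f: "mh A B f" and M: "md A M" and [simp]: "x \<in> Ob C"
  shows "univ A B f (tm A x M) (tm B x (bco A B f M)) (ide x ** bcu A B f M)"
proof -
  note [simp] = M mh_simps[OF f] md_simps[OF M] bc_module[OF f M] md_simps(3)[OF bc_module(1)[OF f M]]
  let ?q = "bcq A B f M" and ?b = "mcar B" and ?m = "ucar M" and ?a = "mcar A"
  let ?Q = "bco A B f M"
  have dq [simp]: "arr ?q" "adom ?q = ?m \<boxtimes> ?b" using linD[OF bc_module(2)[OF f M]] by simp_all
  have tQ: "tm B x ?Q = tm B x ?Q" ..
  \<comment> \<open>The associator carries the parallel pair of \<open>tm A x M\<close> to
    \<open>x\<close> tensored with the parallel pair of \<open>M\<close>; the same isomorphism on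
    the sources serves both maps.\<close>
  have as1: "as x ?m ?b \<bullet> bc1 A B (tm A x M) = (ide x ** bc1 A B M) \<bullet> (as x (?m \<boxtimes> ?a) ?b \<bullet> (as x ?m ?a ** ide ?b))"
  proof -
    have "as x ?m ?b \<bullet> bc1 A B (tm A x M)
      = (as x ?m ?b \<bullet> ((ide x ** ac A M) ** ide ?b)) \<bullet> (as x ?m ?a ** ide ?b)" by (simp add: bc1_def ac_tm)
    also have "\<dots> = ((ide x ** (ac A M ** ide ?b)) \<bullet> as x (?m \<boxtimes> ?a) ?b) \<bullet> (as x ?m ?a ** ide ?b)"
      by (subst as_natural) simp_all
    finally show ?thesis by (simp add: bc1_def)
  qed
  have as2: "as x ?m ?b \<bullet> bc2 A B f (tm A x M) = (ide x ** bc2 A B f M) \<bullet> (as x (?m \<boxtimes> ?a) ?b \<bullet> (as x ?m ?a ** ide ?b))"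
  proof -
    let ?g = "mu B \<bullet> (f ** ide ?b)"
    have "as x ?m ?b \<bullet> bc2 A B f (tm A x M) = (as x ?m ?b \<bullet> ((ide x ** ide ?m) ** ?g)) \<bullet> as (x \<boxtimes> ?m) ?a ?b"
      by (simp add: bc2_def)
    also have "\<dots> = ((ide x ** (ide ?m ** ?g)) \<bullet> as x ?m (?a \<boxtimes> ?b)) \<bullet> as (x \<boxtimes> ?m) ?a ?b"
      by (subst as_natural) simp_all
    also have "\<dots> = (ide x ** (ide ?m ** ?g)) \<bullet> (as x ?m (?a \<boxtimes> ?b) \<bullet> as (x \<boxtimes> ?m) ?a ?b)" by simp
    also have "\<dots> = (ide x ** (ide ?m ** ?g)) \<bullet> ((ide x ** as ?m ?a ?b) \<bullet> (as x (?m \<boxtimes> ?a) ?b \<bullet> (as x ?m ?a ** ide ?b)))"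
      by (subst pentagon_ar) simp_all
    finally show ?thesis by (simp add: bc2_def)
  qed
  let ?k = "as x (?m \<boxtimes> ?a) ?b \<bullet> (as x ?m ?a ** ide ?b)"
  have ik: "iso_ar ?k" by (intro iso_ar_comp iso_ar_tns) simp_all
  have co: "coeq (bc1 A B (tm A x M)) (bc2 A B f (tm A x M)) ((ide x ** ?q) \<bullet> as x ?m ?b)"
    by (rule coeq_iso[OF coeq_tns_left[OF bc_coeq[OF f M], of x] ik _ _ _ as1 _ _ as2])
      (simp_all add: bc1_def bc2_def ac_tm)
  have li: "lin B (tm B (ucar (tm A x M)) (self_mdl B)) (tm B x ?Q) ((ide x ** ?q) \<bullet> as x ?m ?b)"
    using lin_comp[OF lin_as[of x ?m B "self_mdl B"] lin_tm_right[OF bc_module(2)[OF f M], of x]] by simp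
  have "((ide x ** ?q) \<bullet> as x ?m ?b) \<bullet> ((ide (x \<boxtimes> ?m) ** et B) \<bullet> ru' (x \<boxtimes> ?m))
      = (ide x ** ?q) \<bullet> ((as x ?m ?b \<bullet> ((ide x ** ide ?m) ** et B)) \<bullet> ru' (x \<boxtimes> ?m))" by simp
  also have "\<dots> = (ide x ** ?q) \<bullet> (((ide x ** (ide ?m ** et B)) \<bullet> as x ?m (tunit C)) \<bullet> ru' (x \<boxtimes> ?m))"
    by (subst as_natural) simp_all
  also have "\<dots> = (ide x ** (?q \<bullet> (ide ?m ** et B))) \<bullet> (as x ?m (tunit C) \<bullet> ru' (x \<boxtimes> ?m))"
    by simp
  also have "as x ?m (tunit C) \<bullet> ru' (x \<boxtimes> ?m) = ide x ** ru' ?m"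
    by (rule iso_cancel_left[of "ide x ** ru ?m"])
      (simp_all add: iso_ar_tns comp_reduce[OF ru_tens])
  finally show ?thesis
    using univ_of_coeq[OF f md_tm md_tm co li] by (simp add: bcu_def)
qed

end

section \<open>Pushouts of commutative monoids\<close>

context symmetric_monoidal_category
begin

notation comp (infixr "\<bullet>" 70)
notation tns (infixr "**" 75)

text \<open>Naturality of \<open>ru\<close> at itself gives
  \<open>ru (1 \<boxtimes> 1) = ru 1 ** 1\<close>. Comparing the triangle with
  \<open>ru_tens\<close> then leaves the two unit maps under the same tensor.\<close>

lemma lu_tunit: "lu (tunit C) = ru (tunit C)"
proof (rule tns_tunit_cancel_left)
  let ?i = "tunit C"
  have "ru ?i \<bullet> ru (?i \<boxtimes> ?i) = ru ?i \<bullet> (ru ?i ** ide ?i)"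
    using ru_natural[of "ru ?i"] by simp
  then have "ru (?i \<boxtimes> ?i) = ru ?i ** ide ?i"
    by (rule iso_cancel_left[rotated]) simp_all
  then have "(ide ?i ** lu ?i) \<bullet> as ?i ?i ?i = (ide ?i ** ru ?i) \<bullet> as ?i ?i ?i"
    by (simp add: triangle_ar ru_tens)
  then show "ide ?i ** lu ?i = ide ?i ** ru ?i"
    by (rule iso_cancel_right[rotated]) simp_all
qed simp_all

lemma sw_sw: "\<lbrakk>a \<in> Ob C; x \<in> Ob C; m \<in> Ob C\<rbrakk> \<Longrightarrow> sw a x m \<bullet> sw x a m = ide (x \<boxtimes> (a \<boxtimes> m))"
  by (simp add: sw_def)

lemma sw_br: assumes [simp]: "a \<in> Ob C" "x \<in> Ob C" "m \<in> Ob C"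
  shows "br x (a \<boxtimes> m) \<bullet> sw a x m = as' a m x \<bullet> (ide a ** br x m)"
proof (rule iso_cancel_left[of "as a m x"])
  have "as a m x \<bullet> (br x (a \<boxtimes> m) \<bullet> sw a x m)
    = (as a m x \<bullet> (br x (a \<boxtimes> m) \<bullet> as x a m)) \<bullet> ((br a x ** ide m) \<bullet> as' a x m)" by (simp add: sw_def)
  also have "\<dots> = ide a ** br x m" by (subst hexagon_ar) simp_all
  finally show "as a m x \<bullet> (br x (a \<boxtimes> m) \<bullet> sw a x m) = as a m x \<bullet> (as' a m x \<bullet> (ide a ** br x m))" by simp
qed simp_all

lemma mdl_eqI_la: assumes M: "md A M" and N: "md A N" and u: "ucar M = ucar N" and l: "la A M = la A N"
  shows "M = N"
proof (rule mdl_eqI[of A, OF _ u])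
  note [simp] = md_simps[OF M] md_simps[OF N] u
  have "ac A M \<bullet> br (mcar A) (ucar N) = ac A N \<bullet> br (mcar A) (ucar N)" using l by (simp add: la_def)
  then show "ac A M = ac A N" by (rule iso_cancel_right[rotated]) simp_all
qed

text \<open>A linear map on the regular module is multiplication by its value at the unit, as the
  left unitor shows.\<close>

lemma lin_self_eq: assumes Z: "md A Z" and p: "lin A (self_mdl A) Z p" "lin A (self_mdl A) Z p'" "p \<bullet> et A = p' \<bullet> et A"
  shows "p = p'"
proof -
  note [simp] = Z md_simps[OF Z] linD(1-3)[OF p(1)] linD(1-3)[OF p(2)]
  have *: "q \<bullet> lu (mcar A) = ac A Z \<bullet> ((q \<bullet> et A) ** ide (mcar A))" if "lin A (self_mdl A) Z q" for q
  proof -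
    note [simp] = linD(1-3)[OF that]
    have "q \<bullet> lu (mcar A) = (q \<bullet> ac A (self_mdl A)) \<bullet> (et A ** ide (mcar A))" by simp
    also have "\<dots> = ac A Z \<bullet> ((q \<bullet> et A) ** ide (mcar A))" unfolding linD(4)[OF that] by simp
    finally show ?thesis .
  qed
  have "p \<bullet> lu (mcar A) = p' \<bullet> lu (mcar A)" using * p by simp
  then show ?thesis by (rule iso_cancel_right[rotated]) simp_all
qed

lemma lin_mh: assumes "mh A B f" shows "lin A (self_mdl A) (rm f (self_mdl B)) f"
proof -
  note [simp] = mh_simps[OF assms]
  show ?thesis by (simp add: lin_def ac_rm[OF assms] mh_mu[OF assms])
qed

end

text \<open>The pushout of \<open>E\<close> and \<open>F\<close> over \<open>D\<close> will be
  carried by the base change of \<open>E\<close> to \<open>F\<close>. The constructions are made for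
  the base change of an arbitrary \<open>E\<close>-module \<open>N\<close>, since base changes are
  to be compared for modules and not only for \<open>E\<close>.\<close>

locale cospan_of_monoids = geometry U C for U :: "'u set" and C :: "('o, 'a) moncat" (structure) +
  fixes D E F :: "('o, 'a) mon" and d f :: "('o, 'a) ar"
  assumes d: "mh D E d" and f: "mh D F f"
begin

notation comp (infixr "\<bullet>" 70)
notation tns (infixr "**" 75)

lemmas [simp] = mh_simps[OF d] mh_simps[OF f] d f

abbreviation T where "T N \<equiv> bco D F f (rm d N)"
abbreviation u where "u N \<equiv> bcu D F f (rm d N)"
abbreviation e where "e \<equiv> mcar E"
abbreviation t where "t N \<equiv> ucar (T N)"

lemma md_rm_d [simp]: "md E N \<Longrightarrow> md D (rm d N)" by (rule md_rm[OF d])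
lemma md_rm_f [simp]: "md F N \<Longrightarrow> md D (rm f N)" by (rule md_rm[OF f])

lemma univ_T: "md E N \<Longrightarrow> univ D F f (rm d N) (T N) (u N)"
  by (rule univ_bc) simp_all

lemma T_simps [simp]: assumes "md E N"
  shows "md F (T N)" "t N \<in> Ob C" "arr (ac F (T N))" "ucar N \<in> Ob C" "arr (u N)" "adom (u N) = ucar N" "acod (u N) = t N"
  using univD[OF univ_T[OF assms]] md_simps[of F "T N"] md_simps[OF assms] by simp_all

lemma lin_u: "md E N \<Longrightarrow> lin D (rm d N) (rm f (T N)) (u N)"
  using univD[OF univ_T] by blast

text \<open>The universal property is taken with an inert factor \<open>x\<close>, so that maps of
  several variables can be defined and compared on the generators of the last one. Most arrows and
  identities of this locale come from this and \<open>ext_eq\<close>.\<close>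

lemma ext_ex: assumes "md E N" "x \<in> Ob C" "md F Z" "lin D (tm D x (rm d N)) (rm f Z) h"
  obtains k where "lin F (tm F x (T N)) Z k" "k \<bullet> (ide x ** u N) = h"
  using univ_ex[OF univ_tm[OF f, of "rm d N" x] assms(3,4)] assms by auto

lemma ext_eq: assumes "md E N" "x \<in> Ob C" "md F Z" "lin F (tm F x (T N)) Z k" "lin F (tm F x (T N)) Z k'"
    "k \<bullet> (ide x ** u N) = k' \<bullet> (ide x ** u N)"
  shows "k = k'"
  using univ_eq[OF univ_tm[OF f, of "rm d N" x] assms(3-6)] assms by simp

lemma lin_u_la: "md E N \<Longrightarrow> lin D (tm D e (rm d N)) (rm f (T N)) (u N \<bullet> la E N)"
  using lin_comp[OF lin_rm[OF d _ _ lin_la, unfolded rm_tm[OF d]] lin_u] by (simp add: rm_tm[OF d])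

text \<open>The action of \<open>E\<close> on \<open>N \<otimes>\<^sub>D F\<close>.\<close>

definition lam where
  "lam N = (SOME l. lin F (tm F e (T N)) (T N) l \<and> l \<bullet> (ide e ** u N) = u N \<bullet> la E N)"

lemma lam: assumes "md E N"
  shows "lin F (tm F e (T N)) (T N) (lam N)" "lam N \<bullet> (ide e ** u N) = u N \<bullet> la E N"
proof -
  have "\<exists>l. lin F (tm F e (T N)) (T N) l \<and> l \<bullet> (ide e ** u N) = u N \<bullet> la E N"
    by (rule ext_ex[OF assms _ _ lin_u_la[OF assms]]) (use assms in auto)
  from someI_ex[OF this] show "lin F (tm F e (T N)) (T N) (lam N)" "lam N \<bullet> (ide e ** u N) = u N \<bullet> la E N"
    unfolding lam_def by auto
qed

lemma lam_simps [simp]: "md E N \<Longrightarrow> arr (lam N)" "md E N \<Longrightarrow> adom (lam N) = e \<boxtimes> t N" "md E N \<Longrightarrow> acod (lam N) = t N"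
  using linD[OF lam(1)] by simp_all

text \<open>Both sides are \<open>F\<close>-linear in the last variable, so it is enough to compare
  them on \<open>N\<close>, where the law is associativity of the given action of \<open>E\<close>.
  The other laws of \<open>lam\<close> follow the same pattern.\<close>

lemma lam_assoc: assumes [simp]: "md E N"
  shows "lam N \<bullet> (mu E ** ide (t N)) = lam N \<bullet> ((ide e ** lam N) \<bullet> as e e (t N))"
proof (rule ext_eq[OF assms])
  show "lin F (tm F (e \<boxtimes> e) (T N)) (T N) (lam N \<bullet> (mu E ** ide (t N)))"
    using lin_comp[OF lin_tm_left[of "mu E" F "T N"] , of "T N" "lam N"] lam(1)[OF assms] by simp
  have "lin F (tm F (e \<boxtimes> e) (T N)) (tm F e (T N)) ((ide e ** lam N) \<bullet> as e e (t N))"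
    by (rule lin_comp[OF lin_as lin_tm_right[OF lam(1)]]) simp_all
  from lin_comp[OF this lam(1)] show "lin F (tm F (e \<boxtimes> e) (T N)) (T N) (lam N \<bullet> ((ide e ** lam N) \<bullet> as e e (t N)))"
    by simp
  have "(lam N \<bullet> (mu E ** ide (t N))) \<bullet> (ide (e \<boxtimes> e) ** u N)
     = (lam N \<bullet> (ide e ** u N)) \<bullet> (mu E ** ide (ucar N))" by simp
  also have "\<dots> = u N \<bullet> (la E N \<bullet> ((ide e ** la E N) \<bullet> as e e (ucar N)))"
    by (simp add: lam(2) la_assoc)
  also have "\<dots> = lam N \<bullet> ((ide e ** (lam N \<bullet> (ide e ** u N))) \<bullet> as e e (ucar N))"
    using comp_reduce[OF lam(2)[OF assms], of "(ide e ** la E N) \<bullet> as e e (ucar N)"]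
    by (simp add: lam(2))
  also have "\<dots> = lam N \<bullet> ((ide e ** lam N) \<bullet> ((ide e ** (ide e ** u N)) \<bullet> as e e (ucar N)))" by simp
  also have "\<dots> = (lam N \<bullet> ((ide e ** lam N) \<bullet> as e e (t N))) \<bullet> (ide (e \<boxtimes> e) ** u N)"
    by (subst as_natural) simp_all
  finally show "(lam N \<bullet> (mu E ** ide (t N))) \<bullet> (ide (e \<boxtimes> e) ** u N)
    = (lam N \<bullet> ((ide e ** lam N) \<bullet> as e e (t N))) \<bullet> (ide (e \<boxtimes> e) ** u N)" .
qed simp_all

lemma lam_unit: assumes [simp]: "md E N" shows "lam N \<bullet> (et E ** ide (t N)) = lu (t N)"
proof (rule ext_eq[OF assms])
  show "lin F (tm F (tunit C) (T N)) (T N) (lam N \<bullet> (et E ** ide (t N)))"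
    using lin_comp[OF lin_tm_left[of "et E" F "T N"] , of "T N" "lam N"] lam(1)[OF assms] by simp
  show "lin F (tm F (tunit C) (T N)) (T N) (lu (t N))" by (rule lin_lu) simp
  have "(lam N \<bullet> (et E ** ide (t N))) \<bullet> (ide (tunit C) ** u N)
     = (lam N \<bullet> (ide e ** u N)) \<bullet> (et E ** ide (ucar N))" by simp
  also have "\<dots> = u N \<bullet> lu (ucar N)" by (simp add: lam(2) la_unit)
  also have "\<dots> = lu (t N) \<bullet> (ide (tunit C) ** u N)" by (subst lu_natural) simp_all
  finally show "(lam N \<bullet> (et E ** ide (t N))) \<bullet> (ide (tunit C) ** u N) = lu (t N) \<bullet> (ide (tunit C) ** u N)" .
qed simp_all

text \<open>The two actions of \<open>D\<close> on \<open>N \<otimes>\<^sub>D F\<close>, through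
  \<open>E\<close> and through \<open>F\<close>, agree: this is the balancing of the tensor product,
  expressed by linearity of \<open>u N\<close> over \<open>D\<close>.\<close>

lemma lam_d: assumes [simp]: "md E N" shows "lam N \<bullet> (d ** ide (t N)) = la F (T N) \<bullet> (f ** ide (t N))"
proof (rule ext_eq[OF assms])
  show "lin F (tm F (mcar D) (T N)) (T N) (lam N \<bullet> (d ** ide (t N)))"
    using lin_comp[OF lin_tm_left[of d F "T N"] , of "T N" "lam N"] lam(1)[OF assms] by simp
  show "lin F (tm F (mcar D) (T N)) (T N) (la F (T N) \<bullet> (f ** ide (t N)))"
    using lin_comp[OF lin_tm_left[of f F "T N"] , of "T N" "la F (T N)"] lin_la[of F "T N"] by simp
  have "(lam N \<bullet> (d ** ide (t N))) \<bullet> (ide (mcar D) ** u N)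
     = (lam N \<bullet> (ide e ** u N)) \<bullet> (d ** ide (ucar N))" by simp
  also have "\<dots> = u N \<bullet> la D (rm d N)" by (simp add: lam(2) la_rm[OF d])
  also have "\<dots> = la D (rm f (T N)) \<bullet> (ide (mcar D) ** u N)"
    using lin_u[OF assms] by (subst (asm) lin_iff_la) simp_all
  also have "\<dots> = (la F (T N) \<bullet> (f ** ide (t N))) \<bullet> (ide (mcar D) ** u N)"
    by (simp add: la_rm[OF f])
  finally show "(lam N \<bullet> (d ** ide (t N))) \<bullet> (ide (mcar D) ** u N)
    = (la F (T N) \<bullet> (f ** ide (t N))) \<bullet> (ide (mcar D) ** u N)" .
qed simp_all

definition TE where "TE N = \<lparr>ucar = t N, uact = aarr (lam N \<bullet> br (t N) e)\<rparr>"

lemma ucar_TE [simp]: "ucar (TE N) = t N" by (simp add: TE_def)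

lemma TE: assumes "md E N" shows "md E (TE N)" "la E (TE N) = lam N" "ac E (TE N) = lam N \<bullet> br (t N) e"
  by (rule md_of_left_action[OF _ _ _ _ _ lam_unit[OF assms] lam_assoc[OF assms] TE_def];
      use assms in simp)+

lemma TE_simps [simp]: assumes "md E N" shows "md E (TE N)" "arr (ac E (TE N))"
  using TE(1)[OF assms] md_simps(4)[OF TE(1)[OF assms]] by auto

lemma rm_TE: assumes [simp]: "md E N" shows "rm d (TE N) = rm f (T N)"
  by (rule mdl_eqI_la[of D]) (simp_all add: la_rm[OF d] la_rm[OF f] TE lam_d)

lemma lin_u_E: assumes [simp]: "md E N" shows "lin E N (TE N) (u N)"
  by (subst lin_iff_la) (simp_all add: TE lam(2))

section \<open>The multiplication of the pushout and its axioms\<close>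

abbreviation E1 where "E1 \<equiv> self_mdl E"
abbreviation p where "p \<equiv> t E1"
abbreviation uE where "uE \<equiv> u E1"

text \<open>The action of \<open>E \<otimes>\<^sub>D F\<close> on \<open>N \<otimes>\<^sub>D F\<close>.\<close>

definition mp where
  "mp N = (SOME k. lin F (tm F (t N) (T E1)) (T N) k \<and> k \<bullet> (ide (t N) ** uE) = ac E (TE N))"

lemma mp: assumes [simp]: "md E N"
  shows "lin F (tm F (t N) (T E1)) (T N) (mp N)" "mp N \<bullet> (ide (t N) ** uE) = ac E (TE N)"
proof -
  have "lin D (rm d (tm E (t N) E1)) (rm d (TE N)) (ac E (TE N))"
    by (rule lin_rm[OF d]) (use lin_ac[of E "TE N"] in simp_all)
  then have *: "lin D (tm D (t N) (rm d E1)) (rm f (T N)) (ac E (TE N))"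
    by (simp add: rm_tm[OF d] rm_TE)
  have "\<exists>k. lin F (tm F (t N) (T E1)) (T N) k \<and> k \<bullet> (ide (t N) ** uE) = ac E (TE N)"
    by (rule ext_ex[OF _ _ _ *]) auto
  from someI_ex[OF this] show "lin F (tm F (t N) (T E1)) (T N) (mp N)" "mp N \<bullet> (ide (t N) ** uE) = ac E (TE N)"
    unfolding mp_def by auto
qed

lemma mp_simps [simp]: assumes "md E N" shows "arr (mp N)" "adom (mp N) = t N \<boxtimes> p" "acod (mp N) = t N"
  using linD[OF mp(1)[OF assms]] by simp_all

text \<open>\<open>mp\<close> arises by extension in its second variable, so linearity over
  \<open>F\<close> is built in and linearity over \<open>E\<close> has to be proved. On generators
  it is associativity of the action of \<open>E\<close> on \<open>TE N\<close>, together with the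
  fact that left and right action commute.\<close>

lemma lin_mp_E: assumes [simp]: "md E N" shows "lin E (tm E (t N) (TE E1)) (TE N) (mp N)"
proof -
  \<comment> \<open>Rebracketed so that \<open>e \<boxtimes> t N\<close> is the inert factor and
    \<open>ext_eq\<close> applies in the last variable.\<close>
  have "(mp N \<bullet> ((ide (t N) ** lam E1) \<bullet> sw e (t N) p)) \<bullet> as e (t N) p
      = (lam N \<bullet> (ide e ** mp N)) \<bullet> as e (t N) p"
  proof (rule ext_eq[of E1 "e \<boxtimes> t N" "T N"])
    have 1: "lin F (tm F (e \<boxtimes> t N) (T E1)) (tm F (t N \<boxtimes> e) (T E1)) (br e (t N) ** ide p)"
      using lin_tm_left[of "br e (t N)" F "T E1"] by simp
    have 2: "lin F (tm F (t N \<boxtimes> e) (T E1)) (tm F (t N) (T E1)) ((ide (t N) ** lam E1) \<bullet> as (t N) e p)"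
      by (rule lin_comp[OF lin_as lin_tm_right[OF lam(1)]]) simp_all
    from lin_comp[OF lin_comp[OF 1 2] mp(1)]
    show "lin F (tm F (e \<boxtimes> t N) (T E1)) (T N) ((mp N \<bullet> ((ide (t N) ** lam E1) \<bullet> sw e (t N) p)) \<bullet> as e (t N) p)"
      by (simp add: sw_def)
    have "lin F (tm F (e \<boxtimes> t N) (T E1)) (tm F e (T N)) ((ide e ** mp N) \<bullet> as e (t N) p)"
      by (rule lin_comp[OF lin_as lin_tm_right[OF mp(1)]]) simp_all
    from lin_comp[OF this lam(1)]
    show "lin F (tm F (e \<boxtimes> t N) (T E1)) (T N) ((lam N \<bullet> (ide e ** mp N)) \<bullet> as e (t N) p)" by simp
    have "((mp N \<bullet> ((ide (t N) ** lam E1) \<bullet> sw e (t N) p)) \<bullet> as e (t N) p) \<bullet> (ide (e \<boxtimes> t N) ** uE)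
      = mp N \<bullet> ((ide (t N) ** lam E1) \<bullet> ((as (t N) e p \<bullet> ((ide (t N) ** ide e) ** uE)) \<bullet> (br e (t N) ** ide e)))"
      by (simp add: sw_def)
    also have "\<dots> = mp N \<bullet> ((ide (t N) ** lam E1) \<bullet> (((ide (t N) ** (ide e ** uE)) \<bullet> as (t N) e e) \<bullet> (br e (t N) ** ide e)))"
      by (subst as_natural) simp_all
    also have "\<dots> = (mp N \<bullet> (ide (t N) ** uE)) \<bullet> ((ide (t N) ** mu E) \<bullet> (as (t N) e e \<bullet> (br e (t N) ** ide e)))"
      by (simp add: lam(2))
    also have "\<dots> = (ac E (TE N) \<bullet> ((ide (t N) ** mu E) \<bullet> as (t N) e e)) \<bullet> (br e (t N) ** ide e)"
      unfolding mp(2)[OF assms] by simp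
    also have "\<dots> = (ac E (TE N) \<bullet> (ac E (TE N) ** ide e)) \<bullet> (br e (t N) ** ide e)"
      using ac_assoc[of E "TE N"] by simp
    also have "\<dots> = ac E (TE N) \<bullet> (la E (TE N) ** ide e)" by (simp add: la_def)
    also have "\<dots> = la E (TE N) \<bullet> ((ide e ** ac E (TE N)) \<bullet> as e (t N) e)"
      using linD(4)[OF lin_la[of E "TE N"]] by (simp add: ac_tm)
    also have "\<dots> = lam N \<bullet> ((ide e ** mp N) \<bullet> ((ide e ** (ide (t N) ** uE)) \<bullet> as e (t N) e))"
      by (simp add: TE(2) mp(2))
    also have "\<dots> = lam N \<bullet> ((ide e ** mp N) \<bullet> (as e (t N) p \<bullet> ((ide e ** ide (t N)) ** uE)))"
      by (subst as_natural) simp_all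
    finally show "((mp N \<bullet> ((ide (t N) ** lam E1) \<bullet> sw e (t N) p)) \<bullet> as e (t N) p) \<bullet> (ide (e \<boxtimes> t N) ** uE)
      = ((lam N \<bullet> (ide e ** mp N)) \<bullet> as e (t N) p) \<bullet> (ide (e \<boxtimes> t N) ** uE)" by simp
  qed simp_all
  then have "mp N \<bullet> ((ide (t N) ** lam E1) \<bullet> sw e (t N) p) = lam N \<bullet> (ide e ** mp N)"
    by (rule iso_cancel_right[rotated]) simp_all
  then show ?thesis by (subst lin_iff_left) (simp_all add: TE)
qed

text \<open>On the generators \<open>uE\<close> of the last variable this is
  \<open>E\<close>-linearity of \<open>mp\<close>.\<close>

lemma mp_assoc: assumes [simp]: "md E N"
  shows "mp N \<bullet> (mp N ** ide p) = mp N \<bullet> ((ide (t N) ** mp E1) \<bullet> as (t N) p p)"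
proof (rule ext_eq[of E1 "t N \<boxtimes> p" "T N"])
  show "lin F (tm F (t N \<boxtimes> p) (T E1)) (T N) (mp N \<bullet> (mp N ** ide p))"
    using lin_comp[OF lin_tm_left[of "mp N" F "T E1"], of "T N" "mp N"] mp(1)[OF assms] by simp
  have "lin F (tm F (t N \<boxtimes> p) (T E1)) (tm F (t N) (T E1)) ((ide (t N) ** mp E1) \<bullet> as (t N) p p)"
    by (rule lin_comp[OF lin_as lin_tm_right[OF mp(1)]]) simp_all
  from lin_comp[OF this mp(1)]
  show "lin F (tm F (t N \<boxtimes> p) (T E1)) (T N) (mp N \<bullet> ((ide (t N) ** mp E1) \<bullet> as (t N) p p))" by simp
  have "(mp N \<bullet> (mp N ** ide p)) \<bullet> (ide (t N \<boxtimes> p) ** uE) = (mp N \<bullet> (ide (t N) ** uE)) \<bullet> (mp N ** ide e)" by simp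
  also have "\<dots> = ac E (TE N) \<bullet> (mp N ** ide e)" by (simp only: mp(2)[OF assms])
  also have "\<dots> = mp N \<bullet> ((ide (t N) ** ac E (TE E1)) \<bullet> as (t N) p e)"
    using linD(4)[OF lin_mp_E[OF assms]] by (simp add: ac_tm)
  also have "\<dots> = mp N \<bullet> ((ide (t N) ** mp E1) \<bullet> ((ide (t N) ** (ide p ** uE)) \<bullet> as (t N) p e))"
    by (simp add: mp(2))
  also have "\<dots> = mp N \<bullet> ((ide (t N) ** mp E1) \<bullet> (as (t N) p p \<bullet> ((ide (t N) ** ide p) ** uE)))"
    by (subst as_natural) simp_all
  finally show "(mp N \<bullet> (mp N ** ide p)) \<bullet> (ide (t N \<boxtimes> p) ** uE)
    = (mp N \<bullet> ((ide (t N) ** mp E1) \<bullet> as (t N) p p)) \<bullet> (ide (t N \<boxtimes> p) ** uE)" by simp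
qed simp_all

lemma mp_unit: assumes [simp]: "md E N" shows "mp N \<bullet> (ide (t N) ** (uE \<bullet> et E)) = ru (t N)"
proof -
  have "mp N \<bullet> (ide (t N) ** (uE \<bullet> et E)) = (mp N \<bullet> (ide (t N) ** uE)) \<bullet> (ide (t N) ** et E)" by simp
  also have "\<dots> = ru (t N)" unfolding mp(2)[OF assms] using md_simps(5)[of E "TE N"] by simp
  finally show ?thesis .
qed

text \<open>On generators both sides are \<open>uE \<bullet> mu E\<close>. The identity supplies the
  left unit law and the last step of commutativity.\<close>

lemma mp_uE: "mp E1 \<bullet> (uE ** ide p) = lam E1"
proof (rule ext_eq[of E1 e "T E1"])
  show "lin F (tm F e (T E1)) (T E1) (mp E1 \<bullet> (uE ** ide p))"
    using lin_comp[OF lin_tm_left[of uE F "T E1"], of "T E1" "mp E1"] mp(1)[of E1] by simp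
  have "(mp E1 \<bullet> (uE ** ide p)) \<bullet> (ide e ** uE) = (mp E1 \<bullet> (ide p ** uE)) \<bullet> (uE ** ide e)" by simp
  also have "\<dots> = ac E (TE E1) \<bullet> (uE ** ide e)" by (subst mp(2)) simp_all
  also have "\<dots> = uE \<bullet> mu E" using linD(4)[OF lin_u_E[of E1]] by simp
  finally show "(mp E1 \<bullet> (uE ** ide p)) \<bullet> (ide e ** uE) = lam E1 \<bullet> (ide e ** uE)" by (simp add: lam(2))
qed (simp_all add: lam(1))

lemma lin_la_E: "lin E (tm E (mcar F) (TE E1)) (TE E1) (la F (T E1))"
proof -
  have "lam E1 \<bullet> ((ide e ** la F (T E1)) \<bullet> sw (mcar F) e p) = la F (T E1) \<bullet> (ide (mcar F) ** lam E1)"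
    using lam(1)[OF md_self[OF mh_simps(2)[OF d]]] by (subst (asm) lin_iff_left) simp_all
  from comp_reduce[OF this[symmetric], of "sw e (mcar F) p"]
  have "la F (T E1) \<bullet> ((ide (mcar F) ** lam E1) \<bullet> sw e (mcar F) p) = lam E1 \<bullet> (ide e ** la F (T E1))"
    by (simp add: sw_sw)
  then show ?thesis by (subst lin_iff_left) (simp_all add: TE)
qed

text \<open>By construction \<open>mp\<close> is \<open>F\<close>-linear in the second variable. For
  \<open>mp \<bullet> br\<close> to be so as well, \<open>mp\<close> has to be
  \<open>F\<close>-linear in the first variable, which is the inner claim; then both sides can be
  compared on generators.\<close>

lemma mp_comm: "mp E1 \<bullet> br p p = mp E1"
proof (rule ext_eq[of E1 p "T E1"])
  let ?f = "mcar F" and ?l = "la F (T E1)"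
  have "(?l \<bullet> (ide ?f ** mp E1)) \<bullet> as ?f p p = mp E1 \<bullet> (?l ** ide p)"
  proof (rule ext_eq[of E1 "?f \<boxtimes> p" "T E1"])
    have "lin F (tm F (?f \<boxtimes> p) (T E1)) (tm F ?f (T E1)) ((ide ?f ** mp E1) \<bullet> as ?f p p)"
      by (rule lin_comp[OF lin_as lin_tm_right[OF mp(1)]]) simp_all
    from lin_comp[OF this lin_la]
    show "lin F (tm F (?f \<boxtimes> p) (T E1)) (T E1) ((?l \<bullet> (ide ?f ** mp E1)) \<bullet> as ?f p p)" by simp
    show "lin F (tm F (?f \<boxtimes> p) (T E1)) (T E1) (mp E1 \<bullet> (?l ** ide p))"
      using lin_comp[OF lin_tm_left[of ?l F "T E1"], of "T E1" "mp E1"] mp(1)[of E1] by simp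
    have "((?l \<bullet> (ide ?f ** mp E1)) \<bullet> as ?f p p) \<bullet> (ide (?f \<boxtimes> p) ** uE)
      = ?l \<bullet> ((ide ?f ** mp E1) \<bullet> (as ?f p p \<bullet> ((ide ?f ** ide p) ** uE)))" by simp
    also have "\<dots> = ?l \<bullet> ((ide ?f ** mp E1) \<bullet> ((ide ?f ** (ide p ** uE)) \<bullet> as ?f p e))"
      by (subst as_natural) simp_all
    also have "\<dots> = ?l \<bullet> ac E (tm E ?f (TE E1))" by (simp add: mp(2) ac_tm)
    also have "\<dots> = (mp E1 \<bullet> (ide p ** uE)) \<bullet> (?l ** ide e)"
      using linD(4)[OF lin_la_E] by (subst mp(2)) simp_all
    finally show "((?l \<bullet> (ide ?f ** mp E1)) \<bullet> as ?f p p) \<bullet> (ide (?f \<boxtimes> p) ** uE)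
      = (mp E1 \<bullet> (?l ** ide p)) \<bullet> (ide (?f \<boxtimes> p) ** uE)" by simp
  qed simp_all
  from comp_reduce[OF this, of "as' ?f p p"]
  have G: "?l \<bullet> (ide ?f ** mp E1) = mp E1 \<bullet> ((?l ** ide p) \<bullet> as' ?f p p)" by simp
  have "(mp E1 \<bullet> br p p) \<bullet> ((ide p ** ?l) \<bullet> sw ?f p p)
    = mp E1 \<bullet> ((br p p \<bullet> (ide p ** ?l)) \<bullet> sw ?f p p)" by simp
  also have "\<dots> = mp E1 \<bullet> (((?l ** ide p) \<bullet> br p (?f \<boxtimes> p)) \<bullet> sw ?f p p)"
    by (subst br_natural) simp_all
  also have "\<dots> = mp E1 \<bullet> ((?l ** ide p) \<bullet> (as' ?f p p \<bullet> (ide ?f ** br p p)))"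
    by (simp add: sw_br)
  also have "\<dots> = (?l \<bullet> (ide ?f ** mp E1)) \<bullet> (ide ?f ** br p p)" unfolding G by simp
  finally show "lin F (tm F p (T E1)) (T E1) (mp E1 \<bullet> br p p)"
    by (subst lin_iff_left) simp_all
  have "(mp E1 \<bullet> br p p) \<bullet> (ide p ** uE) = mp E1 \<bullet> ((uE ** ide p) \<bullet> br p e)"
    by (subst br_natural) simp_all
  also have "\<dots> = lam E1 \<bullet> br p e" by (simp only: comp_reduce[OF mp_uE])
  also have "\<dots> = mp E1 \<bullet> (ide p ** uE)" by (simp add: mp(2) TE)
  finally show "(mp E1 \<bullet> br p p) \<bullet> (ide p ** uE) = mp E1 \<bullet> (ide p ** uE)" .
qed (simp_all add: mp)

definition P where "P = \<lparr>mcar = p, mmul = aarr (mp E1), muni = aarr (uE \<bullet> et E)\<rparr>"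

lemma P_simps [simp]: "mcar P = p" "mu P = mp E1" "et P = uE \<bullet> et E"
  using arr_eta[of "mp E1"] arr_eta[of "uE \<bullet> et E"] unfolding mu_def[of P] et_def[of P] by (simp_all add: P_def)

lemma comm_mon_P [simp]: "comm_mon C P"
proof -
  have "mp E1 \<bullet> ((uE \<bullet> et E) ** ide p) = (mp E1 \<bullet> (uE ** ide p)) \<bullet> (et E ** ide p)" by simp
  also have "\<dots> = lu p" unfolding mp_uE by (simp add: lam_unit)
  finally show ?thesis unfolding comm_mon_ar by (simp add: mp_assoc mp_unit mp_comm)
qed

definition TP where "TP N = \<lparr>ucar = t N, uact = aarr (mp N)\<rparr>"

lemma TP_simps: "ucar (TP N) = t N" "md E N \<Longrightarrow> ac P (TP N) = mp N"
  using arr_eta[of "mp N"] by (simp_all add: TP_def ac_def)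

lemma md_TP: assumes [simp]: "md E N" shows "md P (TP N)"
  unfolding md_def[of P] by (simp add: is_module_ar TP_simps mp_assoc mp_unit)

lemmas [simp] = TP_simps md_TP

lemma TP_self: "TP E1 = self_mdl P"
  by (rule mdl_eqI[of P]) simp_all

lemma mh_uE: "mh E P uE"
proof -
  have "mp E1 \<bullet> (uE ** uE) = (mp E1 \<bullet> (ide p ** uE)) \<bullet> (uE ** ide e)" by simp
  also have "\<dots> = uE \<bullet> mu E" using linD(4)[OF lin_u_E[of E1]] by (subst mp(2)) simp_all
  finally show ?thesis by (simp add: mh_def)
qed

text \<open>The coprojection b -> 1 \<otimes> b, written as the action of b on the unit; the other
  coprojection is \<open>uE\<close>.\<close>

definition vF where "vF = (ac F (T E1) \<bullet> ((uE \<bullet> et E) ** ide (mcar F))) \<bullet> lu' (mcar F)"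

lemma vF_simps [simp]: "arr vF" "adom vF = mcar F" "acod vF = p"
  by (simp_all add: vF_def)

lemma lin_vF: "lin F (self_mdl F) (T E1) vF"
proof -
  have "lin F (self_mdl F) (tm F (tunit C) (self_mdl F)) (lu' (mcar F))"
    using lin_ainv[OF lin_lu[of F "self_mdl F"]] by (simp add: lu'_def)
  from lin_comp[OF this lin_free[of F "tunit C" "T E1" "uE \<bullet> et E"]] show ?thesis unfolding vF_def by simp
qed

text \<open>Multiplying by 1 \<otimes> b is acting by b, by linearity of \<open>mp\<close> over
  \<open>F\<close> and the unit law. Hence restriction of \<open>TP N\<close> along
  \<open>vF\<close> gives back \<open>T N\<close>.\<close>

lemma mp_vF: assumes [simp]: "md E N" shows "mp N \<bullet> (ide (t N) ** vF) = ac F (T N)"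
proof -
  let ?f = "mcar F"
  have m: "mp N \<bullet> (ide (t N) ** ac F (T E1)) = ac F (T N) \<bullet> ((mp N ** ide ?f) \<bullet> as' (t N) p ?f)"
    using comp_reduce[OF linD(4)[OF mp(1)[OF assms]], of "as' (t N) p ?f"] by (simp add: ac_tm)
  have "mp N \<bullet> (ide (t N) ** vF)
     = (mp N \<bullet> (ide (t N) ** ac F (T E1))) \<bullet> ((ide (t N) ** ((uE \<bullet> et E) ** ide ?f)) \<bullet> (ide (t N) ** lu' ?f))"
    by (simp add: vF_def)
  also have "\<dots> = ac F (T N) \<bullet> ((mp N ** ide ?f) \<bullet> ((as' (t N) p ?f \<bullet> (ide (t N) ** ((uE \<bullet> et E) ** ide ?f))) \<bullet> (ide (t N) ** lu' ?f)))"
    unfolding m by simp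
  also have "\<dots> = ac F (T N) \<bullet> ((mp N ** ide ?f) \<bullet> ((((ide (t N) ** (uE \<bullet> et E)) ** ide ?f) \<bullet> as' (t N) (tunit C) ?f) \<bullet> (ide (t N) ** lu' ?f)))"
    by (subst as'_natural) simp_all
  also have "\<dots> = ac F (T N) \<bullet> (((mp N \<bullet> (ide (t N) ** (uE \<bullet> et E))) ** ide ?f) \<bullet> (as' (t N) (tunit C) ?f \<bullet> (ide (t N) ** lu' ?f)))"
    by simp
  also have "\<dots> = ac F (T N) \<bullet> (((ide (t N) ** lu ?f) \<bullet> as (t N) (tunit C) ?f) \<bullet> (as' (t N) (tunit C) ?f \<bullet> (ide (t N) ** lu' ?f)))"
    by (simp only: mp_unit[OF assms]) (simp add: triangle_ar)
  also have "\<dots> = ac F (T N)" by simp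
  finally show ?thesis .
qed

lemma mh_vF: "mh F P vF"
proof -
  have "vF \<bullet> mu F = ac F (T E1) \<bullet> (vF ** ide (mcar F))" using linD(4)[OF lin_vF] by simp
  also have "\<dots> = (mp E1 \<bullet> (ide p ** vF)) \<bullet> (vF ** ide (mcar F))" by (subst mp_vF) simp_all
  finally have 1: "vF \<bullet> mu F = mp E1 \<bullet> (vF ** vF)" by simp
  have "vF \<bullet> et F = ac F (T E1) \<bullet> (((uE \<bullet> et E) ** ide (mcar F)) \<bullet> (lu' (mcar F) \<bullet> et F))"
    by (simp add: vF_def)
  also have "\<dots> = ac F (T E1) \<bullet> (((uE \<bullet> et E) ** ide (mcar F)) \<bullet> ((ide (tunit C) ** et F) \<bullet> lu' (tunit C)))"
    using lu'_natural[of "et F"] by simp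
  also have "\<dots> = (ac F (T E1) \<bullet> (ide p ** et F)) \<bullet> (((uE \<bullet> et E) ** ide (tunit C)) \<bullet> lu' (tunit C))" by simp
  also have "\<dots> = ru p \<bullet> (((uE \<bullet> et E) ** ide (tunit C)) \<bullet> lu' (tunit C))"
    using md_simps(5)[of F "T E1"] by simp
  also have "\<dots> = ((uE \<bullet> et E) \<bullet> ru (tunit C)) \<bullet> lu' (tunit C)"
    by (subst ru_natural) simp_all
  also have "\<dots> = uE \<bullet> et E" by (simp flip: lu_tunit)
  finally show ?thesis using 1 by (simp add: mh_def)
qed

lemma rm_uE: assumes [simp]: "md E N" shows "rm uE (TP N) = TE N"
  by (rule mdl_eqI[of E]) (simp_all add: ac_rm[OF mh_uE] mp(2))

lemma rm_vF: assumes [simp]: "md E N" shows "rm vF (TP N) = T N"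
  by (rule mdl_eqI[of F]) (simp_all add: ac_rm[OF mh_vF] mp_vF)

text \<open>Both composites let an element of \<open>D\<close> act on 1 \<otimes> 1, once through
  \<open>E\<close> and once through \<open>F\<close>; linearity of \<open>uE\<close> over
  \<open>D\<close> moves it across.\<close>

lemma square: "uE \<bullet> d = vF \<bullet> f"
proof -
  let ?D = "mcar D"
  have "vF \<bullet> f = ac F (T E1) \<bullet> (((uE \<bullet> et E) ** ide (mcar F)) \<bullet> (lu' (mcar F) \<bullet> f))" by (simp add: vF_def)
  also have "\<dots> = ac F (T E1) \<bullet> (((uE \<bullet> et E) ** ide (mcar F)) \<bullet> ((ide (tunit C) ** f) \<bullet> lu' ?D))"
    using lu'_natural[of f] by simp
  also have "\<dots> = (ac D (rm f (T E1)) \<bullet> (uE ** ide ?D)) \<bullet> ((et E ** ide ?D) \<bullet> lu' ?D)"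
    by (simp add: ac_rm[OF f])
  also have "\<dots> = uE \<bullet> (mu E \<bullet> ((et E ** ide e) \<bullet> ((ide (tunit C) ** d) \<bullet> lu' ?D)))"
    using linD(4)[OF lin_u[of E1], symmetric] by (simp add: ac_rm[OF d])
  also have "\<dots> = uE \<bullet> ((lu e \<bullet> (ide (tunit C) ** d)) \<bullet> lu' ?D)"
    by (simp only: comp_reduce[OF comm_mon_simps(4)[OF mh_simps(2)[OF d]]] comp_assoc)
  also have "\<dots> = uE \<bullet> ((d \<bullet> lu ?D) \<bullet> lu' ?D)" by (subst lu_natural) simp_all
  finally show ?thesis by simp
qed

text \<open>A map of \<open>F\<close>-modules out of \<open>N \<otimes>\<^sub>D F\<close> is
  \<open>E\<close>-linear once it is so on \<open>N\<close>. The hypothesis on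
  \<open>la E Z1\<close> says that the actions of \<open>E\<close> and \<open>F\<close> on the
  target commute.\<close>

lemma ext_E_linear:
  assumes N [simp]: "md E N" and Z: "md E Z1" "md F Z2" "ucar Z1 = ucar Z2"
    and h: "lin E N Z1 (k \<bullet> u N)" and k: "lin F (T N) Z2 k" and l: "lin F (tm F e Z2) Z2 (la E Z1)"
  shows "lin E (TE N) Z1 k"
proof -
  note [simp] = Z md_simps[OF Z(1)] md_simps[OF Z(2)] linD(1-3)[OF k]
  have "k \<bullet> lam N = la E Z1 \<bullet> (ide e ** k)"
  proof (rule ext_eq[of N e Z2])
    show "lin F (tm F e (T N)) Z2 (k \<bullet> lam N)" by (rule lin_comp[OF lam(1) k]) simp_all
    show "lin F (tm F e (T N)) Z2 (la E Z1 \<bullet> (ide e ** k))" by (rule lin_comp[OF lin_tm_right[OF k] l]) simp_all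
    have "(k \<bullet> u N) \<bullet> la E N = la E Z1 \<bullet> (ide e ** (k \<bullet> u N))"
      using h by (subst (asm) lin_iff_la) simp_all
    then show "(k \<bullet> lam N) \<bullet> (ide e ** u N) = (la E Z1 \<bullet> (ide e ** k)) \<bullet> (ide e ** u N)"
      by (simp add: lam(2))
  qed simp_all
  then show ?thesis by (subst lin_iff_la) (simp_all add: TE)
qed

text \<open>The two actions commute because both come from the commutative monoid \<open>G\<close>,
  by \<open>lin_la\<close>. This discharges the last hypothesis of
  \<open>ext_E_linear\<close>.\<close>

lemma lin_la_comb:
  assumes a: "mh E G a" and b: "mh F G b" and Z: "md G Z"
  shows "lin F (tm F e (rm b Z)) (rm b Z) (la E (rm a Z))"
proof -
  note [simp] = mh_simps[OF a] mh_simps[OF b] md_simps[OF Z] Z md_rm[OF a] md_rm[OF b]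
  have 1: "lin F (tm F e (rm b Z)) (tm F (mcar G) (rm b Z)) (a ** ide (ucar Z))"
    using lin_tm_left[of a F "rm b Z"] by simp
  have "lin F (rm b (tm G (mcar G) Z)) (rm b Z) (la G Z)" by (rule lin_rm[OF b _ _ lin_la]) simp_all
  then have "lin F (tm F (mcar G) (rm b Z)) (rm b Z) (la G Z)" by (simp add: rm_tm[OF b])
  from lin_comp[OF 1 this] show ?thesis by (simp add: la_rm[OF a])
qed

text \<open>A map to a \<open>P\<close>-module is extended over \<open>F\<close> and then shown to
  be linear over \<open>E\<close> and over \<open>P\<close>. Together with \<open>rm_vF\<close> this
  gives the comparison of base changes along \<open>uE\<close> and along \<open>f\<close>.\<close>

lemma univ_P: assumes N [simp]: "md E N" shows "univ E P uE N (TP N) (u N)"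
proof -
  have "\<exists>!k. lin P (TP N) Z k \<and> k \<bullet> u N = h" if Z [simp]: "md P Z" and h: "lin E N (rm uE Z) h" for Z h
  proof -
    note [simp] = md_simps[OF Z] linD(1-3)[OF h, simplified] md_rm[OF mh_uE] md_rm[OF mh_vF]
    have rr: "rm d (rm uE Z) = rm f (rm vF Z)"
      by (simp add: rm_comp[OF d mh_uE Z, symmetric] rm_comp[OF f mh_vF Z, symmetric] square)
    have "lin D (rm d N) (rm f (rm vF Z)) h" using lin_rm[OF d _ _ h] by (simp add: rr)
    then obtain k where k: "lin F (T N) (rm vF Z) k" "k \<bullet> u N = h"
      by (rule univ_ex[OF univ_T[OF N] md_rm[OF mh_vF Z]])
    note [simp] = linD(1-3)[OF k(1), simplified]
    have kE: "lin E (TE N) (rm uE Z) k"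
      by (rule ext_E_linear[OF N _ _ _ _ k(1) lin_la_comb[OF mh_uE mh_vF Z]]) (use h k(2) in simp_all)
    \<comment> \<open>Linearity over \<open>P\<close>: on the generators of the second factor it is
      linearity over \<open>E\<close>.\<close>
    have "k \<bullet> mp N = ac P Z \<bullet> (k ** ide p)"
    proof (rule ext_eq[of E1 "t N" "rm vF Z"])
      show "lin F (tm F (t N) (T E1)) (rm vF Z) (k \<bullet> mp N)" by (rule lin_comp[OF mp(1) k(1)]) simp_all
      have 1: "lin F (tm F (t N) (T E1)) (tm F (ucar Z) (T E1)) (k ** ide p)"
        using lin_tm_left[of k F "T E1"] by simp
      have "lin F (rm vF (tm P (ucar Z) (self_mdl P))) (rm vF Z) (ac P Z)"
        by (rule lin_rm[OF mh_vF _ _ lin_ac]) simp_all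
      then have "lin F (tm F (ucar Z) (T E1)) (rm vF Z) (ac P Z)"
        by (simp add: rm_tm[OF mh_vF] rm_vF flip: TP_self)
      from lin_comp[OF 1 this] show "lin F (tm F (t N) (T E1)) (rm vF Z) (ac P Z \<bullet> (k ** ide p))" by simp
      have "(k \<bullet> mp N) \<bullet> (ide (t N) ** uE) = k \<bullet> ac E (TE N)" by (simp add: mp(2))
      also have "\<dots> = ac E (rm uE Z) \<bullet> (k ** ide e)" by (rule linD(4)[OF kE])
      finally show "(k \<bullet> mp N) \<bullet> (ide (t N) ** uE) = (ac P Z \<bullet> (k ** ide p)) \<bullet> (ide (t N) ** uE)"
        by (simp add: ac_rm[OF mh_uE])
    qed simp_all
    then have kP: "lin P (TP N) Z k" by (simp add: lin_def)
    show ?thesis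
    proof (rule ex1I[of _ k])
      fix k' assume k': "lin P (TP N) Z k' \<and> k' \<bullet> u N = h"
      then have "lin F (rm vF (TP N)) (rm vF Z) k'" by (intro lin_rm[OF mh_vF]) simp_all
      then show "k' = k"
        using k' k by - (rule univ_eq[OF univ_T[OF N], where Z = "rm vF Z"], simp_all add: rm_vF)
    qed (use kP k in simp)
  qed
  then show ?thesis unfolding univ_def using mh_uE lin_u_E[OF N] by (simp add: rm_uE)
qed

text \<open>The mediating map is the extension of \<open>a\<close> to a map of
  \<open>F\<close>-modules. Multiplicativity is checked on generators, and the value on
  \<open>vF\<close> follows from linearity and the unit.\<close>

lemma pushout_ex:
  assumes a: "mh E G a" and b: "mh F G b" and ab: "a \<bullet> d = b \<bullet> f"
  shows "\<exists>!k. mh P G k \<and> k \<bullet> uE = a \<and> k \<bullet> vF = b"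
proof -
  let ?G = "self_mdl G"
  note [simp] = mh_simps[OF a] mh_simps[OF b] md_rm[OF a] md_rm[OF b]
  have rr: "rm d (rm a ?G) = rm f (rm b ?G)"
    by (simp add: rm_comp[OF d a, symmetric] rm_comp[OF f b, symmetric] ab)
  have "lin D (rm d E1) (rm f (rm b ?G)) a" using lin_rm[OF d _ _ lin_mh[OF a]] by (simp add: rr)
  then obtain k where k: "lin F (T E1) (rm b ?G) k" "k \<bullet> uE = a"
    by (rule univ_ex[OF univ_T[OF md_self[OF mh_simps(2)[OF d]]] md_rm[OF b md_self[OF mh_simps(2)[OF b]]]])
  note [simp] = linD(1-3)[OF k(1), simplified]
  have kE: "lin E (TE E1) (rm a ?G) k"
    by (rule ext_E_linear[OF _ _ _ _ _ k(1) lin_la_comb[OF a b]]) (use lin_mh[OF a] k(2) in simp_all)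
  have "k \<bullet> mp E1 = mu G \<bullet> (k ** k)"
  proof (rule ext_eq[of E1 p "rm b ?G"])
    show "lin F (tm F p (T E1)) (rm b ?G) (k \<bullet> mp E1)" by (rule lin_comp[OF mp(1) k(1)]) simp_all
    have 1: "lin F (tm F p (T E1)) (tm F (mcar G) (T E1)) (k ** ide p)"
      using lin_tm_left[of k F "T E1"] by simp
    have 2: "lin F (tm F (mcar G) (T E1)) (tm F (mcar G) (rm b ?G)) (ide (mcar G) ** k)"
      by (rule lin_tm_right[OF k(1)]) simp_all
    have "lin F (rm b (tm G (mcar G) ?G)) (rm b ?G) (ac G ?G)"
      by (rule lin_rm[OF b]) (use lin_ac[of G ?G] in simp_all)
    then have "lin F (tm F (mcar G) (rm b ?G)) (rm b ?G) (mu G)" by (simp add: rm_tm[OF b])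
    from lin_comp[OF lin_comp[OF 1 2] this] show "lin F (tm F p (T E1)) (rm b ?G) (mu G \<bullet> (k ** k))" by simp
    have "(k \<bullet> mp E1) \<bullet> (ide p ** uE) = k \<bullet> ac E (TE E1)" by (simp add: mp(2))
    also have "\<dots> = ac E (rm a ?G) \<bullet> (k ** ide e)" by (rule linD(4)[OF kE])
    finally show "(k \<bullet> mp E1) \<bullet> (ide p ** uE) = (mu G \<bullet> (k ** k)) \<bullet> (ide p ** uE)"
      using k(2) by (simp add: ac_rm[OF a])
  qed simp_all
  moreover have "k \<bullet> (uE \<bullet> et E) = et G" using comp_reduce[OF k(2), of "et E"] by simp
  ultimately have kh: "mh P G k" by (simp add: mh_def)
  have "k \<bullet> vF = b"
  proof (rule lin_self_eq[of F "rm b ?G"])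
    show "lin F (self_mdl F) (rm b ?G) (k \<bullet> vF)" by (rule lin_comp[OF lin_vF k(1)]) simp_all
    have "k \<bullet> (vF \<bullet> et F) = et G" using mh_simps(6)[OF mh_vF] \<open>k \<bullet> (uE \<bullet> et E) = et G\<close> by simp
    then show "(k \<bullet> vF) \<bullet> et F = b \<bullet> et F" by simp
  qed (simp_all add: lin_mh[OF b])
  show ?thesis
  proof (rule ex1I[of _ k])
    fix k' assume k': "mh P G k' \<and> k' \<bullet> uE = a \<and> k' \<bullet> vF = b"
    then have m: "mh P G k'" and r: "k' \<bullet> vF = b" by auto
    have "lin F (rm vF (self_mdl P)) (rm vF (rm k' ?G)) k'"
      by (rule lin_rm[OF mh_vF _ _ lin_mh[OF m]]) (use md_rm[OF m] in simp_all)
    then have "lin F (T E1) (rm b ?G) k'"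
      by (simp add: rm_comp[OF mh_vF m, symmetric] r rm_vF flip: TP_self)
    then show "k' = k"
      using k' k by - (rule univ_eq[OF univ_T[of E1], where Z = "rm b ?G"], simp_all)
  qed (use kh k \<open>k \<bullet> vF = b\<close> in simp)
qed

end

context geometry
begin

notation comp (infixr "\<bullet>" 70)
notation tns (infixr "**" 75)

definition pushout where
  "pushout D E F d f P u v \<longleftrightarrow> mh D E d \<and> mh D F f \<and> mh E P u \<and> mh F P v \<and> u \<bullet> d = v \<bullet> f \<and>
    (\<forall>G a b. mh E G a \<and> mh F G b \<and> a \<bullet> d = b \<bullet> f \<longrightarrow> (\<exists>!k. mh P G k \<and> k \<bullet> u = a \<and> k \<bullet> v = b))"

text \<open>The second conclusion records the comparison of base changes for the constructed
  pushout; \<open>pushout_univ\<close> extends it to every pushout.\<close>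

lemma pushout_exists: assumes "mh D E d" "mh D F f" obtains P u v where "pushout D E F d f P u v"
    "\<And>N. md E N \<Longrightarrow> \<exists>Q w. univ E P u N Q w \<and> univ D F f (rm d N) (rm v Q) w"
proof -
  interpret cospan_of_monoids U C D E F d f by unfold_locales (use assms in auto)
  have "\<forall>G a b. mh E G a \<and> mh F G b \<and> a \<bullet> d = b \<bullet> f \<longrightarrow> (\<exists>!k. mh P G k \<and> k \<bullet> uE = a \<and> k \<bullet> vF = b)"
    by (intro allI impI, elim conjE) (rule pushout_ex)
  then have "pushout D E F d f P uE vF"
    unfolding pushout_def using assms mh_uE mh_vF square by (intro conjI)
  moreover have "\<exists>Q w. univ E P uE N Q w \<and> univ D F f (rm d N) (rm vF Q) w" if "md E N" for N
    using univ_P[OF that] univ_T[OF that] rm_vF[OF that] by metis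
  ultimately show ?thesis by (rule that)
qed

end

section \<open>Base change along pushouts and epimorphisms\<close>

context geometry
begin

notation comp (infixr "\<bullet>" 70)
notation tns (infixr "**" 75)

lemma univI: assumes "mh A B f" "md A M" "md B Q" "lin A M (rm f Q) u"
    "\<And>Z h. md B Z \<Longrightarrow> lin A M (rm f Z) h \<Longrightarrow> \<exists>!k. lin B Q Z k \<and> k \<bullet> u = h"
  shows "univ A B f M Q u"
  using assms unfolding univ_def by simp

lemma univ_comp: assumes f: "univ A B f M Q u" and g: "univ B D g Q R v" shows "univ A D (g \<bullet> f) M R (v \<bullet> u)"
proof -
  note F = univD[OF f] and G = univD[OF g]
  have rc: "rm (g \<bullet> f) Z = rm f (rm g Z)" if "md D Z" for Z by (rule rm_comp[OF F(1) G(1) that])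
  have l: "lin A M (rm (g \<bullet> f) R) (v \<bullet> u)" unfolding rc[OF G(3)]
    using md_rm[OF G(1,3)] by (intro lin_comp[OF F(4) lin_rm[OF F(1) _ _ G(4)]] md_rm[OF F(1)] F G)
  have "\<exists>!k. lin D R Z k \<and> k \<bullet> (v \<bullet> u) = h" if Z: "md D Z" and h: "lin A M (rm (g \<bullet> f) Z) h" for Z h
  proof -
    have gz: "md B (rm g Z)" using md_rm[OF G(1) Z] .
    obtain k where k: "lin B Q (rm g Z) k" "k \<bullet> u = h" using univ_ex[OF f gz] h rc[OF Z] by metis
    obtain j where j: "lin D R Z j" "j \<bullet> v = k" using univ_ex[OF g Z k(1)] by metis
    show ?thesis
    proof (rule ex1I[of _ j])
      show "lin D R Z j \<and> j \<bullet> (v \<bullet> u) = h" using j k by (simp add: comp_reduce[OF j(2)])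
      fix i assume i: "lin D R Z i \<and> i \<bullet> (v \<bullet> u) = h"
      have "lin B Q (rm g Z) (i \<bullet> v)"
        using i md_rm[OF G(1,3)] by (intro lin_comp[OF G(4) lin_rm[OF G(1,3) Z]] F(3) gz) simp_all
      moreover have "(i \<bullet> v) \<bullet> u = k \<bullet> u" using i k by simp
      ultimately have iv: "i \<bullet> v = k" by (rule univ_eq[OF f gz _ k(1)])
      show "i = j" by (rule univ_eq[OF g Z _ j(1)]) (use i iv j in simp_all)
    qed
  qed
  then show ?thesis by (rule univI[OF mh_comp[OF F(1) G(1)] F(2) G(3) l])
qed

lemma univ_iso_ex:
  assumes f: "univ A B f M Q u" and g: "univ A B f M Q' u'"
  obtains k where "lin B Q Q' k" "iso_ar k" "k \<bullet> u = u'"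
proof -
  note F = univD[OF f] and G = univD[OF g]
  obtain k where k: "lin B Q Q' k" "k \<bullet> u = u'" using univ_ex[OF f G(3,4)] by metis
  obtain j where j: "lin B Q' Q j" "j \<bullet> u' = u" using univ_ex[OF g F(3,4)] by metis
  have "j \<bullet> k = ide (ucar Q)"
    by (rule univ_eq[OF f F(3) lin_comp[OF k(1) j(1)] lin_ide]) (use F G j k in simp_all)
  moreover have "k \<bullet> j = ide (ucar Q')"
    by (rule univ_eq[OF g G(3) lin_comp[OF j(1) k(1)] lin_ide]) (use F G j k in simp_all)
  ultimately have "iso_ar k" by (intro iso_arI[of k j]) (use linD[OF j(1)] linD[OF k(1)] in \<open>simp add: inverses_def\<close>)
  with k that show ?thesis by blast
qed

lemma univ_iso:
  assumes f: "univ A B f M Q u" and k: "lin B Q Q' k" "iso_ar k" and Q': "md B Q'"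
  shows "univ A B f M Q' (k \<bullet> u)"
proof -
  note F = univD[OF f]
  note [simp] = F(5-7) linD(1-3)[OF k(1)] ainv_simps[OF k(2)]
  have ki: "lin B Q' Q (ainv k)" by (rule lin_ainv[OF k(1) F(3) Q' k(2)])
  have "\<exists>!j. lin B Q' Z j \<and> j \<bullet> (k \<bullet> u) = h" if Z: "md B Z" and h: "lin A M (rm f Z) h" for Z h
  proof -
    obtain i where i: "lin B Q Z i" "i \<bullet> u = h" using univ_ex[OF f Z h] by metis
    note [simp] = linD(1-3)[OF i(1)]
    show ?thesis
    proof (rule ex1I[of _ "i \<bullet> ainv k"])
      show "lin B Q' Z (i \<bullet> ainv k) \<and> (i \<bullet> ainv k) \<bullet> (k \<bullet> u) = h"
        using lin_comp[OF ki i(1) Q' F(3) Z] i(2) by (simp add: comp_reduce[OF ainv_simps(6)[OF k(2)]])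
      fix j assume j: "lin B Q' Z j \<and> j \<bullet> (k \<bullet> u) = h"
      have "j \<bullet> k = i"
        by (rule univ_eq[OF f Z lin_comp[OF k(1)] i(1)]) (use j F(3) Q' Z i(2) in simp_all)
      then show "j = i \<bullet> ainv k" using linD(1-3)[OF j[THEN conjunct1]] by auto
    qed
  qed
  moreover have "lin A M (rm f Q') (k \<bullet> u)"
    by (intro lin_comp[OF F(4) lin_rm[OF F(1) F(3) Q' k(1)]] md_rm[OF F(1)] F(2,3) Q')
  ultimately show ?thesis by (intro univI[OF F(1,2) Q'])
qed

text \<open>The extension of \<open>h\<close> to \<open>B\<close> is multiplication by the element
  h(1) of \<open>Z\<close>.\<close>

lemma univ_self: assumes f: "mh A B f" shows "univ A B f (self_mdl A) (self_mdl B) f"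
proof -
  note [simp] = mh_simps[OF f]
  have "\<exists>!k. lin B (self_mdl B) Z k \<and> k \<bullet> f = h" if Z [simp]: "md B Z" and h: "lin A (self_mdl A) (rm f Z) h" for Z h
  proof -
    note [simp] = md_simps[OF Z] linD(1-3)[OF h, simplified]
    let ?b = "mcar B"
    let ?k = "(ac B Z \<bullet> ((h \<bullet> et A) ** ide ?b)) \<bullet> lu' ?b"
    have "lin B (self_mdl B) (tm B (tunit C) (self_mdl B)) (lu' ?b)"
      using lin_ainv[OF lin_lu[of B "self_mdl B"]] by (simp add: lu'_def)
    from lin_comp[OF this lin_free[of B "tunit C" Z "h \<bullet> et A"]] have k: "lin B (self_mdl B) Z ?k" by simp
    have "?k \<bullet> et B = ac B Z \<bullet> (((h \<bullet> et A) ** ide ?b) \<bullet> ((ide (tunit C) ** et B) \<bullet> lu' (tunit C)))"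
      using lu'_natural[of "et B"] by simp
    also have "\<dots> = (ac B Z \<bullet> (ide (ucar Z) ** et B)) \<bullet> (((h \<bullet> et A) ** ide (tunit C)) \<bullet> lu' (tunit C))"
      by (simp del: md_simps(5)[OF Z])
    also have "\<dots> = (ru (ucar Z) \<bullet> ((h \<bullet> et A) ** ide (tunit C))) \<bullet> lu' (tunit C)"
      unfolding md_simps(5)[OF Z] by simp
    also have "\<dots> = ((h \<bullet> et A) \<bullet> ru (tunit C)) \<bullet> lu' (tunit C)" by (subst ru_natural) simp_all
    also have "\<dots> = h \<bullet> et A" by (simp flip: lu_tunit)
    finally have ke: "?k \<bullet> et B = h \<bullet> et A" .
    have kf: "?k \<bullet> f = h"
    proof (rule lin_self_eq[OF md_rm[OF f Z] _ h])
      show "lin A (self_mdl A) (rm f Z) (?k \<bullet> f)"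
        by (rule lin_comp[OF lin_mh[OF f] lin_rm[OF f _ _ k]]) (use md_rm[OF f] in simp_all)
      show "(?k \<bullet> f) \<bullet> et A = h \<bullet> et A" using ke by simp
    qed
    show ?thesis
    proof (rule ex1I[of _ ?k])
      fix j assume j: "lin B (self_mdl B) Z j \<and> j \<bullet> f = h"
      have "j \<bullet> (f \<bullet> et A) = h \<bullet> et A" using j comp_reduce[of j f h "et A"] by simp
      then show "j = ?k" using j ke by - (rule lin_self_eq[OF Z _ k], simp_all)
    qed (use k kf in simp)
  qed
  then show ?thesis by (intro univI[OF f]) (simp_all add: lin_mh[OF f])
qed

lemma pushoutD: assumes "pushout D E F d f P u v"
  shows "mh D E d" "mh D F f" "mh E P u" "mh F P v" "u \<bullet> d = v \<bullet> f"
  using assms by (auto simp: pushout_def)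

text \<open>Transport along the mutually inverse comparison maps \<open>a\<close> and
  \<open>b\<close> between this pushout and the constructed one. Restriction is strictly functorial,
  so the module is carried over simply as \<open>rm b Q\<close>.\<close>

lemma pushout_univ:
  assumes po: "pushout D E F d f P u v" and N: "md E N"
  obtains Q w where "univ E P u N Q w" "univ D F f (rm d N) (rm v Q) w"
proof -
  note p = pushoutD[OF po]
  obtain P0 u0 v0 where po0: "pushout D E F d f P0 u0 v0" and
    Q0: "\<exists>Q w. univ E P0 u0 N Q w \<and> univ D F f (rm d N) (rm v0 Q) w"
    using pushout_exists[OF p(1,2)] N by metis
  note p0 = pushoutD[OF po0]
  obtain Q w where Q: "univ E P0 u0 N Q w" "univ D F f (rm d N) (rm v0 Q) w" using Q0 by blast
  obtain a where a: "mh P0 P a" "a \<bullet> u0 = u" "a \<bullet> v0 = v" using po0 p unfolding pushout_def by metis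
  obtain b where b: "mh P P0 b" "b \<bullet> u = u0" "b \<bullet> v = v0" using po p0 unfolding pushout_def by metis
  have ab: "a \<bullet> b = ide (mcar P)"
  proof -
    have "mh P P (a \<bullet> b) \<and> (a \<bullet> b) \<bullet> u = u \<and> (a \<bullet> b) \<bullet> v = v" using mh_comp[OF b(1) a(1)] a b by simp
    moreover have "mh P P (ide (mcar P)) \<and> ide (mcar P) \<bullet> u = u \<and> ide (mcar P) \<bullet> v = v"
      using mh_ide mh_simps[OF p(3)] mh_simps[OF p(4)] by simp
    ultimately show ?thesis using po p unfolding pushout_def by metis
  qed
  have QP: "md P0 Q" using univD[OF Q(1)] by simp
  let ?Q = "rm b Q"
  have mQ: "md P ?Q" by (rule md_rm[OF b(1) QP])
  have ru: "rm u ?Q = rm u0 Q" using rm_comp[OF p(3) b(1) QP] b by simp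
  have rv: "rm v ?Q = rm v0 Q" using rm_comp[OF p(4) b(1) QP] b by simp
  have "\<exists>!k. lin P ?Q Z k \<and> k \<bullet> w = h" if Z: "md P Z" and h: "lin E N (rm u Z) h" for Z h
  proof -
    have aZ: "md P0 (rm a Z)" by (rule md_rm[OF a(1) Z])
    have uZ: "rm u Z = rm u0 (rm a Z)" using rm_comp[OF p0(3) a(1) Z] a by simp
    have baZ: "rm b (rm a Z) = Z" using rm_comp[OF b(1) a(1) Z] ab rm_ide[OF Z] by simp
    obtain k where k: "lin P0 Q (rm a Z) k" "k \<bullet> w = h" using univ_ex[OF Q(1) aZ] h uZ by metis
    have kl: "lin P ?Q Z k" using lin_rm[OF b(1) QP aZ k(1)] baZ by simp
    show ?thesis
    proof (rule ex1I[of _ k])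
      fix j assume j: "lin P ?Q Z j \<and> j \<bullet> w = h"
      note mb = mh_comp[OF a(1) b(1)]
      have "b \<bullet> a = ide (mcar P0)"
      proof -
        have "mh P0 P0 (b \<bullet> a) \<and> (b \<bullet> a) \<bullet> u0 = u0 \<and> (b \<bullet> a) \<bullet> v0 = v0" using mh_comp[OF a(1) b(1)] a b by simp
        moreover have "mh P0 P0 (ide (mcar P0)) \<and> ide (mcar P0) \<bullet> u0 = u0 \<and> ide (mcar P0) \<bullet> v0 = v0"
          using mh_ide mh_simps[OF p0(3)] mh_simps[OF p0(4)] by simp
        ultimately show ?thesis using po0 p0 unfolding pushout_def by metis
      qed
      then have "rm a ?Q = Q" using rm_comp[OF a(1) b(1) QP] rm_ide[OF QP] by simp
      then have "lin P0 Q (rm a Z) j" using lin_rm[OF a(1) mQ Z] j by metis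
      then show "j = k" using univ_eq[OF Q(1) aZ _ k(1)] j k by simp
    qed (use kl k in simp)
  qed
  then have "univ E P u N ?Q w" using univD(4)[OF Q(1)] ru by (intro univI[OF p(3) N mQ]) simp_all
  then show ?thesis using that[of ?Q w] Q(2) rv by simp
qed

section \<open>Epimorphisms of monoids\<close>

definition mepi where
  "mepi A B f \<longleftrightarrow> mh A B f \<and> (\<forall>G g h. mh B G g \<and> mh B G h \<and> g \<bullet> f = h \<bullet> f \<longrightarrow> g = h)"

text \<open>For an epimorphism the two coprojections \<open>u\<close>, \<open>v\<close> of the
  pushout of \<open>f\<close> with itself coincide. The map \<open>k\<close> extends along
  \<open>w\<close> to a \<open>B\<close>-linear \<open>j\<close> for the structure through
  \<open>v\<close>, and \<open>w\<close> is \<open>B\<close>-linear for the structure through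
  \<open>u\<close>. These structures being equal, \<open>k\<close> is a composite of
  \<open>B\<close>-linear maps.\<close>

lemma mepi_lin:
  assumes f: "mepi A B f" and Z: "md B Z" "md B Z'" and k: "lin A (rm f Z) (rm f Z') k"
  shows "lin B Z Z' k"
proof -
  have m: "mh A B f" using f by (simp add: mepi_def)
  obtain P u v where po: "pushout A B B f f P u v" using pushout_exists[OF m m] by metis
  note p = pushoutD[OF po]
  have uv: "u = v" using f p unfolding mepi_def by blast
  obtain Q w where Q: "univ B P u Z Q w" "univ A B f (rm f Z) (rm v Q) w" by (rule pushout_univ[OF po Z(1)])
  obtain j where j: "lin B (rm v Q) Z' j" "j \<bullet> w = k" using univ_ex[OF Q(2) Z(2) k] by metis
  have "lin B Z Z' (j \<bullet> w)"
    by (rule lin_comp[OF univD(4)[OF Q(1)]]) (use j Z uv univD(3)[OF Q(2)] in simp_all)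
  then show ?thesis using j by simp
qed

text \<open>Fullness of restriction makes the identity a universal arrow, so each
  \<open>B\<close>-module is the base change of its own restriction.\<close>

lemma mepi_univ: assumes f: "mepi A B f" and Z: "md B Z" shows "univ A B f (rm f Z) Z (ide (ucar Z))"
proof -
  have m: "mh A B f" using f by (simp add: mepi_def)
  have "\<exists>!k. lin B Z Z' k \<and> k \<bullet> ide (ucar Z) = h" if "md B Z'" "lin A (rm f Z) (rm f Z') h" for Z' h
  proof (rule ex1I[of _ h])
    note h = mepi_lin[OF f Z that]
    show "lin B Z Z' h \<and> h \<bullet> ide (ucar Z) = h" using h linD(1,2)[OF h] by simp
    fix k assume k: "lin B Z Z' k \<and> k \<bullet> ide (ucar Z) = h"
    then show "k = h" using linD(1,2)[of B Z Z' k] by simp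
  qed
  then show ?thesis using lin_ide[OF md_rm[OF m Z]] by (intro univI[OF m md_rm[OF m Z] Z]) simp_all
qed

lemma mepi_pushout: assumes po: "pushout D E F d f P u v" and f: "mepi D F f" shows "mepi E P u"
proof -
  note p = pushoutD[OF po]
  have "g = h" if g: "mh P G g" and h: "mh P G h" and e: "g \<bullet> u = h \<bullet> u" for G g h
  proof -
    have "(g \<bullet> v) \<bullet> f = (h \<bullet> v) \<bullet> f" using comp_reduce[OF e, of d] p(5) by simp
    then have "g \<bullet> v = h \<bullet> v" using f mh_comp[OF p(4) g] mh_comp[OF p(4) h] unfolding mepi_def by blast
    moreover have "mh E G (g \<bullet> u) \<and> mh F G (g \<bullet> v) \<and> (g \<bullet> u) \<bullet> d = (g \<bullet> v) \<bullet> f"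
      using mh_comp[OF p(3) g] mh_comp[OF p(4) g] p(5) by simp
    ultimately show ?thesis using po g h e unfolding pushout_def by metis
  qed
  then show ?thesis using p unfolding mepi_def by blast
qed

section \<open>Zero modules\<close>

text \<open>Zero objects are expressed by equality of parallel arrows out of them, a form that
  passes directly through the universal property of base change.\<close>

definition null :: "'o \<Rightarrow> bool" where
  "null x \<longleftrightarrow> x \<in> Ob C \<and>
    (\<forall>k k'. arr k \<and> arr k' \<and> adom k = x \<and> adom k' = x \<and> acod k = acod k' \<longrightarrow> k = k')"

lemma nullI: "\<lbrakk>x \<in> Ob C; \<And>k k'. \<lbrakk>arr k; arr k'; adom k = x; adom k' = x; acod k = acod k'\<rbrakk> \<Longrightarrow> k = k'\<rbrakk> \<Longrightarrow> null x"
  unfolding null_def by simp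

definition zo :: 'o where "zo = (SOME z. is_zero C z)"

lemma zo: "is_zero C zo"
  unfolding zo_def using abelian_category.zero_ex[OF abelian] by (rule someI_ex)

lemma zo_Ob [simp]: "zo \<in> Ob C" using zo by (simp add: is_zero_def)

lemma zero_from: assumes z: "is_zero C z" and "arr k" "arr k'" "adom k = z" "adom k' = z" "acod k = acod k'"
  shows "k = k'"
proof -
  have "acod k \<in> Ob C" using assms by simp
  then have "\<exists>!f. f \<in> Hom C z (acod k)" using z by (auto simp: is_zero_def)
  then have "aarr k = aarr k'" using arr_Hom[of k] arr_Hom[of k'] assms by auto
  then show ?thesis using assms by (intro ar_eqI) simp_all
qed

lemma zero_to: assumes z: "is_zero C z" and "arr k" "arr k'" "acod k = z" "acod k' = z" "adom k = adom k'"
  shows "k = k'"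
proof -
  have "adom k \<in> Ob C" using assms by simp
  then have "\<exists>!f. f \<in> Hom C (adom k) z" using z by (auto simp: is_zero_def)
  then have "aarr k = aarr k'" using arr_Hom[of k] arr_Hom[of k'] assms by auto
  then show ?thesis using assms by (intro ar_eqI) simp_all
qed

definition zin where "zin x = Ar zo (THE f. f \<in> Hom C zo x) x"
definition zout where "zout x = Ar x (THE f. f \<in> Hom C x zo) zo"

lemma zin [simp]: "x \<in> Ob C \<Longrightarrow> arr (zin x)" "adom (zin x) = zo" "acod (zin x) = x"
proof -
  assume x: "x \<in> Ob C"
  then have "\<exists>!f. f \<in> Hom C zo x" using zo by (auto simp: is_zero_def)
  from theI'[OF this] show "arr (zin x)" using x by (simp add: zin_def)
qed (simp_all add: zin_def)

lemma zout [simp]: "x \<in> Ob C \<Longrightarrow> arr (zout x)" "adom (zout x) = x" "acod (zout x) = zo"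
proof -
  assume x: "x \<in> Ob C"
  then have "\<exists>!f. f \<in> Hom C x zo" using zo by (auto simp: is_zero_def)
  from theI'[OF this] show "arr (zout x)" using x by (simp add: zout_def)
qed (simp_all add: zout_def)

abbreviation zer where "zer x y \<equiv> zin y \<bullet> zout x"

lemma zer_comp: "\<lbrakk>arr k; x \<in> Ob C; adom k = y\<rbrakk> \<Longrightarrow> k \<bullet> zer x y = zer x (acod k)"
proof -
  assume k: "arr k" "x \<in> Ob C" "adom k = y"
  then have "k \<bullet> zin y = zin (acod k)" using arr_Ob(1)[OF k(1)] by (intro zero_from[OF zo]) simp_all
  then show ?thesis by (metis comp_assoc)
qed

lemma comp_zer: "\<lbrakk>arr k; y \<in> Ob C; acod k = x\<rbrakk> \<Longrightarrow> zer x y \<bullet> k = zer (adom k) y"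
proof -
  assume k: "arr k" "y \<in> Ob C" "acod k = x"
  then have "zout x \<bullet> k = zout (adom k)" using arr_Ob(2)[OF k(1)] by (intro zero_to[OF zo]) simp_all
  then show ?thesis by simp
qed

lemma null_iff: "x \<in> Ob C \<Longrightarrow> null x \<longleftrightarrow> ide x = zer x x"
proof
  assume x: "x \<in> Ob C" and e: "ide x = zer x x"
  have "k = k'" if k: "arr k" "arr k'" "adom k = x" "adom k' = x" "acod k = acod k'" for k k'
  proof -
    have "k \<bullet> ide x = k' \<bullet> ide x" unfolding e using k x zer_comp[of k x x] zer_comp[of k' x x] by simp
    then show ?thesis using k by simp
  qed
  then show "null x" by (rule nullI[OF x])
next
  assume "x \<in> Ob C" and n: "null x"
  then show "ide x = zer x x" unfolding null_def by (metis acod_comp acod_ide adom_comp adom_ide arr_comp arr_ide zin zout)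
qed

text \<open>A zero object is initial, hence the colimit of the empty diagram, which tensoring
  preserves.\<close>

lemma null_zo_tens: assumes a: "a \<in> Ob C" shows "null (zo \<boxtimes> a)"
proof -
  define J :: "('u, 'u) cat" where "J = \<lparr>Ob = {}, Hom = (\<lambda>_ _. {}), idt = (\<lambda>_. undefined), cmp = (\<lambda>_ _. undefined)\<rparr>"
  have "category J" by unfold_locales (auto simp: J_def)
  then have J: "small_cat U J" by (auto simp: small_cat_def J_def small_finite)
  have F: "is_functor J C (\<lambda>_. zo) (\<lambda>_ _ _. undefined)" by (simp add: is_functor_def J_def)
  have "is_colimit C J (\<lambda>_. zo) (\<lambda>_ _ _. undefined) zo (\<lambda>_. undefined)"
    using zo by (auto simp: is_colimit_def is_cocone_def J_def is_zero_def)
  then have "is_colimit C J (\<lambda>i. zo \<boxtimes> a) (\<lambda>i j u. undefined \<boxdot> idt C a) (zo \<boxtimes> a) (\<lambda>i. undefined \<boxdot> idt C a)"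
    using tensor_colimits J F a unfolding tensor_preserves_small_colimits_def by blast
  then have *: "m \<in> Ob C \<Longrightarrow> \<exists>!h. h \<in> Hom C (zo \<boxtimes> a) m" for m
    by (auto simp: is_colimit_def is_cocone_def J_def)
  have "k = k'" if k: "arr k" "arr k'" "adom k = zo \<boxtimes> a" "adom k' = zo \<boxtimes> a" "acod k = acod k'" for k k'
  proof -
    have "aarr k = aarr k'" using *[of "acod k"] arr_Hom[of k] arr_Hom[of k'] k by auto
    then show ?thesis using k by (intro ar_eqI) simp_all
  qed
  then show ?thesis using a by (intro nullI) simp_all
qed

definition zmod where "zmod A = \<lparr>ucar = zo, uact = aarr (zout (zo \<boxtimes> mcar A))\<rparr>"

lemma zmod: assumes A: "comm_mon C A" shows "md A (zmod A)" "ucar (zmod A) = zo"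
proof -
  show u [simp]: "ucar (zmod A) = zo" by (simp add: zmod_def)
  have ac: "ac A (zmod A) = zout (zo \<boxtimes> mcar A)"
    using A arr_eta[of "zout (zo \<boxtimes> mcar A)"] by (simp add: ac_def zmod_def)
  show "md A (zmod A)" unfolding md_def is_module_ar[OF A] ac using A by (auto intro: zero_to[OF zo])
qed

lemma lin_zout: assumes M: "md A M" shows "lin A M (zmod A) (zout (ucar M))"
proof -
  note [simp] = md_simps[OF M] zmod md_simps[OF zmod(1)]
  show ?thesis unfolding lin_def by (auto intro!: zero_to[OF zo])
qed

lemma lin_zin: assumes M: "md A M" shows "lin A (zmod A) M (zin (ucar M))"
proof -
  note [simp] = md_simps[OF M] zmod md_simps[OF zmod(1)]
  have "zin (ucar M) \<bullet> ac A (zmod A) = ac A M \<bullet> (zin (ucar M) ** ide (mcar A))"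
    using null_zo_tens[of "mcar A"] unfolding null_def by auto
  then show ?thesis unfolding lin_def by auto
qed

lemma lin_zer: assumes "md A M" "md A N" shows "lin A M N (zer (ucar M) (ucar N))"
  by (rule lin_comp[OF lin_zout lin_zin]) (use assms zmod md_simps in auto)

text \<open>The identity and the zero map of \<open>M\<close> are both linear, and either notion
  says that they coincide.\<close>

lemma is_zero_Mod: assumes M: "md A M" shows "is_zero (Mod_cat C A) M \<longleftrightarrow> null (ucar M)"
proof
  note [simp] = md_simps[OF M]
  assume z: "is_zero (Mod_cat C A) M"
  then have "\<exists>!f. f \<in> Hom (Mod_cat C A) M M" using M by (auto simp: is_zero_def)
  moreover have "aarr (ide (ucar M)) \<in> Hom (Mod_cat C A) M M" "aarr (zer (ucar M) (ucar M)) \<in> Hom (Mod_cat C A) M M"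
    unfolding lin_Hom[OF M M] using lin_ide[OF M] lin_zer[OF M M] arr_eta[of "ide (ucar M)"] arr_eta[of "zer (ucar M) (ucar M)"] by simp_all
  ultimately have "aarr (ide (ucar M)) = aarr (zer (ucar M) (ucar M))" by blast
  then have "ide (ucar M) = zer (ucar M) (ucar M)" by (intro ar_eqI) simp_all
  then show "null (ucar M)" by (simp add: null_iff)
next
  note [simp] = md_simps[OF M]
  assume n: "null (ucar M)"
  then have e: "ide (ucar M) = zer (ucar M) (ucar M)" by (simp add: null_iff)
  have "(\<exists>!f. f \<in> Hom (Mod_cat C A) X M) \<and> (\<exists>!f. f \<in> Hom (Mod_cat C A) M X)" if "X \<in> Ob (Mod_cat C A)" for X
  proof
    have X: "md A X" using that by (simp add: Mod_cat_def md_def)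
    note [simp] = md_simps[OF X]
    have h: "f \<in> Hom (Mod_cat C A) M X \<longleftrightarrow> lin A M X (Ar (ucar M) f (ucar X))"
      "f \<in> Hom (Mod_cat C A) X M \<longleftrightarrow> lin A X M (Ar (ucar X) f (ucar M))" for f
      using lin_Hom M X by auto
    show "\<exists>!f. f \<in> Hom (Mod_cat C A) M X"
    proof (rule ex1I[of _ "aarr (zer (ucar M) (ucar X))"])
      show "aarr (zer (ucar M) (ucar X)) \<in> Hom (Mod_cat C A) M X"
        using lin_zer[OF M X] arr_eta[of "zer (ucar M) (ucar X)"] by (simp add: h)
      fix f assume "f \<in> Hom (Mod_cat C A) M X"
      then have "Ar (ucar M) f (ucar X) = zer (ucar M) (ucar X)"
        using n unfolding null_def h by (auto dest: linD(1))
      then show "f = aarr (zer (ucar M) (ucar X))" by (metis ar.sel(2))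
    qed
    show "\<exists>!f. f \<in> Hom (Mod_cat C A) X M"
    proof (rule ex1I[of _ "aarr (zer (ucar X) (ucar M))"])
      show "aarr (zer (ucar X) (ucar M)) \<in> Hom (Mod_cat C A) X M"
        using lin_zer[OF X M] arr_eta[of "zer (ucar X) (ucar M)"] by (simp add: h)
      fix f assume "f \<in> Hom (Mod_cat C A) X M"
      then have a: "arr (Ar (ucar X) f (ucar M))" unfolding h by (rule linD(1))
      have "ide (ucar M) \<bullet> Ar (ucar X) f (ucar M) = zer (ucar X) (ucar M)"
        unfolding e using a by (subst comp_zer) auto
      then have "Ar (ucar X) f (ucar M) = zer (ucar X) (ucar M)" using a by simp
      then show "f = aarr (zer (ucar X) (ucar M))" by (metis ar.sel(2))
    qed
  qed
  then show "is_zero (Mod_cat C A) M" using M by (simp add: is_zero_def Mod_cat_def md_def)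
qed

text \<open>The base change is zero exactly when any two linear maps from \<open>N\<close> into the
  restriction of a common \<open>B\<close>-module agree; \<open>null_univD\<close> is the converse.
  Only maps out of \<open>N\<close> appear, so vanishing can be compared across different base
  changes.\<close>

lemma null_univI:
  assumes u: "univ A B f N Q u"
    and h: "\<And>Z h h'. \<lbrakk>md B Z; lin A N (rm f Z) h; lin A N (rm f Z) h'\<rbrakk> \<Longrightarrow> h = h'"
  shows "null (ucar Q)"
proof -
  note U = univD[OF u]
  note [simp] = md_simps[OF U(3)] U
  have "lin A N (rm f Q) (zer (ucar Q) (ucar Q) \<bullet> u)"
    by (rule lin_comp[OF U(4) lin_rm[OF U(1) _ _ lin_zer]]) (use md_rm[OF U(1)] in simp_all)
  then have "ide (ucar Q) \<bullet> u = zer (ucar Q) (ucar Q) \<bullet> u" using h[OF U(3)] by simp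
  then have "ide (ucar Q) = zer (ucar Q) (ucar Q)"
    by (rule univ_eq[OF u U(3) lin_ide[OF U(3)] lin_zer[OF U(3) U(3)]])
  then show ?thesis by (simp add: null_iff)
qed

lemma null_univD:
  assumes u: "univ A B f N Q u" and n: "null (ucar Q)"
    and Z: "md B Z" "lin A N (rm f Z) h" "lin A N (rm f Z) h'"
  shows "h = h'"
proof -
  obtain k where k: "lin B Q Z k" "k \<bullet> u = h" using univ_ex[OF u Z(1,2)] by metis
  obtain k' where k': "lin B Q Z k'" "k' \<bullet> u = h'" using univ_ex[OF u Z(1,3)] by metis
  have "k = k'" using n linD[OF k(1)] linD[OF k'(1)] unfolding null_def by auto
  then show ?thesis using k k' by simp
qed

section \<open>Modules killed by a base change\<close>

definition vanish where "vanish A B f N \<longleftrightarrow> null (ucar (bco A B f N))"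

lemma vanish_univ: assumes u: "univ A B f N Q u" shows "vanish A B f N \<longleftrightarrow> null (ucar Q)"
proof -
  note b = univ_bc[OF univD(1,2)[OF u]]
  show ?thesis unfolding vanish_def
  proof
    assume n: "null (ucar (bco A B f N))"
    show "null (ucar Q)" by (rule null_univI[OF u]) (rule null_univD[OF b n])
  next
    assume n: "null (ucar Q)"
    show "null (ucar (bco A B f N))" by (rule null_univI[OF b]) (rule null_univD[OF u n])
  qed
qed

lemma vanish_comp: assumes "mh A B f" "mh B D g" "md A N"
  shows "vanish A D (g \<bullet> f) N \<longleftrightarrow> vanish B D g (bco A B f N)"
proof -
  note b = univ_bc[OF assms(1,3)]
  note c = univ_bc[OF assms(2) univD(3)[OF b]]
  show ?thesis using vanish_univ[OF univ_comp[OF b c]] by (simp add: vanish_def)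
qed

lemma vanish_pushout: assumes "pushout D E F d f P u v" "md E N"
  shows "vanish E P u N \<longleftrightarrow> vanish D F f (rm d N)"
proof -
  obtain Q w where Q: "univ E P u N Q w" "univ D F f (rm d N) (rm v Q) w" by (rule pushout_univ[OF assms])
  show ?thesis using vanish_univ[OF Q(1)] vanish_univ[OF Q(2)] by simp
qed

text \<open>Let \<open>P\<close> be the pushout of \<open>E'\<close> and \<open>D\<close> over
  \<open>A\<close>. Maps from \<open>N\<close> into a \<open>P\<close>-module are in particular maps
  over \<open>A\<close> into a \<open>D\<close>-module, and any two of these agree by hypothesis.
  The result makes the condition in \<open>zariski_open_detected\<close> local.\<close>

lemma vanish_base_change:
  assumes g: "mh A E g" and h: "mh E E' h" and d: "mh A D d" and N: "md E N" and v: "vanish A D d (rm g N)"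
  shows "vanish A D d (rm (h \<bullet> g) (bco E E' h N))"
proof -
  note hg = mh_comp[OF g h]
  note Y = univ_bc[OF h N]
  obtain P p q where po: "pushout A E' D (h \<bullet> g) d P p q" using pushout_exists[OF hg d] by metis
  note P = pushoutD[OF po]
  obtain Q w where Q: "univ E' P p (bco E E' h N) Q w" "univ A D d (rm (h \<bullet> g) (bco E E' h N)) (rm q Q) w"
    by (rule pushout_univ[OF po univD(3)[OF Y]])
  note u = univ_comp[OF Y Q(1)]
  have "null (ucar Q)"
  proof (rule null_univI[OF u])
    fix Z k k' assume Z: "md P Z" and k: "lin E N (rm (p \<bullet> h) Z) k" "lin E N (rm (p \<bullet> h) Z) k'"
    note ph = mh_comp[OF h P(3)]
    have r: "rm g (rm (p \<bullet> h) Z) = rm d (rm q Z)"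
      using rm_comp[OF g ph Z] rm_comp[OF d P(4) Z] P(5) by simp
    have "lin A (rm g N) (rm d (rm q Z)) k" "lin A (rm g N) (rm d (rm q Z)) k'"
      using lin_rm[OF g N md_rm[OF ph Z] k(1)] lin_rm[OF g N md_rm[OF ph Z] k(2)] r by simp_all
    then show "k = k'" by (rule null_univD[OF univ_bc[OF d md_rm[OF g N]] v[unfolded vanish_def] md_rm[OF P(4) Z]])
  qed
  then show ?thesis using vanish_univ[OF Q(2)] by simp
qed

lemma vanish_null: assumes "mh A B f" "md A N" "null (ucar N)" shows "vanish A B f N"
proof -
  note b = univ_bc[OF assms(1,2)]
  show ?thesis unfolding vanish_def
  proof (rule null_univI[OF b])
    fix Z h h' assume h: "lin A N (rm f Z) h" "lin A N (rm f Z) h'"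
    show "h = h'" using assms(3) linD(1-3)[OF h(1)] linD(1-3)[OF h(2)] unfolding null_def by metis
  qed
qed

end

section \<open>Pullbacks\<close>

text \<open>The shape \<open>a \<rightarrow> c \<leftarrow> b\<close>; all arrows are called \<open>c\<close>.\<close>

definition cosp :: "'j \<Rightarrow> 'j \<Rightarrow> 'j \<Rightarrow> ('j, 'j) cat" where
  "cosp a b c = \<lparr>Ob = {a, b, c}, Hom = (\<lambda>i j. if i = j \<or> j = c then {c} else {}),
     idt = (\<lambda>_. c), cmp = (\<lambda>_ _. c)\<rparr>"

lemma category_cosp: "\<lbrakk>a \<noteq> b; a \<noteq> c; b \<noteq> c\<rbrakk> \<Longrightarrow> category (cosp a b c)"
  by unfold_locales (auto simp: cosp_def split: if_splits)

definition cosp_ob where "cosp_ob a b x y z i = (if i = a then x else if i = b then y else z)"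
definition cosp_arr where
  "cosp_arr K a g h Fo i j u = (if i = j then idt K (Fo i) else if i = a then g else h)"

context category
begin

lemma is_functor_cosp:
  assumes "a \<noteq> b" "a \<noteq> c" "b \<noteq> c" "x \<in> Ob K" "y \<in> Ob K" "z \<in> Ob K" "g \<in> Hom K x z" "h \<in> Hom K y z"
  shows "is_functor (cosp a b c) K (cosp_ob a b x y z) (cosp_arr K a g h (cosp_ob a b x y z))"
  using assms by (auto simp: is_functor_def cosp_def cosp_ob_def cosp_arr_def idt_Hom idt_left idt_right split: if_splits)

definition pb :: "('o, 'a) ar \<Rightarrow> ('o, 'a) ar \<Rightarrow> ('o, 'a) ar \<Rightarrow> ('o, 'a) ar \<Rightarrow> bool" where
  "pb g h p q \<longleftrightarrow> arr g \<and> arr h \<and> arr p \<and> arr q \<and> acod g = acod h \<and> acod p = adom g \<and> acod q = adom h \<and>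
    adom p = adom q \<and> comp g p = comp h q \<and>
    (\<forall>r s. arr r \<and> arr s \<and> acod r = adom g \<and> acod s = adom h \<and> comp g r = comp h s \<longrightarrow>
      (\<exists>!k. arr k \<and> adom k = adom r \<and> acod k = adom p \<and> comp p k = r \<and> comp q k = s))"

lemma pbD: assumes "pb g h p q" shows "arr g" "arr h" "arr p" "arr q" "acod g = acod h" "acod p = adom g"
   "acod q = adom h" "adom q = adom p" "comp g p = comp h q"
  using assms by (auto simp: pb_def)

lemma pb_ex: assumes "pb g h p q" "arr r" "arr s" "acod r = adom g" "acod s = adom h" "comp g r = comp h s"
  obtains k where "arr k" "adom k = adom r" "acod k = adom p" "comp p k = r" "comp q k = s"
  using assms unfolding pb_def by metis

lemma pb_ex1: "\<lbrakk>pb g h p q; arr r; arr s; acod r = adom g; acod s = adom h; comp g r = comp h s\<rbrakk>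
   \<Longrightarrow> \<exists>!k. arr k \<and> adom k = adom r \<and> acod k = adom p \<and> comp p k = r \<and> comp q k = s"
  unfolding pb_def by blast

lemma pb_eq: assumes p: "pb g h p q" and k: "arr k" "arr k'" "acod k = adom p" "acod k' = adom p"
    "comp p k = comp p k'" "comp q k = comp q k'"
  shows "k = k'"
proof -
  note [simp] = pbD(1-8)[OF p]
  have d: "adom k' = adom k" using k adom_comp[of p k] adom_comp[of p k'] by simp
  have "comp g (comp p k) = comp h (comp q k)" using comp_reduce[OF pbD(9)[OF p]] by simp
  then have "\<exists>!j. arr j \<and> adom j = adom (comp p k) \<and> acod j = adom p \<and> comp p j = comp p k \<and> comp q j = comp q k"
    by (rule pb_ex1[OF p, rotated 4]) (use k in simp_all)
  note E = this
  show ?thesis by (rule trans[OF the1_equality[OF E, symmetric] the1_equality[OF E]]) (use k d in simp_all)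
qed

text \<open>A cone is determined by its components at \<open>a\<close> and \<open>b\<close>; the one
  at \<open>c\<close> is forced.\<close>

lemma is_limit_cosp:
  assumes abc: "a \<noteq> b" "a \<noteq> c" "b \<noteq> c" and F: "is_functor (cosp a b c) K Fo Fa"
  shows "is_limit K (cosp a b c) Fo Fa l \<pi> \<longleftrightarrow>
    pb (Ar (Fo a) (Fa a c c) (Fo c)) (Ar (Fo b) (Fa b c c) (Fo c)) (Ar l (\<pi> a) (Fo a)) (Ar l (\<pi> b) (Fo b)) \<and>
    \<pi> c = Fa a c c \<cdot> \<pi> a"
proof -
  have ob [simp]: "Fo a \<in> Ob K" "Fo b \<in> Ob K" "Fo c \<in> Ob K"
    and hm [simp]: "Fa a c c \<in> Hom K (Fo a) (Fo c)" "Fa b c c \<in> Hom K (Fo b) (Fo c)"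
    and i: "Fa a a c = idt K (Fo a)" "Fa b b c = idt K (Fo b)" "Fa c c c = idt K (Fo c)"
    using F abc by (auto simp: is_functor_def cosp_def)
  have [simp]: "m \<in> Ob K \<Longrightarrow> r \<in> Hom K m (Fo b) \<Longrightarrow> Fa b c c \<cdot> r \<in> Hom K m (Fo c)" for m r
    using cmp_Hom[of m "Fo b" "Fo c" r] by simp
  have [simp]: "m \<in> Ob K \<Longrightarrow> r \<in> Hom K m (Fo c) \<Longrightarrow> idt K (Fo c) \<cdot> r = r" for m r
    using idt_left[of m "Fo c" r] by simp
  have cone: "is_cone K (cosp a b c) Fo Fa m q \<longleftrightarrow> m \<in> Ob K \<and> q a \<in> Hom K m (Fo a) \<and> q b \<in> Hom K m (Fo b) \<and>
      Fa a c c \<cdot> q a = Fa b c c \<cdot> q b \<and> q c = Fa a c c \<cdot> q a" for m q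
    using abc i by (auto simp: is_cone_def cosp_def idt_left cmp_Hom)
  let ?g = "Ar (Fo a) (Fa a c c) (Fo c)" and ?h = "Ar (Fo b) (Fa b c c) (Fo c)"
  let ?p = "Ar l (\<pi> a) (Fo a)" and ?q = "Ar l (\<pi> b) (Fo b)"
  have med: "(k \<in> Hom K m l \<and> (\<forall>i\<in>Ob (cosp a b c). \<pi> i \<cdot> k = q i)) \<longleftrightarrow>
     (arr (Ar m k l) \<and> comp ?p (Ar m k l) = Ar m (q a) (Fo a) \<and> comp ?q (Ar m k l) = Ar m (q b) (Fo b))"
    if "is_cone K (cosp a b c) Fo Fa m q" "is_cone K (cosp a b c) Fo Fa l \<pi>" for m q k
    using that abc by (auto simp: cone) (auto simp: cosp_def cmp_assoc[of m l "Fo a" "Fo c"] cmp_assoc[of m l "Fo b" "Fo c"])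
  show ?thesis
  proof
    assume L: "is_limit K (cosp a b c) Fo Fa l \<pi>"
    then have c: "is_cone K (cosp a b c) Fo Fa l \<pi>" by (simp add: is_limit_def)
    have "\<exists>!k. arr k \<and> adom k = adom r \<and> acod k = l \<and> comp ?p k = r \<and> comp ?q k = s"
      if r: "arr r" "arr s" "acod r = Fo a" "acod s = Fo b" "comp ?g r = comp ?h s" for r s
    proof -
      have ds: "adom r = adom s" using r by (metis adom_comp arr_comp arr_Ar ar.sel(1) hm ob)
      define m where "m = adom r"
      define q where "q i = (if i = a then aarr r else if i = b then aarr s else Fa a c c \<cdot> aarr r)" for i
      have rs: "r = Ar m (aarr r) (Fo a)" "s = Ar m (aarr s) (Fo b)"
        using arr_eta[of r] arr_eta[of s] r ds by (simp_all add: m_def)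
      have h: "m \<in> Ob K" "aarr r \<in> Hom K m (Fo a)" "aarr s \<in> Hom K m (Fo b)"
        using arr_Hom[of r] arr_Hom[of s] r ds arr_Ob(1)[of r] by (simp_all add: m_def)
      have e: "Fa a c c \<cdot> aarr r = Fa b c c \<cdot> aarr s"
        using r(5) h by (subst (asm) rs(1), subst (asm) rs(2)) simp
      have q: "is_cone K (cosp a b c) Fo Fa m q" using h e abc by (simp add: cone q_def)
      then have "\<exists>!k. k \<in> Hom K m l \<and> (\<forall>i\<in>Ob (cosp a b c). \<pi> i \<cdot> k = q i)" using L by (simp add: is_limit_def)
      then obtain k where k: "arr (Ar m k l)" "comp ?p (Ar m k l) = r" "comp ?q (Ar m k l) = s"
        and un: "\<And>k'. \<lbrakk>arr (Ar m k' l); comp ?p (Ar m k' l) = r; comp ?q (Ar m k' l) = s\<rbrakk> \<Longrightarrow> k' = k"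
        using abc rs unfolding med[OF q c] by (auto simp: q_def)
      show ?thesis
      proof (rule ex1I[of _ "Ar m k l"])
        fix k' assume k': "arr k' \<and> adom k' = adom r \<and> acod k' = l \<and> comp ?p k' = r \<and> comp ?q k' = s"
        then have "k' = Ar m (aarr k') l" using arr_eta[of k'] by (simp add: m_def)
        then show "k' = Ar m k l" using un[of "aarr k'"] k' by metis
      qed (use k in \<open>simp add: m_def\<close>)
    qed
    then have "pb ?g ?h ?p ?q" unfolding pb_def using c by (auto simp: cone)
    then show "pb ?g ?h ?p ?q \<and> \<pi> c = Fa a c c \<cdot> \<pi> a" using c by (simp add: cone)
  next
    assume R: "pb ?g ?h ?p ?q \<and> \<pi> c = Fa a c c \<cdot> \<pi> a"
    then have pbR: "pb ?g ?h ?p ?q" by simp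
    have c: "is_cone K (cosp a b c) Fo Fa l \<pi>" using R pbD[OF pbR] by (auto simp: cone)
    have "\<exists>!k. k \<in> Hom K m l \<and> (\<forall>i\<in>Ob (cosp a b c). \<pi> i \<cdot> k = q i)"
      if q: "is_cone K (cosp a b c) Fo Fa m q" for m q
    proof -
      have h: "m \<in> Ob K" "q a \<in> Hom K m (Fo a)" "q b \<in> Hom K m (Fo b)" "Fa a c c \<cdot> q a = Fa b c c \<cdot> q b"
        using q by (auto simp: cone)
      obtain k where k: "arr k" "adom k = m" "acod k = l" "comp ?p k = Ar m (q a) (Fo a)" "comp ?q k = Ar m (q b) (Fo b)"
        by (rule pb_ex[OF pbR, of "Ar m (q a) (Fo a)" "Ar m (q b) (Fo b)"]) (use h in simp_all)
      then have ke: "k = Ar m (aarr k) l" using arr_eta[of k] by simp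
      show ?thesis unfolding med[OF q c]
      proof (rule ex1I[of _ "aarr k"])
        show "arr (Ar m (aarr k) l) \<and> comp ?p (Ar m (aarr k) l) = Ar m (q a) (Fo a) \<and> comp ?q (Ar m (aarr k) l) = Ar m (q b) (Fo b)"
          using k ke by metis
        fix k' assume k': "arr (Ar m k' l) \<and> comp ?p (Ar m k' l) = Ar m (q a) (Fo a) \<and> comp ?q (Ar m k' l) = Ar m (q b) (Fo b)"
        have "Ar m k' l = k" by (rule pb_eq[OF pbR]) (use k k' in auto)
        then show "k' = aarr k" by auto
      qed
    qed
    then show "is_limit K (cosp a b c) Fo Fa l \<pi>" using c by (simp add: is_limit_def)
  qed
qed

text \<open>Invariance under isomorphisms of all four corners. In this way chosen base changes are
  replaced by arbitrary universal arrows.\<close>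

lemma pb_iso:
  assumes p: "pb g h p q" and iso: "iso_ar a" "iso_ar b" "iso_ar c" "iso_ar l"
    and ar: "arr g'" "arr h'" "arr p'" "arr q'"
    and d: "adom a = adom g" "adom b = adom h" "adom c = acod g" "adom l = adom p"
      "adom g' = acod a" "adom h' = acod b" "acod g' = acod c" "acod h' = acod c"
      "adom p' = acod l" "adom q' = acod l" "acod p' = acod a" "acod q' = acod b"
    and e: "comp g' a = comp c g" "comp h' b = comp c h" "comp p' l = comp a p" "comp q' l = comp b q"
  shows "pb g' h' p' q'"
proof -
  note P = pbD[OF p]
  note [simp] = P(1-4) P(5)[symmetric] P(6-8) ainv_simps[OF iso(1)] ainv_simps[OF iso(2)] ainv_simps[OF iso(3)] ainv_simps[OF iso(4)] ar d
  have "comp (comp g' p') l = comp (comp h' q') l"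
    using e comp_reduce[OF e(1)] comp_reduce[OF e(2)] P(9) by simp
  then have sq: "comp g' p' = comp h' q'" by (rule iso_cancel_right[OF iso(4)]) simp_all
  have "\<exists>!k. arr k \<and> adom k = adom r \<and> acod k = adom p' \<and> comp p' k = r \<and> comp q' k = s"
    if r [simp]: "arr r" "arr s" "acod r = adom g'" "acod s = adom h'" and rs: "comp g' r = comp h' s" for r s
  proof -
    have 1: "comp c (comp g (comp (ainv a) r)) = comp g' r"
      using comp_reduce[OF e(1), of "comp (ainv a) r"] comp_reduce[OF ainv_simps(5)[OF iso(1)], of r] by simp
    have 2: "comp c (comp h (comp (ainv b) s)) = comp h' s"
      using comp_reduce[OF e(2), of "comp (ainv b) s"] comp_reduce[OF ainv_simps(5)[OF iso(2)], of s] by simp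
    have "comp g (comp (ainv a) r) = comp h (comp (ainv b) s)"
      by (rule iso_cancel_left[OF iso(3)]) (use 1 2 rs in simp_all)
    then obtain k where k: "arr k" "adom k = adom r" "acod k = adom p" "comp p k = comp (ainv a) r" "comp q k = comp (ainv b) s"
      by (rule pb_ex[OF p, rotated 4]) simp_all
    note [simp] = k(1-3)
    show ?thesis
    proof (rule ex1I[of _ "comp l k"])
      show "arr (comp l k) \<and> adom (comp l k) = adom r \<and> acod (comp l k) = adom p' \<and> comp p' (comp l k) = r \<and> comp q' (comp l k) = s"
        using comp_reduce[OF e(3), of k] comp_reduce[OF e(4), of k] k(4,5)
          comp_reduce[OF ainv_simps(5)[OF iso(1)], of r] comp_reduce[OF ainv_simps(5)[OF iso(2)], of s] by simp
      fix j assume j: "arr j \<and> adom j = adom r \<and> acod j = adom p' \<and> comp p' j = r \<and> comp q' j = s"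
      then have [simp]: "arr j" "acod j = acod l" by auto
      have "comp a (comp p (comp (ainv l) j)) = comp p' j"
        using comp_reduce[OF e(3), of "comp (ainv l) j"] comp_reduce[OF ainv_simps(5)[OF iso(4)], of j] by simp
      also have "\<dots> = comp a (comp p k)"
        using j k(4) comp_reduce[OF ainv_simps(5)[OF iso(1)], of r] by simp
      finally have p1: "comp p (comp (ainv l) j) = comp p k" by (rule iso_cancel_left[OF iso(1)]) simp_all
      have "comp b (comp q (comp (ainv l) j)) = comp q' j"
        using comp_reduce[OF e(4), of "comp (ainv l) j"] comp_reduce[OF ainv_simps(5)[OF iso(4)], of j] by simp
      also have "\<dots> = comp b (comp q k)"
        using j k(5) comp_reduce[OF ainv_simps(5)[OF iso(2)], of s] by simp
      finally have "comp q (comp (ainv l) j) = comp q k" by (rule iso_cancel_left[OF iso(2)]) simp_all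
      with p1 have "comp (ainv l) j = k" by - (rule pb_eq[OF p], simp_all)
      then have "comp l (comp (ainv l) j) = comp l k" by simp
      then show "j = comp l k" using comp_reduce[OF ainv_simps(5)[OF iso(4)], of j] by simp
    qed
  qed
  then show ?thesis unfolding pb_def using sq by simp
qed

lemma pb_uniq:
  assumes p: "pb g h p q" and p': "pb g h p' q'"
  obtains k where "iso_ar k" "adom k = adom p'" "acod k = adom p" "comp p k = p'" "comp q k = q'"
proof -
  note P = pbD[OF p] and P' = pbD[OF p']
  obtain k where k: "arr k" "adom k = adom p'" "acod k = adom p" "comp p k = p'" "comp q k = q'"
    by (rule pb_ex[OF p, of p' q']) (use P' in auto)
  obtain j where j: "arr j" "adom j = adom p" "acod j = adom p'" "comp p' j = p" "comp q' j = q"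
    by (rule pb_ex[OF p', of p q]) (use P in auto)
  have "comp k j = ide (adom p)"
    by (rule pb_eq[OF p]) (use P k j comp_reduce[OF k(4), of j] comp_reduce[OF k(5), of j] in simp_all)
  moreover have "comp j k = ide (adom p')"
    by (rule pb_eq[OF p']) (use P' k j comp_reduce[OF j(4), of k] comp_reduce[OF j(5), of k] in simp_all)
  ultimately have "iso_ar k" by (intro iso_arI[of k j]) (use k j in \<open>simp add: inverses_def\<close>)
  then show ?thesis using that k by blast
qed

section \<open>Monomorphisms\<close>

definition tmono where
  "tmono m \<longleftrightarrow> arr m \<and> (\<forall>g h. arr g \<and> arr h \<and> acod g = adom m \<and> acod h = adom m \<and> comp m g = comp m h \<longrightarrow> g = h)"

lemma tmonoD: "\<lbrakk>tmono m; arr g; arr h; acod g = adom m; acod h = adom m; comp m g = comp m h\<rbrakk> \<Longrightarrow> g = h"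
  unfolding tmono_def by blast

lemma tmono_arr: "tmono m \<Longrightarrow> arr m"
  unfolding tmono_def by blast

lemma tmonoI: "\<lbrakk>arr m; \<And>g h. \<lbrakk>arr g; arr h; acod g = adom m; acod h = adom m; comp m g = comp m h\<rbrakk> \<Longrightarrow> g = h\<rbrakk> \<Longrightarrow> tmono m"
  unfolding tmono_def by blast

text \<open>Being a monomorphism is a pullback condition, so it can be fed to whatever is known
  about pullbacks: flat base change and filtered colimits.\<close>

lemma tmono_pb: "tmono m \<longleftrightarrow> arr m \<and> pb m m (ide (adom m)) (ide (adom m))"
proof
  assume m: "tmono m"
  then have [simp]: "arr m" by (rule tmono_arr)
  have "\<exists>!k. arr k \<and> adom k = adom r \<and> acod k = adom m \<and> comp (ide (adom m)) k = r \<and> comp (ide (adom m)) k = s"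
    if "arr r" "arr s" "acod r = adom m" "acod s = adom m" "comp m r = comp m s" for r s
  proof (rule ex1I[of _ r])
    show "arr r \<and> adom r = adom r \<and> acod r = adom m \<and> comp (ide (adom m)) r = r \<and> comp (ide (adom m)) r = s"
      using tmonoD[OF m that] that by simp
  qed auto
  then show "arr m \<and> pb m m (ide (adom m)) (ide (adom m))" by (simp add: pb_def)
next
  assume m: "arr m \<and> pb m m (ide (adom m)) (ide (adom m))"
  then have p: "pb m m (ide (adom m)) (ide (adom m))" by simp
  have "g = h" if gh: "arr g" "arr h" "acod g = adom m" "acod h = adom m" "comp m g = comp m h" for g h
  proof -
    obtain k where "arr k" "acod k = adom m" "comp (ide (adom m)) k = g" "comp (ide (adom m)) k = h"
      by (rule pb_ex[OF p gh(1,2) _ _ gh(5)]) (use gh(3,4) in simp_all)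
    then show ?thesis by simp
  qed
  then show "tmono m" using m by (intro tmonoI) simp_all
qed

lemma tmono_of_comp: assumes fg: "tmono (comp f g)" shows "tmono g"
proof (rule tmonoI)
  have [simp]: "arr f" "arr g" "adom f = acod g" using tmono_arr[OF fg] by simp_all
  show "arr g" by simp
  fix h k assume "arr h" "arr k" "acod h = adom g" "acod k = adom g" "comp g h = comp g k"
  then show "h = k" by - (rule tmonoD[OF fg], simp_all)
qed

lemma tmono_pullback: assumes p: "pb g h p q" and g: "tmono g" shows "tmono q"
proof (rule tmonoI)
  note P = pbD[OF p]
  show "arr q" by (rule P)
  fix k k' assume k: "arr k" "arr k'" "acod k = adom q" "acod k' = adom q" "comp q k = comp q k'"
  have "comp g (comp p k) = comp g (comp p k')"
    using k(5) comp_reduce[OF P(9), of k] comp_reduce[OF P(9), of k'] by simp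
  then have "comp p k = comp p k'" by (rule tmonoD[OF g, rotated 4]) (use k(1-4) P(1-8) in simp_all)
  then show "k = k'" using k P(1-8) by - (rule pb_eq[OF p], simp_all)
qed

end

context geometry
begin

notation comp (infixr "\<bullet>" 70)
notation tns (infixr "**" 75)

lemma pb_exists:
  assumes "arr g" "arr h" "acod g = acod h"
  obtains p q where "pb g h p q"
proof -
  define x where "x = adom g"
  define y where "y = adom h"
  define z where "z = acod g"
  have g: "g = Ar x (aarr g) z" "x \<in> Ob C" "z \<in> Ob C" "aarr g \<in> Hom C x z"
    using arr_eta[of g] arr_Hom[of g] assms by (simp_all add: x_def z_def)
  have h: "h = Ar y (aarr h) z" "y \<in> Ob C" "aarr h \<in> Hom C y z"
    using arr_eta[of h] arr_Hom[of h] assms by (simp_all add: y_def z_def)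
  obtain a b c where abc: "a \<in> U" "b \<in> U" "c \<in> U" "a \<noteq> b" "a \<noteq> c" "b \<noteq> c" by (rule three_elements)
  have J: "small_cat U (cosp a b c)"
    using abc category_cosp[OF abc(4-6)] by (auto simp: small_cat_def small_finite) (auto simp: cosp_def small_finite split: if_splits)
  note F = is_functor_cosp[OF abc(4-6) g(2) h(2) g(3,4) h(3)]
  obtain l \<pi> where "is_limit C (cosp a b c) (cosp_ob a b x y z) (cosp_arr C a (aarr g) (aarr h) (cosp_ob a b x y z)) l \<pi>"
    using small_limits J F unfolding has_small_limits_def by blast
  then have "pb g h (Ar l (\<pi> a) x) (Ar l (\<pi> b) y)"
    unfolding is_limit_cosp[OF abc(4-6) F] using abc g h by (simp add: cosp_ob_def cosp_arr_def)
  then show ?thesis by (rule that)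
qed

section \<open>Pullbacks and monomorphisms of modules\<close>

lemma pb_lin:
  assumes X: "md A X" and Y: "md A Y" and L: "md A L" and M: "md A M" and p: "pb g h p q"
    and l: "lin A L X p" "lin A L Y q" and k: "arr k" "acod k = ucar L" "lin A M X (p \<bullet> k)" "lin A M Y (q \<bullet> k)"
  shows "lin A M L k"
proof -
  note P = pbD[OF p]
  note [simp] = md_simps[OF X] md_simps[OF Y] md_simps[OF L] md_simps[OF M] linD(1-3)[OF l(1)] linD(1-3)[OF l(2)] k(1,2)
  have [simp]: "adom k = ucar M" using linD(2)[OF k(3)] by simp
  have "k \<bullet> ac A M = ac A L \<bullet> (k ** ide (mcar A))"
  proof (rule pb_eq[OF p])
    show "p \<bullet> (k \<bullet> ac A M) = p \<bullet> (ac A L \<bullet> (k ** ide (mcar A)))"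
      using linD(4)[OF k(3)] comp_reduce[OF linD(4)[OF l(1)], of "k ** ide (mcar A)"] by simp
    show "q \<bullet> (k \<bullet> ac A M) = q \<bullet> (ac A L \<bullet> (k ** ide (mcar A)))"
      using linD(4)[OF k(4)] comp_reduce[OF linD(4)[OF l(2)], of "k ** ide (mcar A)"] by simp
  qed simp_all
  then show ?thesis by (simp add: lin_def)
qed

text \<open>The forgetful functor creates pullbacks: the action on the corner is induced, and each
  module axiom is checked after the two projections, for which \<open>r\<close> stands.\<close>

lemma pb_module:
  assumes X: "md A X" and Y: "md A Y" and Z: "md A Z" and g: "lin A X Z g" and h: "lin A Y Z h" and p: "pb g h p q"
  obtains L where "md A L" "ucar L = adom p" "lin A L X p" "lin A L Y q"
proof -
  note P = pbD[OF p]
  note [simp] = X Y Z md_simps[OF X] md_simps[OF Y] md_simps[OF Z] linD(1-3)[OF g] linD(1-3)[OF h]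
  have [simp]: "arr p" "arr q" "acod p = ucar X" "acod q = ucar Y" "adom q = adom p" using P by auto
  let ?a = "mcar A" and ?l = "adom p"
  have "g \<bullet> (ac A X \<bullet> (p ** ide ?a)) = h \<bullet> (ac A Y \<bullet> (q ** ide ?a))"
    using comp_reduce[OF linD(4)[OF g], of "p ** ide ?a"] comp_reduce[OF linD(4)[OF h], of "q ** ide ?a"] P(9) by simp
  then obtain \<alpha> where \<alpha>: "arr \<alpha>" "adom \<alpha> = ?l \<boxtimes> ?a" "acod \<alpha> = ?l" "p \<bullet> \<alpha> = ac A X \<bullet> (p ** ide ?a)" "q \<bullet> \<alpha> = ac A Y \<bullet> (q ** ide ?a)"
    by (rule pb_ex[OF p, rotated 4]) simp_all
  note [simp] = \<alpha>(1-3)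
  define L where "L = \<lparr>ucar = ?l, uact = aarr \<alpha>\<rparr>"
  have uL [simp]: "ucar L = ?l" by (simp add: L_def)
  have ac: "ac A L = \<alpha>" using arr_eta[OF \<alpha>(1)] by (simp add: L_def ac_def)
  have assoc: "r \<bullet> (\<alpha> \<bullet> (\<alpha> ** ide ?a)) = r \<bullet> (\<alpha> \<bullet> ((ide ?l ** mu A) \<bullet> as ?l ?a ?a))"
    and unit: "r \<bullet> (\<alpha> \<bullet> (ide ?l ** et A)) = r \<bullet> ru ?l"
    if M: "md A M" and r: "arr r" "adom r = ?l" "acod r = ucar M" "r \<bullet> \<alpha> = ac A M \<bullet> (r ** ide ?a)" for r M
  proof -
    note [simp] = M md_simps[OF M] r(1-3)
    have "r \<bullet> (\<alpha> \<bullet> (\<alpha> ** ide ?a)) = ac A M \<bullet> ((r \<bullet> \<alpha>) ** ide ?a)"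
      using comp_reduce[OF r(4), of "\<alpha> ** ide ?a"] by simp
    also have "\<dots> = (ac A M \<bullet> (ac A M ** ide ?a)) \<bullet> ((r ** ide ?a) ** ide ?a)" by (simp add: r(4))
    also have "\<dots> = ac A M \<bullet> ((ide (ucar M) ** mu A) \<bullet> (as (ucar M) ?a ?a \<bullet> ((r ** ide ?a) ** ide ?a)))"
      unfolding ac_assoc[OF M] by simp
    also have "\<dots> = ac A M \<bullet> ((ide (ucar M) ** mu A) \<bullet> ((r ** (ide ?a ** ide ?a)) \<bullet> as ?l ?a ?a))"
      by (subst as_natural) simp_all
    also have "\<dots> = (r \<bullet> \<alpha>) \<bullet> ((ide ?l ** mu A) \<bullet> as ?l ?a ?a)" by (simp add: comp_reduce[OF r(4)])
    finally show "r \<bullet> (\<alpha> \<bullet> (\<alpha> ** ide ?a)) = r \<bullet> (\<alpha> \<bullet> ((ide ?l ** mu A) \<bullet> as ?l ?a ?a))" by simp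
    have "r \<bullet> (\<alpha> \<bullet> (ide ?l ** et A)) = (ac A M \<bullet> (ide (ucar M) ** et A)) \<bullet> (r ** ide (tunit C))"
      using comp_reduce[OF r(4), of "ide ?l ** et A"] by (simp del: md_simps(5)[OF M])
    also have "\<dots> = r \<bullet> ru ?l" unfolding md_simps(5)[OF M] by (subst ru_natural) simp_all
    finally show "r \<bullet> (\<alpha> \<bullet> (ide ?l ** et A)) = r \<bullet> ru ?l" .
  qed
  have "\<alpha> \<bullet> (\<alpha> ** ide ?a) = \<alpha> \<bullet> ((ide ?l ** mu A) \<bullet> as ?l ?a ?a)"
    by (rule pb_eq[OF p]) (use assoc[OF X _ _ _ \<alpha>(4)] assoc[OF Y _ _ _ \<alpha>(5)] in simp_all)
  moreover have "\<alpha> \<bullet> (ide ?l ** et A) = ru ?l"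
    by (rule pb_eq[OF p]) (use unit[OF X _ _ _ \<alpha>(4)] unit[OF Y _ _ _ \<alpha>(5)] in simp_all)
  ultimately have "md A L" using ac unfolding md_def by (simp add: is_module_ar)
  moreover have "lin A L X p" "lin A L Y q" using \<alpha> ac by (simp_all add: lin_def)
  ultimately show ?thesis using that uL by blast
qed

lemma category_Mod: assumes A: "comm_mon C A" shows "category (Mod_cat C A)"
proof -
  have ob: "M \<in> Ob (Mod_cat C A) \<longleftrightarrow> md A M" for M using A by (simp add: Mod_cat_def md_def)
  have cmp: "cmp (Mod_cat C A) = cmp C" "idt (Mod_cat C A) M = idt C (ucar M)" for M by (simp_all add: Mod_cat_def)
  have H: "f \<in> Hom C (ucar M) (ucar N)" if "f \<in> Hom (Mod_cat C A) M N" for M N f using that by (simp add: Mod_cat_def)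
  show ?thesis
  proof (unfold_locales, unfold ob cmp)
    fix M assume M: "md A M"
    show "idt C (ucar M) \<in> Hom (Mod_cat C A) M M"
      using lin_ide[OF M] by (simp add: lin_Hom[OF M M] ide_def)
  next
    fix X Y Z f g assume m: "md A X" "md A Y" "md A Z" and f: "f \<in> Hom (Mod_cat C A) X Y" and g: "g \<in> Hom (Mod_cat C A) Y Z"
    note [simp] = md_simps(3)[OF m(1)] md_simps(3)[OF m(2)] md_simps(3)[OF m(3)] H[OF f] H[OF g]
    have "lin A X Z (Ar (ucar Y) g (ucar Z) \<bullet> Ar (ucar X) f (ucar Y))"
      using f g m by (intro lin_comp[of A X Y _ Z]) (simp_all add: lin_Hom)
    then show "g \<cdot> f \<in> Hom (Mod_cat C A) X Z" by (simp add: lin_Hom[OF m(1,3)])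
  qed (auto dest!: H md_simps(3) simp: idt_left idt_right cmp_assoc)
qed

lemma Ob_Mod: "comm_mon C A \<Longrightarrow> M \<in> Ob (Mod_cat C A) \<longleftrightarrow> md A M"
  by (simp add: Mod_cat_def md_def)

lemma cmp_Mod [simp]: "cmp (Mod_cat C A) = cmp C" "idt (Mod_cat C A) M = idt C (ucar M)"
  by (simp_all add: Mod_cat_def)

text \<open>The forgetful functor on tagged arrows, from modules to the ambient category.\<close>

definition fa where "fa t = Ar (ucar (adom t)) (aarr t) (ucar (acod t))"

lemma fa_simps [simp]: "fa (Ar M f N) = Ar (ucar M) f (ucar N)" by (simp add: fa_def)

lemma arr_Mod: assumes "comm_mon C A"
  shows "category.arr (Mod_cat C A) (Ar M f N) \<longleftrightarrow> md A M \<and> md A N \<and> lin A M N (Ar (ucar M) f (ucar N))"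
  using category.arr_Ar[OF category_Mod[OF assms]] lin_Hom by (auto simp: Ob_Mod[OF assms])

lemma Hom_lin: "lin A M N t \<Longrightarrow> md A M \<Longrightarrow> md A N \<Longrightarrow> aarr t \<in> Hom (Mod_cat C A) M N"
  using arr_eta[of t] linD[of A M N t] by (simp add: lin_Hom)

lemma Ar_aarr: "lin A M N t \<Longrightarrow> Ar (ucar M) (aarr t) (ucar N) = t"
  using arr_eta[of t] linD[of A M N t] by simp

lemma comp_Mod: assumes A: "comm_mon C A" and "category.arr (Mod_cat C A) (Ar N g P)" "category.arr (Mod_cat C A) (Ar M f N)"
  shows "category.comp (Mod_cat C A) (Ar N g P) (Ar M f N) = Ar M (g \<cdot> f) P"
  using category.comp_Ar[OF category_Mod[OF A]] assms by (simp add: category.arr_Ar[OF category_Mod[OF A]])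

text \<open>If the underlying square is a pullback, its factorizations are automatically linear.
  Conversely, a pullback of modules is compared with the one created on the underlying pullback, and
  the comparison map is an isomorphism.\<close>

lemma pb_Mod:
  assumes A: "comm_mon C A" and m: "md A X" "md A Y" "md A Z" "md A L"
    and g: "lin A X Z g" and h: "lin A Y Z h" and p: "lin A L X p" and q: "lin A L Y q"
  shows "category.pb (Mod_cat C A) (Ar X (aarr g) Z) (Ar Y (aarr h) Z) (Ar L (aarr p) X) (Ar L (aarr q) Y) \<longleftrightarrow> pb g h p q"
    (is "category.pb ?K ?g ?h ?p ?q \<longleftrightarrow> _")
proof
  interpret K: category ?K by (rule category_Mod[OF A])
  note G = linD[OF g] and H = linD[OF h] and P = linD[OF p] and Q = linD[OF q]
  note e = Ar_aarr[OF g] Ar_aarr[OF h] Ar_aarr[OF p] Ar_aarr[OF q]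
  have ar: "K.arr ?g" "K.arr ?h" "K.arr ?p" "K.arr ?q" using m g h p q e by (simp_all add: arr_Mod[OF A] del: K.arr_Ar)
  have cm: "K.comp (Ar N b R) (Ar M a N) = Ar M (b \<cdot> a) R" "Ar (ucar N) b (ucar R) \<bullet> Ar (ucar M) a (ucar N) = Ar (ucar M) (b \<cdot> a) (ucar R)"
    if "K.arr (Ar N b R)" "K.arr (Ar M a N)" for M N R a b
  proof -
    show "K.comp (Ar N b R) (Ar M a N) = Ar M (b \<cdot> a) R" by (rule comp_Mod[OF A that])
    show "Ar (ucar N) b (ucar R) \<bullet> Ar (ucar M) a (ucar N) = Ar (ucar M) (b \<cdot> a) (ucar R)"
      using that unfolding arr_Mod[OF A] by (intro comp_Ar) (auto dest: linD(1) md_simps(3))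
  qed
  {
    assume C: "pb g h p q"
    have "\<exists>!k. K.arr k \<and> adom k = adom r \<and> acod k = L \<and> K.comp ?p k = r \<and> K.comp ?q k = s"
      if r: "K.arr r" "K.arr s" "acod r = X" "acod s = Y" "K.comp ?g r = K.comp ?h s" for r s
    proof -
      have "K.arr (K.comp ?g r)" using r ar by simp
      then have "adom r = adom s" using r ar by (metis K.adom_comp K.arr_comp)
      then obtain M r' s' where rs: "r = Ar M r' X" "s = Ar M s' Y"
        using r K.arr_eta[of r] K.arr_eta[of s] by metis
      have a': "K.arr (Ar M r' X)" "K.arr (Ar M s' Y)" using r rs by auto
      then have M: "md A M" "lin A M X (fa r)" "lin A M Y (fa s)" unfolding arr_Mod[OF A] rs by auto
      have "g \<bullet> fa r = h \<bullet> fa s"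
        using r(5) unfolding rs cm(1)[OF ar(1) a'(1)] cm(1)[OF ar(2) a'(2)] using cm(2)[OF ar(1) a'(1)] cm(2)[OF ar(2) a'(2)] e by simp
      then obtain k where k: "arr k" "adom k = ucar M" "acod k = ucar L" "p \<bullet> k = fa r" "q \<bullet> k = fa s"
        by (rule pb_ex[OF C, rotated 4]) (use linD[OF M(2)] linD[OF M(3)] G H P Q in simp_all)
      have lk: "lin A M L k" by (rule pb_lin[OF m(1,2,4) M(1) C p q k(1,3)]) (use k M in simp_all)
      let ?k = "Ar M (aarr k) L"
      have ka: "K.arr ?k" using Ar_aarr[OF lk] lk m M by (simp add: arr_Mod[OF A] del: K.arr_Ar)
      show ?thesis
      proof (rule ex1I[of _ ?k])
        have "fa (K.comp ?p ?k) = fa r" "fa (K.comp ?q ?k) = fa s"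
          using cm[OF ar(3) ka] cm[OF ar(4) ka] Ar_aarr[OF lk] e k by simp_all
        then show "K.arr ?k \<and> adom ?k = adom r \<and> acod ?k = L \<and> K.comp ?p ?k = r \<and> K.comp ?q ?k = s"
          using ka cm(1)[OF ar(3) ka] cm(1)[OF ar(4) ka] rs by simp
        fix j assume j: "K.arr j \<and> adom j = adom r \<and> acod j = L \<and> K.comp ?p j = r \<and> K.comp ?q j = s"
        then have je: "j = Ar M (aarr j) L" using K.arr_eta[of j] rs by simp
        then have ja: "K.arr (Ar M (aarr j) L)" using j by metis
        have "p \<bullet> fa j = fa r" "q \<bullet> fa j = fa s"
          using cm[OF ar(3) ja] cm[OF ar(4) ja] j je e rs by (metis fa_simps)+
        moreover have lfj: "lin A M L (fa j)" using ja unfolding arr_Mod[OF A] using je by (metis fa_simps)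
        ultimately have "fa j = k" by - (rule pb_eq[OF C], use k linD[OF lfj] P Q in simp_all)
        then show "j = ?k" using je by (metis ar.sel(2) fa_def)
      qed
    qed
    moreover have "K.comp ?g ?p = K.comp ?h ?q"
      unfolding cm(1)[OF ar(1,3)] cm(1)[OF ar(2,4)] using cm(2)[OF ar(1,3)] cm(2)[OF ar(2,4)] pbD(9)[OF C] e by simp
    ultimately show "K.pb ?g ?h ?p ?q" unfolding K.pb_def using ar by simp
  }
  assume MP: "K.pb ?g ?h ?p ?q"
  obtain p0 q0 where c0: "pb g h p0 q0" by (rule pb_exists[OF G(1) H(1)]) (use G H in simp)
  obtain L0 where L0: "md A L0" "ucar L0 = adom p0" "lin A L0 X p0" "lin A L0 Y q0"
    by (rule pb_module[OF m(1-3) g h c0])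
  have gp: "g \<bullet> p = h \<bullet> q"
    using K.pbD(9)[OF MP] unfolding cm(1)[OF ar(1,3)] cm(1)[OF ar(2,4)] using cm(2)[OF ar(1,3)] cm(2)[OF ar(2,4)] e by simp
  obtain k where k: "arr k" "adom k = ucar L" "acod k = ucar L0" "p0 \<bullet> k = p" "q0 \<bullet> k = q"
    by (rule pb_ex[OF c0 _ _ _ _ gp]) (use G H P Q L0 in auto)
  have lk: "lin A L L0 k" by (rule pb_lin[OF m(1,2) L0(1) m(4) c0 L0(3,4) k(1,3)]) (use k p q in simp_all)
  note e0 = Ar_aarr[OF L0(3)] Ar_aarr[OF L0(4)]
  have ar0: "K.arr (Ar L0 (aarr p0) X)" "K.arr (Ar L0 (aarr q0) Y)"
    using L0 m e0 by (simp_all add: arr_Mod[OF A] del: K.arr_Ar)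
  have "K.comp ?g (Ar L0 (aarr p0) X) = K.comp ?h (Ar L0 (aarr q0) Y)"
    unfolding cm(1)[OF ar(1) ar0(1)] cm(1)[OF ar(2) ar0(2)] using cm(2)[OF ar(1) ar0(1)] cm(2)[OF ar(2) ar0(2)] e e0 pbD(9)[OF c0] by simp
  then obtain j where j: "K.arr j" "adom j = L0" "acod j = L" "K.comp ?p j = Ar L0 (aarr p0) X" "K.comp ?q j = Ar L0 (aarr q0) Y"
    by (rule K.pb_ex[OF MP, rotated 4]) (use ar0 in simp_all)
  then have je: "j = Ar L0 (aarr j) L" using K.arr_eta[of j] by simp
  then have ja: "K.arr (Ar L0 (aarr j) L)" using j by metis
  have lj: "lin A L0 L (fa j)" using ja unfolding arr_Mod[OF A] using je by (metis fa_simps)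
  have pj: "p \<bullet> fa j = p0" "q \<bullet> fa j = q0"
    using cm[OF ar(3) ja] cm[OF ar(4) ja] j je e e0 by (metis fa_simps)+
  have kj: "k \<bullet> fa j = ide (ucar L0)"
    by (rule pb_eq[OF c0]) (use k pj linD(1-3)[OF lj] md_simps(3)[OF L0(1)] comp_reduce[OF k(4), of "fa j"] comp_reduce[OF k(5), of "fa j"] linD(1-3)[OF L0(3)] linD(1-3)[OF L0(4)] in simp_all)
  have "fa j \<bullet> k = ide (ucar L)"
  proof -
    let ?t = "fa j \<bullet> k"
    have lt: "lin A L L ?t" by (rule lin_comp[OF lk lj m(4) L0(1) m(4)])
    have ta: "K.arr (Ar L (aarr ?t) L)" using lt Ar_aarr[OF lt] m by (simp add: arr_Mod[OF A] del: K.arr_Ar)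
    have "p \<bullet> ?t = p" "q \<bullet> ?t = q" using comp_reduce[OF pj(1), of k] comp_reduce[OF pj(2), of k] k by simp_all
    then have "K.comp ?p (Ar L (aarr ?t) L) = ?p" "K.comp ?q (Ar L (aarr ?t) L) = ?q"
      using cm[OF ar(3) ta] cm[OF ar(4) ta] Ar_aarr[OF lt] e by (metis ar.sel(2))+
    moreover have "K.comp ?p (K.ide L) = ?p" "K.comp ?q (K.ide L) = ?q" using ar by simp_all
    ultimately have "Ar L (aarr ?t) L = K.ide L" using ta m by - (rule K.pb_eq[OF MP], simp_all add: Ob_Mod[OF A] del: K.arr_Ar)
    then have "aarr ?t = idt C (ucar L)" by (simp add: K.ide_def)
    then show ?thesis using Ar_aarr[OF lt] by (simp add: ide_def)
  qed
  then have ij: "iso_ar (fa j)" using kj k(1-3) linD(1-3)[OF lj] by (intro iso_arI[of "fa j" k]) (simp add: inverses_def)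
  show "pb g h p q"
    by (rule pb_iso[OF c0, of "ide (ucar X)" "ide (ucar Y)" "ide (ucar Z)" "fa j"])
       (use G(1-3) H(1-3) P(1-3) Q(1-3) linD(1-3)[OF L0(3)] linD(1-3)[OF L0(4)] md_simps(3)[OF m(1)] md_simps(3)[OF m(2)]
          md_simps(3)[OF m(3)] pj linD(1-3)[OF lj] ij in simp_all)
qed

text \<open>The kernel pair \<open>p\<close>, \<open>q\<close> formed in \<open>C\<close> consists
  of linear maps, so a monomorphism of modules equates them; two arrows from any object that become
  equal factor through this pair.\<close>

lemma is_mono_Mod: assumes M: "md A M" and N: "md A N"
  shows "is_mono (Mod_cat C A) M N m \<longleftrightarrow> lin A M N (Ar (ucar M) m (ucar N)) \<and> tmono (Ar (ucar M) m (ucar N))"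
proof
  let ?m = "Ar (ucar M) m (ucar N)"
  have A: "comm_mon C A" using md_simps(1)[OF M] .
  note [simp] = md_simps(3)[OF M] md_simps(3)[OF N]
  assume L: "is_mono (Mod_cat C A) M N m"
  then have l: "lin A M N ?m" using lin_Hom[OF M N] by (simp add: is_mono_def)
  have [simp]: "m \<in> Hom C (ucar M) (ucar N)" using linD(1)[OF l] by simp
  obtain p q where pq: "pb ?m ?m p q" using pb_exists[of ?m ?m] by auto
  note P = pbD[OF pq]
  obtain L0 where L0: "md A L0" "ucar L0 = adom p" "lin A L0 M p" "lin A L0 M q"
    by (rule pb_module[OF M M N l l pq])
  have "aarr (?m \<bullet> p) = aarr (?m \<bullet> q)" by (simp only: P(9))
  then have "m \<cdot> aarr p = m \<cdot> aarr q" using P(3,4,6,7,8) by (simp add: aarr_comp)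
  then have "aarr p = aarr q" using L Hom_lin[OF L0(3) L0(1) M] Hom_lin[OF L0(4) L0(1) M] L0(1)
    unfolding is_mono_def by (auto simp: Ob_Mod[OF A])
  then have e: "p = q" using P by (intro ar_eqI) simp_all
  have "tmono ?m"
  proof (rule tmonoI)
    fix g h assume gh: "arr g" "arr h" "acod g = adom ?m" "acod h = adom ?m" "?m \<bullet> g = ?m \<bullet> h"
    obtain k where k: "p \<bullet> k = g" "q \<bullet> k = h"
      by (rule pb_ex[OF pq gh(1,2) _ _ gh(5)]) (use gh in simp_all)
    then show "g = h" using e by simp
  qed simp
  then show "lin A M N ?m \<and> tmono ?m" using l by simp
next
  let ?m = "Ar (ucar M) m (ucar N)"
  have A: "comm_mon C A" using md_simps(1)[OF M] .
  assume R: "lin A M N ?m \<and> tmono ?m"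
  have "g = h" if t: "T \<in> Ob (Mod_cat C A)" and g: "g \<in> Hom (Mod_cat C A) T M" and h: "h \<in> Hom (Mod_cat C A) T M" and e: "m \<cdot> g = m \<cdot> h" for T g h
  proof -
    have T: "md A T" using t Ob_Mod[OF A] by simp
    have a: "arr (Ar (ucar T) g (ucar M))" "arr (Ar (ucar T) h (ucar M))" "arr ?m"
      using g h lin_Hom[OF T M] linD(1) R by blast+
    have "?m \<bullet> Ar (ucar T) g (ucar M) = ?m \<bullet> Ar (ucar T) h (ucar M)" using a e by auto
    then have "Ar (ucar T) g (ucar M) = Ar (ucar T) h (ucar M)" using R a by - (rule tmonoD[of ?m], auto)
    then show ?thesis by simp
  qed
  then show "is_mono (Mod_cat C A) M N m" using R lin_Hom[OF M N] by (simp add: is_mono_def)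
qed

end

section \<open>Flatness\<close>

text \<open>Functors are total functions, so diagrams that agree only on the index category have to
  be identified explicitly.\<close>

lemma is_functor_cong:
  assumes J: "category J" and F: "is_functor J K Fo Fa" and o: "\<And>i. i \<in> Ob J \<Longrightarrow> Go i = Fo i"
    and a: "\<And>i j u. \<lbrakk>i \<in> Ob J; j \<in> Ob J; u \<in> Hom J i j\<rbrakk> \<Longrightarrow> Ga i j u = Fa i j u"
  shows "is_functor J K Go Ga"
proof -
  interpret J: category J by (rule J)
  show ?thesis unfolding is_functor_def
  proof (intro conjI ballI)
    fix i j k u v assume h: "i \<in> Ob J" "j \<in> Ob J" "k \<in> Ob J" "u \<in> Hom J i j" "v \<in> Hom J j k"
    have "v \<cdot>\<^bsub>J\<^esub> u \<in> Hom J i k" by (rule J.cmp_Hom[OF h])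
    then show "Ga i k (v \<cdot>\<^bsub>J\<^esub> u) = Ga j k v \<cdot>\<^bsub>K\<^esub> Ga i j u" using F h by (simp add: a is_functor_def)
  qed (use F J.idt_Hom in \<open>simp_all add: o a is_functor_def\<close>)
qed

context geometry
begin

notation comp (infixr "\<bullet>" 70)
notation tns (infixr "**" 75)

definition bca where
  "bca A B f M N h = Ar (ucar (bco A B f M)) (bc_arr C A B (aarr f) M N (aarr h)) (ucar (bco A B f N))"

text \<open>The \<open>THE\<close> in \<open>bc_arr\<close> asks for compatibility with the
  coequalizer projections, whereas the second conclusion asks for it with the units. The two agree
  because linear maps out of a free module are determined on generators.\<close>

lemma bca:
  assumes f: "mh A B f" and M: "md A M" and N: "md A N" and h: "lin A M N h"
  shows "lin B (bco A B f M) (bco A B f N) (bca A B f M N h)"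
    "bca A B f M N h \<bullet> bcu A B f M = bcu A B f N \<bullet> h"
proof -
  let ?bM = "bco A B f M" and ?bN = "bco A B f N" and ?qM = "bcq A B f M" and ?qN = "bcq A B f N" and ?b = "mcar B"
  note uM = univ_bc[OF f M] and uN = univ_bc[OF f N]
  note UM = univD[OF uM] and UN = univD[OF uN]
  note qM = bc_coeq[OF f M] and mM = bc_module[OF f M] and mN = bc_module[OF f N]
  note lM = linD(1-3)[OF mM(2)] and lN = linD(1-3)[OF mN(2)]
  note [simp] = mh_simps[OF f] M N md_simps[OF M] md_simps[OF N] UM UN linD(1-3)[OF h]
    md_simps(3)[OF UM(3)] md_simps(3)[OF UN(3)]
  note [simp] = lM[simplified] lN[simplified]
  have "lin A M (rm f ?bN) (bcu A B f N \<bullet> h)"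
    by (rule lin_comp[OF h UN(4)]) (simp_all add: md_rm[OF f])
  then obtain k where k: "lin B ?bM ?bN k" "k \<bullet> bcu A B f M = bcu A B f N \<bullet> h"
    using univ_ex[OF uM UN(3)] by metis
  note [simp] = linD(1-3)[OF k(1)]
  have l1: "lin B (tm B (ucar M) (self_mdl B)) ?bN (k \<bullet> ?qM)" by (rule lin_comp[OF mM(2) k(1)]) simp_all
  have "lin B (tm B (ucar M) (self_mdl B)) (tm B (ucar N) (self_mdl B)) (h ** ide ?b)"
    using lin_tm_left[of h B "self_mdl B"] by simp
  from lin_comp[OF this mN(2)] have l2: "lin B (tm B (ucar M) (self_mdl B)) ?bN (?qN \<bullet> (h ** ide ?b))" by simp
  let ?e = "(ide (ucar M) ** et B) \<bullet> ru' (ucar M)"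
  have "(?qN \<bullet> (h ** ide ?b)) \<bullet> ?e = ?qN \<bullet> ((ide (ucar N) ** et B) \<bullet> ((h ** ide (tunit C)) \<bullet> ru' (ucar M)))" by simp
  also have "\<dots> = bcu A B f N \<bullet> h" using ru'_natural[of h "ucar M"] by (simp add: bcu_def)
  also have "\<dots> = (k \<bullet> ?qM) \<bullet> ?e" using k(2) by (simp add: bcu_def)
  finally have e: "(?qN \<bullet> (h ** ide ?b)) \<bullet> ?e = (k \<bullet> ?qM) \<bullet> ?e" .
  have kq: "k \<bullet> ?qM = ?qN \<bullet> (h ** ide ?b)"
    using lin_free_eq[OF mh_simps(2)[OF f] md_simps(3)[OF M] UN(3) l1]
      lin_free_eq[OF mh_simps(2)[OF f] md_simps(3)[OF M] UN(3) l2] e by metis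
  have char: "(k' \<in> Hom C (ucar ?bM) (ucar ?bN) \<and>
      k' \<cdot> bc_proj C A B (aarr f) M = bc_proj C A B (aarr f) N \<cdot> (aarr h \<boxdot> idt C ?b)) \<longleftrightarrow> k' = aarr k" for k'
  proof
    assume P: "k' \<in> Hom C (ucar ?bM) (ucar ?bN) \<and>
      k' \<cdot> bc_proj C A B (aarr f) M = bc_proj C A B (aarr f) N \<cdot> (aarr h \<boxdot> idt C ?b)"
    let ?k = "Ar (ucar ?bM) k' (ucar ?bN)"
    have a: "arr ?k" using P by simp
    have "?k \<bullet> ?qM = ?qN \<bullet> (h ** ide ?b)"
      using P a by (intro ar_eqI) (simp_all add: aarr_comp aarr_tns aarr_structure bcq_def[THEN arg_cong[where f=aarr], simplified] del: arr_Ar)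
    then have "?k = k" using kq a by - (rule coeq_epi[OF qM], simp_all add: mM(3)[symmetric] del: arr_Ar)
    then show "k' = aarr k" by auto
  next
    assume [simp]: "k' = aarr k"
    have "aarr (k \<bullet> ?qM) = aarr (?qN \<bullet> (h ** ide ?b))" by (simp only: kq)
    then show "k' \<in> Hom C (ucar ?bM) (ucar ?bN) \<and>
      k' \<cdot> bc_proj C A B (aarr f) M = bc_proj C A B (aarr f) N \<cdot> (aarr h \<boxdot> idt C ?b)"
      using arr_Hom[of k] by (simp add: aarr_comp aarr_tns aarr_structure bcq_def[THEN arg_cong[where f=aarr], simplified])
  qed
  have "bc_arr C A B (aarr f) M N (aarr h) = aarr k" unfolding bc_arr_def char by simp
  then have "bca A B f M N h = k" unfolding bca_def using arr_eta[of k] by simp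
  then show "lin B ?bM ?bN (bca A B f M N h)" "bca A B f M N h \<bullet> bcu A B f M = bcu A B f N \<bullet> h"
    using k by auto
qed

lemma bca_comp:
  assumes f: "mh A B f" and m: "md A M" "md A N" "md A P" and h: "lin A M N h" "lin A N P k"
  shows "bca A B f M P (k \<bullet> h) = bca A B f N P k \<bullet> bca A B f M N h"
proof (rule univ_eq[OF univ_bc[OF f m(1)]])
  note u = univ_bc[OF f m(1)] univ_bc[OF f m(2)] univ_bc[OF f m(3)]
  note b1 = bca[OF f m(1,2) h(1)] and b2 = bca[OF f m(2,3) h(2)] and b3 = bca[OF f m(1,3) lin_comp[OF h m]]
  show "md B (bco A B f P)" by (rule univD(3)[OF u(3)])
  show "lin B (bco A B f M) (bco A B f P) (bca A B f M P (k \<bullet> h))" by (rule b3)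
  show "lin B (bco A B f M) (bco A B f P) (bca A B f N P k \<bullet> bca A B f M N h)"
    by (rule lin_comp[OF b1(1) b2(1)]) (use univD(3)[OF u(1)] univD(3)[OF u(2)] univD(3)[OF u(3)] in simp_all)
  show "bca A B f M P (k \<bullet> h) \<bullet> bcu A B f M = (bca A B f N P k \<bullet> bca A B f M N h) \<bullet> bcu A B f M"
    using b3(2) b1(2) comp_reduce[OF b2(2), of h] by simp
qed

lemma bca_ide: assumes f: "mh A B f" and M: "md A M" shows "bca A B f M M (ide (ucar M)) = ide (ucar (bco A B f M))"
proof (rule univ_eq[OF univ_bc[OF f M] univD(3)[OF univ_bc[OF f M]]])
  note b = bca[OF f M M lin_ide[OF M]] and uM = univ_bc[OF f M]
  show "lin B (bco A B f M) (bco A B f M) (bca A B f M M (ide (ucar M)))" by (rule b)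
  show "lin B (bco A B f M) (bco A B f M) (ide (ucar (bco A B f M)))" by (rule lin_ide[OF univD(3)[OF uM]])
  show "bca A B f M M (ide (ucar M)) \<bullet> bcu A B f M = ide (ucar (bco A B f M)) \<bullet> bcu A B f M"
    using b univD[OF uM] by simp
qed

subsection \<open>Systems of modules\<close>

text \<open>A functor to the module category, with transition maps tagged by the underlying objects
  so that they can be composed in \<open>C\<close>.\<close>

definition msys where
  "msys A J Fo T \<longleftrightarrow> (\<forall>i\<in>Ob J. md A (Fo i)) \<and>
    (\<forall>i\<in>Ob J. \<forall>j\<in>Ob J. \<forall>u\<in>Hom J i j. lin A (Fo i) (Fo j) (T i j u)) \<and>
    (\<forall>i\<in>Ob J. T i i (idt J i) = ide (ucar (Fo i))) \<and>
    (\<forall>i\<in>Ob J. \<forall>j\<in>Ob J. \<forall>k\<in>Ob J. \<forall>u\<in>Hom J i j. \<forall>v\<in>Hom J j k.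
       T i k (v \<cdot>\<^bsub>J\<^esub> u) = T j k v \<bullet> T i j u)"

lemma msysD: assumes "msys A J Fo T"
  shows "i \<in> Ob J \<Longrightarrow> md A (Fo i)"
    "\<lbrakk>i \<in> Ob J; j \<in> Ob J; w \<in> Hom J i j\<rbrakk> \<Longrightarrow> lin A (Fo i) (Fo j) (T i j w)"
    "i \<in> Ob J \<Longrightarrow> T i i (idt J i) = ide (ucar (Fo i))"
    "\<lbrakk>i \<in> Ob J; j \<in> Ob J; k \<in> Ob J; w \<in> Hom J i j; v \<in> Hom J j k\<rbrakk> \<Longrightarrow> T i k (v \<cdot>\<^bsub>J\<^esub> w) = T j k v \<bullet> T i j w"
  using assms unfolding msys_def by blast+

lemma msys_functor: assumes A: "comm_mon C A" and s: "msys A J Fo T"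
  shows "is_functor J (Mod_cat C A) Fo (\<lambda>i j u. aarr (T i j u))"
proof -
  note d = msysD[OF s]
  have "aarr (T j k v \<bullet> T i j w) = aarr (T j k v) \<cdot> aarr (T i j w)"
    if "i \<in> Ob J" "j \<in> Ob J" "k \<in> Ob J" "w \<in> Hom J i j" "v \<in> Hom J j k" for i j k w v
    using linD[OF d(2)[OF that(1,2,4)]] linD[OF d(2)[OF that(2,3,5)]] by (intro aarr_comp) simp_all
  then show ?thesis unfolding is_functor_def using d
    by (auto simp: Ob_Mod[OF A] aarr_structure intro!: Hom_lin)
qed

lemma functor_msys: assumes A: "comm_mon C A" and F: "is_functor J (Mod_cat C A) Fo Fa"
  shows "msys A J Fo (\<lambda>i j u. Ar (ucar (Fo i)) (Fa i j u) (ucar (Fo j)))"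
proof -
  have m: "md A (Fo i)" if "i \<in> Ob J" for i using F that by (auto simp: is_functor_def Ob_Mod[OF A])
  have l: "lin A (Fo i) (Fo j) (Ar (ucar (Fo i)) (Fa i j w) (ucar (Fo j)))" if "i \<in> Ob J" "j \<in> Ob J" "w \<in> Hom J i j" for i j w
    using F that lin_Hom[OF m[OF that(1)] m[OF that(2)]] unfolding is_functor_def by blast
  have "Ar (ucar (Fo i)) (Fa i k (v \<cdot>\<^bsub>J\<^esub> w)) (ucar (Fo k)) =
      Ar (ucar (Fo j)) (Fa j k v) (ucar (Fo k)) \<bullet> Ar (ucar (Fo i)) (Fa i j w) (ucar (Fo j))"
    if "i \<in> Ob J" "j \<in> Ob J" "k \<in> Ob J" "w \<in> Hom J i j" "v \<in> Hom J j k" for i j k w v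
    using linD(1)[OF l[OF that(1,2,4)]] linD(1)[OF l[OF that(2,3,5)]] F that by (simp add: is_functor_def)
  then show ?thesis unfolding msys_def using m l F by (auto simp: is_functor_def ide_def)
qed

definition cosp_ar where
  "cosp_ar a g h Fo i j = (if i = j then ide (ucar (Fo i)) else if i = a then g else h)"

lemma msys_cosp:
  assumes "a \<noteq> b" "a \<noteq> c" "b \<noteq> c" "md A X" "md A Y" "md A Z" "lin A X Z g" "lin A Y Z h"
  shows "msys A (cosp a b c) (cosp_ob a b X Y Z) (\<lambda>i j u. cosp_ar a g h (cosp_ob a b X Y Z) i j)"
  using assms linD(1-3)[OF assms(7)] linD(1-3)[OF assms(8)] lin_ide md_simps(3)
  unfolding msys_def by (auto simp: cosp_def cosp_ob_def cosp_ar_def split: if_splits)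

lemma is_limit_Mod_cosp:
  assumes abc: "a \<noteq> b" "a \<noteq> c" "b \<noteq> c" and m: "md A X" "md A Y" "md A Z" "md A L"
    and l: "lin A X Z g" "lin A Y Z h" "lin A L X p" "lin A L Y q"
    and Fo: "Fo a = X" "Fo b = Y" "Fo c = Z" and Fa: "Fa a c c = aarr g" "Fa b c c = aarr h"
    and F: "is_functor (cosp a b c) (Mod_cat C A) Fo Fa"
    and \<pi>: "\<pi> a = aarr p" "\<pi> b = aarr q"
  shows "is_limit (Mod_cat C A) (cosp a b c) Fo Fa L \<pi> \<longleftrightarrow> pb g h p q \<and> \<pi> c = aarr g \<cdot> aarr p"
  using category.is_limit_cosp[OF category_Mod[OF md_simps(1)[OF m(1)]] abc F, of L \<pi>] pb_Mod[OF md_simps(1)[OF m(1)] m l]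
  by (simp add: Fo Fa \<pi>)

text \<open>Preservation of pullbacks by flat base change, stated for arbitrary universal arrows in place of
  the chosen tensor products.\<close>

definition flatU where
  "flatU A B f \<longleftrightarrow> mh A B f \<and> (\<forall>X Y Z L g h p q X' Y' Z' L' uX uY uZ uL g' h' p' q'.
    md A X \<and> md A Y \<and> md A Z \<and> md A L \<and> lin A X Z g \<and> lin A Y Z h \<and> lin A L X p \<and> lin A L Y q \<and> pb g h p q \<and>
    univ A B f X X' uX \<and> univ A B f Y Y' uY \<and> univ A B f Z Z' uZ \<and> univ A B f L L' uL \<and>
    lin B X' Z' g' \<and> lin B Y' Z' h' \<and> lin B L' X' p' \<and> lin B L' Y' q' \<and>
    g' \<bullet> uX = uZ \<bullet> g \<and> h' \<bullet> uY = uZ \<bullet> h \<and> p' \<bullet> uL = uX \<bullet> p \<and> q' \<bullet> uL = uY \<bullet> q \<longrightarrow> pb g' h' p' q')"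

lemma flatUD:
  assumes "flatU A B f" "md A X" "md A Y" "md A Z" "md A L" "lin A X Z g" "lin A Y Z h" "lin A L X p" "lin A L Y q"
    "pb g h p q" "univ A B f X X' uX" "univ A B f Y Y' uY" "univ A B f Z Z' uZ" "univ A B f L L' uL"
    "lin B X' Z' g'" "lin B Y' Z' h'" "lin B L' X' p'" "lin B L' Y' q'"
    "g' \<bullet> uX = uZ \<bullet> g" "h' \<bullet> uY = uZ \<bullet> h" "p' \<bullet> uL = uX \<bullet> p" "q' \<bullet> uL = uY \<bullet> q"
  shows "pb g' h' p' q'"
  using assms unfolding flatU_def by blast

text \<open>Flatness applied to the shape \<open>cosp\<close> gives a pullback of the chosen base
  changes, which the isomorphisms between universal arrows carry to the given ones.\<close>

lemma flat_flatU:
  assumes f: "mh A B f" and fl: "flat C A B (aarr f)"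
  shows "flatU A B f"
  unfolding flatU_def
proof (intro conjI f allI impI, elim conjE)
  fix X Y Z L g h p q X' Y' Z' L' uX uY uZ uL g' h' p' q'
  assume m: "md A X" "md A Y" "md A Z" "md A L" and l: "lin A X Z g" "lin A Y Z h" "lin A L X p" "lin A L Y q"
    and p: "pb g h p q" and u: "univ A B f X X' uX" "univ A B f Y Y' uY" "univ A B f Z Z' uZ" "univ A B f L L' uL"
    and l': "lin B X' Z' g'" "lin B Y' Z' h'" "lin B L' X' p'" "lin B L' Y' q'"
    and e: "g' \<bullet> uX = uZ \<bullet> g" "h' \<bullet> uY = uZ \<bullet> h" "p' \<bullet> uL = uX \<bullet> p" "q' \<bullet> uL = uY \<bullet> q"
  let ?J = "cosp 0 1 (2::nat)"
  let ?Fo = "cosp_ob 0 (1::nat) X Y Z"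
  let ?FT = "\<lambda>i j u. cosp_ar 0 g h ?Fo i j"
  let ?\<pi> = "\<lambda>i. if i = 0 then aarr p else if i = (1::nat) then aarr q else aarr g \<cdot> aarr p"
  have abc: "(0::nat) \<noteq> 1" "(0::nat) \<noteq> 2" "(1::nat) \<noteq> 2" by auto
  have A: "comm_mon C A" using m md_simps by blast
  have J: "finite_cat ?J" using category_cosp[OF abc] by (auto simp: finite_cat_def) (auto simp: cosp_def split: if_splits)
  note F = msys_functor[OF A msys_cosp[OF abc m(1-3) l(1,2)]]
  have FF: "?Fo 0 = X" "?Fo 1 = Y" "?Fo 2 = Z" by (auto simp: cosp_ob_def)
  have FTs: "aarr (?FT 0 2 2) = aarr g" "aarr (?FT 1 2 2) = aarr h" by (auto simp: cosp_ar_def)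
  have "is_limit (Mod_cat C A) ?J ?Fo (\<lambda>i j u. aarr (?FT i j u)) L ?\<pi>"
    by (subst is_limit_Mod_cosp[OF abc m l FF FTs F]) (simp_all add: p)
  then have lim: "is_limit (Mod_cat C B) ?J (\<lambda>i. bco A B f (?Fo i)) (\<lambda>i j u. bc_arr C A B (aarr f) (?Fo i) (?Fo j) (aarr (?FT i j u)))
        (bco A B f L) (\<lambda>i. bc_arr C A B (aarr f) L (?Fo i) (?\<pi> i))"
    using fl J F unfolding flat_def by blast
  note bu = univ_bc[OF f m(1)] univ_bc[OF f m(2)] univ_bc[OF f m(3)] univ_bc[OF f m(4)]
  note bm = univD(3)[OF bu(1)] univD(3)[OF bu(2)] univD(3)[OF bu(3)] univD(3)[OF bu(4)]
  note b1 = bca[OF f m(1) m(3) l(1)] and b2 = bca[OF f m(2) m(3) l(2)] and b3 = bca[OF f m(4) m(1) l(3)] and b4 = bca[OF f m(4) m(2) l(4)]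
  have bide: "aarr (bca A B f M M (ide (ucar M))) = idt C (ucar (bco A B f M))" if M: "md A M" for M
    using bca_ide[OF f M] by (simp add: aarr_structure)
  have bcar: "bc_arr C A B (aarr f) M N (aarr k) = aarr (bca A B f M N k)" for M N k by (simp add: bca_def)
  have fnc: "is_functor ?J (Mod_cat C B) (\<lambda>i. bco A B f (?Fo i)) (\<lambda>i j u. bc_arr C A B (aarr f) (?Fo i) (?Fo j) (aarr (?FT i j u)))"
  proof -
    let ?g = "bca A B f X Z g" and ?h = "bca A B f Y Z h"
    let ?Go = "cosp_ob 0 (1::nat) (bco A B f X) (bco A B f Y) (bco A B f Z)"
    have G: "is_functor ?J (Mod_cat C B) ?Go (\<lambda>i j u. aarr (cosp_ar 0 ?g ?h ?Go i j))"
      by (rule msys_functor[OF mh_simps(2)[OF f] msys_cosp[OF abc bm(1-3) b1(1) b2(1)]])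
    have "?Go i = bco A B f (?Fo i)" for i by (simp add: cosp_ob_def)
    moreover have "aarr (cosp_ar 0 ?g ?h ?Go i j) = bc_arr C A B (aarr f) (?Fo i) (?Fo j) (aarr (?FT i j u))"
      if "i \<in> Ob ?J" "j \<in> Ob ?J" "u \<in> Hom ?J i j" for i j u
      using that bide[OF m(1)] bide[OF m(2)] bide[OF m(3)] unfolding bcar
      by (auto simp: cosp_def cosp_ob_def cosp_ar_def aarr_structure split: if_splits)
    ultimately show ?thesis
      by - (rule is_functor_cong[OF category_cosp[OF abc] G], simp_all only:)
  qed
  have pb0: "pb (bca A B f X Z g) (bca A B f Y Z h) (bca A B f L X p) (bca A B f L Y q)"
    using lim by (subst (asm) is_limit_Mod_cosp[OF abc bm b1(1) b2(1) b3(1) b4(1)])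
       (use fnc in \<open>simp_all add: FF FTs bcar del: One_nat_def\<close>)
  obtain a where a: "lin B (bco A B f X) X' a" "iso_ar a" "a \<bullet> bcu A B f X = uX" by (rule univ_iso_ex[OF bu(1) u(1)])
  obtain b where b: "lin B (bco A B f Y) Y' b" "iso_ar b" "b \<bullet> bcu A B f Y = uY" by (rule univ_iso_ex[OF bu(2) u(2)])
  obtain c where c: "lin B (bco A B f Z) Z' c" "iso_ar c" "c \<bullet> bcu A B f Z = uZ" by (rule univ_iso_ex[OF bu(3) u(3)])
  obtain k where k: "lin B (bco A B f L) L' k" "iso_ar k" "k \<bullet> bcu A B f L = uL" by (rule univ_iso_ex[OF bu(4) u(4)])
  \<comment> \<open>Naturality of these isomorphisms, from uniqueness in the universal
    property.\<close>
  have tr: "g' \<bullet> a = c \<bullet> bca A B f M N g"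
    if M: "md A M" and N: "md A N" and uM: "univ A B f M M' uM" and uN: "univ A B f N N' uN" and g: "lin A M N g" and g': "lin B M' N' g'"
      and a: "lin B (bco A B f M) M' a" "a \<bullet> bcu A B f M = uM" and c: "lin B (bco A B f N) N' c" "c \<bullet> bcu A B f N = uN"
      and e: "g' \<bullet> uM = uN \<bullet> g" for M N M' N' uM uN g g' a c
  proof (rule univ_eq[OF univ_bc[OF f M] univD(3)[OF uN]])
    note bm = univD(3)[OF univ_bc[OF f M]] univD(3)[OF univ_bc[OF f N]]
    note bb = bca[OF f M N g]
    show "lin B (bco A B f M) N' (g' \<bullet> a)" by (rule lin_comp[OF a(1) g']) (use bm univD(3)[OF uM] univD(3)[OF uN] in auto)
    show "lin B (bco A B f M) N' (c \<bullet> bca A B f M N g)" by (rule lin_comp[OF bb(1) c(1)]) (use bm univD(3)[OF uN] in auto)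
    show "(g' \<bullet> a) \<bullet> bcu A B f M = (c \<bullet> bca A B f M N g) \<bullet> bcu A B f M"
      using e a(2) bb(2) comp_reduce[OF c(2), of g] by simp
  qed
  show "pb g' h' p' q'"
    by (rule pb_iso[OF pb0 a(2) b(2) c(2) k(2)])
      (use tr[OF m(1,3) u(1,3) l(1) l'(1) a(1,3) c(1,3) e(1)] tr[OF m(2,3) u(2,3) l(2) l'(2) b(1,3) c(1,3) e(2)]
         tr[OF m(4,1) u(4,1) l(3) l'(3) k(1,3) a(1,3) e(3)] tr[OF m(4,2) u(4,2) l(4) l'(4) k(1,3) b(1,3) e(4)]
         linD(1-3)[OF a(1)] linD(1-3)[OF b(1)] linD(1-3)[OF c(1)] linD(1-3)[OF k(1)]
         linD(1-3)[OF l'(1)] linD(1-3)[OF l'(2)] linD(1-3)[OF l'(3)] linD(1-3)[OF l'(4)]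
         linD(1-3)[OF b1(1)] linD(1-3)[OF b2(1)] linD(1-3)[OF b3(1)] linD(1-3)[OF b4(1)] in simp_all)
qed

text \<open>\<open>pushout_univ\<close> yields one base change with this property; every other
  differs from it by an isomorphism.\<close>

lemma pushout_univ_any:
  assumes po: "pushout D E F d f P u v" and w: "univ E P u N Q w"
  shows "univ D F f (rm d N) (rm v Q) w"
proof -
  note p = pushoutD[OF po] and W = univD[OF w]
  obtain Q0 w0 where Q0: "univ E P u N Q0 w0" "univ D F f (rm d N) (rm v Q0) w0" by (rule pushout_univ[OF po W(2)])
  obtain k where k: "lin P Q0 Q k" "iso_ar k" "k \<bullet> w0 = w" by (rule univ_iso_ex[OF Q0(1) w])
  have "lin F (rm v Q0) (rm v Q) k" by (rule lin_rm[OF p(4) univD(3)[OF Q0(1)] W(3) k(1)])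
  from univ_iso[OF Q0(2) this k(2) md_rm[OF p(4) W(3)]] show ?thesis by (simp add: k(3))
qed

text \<open>Restricted along \<open>d\<close> and \<open>v\<close>, universal arrows over
  \<open>u\<close> become universal arrows over \<open>f\<close>, and being a pullback concerns only
  the underlying arrows. So flatness of \<open>f\<close> applies as it stands.\<close>

lemma flatU_pushout:
  assumes po: "pushout D E F d f P u v" and fl: "flatU D F f"
  shows "flatU E P u"
  unfolding flatU_def
proof (intro conjI pushoutD(3)[OF po] allI impI, elim conjE)
  note p = pushoutD[OF po]
  fix X Y Z L g h pp q X' Y' Z' L' uX uY uZ uL g' h' p' q'
  assume m: "md E X" "md E Y" "md E Z" "md E L" and l: "lin E X Z g" "lin E Y Z h" "lin E L X pp" "lin E L Y q"
    and pb: "pb g h pp q" and w: "univ E P u X X' uX" "univ E P u Y Y' uY" "univ E P u Z Z' uZ" "univ E P u L L' uL"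
    and l': "lin P X' Z' g'" "lin P Y' Z' h'" "lin P L' X' p'" "lin P L' Y' q'"
    and e: "g' \<bullet> uX = uZ \<bullet> g" "h' \<bullet> uY = uZ \<bullet> h" "p' \<bullet> uL = uX \<bullet> pp" "q' \<bullet> uL = uY \<bullet> q"
  note R = md_rm[OF p(1)] and S = lin_rm[OF p(1)] and V = lin_rm[OF p(4)] and m' = w[THEN univD(3)] and PU = pushout_univ_any[OF po]
  show "pb g' h' p' q'"
    by (rule flatUD[OF fl R[OF m(1)] R[OF m(2)] R[OF m(3)] R[OF m(4)] S[OF m(1,3) l(1)] S[OF m(2,3) l(2)] S[OF m(4,1) l(3)] S[OF m(4,2) l(4)] pb
       PU[OF w(1)] PU[OF w(2)] PU[OF w(3)] PU[OF w(4)] V[OF m'(1,3) l'(1)] V[OF m'(2,3) l'(2)] V[OF m'(4,1) l'(3)] V[OF m'(4,2) l'(4)] e])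
qed

lemma flatU_mono:
  assumes fl: "flatU A B f" and u: "univ A B f X X' uX" "univ A B f Z Z' uZ" and g: "lin A X Z g" "tmono g"
    and g': "lin B X' Z' g'" "g' \<bullet> uX = uZ \<bullet> g"
  shows "tmono g'"
proof -
  note X = univD[OF u(1)] and Z = univD[OF u(2)]
  have "pb g g (ide (ucar X)) (ide (ucar X))" using g linD[OF g(1)] by (simp add: tmono_pb)
  then have "pb g' g' (ide (ucar X')) (ide (ucar X'))"
    by (rule flatUD[OF fl X(2) X(2) Z(2) X(2) g(1) g(1) lin_ide[OF X(2)] lin_ide[OF X(2)] _ u(1) u(1) u(2) u(1) g'(1) g'(1)
        lin_ide[OF X(3)] lin_ide[OF X(3)] g'(2) g'(2)]) (use X in simp_all)
  then show ?thesis using linD[OF g'(1)] by (simp add: tmono_pb)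
qed

end

section \<open>Colimits of modules\<close>

context category
begin

definition coc where
  "coc J X T l c \<longleftrightarrow> l \<in> Ob K \<and> (\<forall>i\<in>Ob J. arr (c i) \<and> adom (c i) = X i \<and> acod (c i) = l) \<and>
    (\<forall>i\<in>Ob J. \<forall>j\<in>Ob J. \<forall>u\<in>Hom J i j. comp (c j) (T i j u) = c i)"

text \<open>Existence and uniqueness of factorizations are kept apart, since uniqueness is often
  used alone, to compare arrows out of a colimit.\<close>

definition colim where
  "colim J X T l c \<longleftrightarrow> coc J X T l c \<and>
    (\<forall>m d. coc J X T m d \<longrightarrow> (\<exists>h. arr h \<and> adom h = l \<and> acod h = m \<and> (\<forall>i\<in>Ob J. comp h (c i) = d i))) \<and>
    (\<forall>h h'. arr h \<and> arr h' \<and> adom h = l \<and> adom h' = l \<and> acod h = acod h' \<and>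
       (\<forall>i\<in>Ob J. comp h (c i) = comp h' (c i)) \<longrightarrow> h = h')"

lemma cocD: assumes "coc J X T l c"
  shows "l \<in> Ob K" "i \<in> Ob J \<Longrightarrow> arr (c i)" "i \<in> Ob J \<Longrightarrow> adom (c i) = X i" "i \<in> Ob J \<Longrightarrow> acod (c i) = l"
    "\<lbrakk>i \<in> Ob J; j \<in> Ob J; u \<in> Hom J i j\<rbrakk> \<Longrightarrow> comp (c j) (T i j u) = c i"
  using assms unfolding coc_def by blast+

lemma colim_coc: "colim J X T l c \<Longrightarrow> coc J X T l c"
  by (simp only: colim_def)

lemma colim_ex: assumes "colim J X T l c" "coc J X T m d"
  obtains h where "arr h" "adom h = l" "acod h = m" "\<forall>i\<in>Ob J. comp h (c i) = d i"
  using assms unfolding colim_def by blast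

lemma colim_eq: assumes "colim J X T l c" "arr h" "arr h'" "adom h = l" "adom h' = l" "acod h = acod h'"
    "\<And>i. i \<in> Ob J \<Longrightarrow> comp h (c i) = comp h' (c i)"
  shows "h = h'"
  using assms unfolding colim_def by blast

lemma coc_cong:
  assumes "\<And>i. i \<in> Ob J \<Longrightarrow> X i = X' i" "\<And>i j u. \<lbrakk>i \<in> Ob J; j \<in> Ob J; u \<in> Hom J i j\<rbrakk> \<Longrightarrow> T i j u = T' i j u"
    "\<And>i. i \<in> Ob J \<Longrightarrow> c i = c' i"
  shows "coc J X T l c \<longleftrightarrow> coc J X' T' l c'"
  unfolding coc_def using assms by (simp cong: ball_cong)

lemma colim_cong:
  assumes "\<And>i. i \<in> Ob J \<Longrightarrow> X i = X' i" "\<And>i j u. \<lbrakk>i \<in> Ob J; j \<in> Ob J; u \<in> Hom J i j\<rbrakk> \<Longrightarrow> T i j u = T' i j u"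
    "\<And>i. i \<in> Ob J \<Longrightarrow> c i = c' i"
  shows "colim J X T l c \<longleftrightarrow> colim J X' T' l c'"
proof -
  have 2: "coc J X T m d \<longleftrightarrow> coc J X' T' m d" for m d by (rule coc_cong) (use assms in auto)
  have 3: "coc J X' T' l c \<longleftrightarrow> coc J X' T' l c'" by (rule coc_cong) (use assms in auto)
  show ?thesis unfolding colim_def 2 3 using assms(3) by (simp cong: ball_cong)
qed

lemma is_cocone_coc:
  assumes F: "is_functor J K Fo Fa"
  shows "is_cocone K J Fo Fa l c \<longleftrightarrow> coc J Fo (\<lambda>i j u. Ar (Fo i) (Fa i j u) (Fo j)) l (\<lambda>i. Ar (Fo i) (c i) l)"
proof -
  have "Fo i \<in> Ob K" if "i \<in> Ob J" for i using F that by (simp add: is_functor_def)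
  moreover have "Fa i j u \<in> Hom K (Fo i) (Fo j)" if "i \<in> Ob J" "j \<in> Ob J" "u \<in> Hom J i j" for i j u
    using F that by (simp add: is_functor_def)
  ultimately show ?thesis unfolding is_cocone_def coc_def
    by (auto 0 3 simp: comp_def)
qed

lemma is_colimit_colim:
  assumes F: "is_functor J K Fo Fa"
  shows "is_colimit K J Fo Fa l c \<longleftrightarrow> colim J Fo (\<lambda>i j u. Ar (Fo i) (Fa i j u) (Fo j)) l (\<lambda>i. Ar (Fo i) (c i) l)"
    (is "_ \<longleftrightarrow> colim J Fo ?T l ?c")
proof -
  have ob: "Fo i \<in> Ob K" if "i \<in> Ob J" for i using F that by (simp add: is_functor_def)
  have med: "(h \<in> Hom K l m \<and> (\<forall>i\<in>Ob J. h \<cdot> c i = d i)) \<longleftrightarrow>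
      (arr (Ar l h m) \<and> (\<forall>i\<in>Ob J. comp (Ar l h m) (?c i) = Ar (Fo i) (d i) m))"
    if "coc J Fo ?T l ?c" "coc J Fo ?T m (\<lambda>i. Ar (Fo i) (d i) m)" for h m d
    using cocD(1,2)[OF that(1)] cocD(1)[OF that(2)] ob by (auto simp: comp_def)
  show ?thesis
  proof
    assume L: "is_colimit K J Fo Fa l c"
    then have c: "coc J Fo ?T l ?c" using is_cocone_coc[OF F] by (simp add: is_colimit_def)
    have d_eq: "coc J Fo ?T m d \<longleftrightarrow> coc J Fo ?T m (\<lambda>i. Ar (Fo i) (aarr (d i)) m)" if "coc J Fo ?T m d" for m d
      using cocD(2-4)[OF that] arr_eta by (intro coc_cong) (auto, metis)
    have ex1: "\<exists>!h. h \<in> Hom K l m \<and> (\<forall>i\<in>Ob J. h \<cdot> c i = aarr (d i))" if "coc J Fo ?T m d" for m d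
      using L is_cocone_coc[OF F] that d_eq[OF that] by (simp add: is_colimit_def)
    have eta: "Ar (Fo i) (aarr (d i)) m = d i" if "coc J Fo ?T m d" "i \<in> Ob J" for m d i
      using cocD(2-4)[OF that] arr_eta by metis
    have E: "\<exists>h. arr h \<and> adom h = l \<and> acod h = m \<and> (\<forall>i\<in>Ob J. comp h (?c i) = d i)" if d: "coc J Fo ?T m d" for m d
    proof -
      obtain h where "h \<in> Hom K l m \<and> (\<forall>i\<in>Ob J. h \<cdot> c i = aarr (d i))" using ex1[OF d] by blast
      then have "arr (Ar l h m) \<and> (\<forall>i\<in>Ob J. comp (Ar l h m) (?c i) = d i)"
        using med[OF c, of m "\<lambda>i. aarr (d i)" h] d d_eq[OF d] eta[OF d] by simp
      then show ?thesis by (intro exI[of _ "Ar l h m"]) simp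
    qed
    have "h = h'" if h: "arr h" "arr h'" "adom h = l" "adom h' = l" "acod h = acod h'" "\<forall>i\<in>Ob J. comp h (?c i) = comp h' (?c i)" for h h'
    proof -
      let ?d = "\<lambda>i. comp h (?c i)" and ?m = "acod h"
      have d: "coc J Fo ?T ?m ?d" using cocD[OF c] h by (simp add: coc_def)
      have e: "h = Ar l (aarr h) ?m" "h' = Ar l (aarr h') ?m" using arr_eta[OF h(1)] arr_eta[OF h(2)] h by simp_all
      have "aarr h = aarr h'"
      proof (rule trans[OF the1_equality[OF ex1[OF d], symmetric] the1_equality[OF ex1[OF d]]])
        have *: "(k \<in> Hom K l ?m \<and> (\<forall>i\<in>Ob J. k \<cdot> c i = aarr (?d i))) \<longleftrightarrow>
          (arr (Ar l k ?m) \<and> (\<forall>i\<in>Ob J. comp (Ar l k ?m) (?c i) = ?d i))" for k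
          using med[OF c, of ?m "\<lambda>i. aarr (?d i)" k] d d_eq[OF d] eta[OF d] by simp
        show "aarr h \<in> Hom K l ?m \<and> (\<forall>i\<in>Ob J. aarr h \<cdot> c i = aarr (?d i))"
          unfolding * e(1)[symmetric] using h by simp
        show "aarr h' \<in> Hom K l ?m \<and> (\<forall>i\<in>Ob J. aarr h' \<cdot> c i = aarr (?d i))"
          unfolding * e(2)[symmetric] using h by simp
      qed
      then show ?thesis using e by metis
    qed
    then show "colim J Fo ?T l ?c" unfolding colim_def using c E by blast
  next
    assume R: "colim J Fo ?T l ?c"
    note c = colim_coc[OF R]
    have "\<exists>!h. h \<in> Hom K l m \<and> (\<forall>i\<in>Ob J. h \<cdot> c i = d i)" if "is_cocone K J Fo Fa m d" for m d
    proof -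
      have d: "coc J Fo ?T m (\<lambda>i. Ar (Fo i) (d i) m)" using that is_cocone_coc[OF F] by simp
      obtain h where h: "arr h" "adom h = l" "acod h = m" "\<forall>i\<in>Ob J. comp h (?c i) = Ar (Fo i) (d i) m"
        by (rule colim_ex[OF R d])
      then have e: "h = Ar l (aarr h) m" using arr_eta[of h] by simp
      show ?thesis unfolding med[OF c d]
      proof (rule ex1I[of _ "aarr h"])
        show "arr (Ar l (aarr h) m) \<and> (\<forall>i\<in>Ob J. comp (Ar l (aarr h) m) (?c i) = Ar (Fo i) (d i) m)"
          unfolding e[symmetric] using h by blast
        fix k assume k: "arr (Ar l k m) \<and> (\<forall>i\<in>Ob J. comp (Ar l k m) (?c i) = Ar (Fo i) (d i) m)"
        have "Ar l k m = h" by (rule colim_eq[OF R]) (use k h in auto)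
        then show "k = aarr h" by auto
      qed
    qed
    then show "is_colimit K J Fo Fa l c" using is_cocone_coc[OF F] c by (simp add: is_colimit_def)
  qed
qed

lemma colim_iso:
  assumes c: "colim J X T l c" and k: "iso_ar k" "adom k = l"
  shows "colim J X T (acod k) (\<lambda>i. comp k (c i))"
  unfolding colim_def
proof (intro conjI allI impI; (elim conjE)?)
  note [simp] = ainv_simps[OF k(1)] k(2)
  note D = cocD[OF colim_coc[OF c]]
  show "coc J X T (acod k) (\<lambda>i. comp k (c i))" using D by (simp add: coc_def)
  fix m d assume "coc J X T m d"
  then obtain h where h: "arr h" "adom h = l" "acod h = m" "\<forall>i\<in>Ob J. comp h (c i) = d i"
    by (rule colim_ex[OF c])
  show "\<exists>h. arr h \<and> adom h = acod k \<and> acod h = m \<and> (\<forall>i\<in>Ob J. comp h (comp k (c i)) = d i)"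
    by (rule exI[of _ "comp h (ainv k)"]) (use h D in \<open>simp add: comp_reduce[OF ainv_simps(6)[OF k(1)]]\<close>)
next
  note [simp] = ainv_simps[OF k(1)] k(2)
  fix h h' assume h: "arr h" "arr h'" "adom h = acod k" "adom h' = acod k" "acod h = acod h'"
    "\<forall>i\<in>Ob J. comp h (comp k (c i)) = comp h' (comp k (c i))"
  have "comp h k = comp h' k" by (rule colim_eq[OF c]) (use h in simp_all)
  then show "h = h'" by (rule iso_cancel_right[OF k(1)]) (use h in simp_all)
qed

lemma colim_uniq:
  assumes c: "colim J X T l c" and d: "colim J X T m d"
  obtains k where "iso_ar k" "adom k = l" "acod k = m" "\<forall>i\<in>Ob J. comp k (c i) = d i"
proof -
  obtain k where k: "arr k" "adom k = l" "acod k = m" "\<forall>i\<in>Ob J. comp k (c i) = d i"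
    by (rule colim_ex[OF c colim_coc[OF d]])
  obtain j where j: "arr j" "adom j = m" "acod j = l" "\<forall>i\<in>Ob J. comp j (d i) = c i"
    by (rule colim_ex[OF d colim_coc[OF c]])
  have lm: "l \<in> Ob K" "m \<in> Ob K" using cocD(1)[OF colim_coc[OF c]] cocD(1)[OF colim_coc[OF d]] .
  have "comp j k = ide l" by (rule colim_eq[OF c]) (use k j lm cocD[OF colim_coc[OF c]] in simp_all)
  moreover have "comp k j = ide m" by (rule colim_eq[OF d]) (use k j lm cocD[OF colim_coc[OF d]] in simp_all)
  ultimately have "iso_ar k" by (intro iso_arI[of k j]) (use k j in \<open>simp add: inverses_def\<close>)
  then show ?thesis using that k by blast
qed

end

context geometry
begin

notation comp (infixr "\<bullet>" 70)
notation tns (infixr "**" 75)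

section \<open>Colimits in the ambient category and the tensor product\<close>

definition tfun where
  "tfun J X T \<longleftrightarrow> (\<forall>i\<in>Ob J. X i \<in> Ob C) \<and>
    (\<forall>i\<in>Ob J. \<forall>j\<in>Ob J. \<forall>u\<in>Hom J i j. arr (T i j u) \<and> adom (T i j u) = X i \<and> acod (T i j u) = X j) \<and>
    (\<forall>i\<in>Ob J. T i i (idt J i) = ide (X i)) \<and>
    (\<forall>i\<in>Ob J. \<forall>j\<in>Ob J. \<forall>k\<in>Ob J. \<forall>u\<in>Hom J i j. \<forall>v\<in>Hom J j k. T i k (v \<cdot>\<^bsub>J\<^esub> u) = T j k v \<bullet> T i j u)"

lemma tfunD: assumes "tfun J X T"
  shows "i \<in> Ob J \<Longrightarrow> X i \<in> Ob C"
    "\<lbrakk>i \<in> Ob J; j \<in> Ob J; w \<in> Hom J i j\<rbrakk> \<Longrightarrow> arr (T i j w)"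
    "\<lbrakk>i \<in> Ob J; j \<in> Ob J; w \<in> Hom J i j\<rbrakk> \<Longrightarrow> adom (T i j w) = X i"
    "\<lbrakk>i \<in> Ob J; j \<in> Ob J; w \<in> Hom J i j\<rbrakk> \<Longrightarrow> acod (T i j w) = X j"
    "i \<in> Ob J \<Longrightarrow> T i i (idt J i) = ide (X i)"
    "\<lbrakk>i \<in> Ob J; j \<in> Ob J; k \<in> Ob J; w \<in> Hom J i j; v \<in> Hom J j k\<rbrakk> \<Longrightarrow> T i k (v \<cdot>\<^bsub>J\<^esub> w) = T j k v \<bullet> T i j w"
  using assms unfolding tfun_def by blast+

lemma tfun_functor: assumes "tfun J X T" shows "is_functor J C X (\<lambda>i j u. aarr (T i j u))"
proof -
  note d = tfunD[OF assms]
  have "aarr (T i j w) \<in> Hom C (X i) (X j)" if "i \<in> Ob J" "j \<in> Ob J" "w \<in> Hom J i j" for i j w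
    using arr_Hom[OF d(2)[OF that]] d(3,4)[OF that] by simp
  moreover have "aarr (T i k (v \<cdot>\<^bsub>J\<^esub> w)) = aarr (T j k v) \<cdot> aarr (T i j w)"
    if "i \<in> Ob J" "j \<in> Ob J" "k \<in> Ob J" "w \<in> Hom J i j" "v \<in> Hom J j k" for i j k w v
    unfolding d(6)[OF that] using d(2-4)[OF that(1,2,4)] d(2-4)[OF that(2,3,5)] by (simp add: aarr_comp)
  ultimately show ?thesis unfolding is_functor_def using d(1,5) by (simp add: aarr_structure)
qed

lemma tfun_tns: assumes "tfun J X T" and [simp]: "z \<in> Ob C"
  shows "tfun J (\<lambda>i. X i \<boxtimes> z) (\<lambda>i j u. T i j u ** ide z)"
  using tfunD[OF assms(1)] unfolding tfun_def by simp

lemma msys_tfun: assumes "msys A J Fo T" shows "tfun J (\<lambda>i. ucar (Fo i)) T"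
  unfolding tfun_def
proof (intro conjI ballI)
  note d = msysD[OF assms]
  fix i assume i: "i \<in> Ob J"
  show "ucar (Fo i) \<in> Ob C" by (rule md_simps(3)[OF d(1)[OF i]])
  show "T i i (idt J i) = ide (ucar (Fo i))" by (rule d(3)[OF i])
  fix j w assume j: "j \<in> Ob J" and w: "w \<in> Hom J i j"
  show "arr (T i j w)" "adom (T i j w) = ucar (Fo i)" "acod (T i j w) = ucar (Fo j)"
    using linD(1-3)[OF d(2)[OF i j w]] .
  fix k v assume k: "k \<in> Ob J" and v: "v \<in> Hom J j k"
  show "T i k (v \<cdot>\<^bsub>J\<^esub> w) = T j k v \<bullet> T i j w" by (rule d(4)[OF i j k w v])
qed

lemma functor_colim:
  assumes F: "tfun J X T" and c: "\<And>i. i \<in> Ob J \<Longrightarrow> arr (c i)" "\<And>i. i \<in> Ob J \<Longrightarrow> adom (c i) = X i" "\<And>i. i \<in> Ob J \<Longrightarrow> acod (c i) = l"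
  shows "is_colimit C J X (\<lambda>i j u. aarr (T i j u)) l (\<lambda>i. aarr (c i)) \<longleftrightarrow> colim J X T l c"
proof -
  note d = tfunD[OF F]
  have "colim J X (\<lambda>i j u. Ar (X i) (aarr (T i j u)) (X j)) l (\<lambda>i. Ar (X i) (aarr (c i)) l) \<longleftrightarrow> colim J X T l c"
    by (rule colim_cong) (use d arr_eta c in \<open>metis+\<close>)
  then show ?thesis unfolding is_colimit_colim[OF tfun_functor[OF F]] .
qed

lemma colim_tns:
  assumes J: "small_cat U J" and F: "tfun J X T" and c: "colim J X T l c" and z: "z \<in> Ob C"
  shows "colim J (\<lambda>i. X i \<boxtimes> z) (\<lambda>i j u. T i j u ** ide z) (l \<boxtimes> z) (\<lambda>i. c i ** ide z)"
proof -
  note d = tfunD[OF F] and D = cocD[OF colim_coc[OF c]]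
  note F2 = tfun_tns[OF F z]
  have "is_colimit C J X (\<lambda>i j u. aarr (T i j u)) l (\<lambda>i. aarr (c i))"
    using c D by (subst functor_colim[OF F]) auto
  then have L: "is_colimit C J (\<lambda>i. X i \<boxtimes> z) (\<lambda>i j u. aarr (T i j u) \<boxdot> idt C z) (l \<boxtimes> z) (\<lambda>i. aarr (c i) \<boxdot> idt C z)"
    using tensor_colimits J tfun_functor[OF F] z unfolding tensor_preserves_small_colimits_def by blast
  have J': "category J" using J by (simp add: small_cat_def)
  have T: "aarr (T i j w ** ide z) = aarr (T i j w) \<boxdot> idt C z" if "i \<in> Ob J" "j \<in> Ob J" "w \<in> Hom J i j" for i j w
    using d(2)[OF that] z by (simp add: aarr_tns aarr_structure)
  have F3: "is_functor J C (\<lambda>i. X i \<boxtimes> z) (\<lambda>i j u. aarr (T i j u) \<boxdot> idt C z)"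
    by (rule is_functor_cong[OF J' tfun_functor[OF F2]]) (simp_all add: T)
  have "colim J (\<lambda>i. X i \<boxtimes> z) (\<lambda>i j u. Ar (X i \<boxtimes> z) (aarr (T i j u) \<boxdot> idt C z) (X j \<boxtimes> z)) (l \<boxtimes> z) (\<lambda>i. Ar (X i \<boxtimes> z) (aarr (c i) \<boxdot> idt C z) (l \<boxtimes> z))"
    using L unfolding is_colimit_colim[OF F3] .
  moreover have "Ar (X i \<boxtimes> z) (aarr (T i j w) \<boxdot> idt C z) (X j \<boxtimes> z) = T i j w ** ide z" if "i \<in> Ob J" "j \<in> Ob J" "w \<in> Hom J i j" for i j w
    using d[OF that(1)] d(2-4)[OF that] z by (simp add: tns_def aarr_structure)
  moreover have "Ar (X i \<boxtimes> z) (aarr (c i) \<boxdot> idt C z) (l \<boxtimes> z) = c i ** ide z" if "i \<in> Ob J" for i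
    using D(2-4)[OF that] z by (simp add: tns_def aarr_structure)
  ultimately show ?thesis by (subst (asm) colim_cong) auto
qed

text \<open>The colimit property is demanded of the underlying objects. By
  \<open>mcol_is_colimit\<close> and \<open>is_colimit_mcol\<close> this matches colimits in the
  module category, and it has the advantage that restriction of scalars does not affect it.\<close>

definition mcol where
  "mcol A J Fo T L c \<longleftrightarrow> md A L \<and> (\<forall>i\<in>Ob J. lin A (Fo i) L (c i)) \<and> colim J (\<lambda>i. ucar (Fo i)) T (ucar L) c"

lemma mcolD: assumes "mcol A J Fo T L c"
  shows "md A L" "i \<in> Ob J \<Longrightarrow> lin A (Fo i) L (c i)" "colim J (\<lambda>i. ucar (Fo i)) T (ucar L) c"
    "\<lbrakk>i \<in> Ob J; j \<in> Ob J; u \<in> Hom J i j\<rbrakk> \<Longrightarrow> c j \<bullet> T i j u = c i"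
proof -
  have c: "colim J (\<lambda>i. ucar (Fo i)) T (ucar L) c" using assms by (simp add: mcol_def)
  show "md A L" "i \<in> Ob J \<Longrightarrow> lin A (Fo i) L (c i)" "colim J (\<lambda>i. ucar (Fo i)) T (ucar L) c"
    using assms by (simp_all add: mcol_def)
  show "\<lbrakk>i \<in> Ob J; j \<in> Ob J; u \<in> Hom J i j\<rbrakk> \<Longrightarrow> c j \<bullet> T i j u = c i" by (rule cocD(5)[OF colim_coc[OF c]])
qed

text \<open>Linearity can be tested on the tensored cocone, which is again a colimit cocone.\<close>

lemma mcol_lin:
  assumes J: "small_cat U J" and s: "msys A J Fo T" and c: "mcol A J Fo T L c" and M: "md A M"
    and k: "arr k" "adom k = ucar L" "acod k = ucar M" "\<And>i. i \<in> Ob J \<Longrightarrow> lin A (Fo i) M (k \<bullet> c i)"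
  shows "lin A L M k"
proof -
  note D = mcolD[OF c]
  note [simp] = md_simps[OF D(1)] md_simps[OF M] k(1-3)
  have "k \<bullet> ac A L = ac A M \<bullet> (k ** ide (mcar A))"
  proof (rule colim_eq[OF colim_tns[OF J msys_tfun[OF s] D(3), of "mcar A"]])
    fix i assume i: "i \<in> Ob J"
    note [simp] = md_simps[OF msysD(1)[OF s i]] linD(1-3)[OF D(2)[OF i]]
    have "(k \<bullet> ac A L) \<bullet> (c i ** ide (mcar A)) = (k \<bullet> c i) \<bullet> ac A (Fo i)"
      by (simp add: linD(4)[OF D(2)[OF i]])
    also have "\<dots> = ac A M \<bullet> ((k \<bullet> c i) ** ide (mcar A))" by (rule linD(4)[OF k(4)[OF i]])
    finally show "(k \<bullet> ac A L) \<bullet> (c i ** ide (mcar A)) = (ac A M \<bullet> (k ** ide (mcar A))) \<bullet> (c i ** ide (mcar A))"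
      by simp
  qed simp_all
  then show ?thesis by (simp add: lin_def)
qed

lemma mcol_factor:
  assumes J: "small_cat U J" and s: "msys A J Fo T" and c: "mcol A J Fo T L c" and M: "md A M"
    and d: "\<And>i. i \<in> Ob J \<Longrightarrow> lin A (Fo i) M (d i)"
      "\<And>i j u. \<lbrakk>i \<in> Ob J; j \<in> Ob J; u \<in> Hom J i j\<rbrakk> \<Longrightarrow> d j \<bullet> T i j u = d i"
  obtains k where "lin A L M k" "\<forall>i\<in>Ob J. k \<bullet> c i = d i"
proof -
  note D = mcolD[OF c]
  have "coc J (\<lambda>i. ucar (Fo i)) T (ucar M) d"
    unfolding coc_def using d linD md_simps(3)[OF M] by blast
  then obtain k where k: "arr k" "adom k = ucar L" "acod k = ucar M" "\<forall>i\<in>Ob J. k \<bullet> c i = d i"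
    by (rule colim_ex[OF D(3)])
  then show ?thesis using that mcol_lin[OF J s c M k(1-3)] d(1) by simp
qed

text \<open>The forgetful functor creates colimits: the cocone tensored with the monoid is a colimit
  and induces the action, and tensored twice it is a colimit that tests associativity.\<close>

lemma mcol_ex:
  assumes J: "small_cat U J" and s: "msys A J Fo T" and A: "comm_mon C A"
  obtains L c where "mcol A J Fo T L c"
proof -
  let ?X = "\<lambda>i. ucar (Fo i)" and ?a = "mcar A"
  note F = msys_tfun[OF s]
  note [simp] = A comm_mon_simps(1)[OF A]
  obtain l c0 where "is_colimit C J ?X (\<lambda>i j u. aarr (T i j u)) l c0"
    using small_colimits J tfun_functor[OF F] unfolding has_small_colimits_def by blast
  then have c0: "colim J ?X (\<lambda>i j u. Ar (?X i) (aarr (T i j u)) (?X j)) l (\<lambda>i. Ar (?X i) (c0 i) l)"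
    unfolding is_colimit_colim[OF tfun_functor[OF F]] .
  define c where "c i = Ar (?X i) (c0 i) l" for i
  have c: "colim J ?X T l c"
    using c0 by (subst (asm) colim_cong[of _ _ ?X _ T _ c]) (use tfunD[OF F] arr_eta c_def in \<open>metis+\<close>)
  note D = cocD[OF colim_coc[OF c]]
  have [simp]: "l \<in> Ob C" by (rule D)
  note ca = colim_tns[OF J F c, of ?a, simplified]
  note caa = colim_tns[OF J tfun_tns[OF F] ca, of ?a, simplified]
  have "coc J (\<lambda>i. ?X i \<boxtimes> ?a) (\<lambda>i j u. T i j u ** ide ?a) l (\<lambda>i. c i \<bullet> ac A (Fo i))"
    unfolding coc_def
  proof (intro conjI ballI)
    fix i assume i: "i \<in> Ob J"
    note [simp] = md_simps[OF msysD(1)[OF s i]] D(2-4)[OF i]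
    show "arr (c i \<bullet> ac A (Fo i))" "adom (c i \<bullet> ac A (Fo i)) = ?X i \<boxtimes> ?a" "acod (c i \<bullet> ac A (Fo i)) = l" by simp_all
    fix j w assume j: "j \<in> Ob J" "w \<in> Hom J i j"
    note t = msysD(2)[OF s i j]
    note [simp] = md_simps[OF msysD(1)[OF s j(1)]] D(2-4)[OF j(1)] linD(1-3)[OF t]
    show "(c j \<bullet> ac A (Fo j)) \<bullet> (T i j w ** ide ?a) = c i \<bullet> ac A (Fo i)"
      using linD(4)[OF t, symmetric] comp_reduce[OF D(5)[OF i j], of "ac A (Fo i)"] by simp
  qed simp
  then obtain \<alpha> where \<alpha>: "arr \<alpha>" "adom \<alpha> = l \<boxtimes> ?a" "acod \<alpha> = l" "\<forall>i\<in>Ob J. \<alpha> \<bullet> (c i ** ide ?a) = c i \<bullet> ac A (Fo i)"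
    by (rule colim_ex[OF ca])
  define L where "L = \<lparr>ucar = l, uact = aarr \<alpha>\<rparr>"
  have uL [simp]: "ucar L = l" by (simp add: L_def)
  have ac: "ac A L = \<alpha>" using arr_eta[OF \<alpha>(1)] \<alpha> by (simp add: L_def ac_def)
  note [simp] = \<alpha>(1-3)
  have 1: "\<alpha> \<bullet> (\<alpha> ** ide ?a) = \<alpha> \<bullet> ((ide l ** mu A) \<bullet> as l ?a ?a)"
  proof (rule colim_eq[OF caa])
    fix i assume i: "i \<in> Ob J"
    note M = msysD(1)[OF s i]
    note [simp] = md_simps[OF M] D(2-4)[OF i]
    note \<alpha>i = \<alpha>(4)[rule_format, OF i]
    have "(\<alpha> \<bullet> (\<alpha> ** ide ?a)) \<bullet> ((c i ** ide ?a) ** ide ?a) = \<alpha> \<bullet> ((\<alpha> \<bullet> (c i ** ide ?a)) ** ide ?a)" by simp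
    also have "\<dots> = \<alpha> \<bullet> ((c i \<bullet> ac A (Fo i)) ** ide ?a)" by (simp only: \<alpha>i)
    also have "\<dots> = (\<alpha> \<bullet> (c i ** ide ?a)) \<bullet> (ac A (Fo i) ** ide ?a)" by simp
    also have "\<dots> = c i \<bullet> (ac A (Fo i) \<bullet> ((ide (?X i) ** mu A) \<bullet> as (?X i) ?a ?a))"
      unfolding \<alpha>i using ac_assoc[OF M] by simp
    also have "\<dots> = \<alpha> \<bullet> ((ide l ** mu A) \<bullet> ((c i ** (ide ?a ** ide ?a)) \<bullet> as (?X i) ?a ?a))"
      using comp_reduce[OF \<alpha>i, of "(ide (?X i) ** mu A) \<bullet> as (?X i) ?a ?a"] by simp
    also have "\<dots> = (\<alpha> \<bullet> ((ide l ** mu A) \<bullet> as l ?a ?a)) \<bullet> ((c i ** ide ?a) ** ide ?a)"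
      by (subst as_natural) simp_all
    finally show "(\<alpha> \<bullet> (\<alpha> ** ide ?a)) \<bullet> ((c i ** ide ?a) ** ide ?a)
      = (\<alpha> \<bullet> ((ide l ** mu A) \<bullet> as l ?a ?a)) \<bullet> ((c i ** ide ?a) ** ide ?a)" .
  qed simp_all
  have 2: "\<alpha> \<bullet> (ide l ** et A) = ru l"
  proof (rule colim_eq[OF colim_tns[OF J F c tunit_Ob]])
    fix i assume i: "i \<in> Ob J"
    note M = msysD(1)[OF s i]
    note [simp] = md_simps[OF M] D(2-4)[OF i]
    note \<alpha>i = \<alpha>(4)[rule_format, OF i]
    have "(\<alpha> \<bullet> (ide l ** et A)) \<bullet> (c i ** ide (tunit C)) = (\<alpha> \<bullet> (c i ** ide ?a)) \<bullet> (ide (?X i) ** et A)" by simp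
    also have "\<dots> = c i \<bullet> ru (?X i)" unfolding \<alpha>i by simp
    also have "\<dots> = ru l \<bullet> (c i ** ide (tunit C))" by (subst ru_natural) simp_all
    finally show "(\<alpha> \<bullet> (ide l ** et A)) \<bullet> (c i ** ide (tunit C)) = ru l \<bullet> (c i ** ide (tunit C))" .
  qed simp_all
  have "md A L" using 1 2 ac unfolding md_def by (simp add: is_module_ar)
  moreover have "lin A (Fo i) L (c i)" if "i \<in> Ob J" for i
    using D(2-4)[OF that] \<alpha>(4) that ac by (simp add: lin_def)
  ultimately have "mcol A J Fo T L c" using c by (simp add: mcol_def)
  then show ?thesis by (rule that)
qed

lemma mcol_is_colimit:
  assumes J: "small_cat U J" and s: "msys A J Fo T" and A: "comm_mon C A" and c: "mcol A J Fo T L c"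
  shows "is_colimit (Mod_cat C A) J Fo (\<lambda>i j u. aarr (T i j u)) L (\<lambda>i. aarr (c i))"
  unfolding is_colimit_def
proof (intro conjI allI impI)
  note D = mcolD[OF c]
  have "aarr (c j) \<cdot> aarr (T i j w) = aarr (c i)" if "i \<in> Ob J" "j \<in> Ob J" "w \<in> Hom J i j" for i j w
    unfolding D(4)[OF that, symmetric] using linD(1-3)[OF D(2)[OF that(2)]] linD(1-3)[OF msysD(2)[OF s that]]
    by (simp add: aarr_comp)
  then show "is_cocone (Mod_cat C A) J Fo (\<lambda>i j u. aarr (T i j u)) L (\<lambda>i. aarr (c i))"
    unfolding is_cocone_def using D(1,2) msysD(1)[OF s] by (simp add: Ob_Mod[OF A] Hom_lin)
  fix M d assume "is_cocone (Mod_cat C A) J Fo (\<lambda>i j u. aarr (T i j u)) M d"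
  then have M: "md A M" and dH: "\<And>i. i \<in> Ob J \<Longrightarrow> d i \<in> Hom (Mod_cat C A) (Fo i) M" and
    dT: "\<And>i j u. \<lbrakk>i \<in> Ob J; j \<in> Ob J; u \<in> Hom J i j\<rbrakk> \<Longrightarrow> d j \<cdot> aarr (T i j u) = d i"
    unfolding is_cocone_def by (auto simp: Ob_Mod[OF A])
  let ?d = "\<lambda>i. Ar (ucar (Fo i)) (d i) (ucar M)"
  have dl: "lin A (Fo i) M (?d i)" if "i \<in> Ob J" for i
    using dH[OF that] lin_Hom[OF msysD(1)[OF s that] M] by simp
  have dc: "?d j \<bullet> T i j w = ?d i" if "i \<in> Ob J" "j \<in> Ob J" "w \<in> Hom J i j" for i j w
    using dT[OF that] linD(1-3)[OF dl[OF that(2)]] linD(1-3)[OF dl[OF that(1)]] linD(1-3)[OF msysD(2)[OF s that]]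
    by (intro ar_eqI) (simp_all add: aarr_comp del: arr_Ar)
  obtain k where k: "lin A L M k" "\<forall>i\<in>Ob J. k \<bullet> c i = ?d i" by (rule mcol_factor[OF J s c M dl dc])
  have med: "h \<in> Hom (Mod_cat C A) L M \<and> (\<forall>i\<in>Ob J. h \<cdot> aarr (c i) = d i) \<longleftrightarrow> h = aarr k" for h
  proof
    assume h: "h \<in> Hom (Mod_cat C A) L M \<and> (\<forall>i\<in>Ob J. h \<cdot> aarr (c i) = d i)"
    let ?h = "Ar (ucar L) h (ucar M)"
    have hl: "lin A L M ?h" using h lin_Hom[OF D(1) M] by simp
    have "?h = k"
    proof (rule colim_eq[OF D(3)])
      fix i assume i: "i \<in> Ob J"
      show "?h \<bullet> c i = k \<bullet> c i"
        using k(2) i h linD(1-3)[OF hl] linD(1-3)[OF D(2)[OF i]] linD(1-3)[OF dl[OF i]]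
        by (intro ar_eqI) (simp_all add: aarr_comp del: arr_Ar)
    qed (use linD(1-3)[OF hl] linD(1-3)[OF k(1)] in simp_all)
    then show "h = aarr k" by auto
  next
    assume h: "h = aarr k"
    have "aarr k \<cdot> aarr (c i) = d i" if i: "i \<in> Ob J" for i
    proof -
      have "aarr (k \<bullet> c i) = d i" using k(2) i by simp
      then show ?thesis using linD(1-3)[OF D(2)[OF i]] linD(1-3)[OF k(1)] by (simp add: aarr_comp)
    qed
    then show "h \<in> Hom (Mod_cat C A) L M \<and> (\<forall>i\<in>Ob J. h \<cdot> aarr (c i) = d i)"
      using Hom_lin[OF k(1) D(1) M] h by simp
  qed
  show "\<exists>!h. h \<in> Hom (Mod_cat C A) L M \<and> (\<forall>i\<in>Ob J. cmp (Mod_cat C A) h (aarr (c i)) = d i)"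
    by (simp add: med)
qed

lemma fa_comp:
  assumes A: "comm_mon C A" and "category.arr (Mod_cat C A) g" "category.arr (Mod_cat C A) f" "adom g = acod f"
  shows "fa (category.comp (Mod_cat C A) g f) = fa g \<bullet> fa f"
proof -
  interpret K: category "Mod_cat C A" by (rule category_Mod[OF A])
  obtain M f' N where f: "f = Ar M f' N" using assms(3) by (rule K.arrE)
  obtain N' g' P where g: "g = Ar N' g' P" using assms(2) by (rule K.arrE)
  have "lin A M N (Ar (ucar M) f' (ucar N))" "lin A N' P (Ar (ucar N') g' (ucar P))" "md A M" "md A N" "md A P"
    using assms(2,3) arr_Mod[OF A] f g by auto
  then have "Ar (ucar N) g' (ucar P) \<bullet> Ar (ucar M) f' (ucar N) = Ar (ucar M) (g' \<cdot> f') (ucar P)"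
    using assms(4) f g by (intro comp_Ar) (auto dest: linD(1) md_simps(3))
  then show ?thesis using comp_Mod[OF A, of N g' P M f'] assms f g by simp
qed

text \<open>Uniqueness of colimits compares it with the one created by the forgetful
  functor.\<close>

lemma is_colimit_mcol:
  assumes J: "small_cat U J" and s: "msys A J Fo T" and A: "comm_mon C A"
    and c: "is_colimit (Mod_cat C A) J Fo (\<lambda>i j u. aarr (T i j u)) L c"
  shows "mcol A J Fo T L (\<lambda>i. Ar (ucar (Fo i)) (c i) (ucar L))"
proof -
  interpret K: category "Mod_cat C A" by (rule category_Mod[OF A])
  obtain L0 c0 where c0: "mcol A J Fo T L0 c0" by (rule mcol_ex[OF J s A])
  note D0 = mcolD[OF c0]
  note F = msys_functor[OF A s]
  note k0 = mcol_is_colimit[OF J s A c0, unfolded K.is_colimit_colim[OF F]]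
  note k1 = c[unfolded K.is_colimit_colim[OF F]]
  obtain k where k: "K.iso_ar k" "adom k = L0" "acod k = L"
    "\<forall>i\<in>Ob J. K.comp k (Ar (Fo i) (aarr (c0 i)) L0) = Ar (Fo i) (c i) L" by (rule K.colim_uniq[OF k0 k1])
  note kI = K.ainv_simps[OF k(1)]
  have L: "md A L" using kI(1) k(3) Ob_Mod[OF A] K.arr_Ob(2)[of k] by simp
  have lk: "lin A (adom x) (acod x) (fa x)" if "K.arr x" for x
    using arr_Mod[OF A, of "adom x" "aarr x" "acod x"] K.arr_eta[OF that] that by (simp add: fa_def del: K.arr_Ar)
  have kl: "lin A L0 L (fa k)" using lk[OF kI(1)] k by simp
  have jl: "lin A L L0 (fa (K.ainv k))" using lk[OF kI(2)] kI(3,4) k by simp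
  have fi: "fa (K.ide M) = ide (ucar M)" for M by (simp add: K.ide_def ide_def)
  have "fa k \<bullet> fa (K.ainv k) = ide (ucar L)" "fa (K.ainv k) \<bullet> fa k = ide (ucar L0)"
    using fa_comp[OF A kI(1,2)] fa_comp[OF A kI(2,1)] kI k fi by simp_all
  then have ik: "iso_ar (fa k)"
    using linD(1-3)[OF kl] linD(1-3)[OF jl] by (intro iso_arI[of _ "fa (K.ainv k)"]) (simp add: inverses_def)
  have e: "fa k \<bullet> c0 i = Ar (ucar (Fo i)) (c i) (ucar L)" if i: "i \<in> Ob J" for i
  proof -
    note ci = D0(2)[OF i]
    have "K.arr (Ar (Fo i) (aarr (c0 i)) L0)"
      using ci msysD(1)[OF s i] D0(1) Ar_aarr[OF ci] arr_Mod[OF A] by metis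
    then have "fa (K.comp k (Ar (Fo i) (aarr (c0 i)) L0)) = fa k \<bullet> Ar (ucar (Fo i)) (aarr (c0 i)) (ucar L0)"
      using fa_comp[OF A kI(1)] k by simp
    then show ?thesis using k(4) i Ar_aarr[OF ci] by simp
  qed
  have "colim J (\<lambda>i. ucar (Fo i)) T (ucar L) (\<lambda>i. fa k \<bullet> c0 i)"
    using colim_iso[OF D0(3) ik] linD(1-3)[OF kl] by simp
  then have "colim J (\<lambda>i. ucar (Fo i)) T (ucar L) (\<lambda>i. Ar (ucar (Fo i)) (c i) (ucar L))"
    using e by (subst (asm) colim_cong[of _ _ "\<lambda>i. ucar (Fo i)" _ T _ "\<lambda>i. Ar (ucar (Fo i)) (c i) (ucar L)"]) auto
  moreover have "lin A (Fo i) L (Ar (ucar (Fo i)) (c i) (ucar L))" if i: "i \<in> Ob J" for i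
    using lin_comp[OF D0(2)[OF i] kl msysD(1)[OF s i] D0(1) L] e[OF i] by simp
  ultimately show ?thesis using L by (simp add: mcol_def)
qed

text \<open>A filtered category is nonempty and connected, so the components of a cocone on a
  constant system are all equal.\<close>

lemma mcol_const:
  assumes J: "filtered_cat J" and N: "md A N"
  shows "msys A J (\<lambda>_. N) (\<lambda>_ _ _. ide (ucar N))" "mcol A J (\<lambda>_. N) (\<lambda>_ _ _. ide (ucar N)) N (\<lambda>_. ide (ucar N))"
proof -
  note [simp] = md_simps[OF N]
  show "msys A J (\<lambda>_. N) (\<lambda>_ _ _. ide (ucar N))" unfolding msys_def using N lin_ide[OF N] by simp
  have "\<exists>h. arr h \<and> adom h = ucar N \<and> acod h = m \<and> (\<forall>i\<in>Ob J. h \<bullet> ide (ucar N) = d i)"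
    if d: "coc J (\<lambda>_. ucar N) (\<lambda>_ _ _. ide (ucar N)) m d" for m d
  proof -
    note D = cocD[OF d]
    obtain i0 where i0: "i0 \<in> Ob J" using J by (auto simp: filtered_cat_def)
    have "d i = d i0" if i: "i \<in> Ob J" for i
    proof -
      obtain k w v where k: "k \<in> Ob J" "w \<in> Hom J i k" "v \<in> Hom J i0 k" using J i i0 unfolding filtered_cat_def by blast
      have "d k = d i" using D(5)[OF i k(1,2)] D(2-4)[OF k(1)] by simp
      moreover have "d k = d i0" using D(5)[OF i0 k(1,3)] D(2-4)[OF k(1)] by simp
      ultimately show ?thesis by simp
    qed
    then show ?thesis using D(2-4)[OF i0] by (intro exI[of _ "d i0"]) simp
  qed
  moreover have "h = h'" if "arr h" "arr h'" "adom h = ucar N" "adom h' = ucar N" "\<forall>i\<in>Ob J. h \<bullet> ide (ucar N) = h' \<bullet> ide (ucar N)" for h h'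
  proof -
    obtain i0 where "i0 \<in> Ob J" using J by (auto simp: filtered_cat_def)
    with that(5) have "h \<bullet> ide (ucar N) = h' \<bullet> ide (ucar N)" by blast
    then show ?thesis using that(1-4) by simp
  qed
  moreover have "coc J (\<lambda>_. ucar N) (\<lambda>_ _ _. ide (ucar N)) (ucar N) (\<lambda>_. ide (ucar N))"
    unfolding coc_def by simp
  ultimately have "colim J (\<lambda>_. ucar N) (\<lambda>_ _ _. ide (ucar N)) (ucar N) (\<lambda>_. ide (ucar N))"
    unfolding colim_def by blast
  then show "mcol A J (\<lambda>_. N) (\<lambda>_ _ _. ide (ucar N)) N (\<lambda>_. ide (ucar N))"
    unfolding mcol_def using N lin_ide[OF N] by simp
qed

text \<open>The instance of \<open>filtered_exact\<close> for pullbacks.\<close>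

lemma filtered_colimit_pullback:
  assumes A: "comm_mon C A" and I: "small_cat U I" "filtered_cat I"
    and sX: "msys A I Xo TX" and sY: "msys A I Yo TY" and sZ: "msys A I Zo TZ" and sL: "msys A I Lo TL"
    and f: "\<And>i. i \<in> Ob I \<Longrightarrow> lin A (Xo i) (Zo i) (f i)" and g: "\<And>i. i \<in> Ob I \<Longrightarrow> lin A (Yo i) (Zo i) (g i)"
    and p: "\<And>i. i \<in> Ob I \<Longrightarrow> lin A (Lo i) (Xo i) (p i)" and q: "\<And>i. i \<in> Ob I \<Longrightarrow> lin A (Lo i) (Yo i) (q i)"
    and pbi: "\<And>i. i \<in> Ob I \<Longrightarrow> pb (f i) (g i) (p i) (q i)"
    and nat: "\<And>i j u. \<lbrakk>i \<in> Ob I; j \<in> Ob I; u \<in> Hom I i j\<rbrakk> \<Longrightarrow> TZ i j u \<bullet> f i = f j \<bullet> TX i j u"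
      "\<And>i j u. \<lbrakk>i \<in> Ob I; j \<in> Ob I; u \<in> Hom I i j\<rbrakk> \<Longrightarrow> TZ i j u \<bullet> g i = g j \<bullet> TY i j u"
      "\<And>i j u. \<lbrakk>i \<in> Ob I; j \<in> Ob I; u \<in> Hom I i j\<rbrakk> \<Longrightarrow> TX i j u \<bullet> p i = p j \<bullet> TL i j u"
      "\<And>i j u. \<lbrakk>i \<in> Ob I; j \<in> Ob I; u \<in> Hom I i j\<rbrakk> \<Longrightarrow> TY i j u \<bullet> q i = q j \<bullet> TL i j u"
    and cX: "mcol A I Xo TX x cx" and cY: "mcol A I Yo TY y cy" and cZ: "mcol A I Zo TZ z cz"
    and f': "lin A x z f'" "\<And>i. i \<in> Ob I \<Longrightarrow> f' \<bullet> cx i = cz i \<bullet> f i"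
    and g': "lin A y z g'" "\<And>i. i \<in> Ob I \<Longrightarrow> g' \<bullet> cy i = cz i \<bullet> g i"
    and w: "md A w" "lin A w x p'" "lin A w y q'" "pb f' g' p' q'"
    and l: "\<And>i. i \<in> Ob I \<Longrightarrow> lin A (Lo i) w (l i)" "\<And>i. i \<in> Ob I \<Longrightarrow> p' \<bullet> l i = cx i \<bullet> p i"
      "\<And>i. i \<in> Ob I \<Longrightarrow> q' \<bullet> l i = cy i \<bullet> q i"
  shows "mcol A I Lo TL w l"
proof -
  let ?K = "Mod_cat C A" and ?J = "cosp 0 1 (2::nat)"
  interpret K: category ?K by (rule category_Mod[OF A])
  interpret I: category I using I(1) by (simp add: small_cat_def)
  have abc: "(0::nat) \<noteq> 1" "(0::nat) \<noteq> 2" "(1::nat) \<noteq> 2" by auto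
  have J: "finite_cat ?J" using category_cosp[OF abc] by (auto simp: finite_cat_def) (auto simp: cosp_def split: if_splits)
  note cJ = category_cosp[OF abc]
  have OJ: "j \<in> Ob ?J \<longleftrightarrow> j = 0 \<or> j = 1 \<or> j = 2" for j by (auto simp: cosp_def)
  have HJ: "v \<in> Hom ?J j j' \<longleftrightarrow> v = 2 \<and> (j = j' \<or> j' = 2)" for j j' v by (auto simp: cosp_def)
  have iJ: "idt ?J j = 2" for j by (simp add: cosp_def)
  note mX = msysD[OF sX] and mY = msysD[OF sY] and mZ = msysD[OF sZ] and mL = msysD[OF sL]
  define G where "G i j = cosp_ob 0 (1::nat) (Xo i) (Yo i) (Zo i) j" for i j
  have G: "G i 0 = Xo i" "G i 1 = Yo i" "G i 2 = Zo i" for i by (simp_all add: G_def cosp_ob_def)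
  \<comment> \<open>The diagram on the product of \<open>I\<close> with the cospan shape: within one
    corner the transition maps of its system, and between corners a leg \<open>f i\<close> or
    \<open>g i\<close> followed by a transition map of \<open>Zo\<close>.\<close>
  define FT where "FT i j i' j' (u :: 'u) = (if j = j' then (if j = 0 then TX i i' u else if j = 1 then TY i i' u else TZ i i' u)
      else if j = 0 then TZ i i' u \<bullet> f i else TZ i i' u \<bullet> g i)" for i j i' u and j' :: nat
  have FT: "FT i 0 i' 0 u = TX i i' u" "FT i 1 i' 1 u = TY i i' u" "FT i 2 i' 2 u = TZ i i' u"
     "FT i 0 i' 2 u = TZ i i' u \<bullet> f i" "FT i 1 i' 2 u = TZ i i' u \<bullet> g i" for i i' u by (simp_all add: FT_def)
  define Fo where "Fo = (\<lambda>x. G (fst x) (snd x))"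
  define PT where "PT = (\<lambda>x y (w :: 'u \<times> nat). FT (fst x) (snd x) (fst y) (snd y) (fst w))"
  have FTl: "lin A (G i j) (G i' j') (FT i j i' j' u)"
    if "i \<in> Ob I" "i' \<in> Ob I" "u \<in> Hom I i i'" "j \<in> Ob ?J" "j' \<in> Ob ?J" "v \<in> Hom ?J j j'" for i i' u j j' v
    using that(4-6) mX(2)[OF that(1-3)] mY(2)[OF that(1-3)] mZ(2)[OF that(1-3)]
      lin_comp[OF f[OF that(1)] mZ(2)[OF that(1-3)] mX(1)[OF that(1)] mZ(1)[OF that(1)] mZ(1)[OF that(2)]]
      lin_comp[OF g[OF that(1)] mZ(2)[OF that(1-3)] mY(1)[OF that(1)] mZ(1)[OF that(1)] mZ(1)[OF that(2)]]
    unfolding OJ HJ by (auto simp: G FT simp del: One_nat_def)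
  have FTid: "FT i j i j (idt I i) = ide (ucar (G i j))" if "i \<in> Ob I" "j \<in> Ob ?J" for i j
    using that(2) mX(3)[OF that(1)] mY(3)[OF that(1)] mZ(3)[OF that(1)] unfolding OJ by (auto simp: G FT simp del: One_nat_def)
  have FTc: "FT i j i'' j'' (u' \<cdot>\<^bsub>I\<^esub> u) = FT i' j' i'' j'' u' \<bullet> FT i j i' j' u"
    if h: "i \<in> Ob I" "i' \<in> Ob I" "i'' \<in> Ob I" "u \<in> Hom I i i'" "u' \<in> Hom I i' i''" and "j \<in> Ob ?J" "j' \<in> Ob ?J" "j'' \<in> Ob ?J"
      "v \<in> Hom ?J j j'" "v' \<in> Hom ?J j' j''" for i i' i'' u u' j j' j'' v v'
  proof -
    note n = nat(1)[OF h(1,2,4)] nat(2)[OF h(1,2,4)]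
    show ?thesis using that(6-10) mX(4)[OF h] mY(4)[OF h] mZ(4)[OF h] comp_reduce[OF n(1)] n(1) n(2)
      unfolding OJ HJ by (auto simp: FT simp del: One_nat_def)
  qed
  have sP: "msys A (prod_cat I ?J) Fo PT"
    unfolding msys_def
  proof (intro conjI ballI)
    fix x assume "x \<in> Ob (prod_cat I ?J)"
    then have x: "fst x \<in> Ob I" "snd x \<in> Ob ?J" by (auto simp: prod_cat_def)
    show "md A (Fo x)" using x mX(1) mY(1) mZ(1) unfolding OJ Fo_def by (auto simp: G simp del: One_nat_def)
    show "PT x x (idt (prod_cat I ?J) x) = ide (ucar (Fo x))" using FTid[OF x] by (simp add: PT_def Fo_def prod_cat_def)
    fix y w assume "y \<in> Ob (prod_cat I ?J)" "w \<in> Hom (prod_cat I ?J) x y"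
    then have y: "fst y \<in> Ob I" "snd y \<in> Ob ?J" "fst w \<in> Hom I (fst x) (fst y)" "snd w \<in> Hom ?J (snd x) (snd y)"
      by (auto simp: prod_cat_def)
    show "lin A (Fo x) (Fo y) (PT x y w)" unfolding Fo_def PT_def by (rule FTl[OF x(1) y(1,3) x(2) y(2,4)])
  next
    fix x y t w v assume "x \<in> Ob (prod_cat I ?J)" "y \<in> Ob (prod_cat I ?J)" "t \<in> Ob (prod_cat I ?J)"
      "w \<in> Hom (prod_cat I ?J) x y" "v \<in> Hom (prod_cat I ?J) y t"
    then have h: "fst x \<in> Ob I" "fst y \<in> Ob I" "fst t \<in> Ob I" "fst w \<in> Hom I (fst x) (fst y)" "fst v \<in> Hom I (fst y) (fst t)"
      "snd x \<in> Ob ?J" "snd y \<in> Ob ?J" "snd t \<in> Ob ?J" "snd w \<in> Hom ?J (snd x) (snd y)" "snd v \<in> Hom ?J (snd y) (snd t)"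
      by (auto simp: prod_cat_def)
    have "fst (v \<cdot>\<^bsub>prod_cat I ?J\<^esub> w) = fst v \<cdot>\<^bsub>I\<^esub> fst w" by (simp add: prod_cat_def)
    then show "PT x t (v \<cdot>\<^bsub>prod_cat I ?J\<^esub> w) = PT y t v \<bullet> PT x y w"
      using FTc[OF h] by (simp add: PT_def)
  qed
  define \<pi> where "\<pi> i j = (if j = 0 then aarr (p i) else if j = (1::nat) then aarr (q i) else aarr (f i) \<cdot> aarr (p i))" for i j
  define Co where "Co = cosp_ob 0 (1::nat) x y z"
  define \<iota> where "\<iota> i j = (if j = 0 then aarr (cx i) else if j = (1::nat) then aarr (cy i) else aarr (cz i))" for i j
  define \<rho> where "\<rho> j = (if j = 0 then aarr p' else if j = (1::nat) then aarr q' else aarr f' \<cdot> aarr p')" for j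
  have Co: "Co 0 = x" "Co 1 = y" "Co 2 = z" by (simp_all add: Co_def cosp_ob_def)
  note DX = mcolD[OF cX] and DY = mcolD[OF cY] and DZ = mcolD[OF cZ]
  have mul: "aarr (b \<bullet> a) = aarr b \<cdot> aarr a" if "lin A M N a" "lin A N P b" for M N P a b
    using linD(1-3)[OF that(1)] linD(1-3)[OF that(2)] by (simp add: aarr_comp)
  have H5: "is_limit ?K ?J (\<lambda>j. Fo (i, j)) (\<lambda>j j' v. aarr (PT (i, j) (i, j') (idt I i, v))) (Lo i) (\<pi> i)" if i: "i \<in> Ob I" for i
  proof -
    have fn: "is_functor ?J ?K (\<lambda>j. Fo (i, j)) (\<lambda>j j' v. aarr (PT (i, j) (i, j') (idt I i, v)))"
    proof (rule is_functor_cong[OF cJ msys_functor[OF A msys_cosp[OF abc mX(1)[OF i] mY(1)[OF i] mZ(1)[OF i] f[OF i] g[OF i]]]])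
      fix j j' v assume j: "j \<in> Ob ?J" "j' \<in> Ob ?J" "v \<in> Hom ?J j j'"
      have "FT i j i j' (idt I i) = cosp_ar 0 (f i) (g i) (cosp_ob 0 1 (Xo i) (Yo i) (Zo i)) j j'"
      proof (cases "j = j'")
        case True
        then show ?thesis using FTid[OF i j(1)] by (simp add: cosp_ar_def G_def)
      next
        case False
        note [simp] = linD(1-3)[OF f[OF i]] linD(1-3)[OF g[OF i]] mZ(3)[OF i]
        from False j have "j' = 2" "j = 0 \<or> j = 1" unfolding OJ HJ by blast+
        then show ?thesis by (elim disjE) (simp_all add: FT cosp_ar_def del: One_nat_def)
      qed
      then show "aarr (PT (i, j) (i, j') (idt I i, v)) = aarr (cosp_ar 0 (f i) (g i) (cosp_ob 0 1 (Xo i) (Yo i) (Zo i)) j j')"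
        by (simp add: PT_def del: One_nat_def)
    qed (simp add: Fo_def G_def)
    show ?thesis
      by (subst is_limit_Mod_cosp[OF abc mX(1)[OF i] mY(1)[OF i] mZ(1)[OF i] mL(1)[OF i] f[OF i] g[OF i] p[OF i] q[OF i] _ _ _ _ _ fn])
        (use pbi[OF i] mZ(3)[OF i] linD(1-3)[OF f[OF i]] linD(1-3)[OF g[OF i]] in
          \<open>simp_all add: Fo_def PT_def FT G \<pi>_def del: One_nat_def\<close>)
  qed
  have H7: "\<pi> i' j \<cdot> aarr (TL i i' u) = aarr (PT (i, j) (i', j) (u, idt ?J j)) \<cdot> \<pi> i j"
    if h: "i \<in> Ob I" "i' \<in> Ob I" "u \<in> Hom I i i'" and j: "j \<in> Ob ?J" for i i' u j
  proof -
    have "f i' \<bullet> (p i' \<bullet> TL i i' u) = TZ i i' u \<bullet> (f i \<bullet> p i)"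
      using comp_reduce[OF nat(1)[OF h], of "p i"] nat(3)[OF h] by simp
    from arg_cong[OF this, of aarr] have "(aarr (f i') \<cdot> aarr (p i')) \<cdot> aarr (TL i i' u) = aarr (TZ i i' u) \<cdot> (aarr (f i) \<cdot> aarr (p i))"
      using mul[OF lin_comp[OF mL(2)[OF h] p[OF h(2)] mL(1)[OF h(1)] mL(1)[OF h(2)] mX(1)[OF h(2)]] f[OF h(2)]]
        mul[OF mL(2)[OF h] p[OF h(2)]]
        mul[OF lin_comp[OF p[OF h(1)] f[OF h(1)] mL(1)[OF h(1)] mX(1)[OF h(1)] mZ(1)[OF h(1)]] mZ(2)[OF h]]
        mul[OF p[OF h(1)] f[OF h(1)]]
        mul[OF mL(2)[OF h] lin_comp[OF p[OF h(2)] f[OF h(2)] mL(1)[OF h(2)] mX(1)[OF h(2)] mZ(1)[OF h(2)]]]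
        mul[OF p[OF h(2)] f[OF h(2)]] by simp
    then show ?thesis using j nat(3,4)[OF h] mul[OF mL(2)[OF h] p[OF h(2)]] mul[OF mL(2)[OF h] q[OF h(2)]]
        mul[OF p[OF h(1)] mX(2)[OF h]] mul[OF q[OF h(1)] mY(2)[OF h]]
      unfolding OJ by (auto simp: \<pi>_def PT_def FT simp del: One_nat_def)
  qed
  have H8: "is_colimit ?K I (\<lambda>i. Fo (i, j)) (\<lambda>i i' u. aarr (PT (i, j) (i', j) (u, idt ?J j))) (Co j) (\<lambda>i. \<iota> i j)" if "j \<in> Ob ?J" for j
    using that mcol_is_colimit[OF I(1) sX A cX] mcol_is_colimit[OF I(1) sY A cY] mcol_is_colimit[OF I(1) sZ A cZ]
    unfolding OJ by (auto simp: Fo_def PT_def FT G Co \<iota>_def simp del: One_nat_def)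
  let ?Ca = "\<lambda>j j' v. aarr (cosp_ar 0 f' g' Co j j')"
  have H9: "is_functor ?J ?K Co ?Ca" unfolding Co_def
    by (rule msys_functor[OF A msys_cosp[OF abc DX(1) DY(1) DZ(1) f'(1) g'(1)]])
  have H10: "?Ca j j' v \<cdot> \<iota> i j = \<iota> i j' \<cdot> aarr (PT (i, j) (i, j') (idt I i, v))"
    if i: "i \<in> Ob I" and j: "j \<in> Ob ?J" "j' \<in> Ob ?J" "v \<in> Hom ?J j j'" for i j j' v
  proof -
    note n = mul[OF DX(2)[OF i] f'(1)] mul[OF DY(2)[OF i] g'(1)] mul[OF f[OF i] DZ(2)[OF i]] mul[OF g[OF i] DZ(2)[OF i]]
    have id: "aarr (ide (ucar N)) \<cdot> aarr a = aarr a" "aarr a \<cdot> aarr (ide (ucar M)) = aarr a" if "lin A M N a" "md A M" "md A N" for M N a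
      using that mul[OF that(1) lin_ide[OF that(3)]] mul[OF lin_ide[OF that(2)] that(1)] linD(1-3)[OF that(1)] by simp_all
    show ?thesis using j f'(2)[OF i] g'(2)[OF i] n id[OF DX(2)[OF i] mX(1)[OF i] DX(1)] id[OF DY(2)[OF i] mY(1)[OF i] DY(1)]
        id[OF DZ(2)[OF i] mZ(1)[OF i] DZ(1)] mX(3)[OF i] mY(3)[OF i] mZ(3)[OF i] linD(1-3)[OF f[OF i]] linD(1-3)[OF g[OF i]]
      unfolding OJ HJ by (auto simp: \<iota>_def PT_def FT Co cosp_ar_def simp del: One_nat_def)
  qed
  \<comment> \<open>The colimit of the pullbacks. The exactness assumption makes its comparison map
    \<open>h\<close> to the pullback \<open>w\<close> of the colimits invertible, and transport
    along \<open>h\<close> shows \<open>l\<close> to be a colimit cocone.\<close>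
  obtain P \<kappa> where P: "mcol A I Lo TL P \<kappa>" by (rule mcol_ex[OF I(1) sL A])
  note DP = mcolD[OF P]
  have H12: "is_limit ?K ?J Co ?Ca w \<rho>"
    by (subst is_limit_Mod_cosp[OF abc DX(1) DY(1) DZ(1) w(1) f'(1) g'(1) w(2,3) Co _ _ H9])
      (use w(4) in \<open>simp_all add: cosp_ar_def \<rho>_def\<close>)
  have "l j \<bullet> TL i j u = l i" if h: "i \<in> Ob I" "j \<in> Ob I" "u \<in> Hom I i j" for i j u
  proof (rule pb_eq[OF w(4)])
    note [simp] = linD(1-3)[OF l(1)[OF h(1)]] linD(1-3)[OF l(1)[OF h(2)]] linD(1-3)[OF mL(2)[OF h]] linD(1-3)[OF w(2)]
    show "p' \<bullet> (l j \<bullet> TL i j u) = p' \<bullet> l i"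
      using comp_reduce[OF l(2)[OF h(2)], of "TL i j u"] nat(3)[OF h] comp_reduce[OF DX(4)[OF h], of "p i"] l(2)[OF h(1)] by simp
    show "q' \<bullet> (l j \<bullet> TL i j u) = q' \<bullet> l i"
      using comp_reduce[OF l(3)[OF h(2)], of "TL i j u"] nat(4)[OF h] comp_reduce[OF DY(4)[OF h], of "q i"] l(3)[OF h(1)] by simp
  qed (use linD(1-3)[OF l(1)[OF h(1)]] linD(1-3)[OF l(1)[OF h(2)]] linD(1-3)[OF mL(2)[OF h]] linD(1-3)[OF w(2)] in simp_all)
  note lT = this
  obtain h where h: "lin A P w h" "\<forall>i\<in>Ob I. h \<bullet> \<kappa> i = l i"
    by (rule mcol_factor[OF I(1) sL P w(1) l(1) lT])
  have H14: "\<rho> j \<cdot> (aarr h \<cdot> aarr (\<kappa> i)) = \<iota> i j \<cdot> \<pi> i j" if i: "i \<in> Ob I" and j: "j \<in> Ob ?J" for i j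
  proof -
    have e: "aarr h \<cdot> aarr (\<kappa> i) = aarr (l i)" using mul[OF DP(2)[OF i] h(1)] h(2) i by simp
    have "f' \<bullet> (p' \<bullet> l i) = cz i \<bullet> (f i \<bullet> p i)"
      using l(2)[OF i] comp_reduce[OF f'(2)[OF i], of "p i"] by simp
    from arg_cong[OF this, of aarr] have "(aarr f' \<cdot> aarr p') \<cdot> aarr (l i) = aarr (cz i) \<cdot> (aarr (f i) \<cdot> aarr (p i))"
      using mul[OF l(1)[OF i] lin_comp[OF w(2) f'(1) w(1) DX(1) DZ(1)]] mul[OF w(2) f'(1)]
        mul[OF lin_comp[OF p[OF i] f[OF i] mL(1)[OF i] mX(1)[OF i] mZ(1)[OF i]] DZ(2)[OF i]] mul[OF p[OF i] f[OF i]] by simp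
    then show ?thesis using j l(2,3)[OF i] mul[OF l(1)[OF i] w(2)] mul[OF l(1)[OF i] w(3)] mul[OF p[OF i] DX(2)[OF i]] mul[OF q[OF i] DY(2)[OF i]]
      unfolding OJ e by (auto simp: \<rho>_def \<iota>_def \<pi>_def simp del: One_nat_def)
  qed
  have "is_iso ?K P w (aarr h)"
    by (rule filtered_exact[OF A, unfolded filtered_colimits_commute_with_finite_limits_def, rule_format,
          OF I J msys_functor[OF A sP], of Lo \<pi> "\<lambda>i j u. aarr (TL i j u)" Co \<iota> ?Ca P "\<lambda>i. aarr (\<kappa> i)" w \<rho> "aarr h"])
       (use H5 H7 H8 H9 H10 H12 H14 msys_functor[OF A sL] mcol_is_colimit[OF I(1) sL A P] Hom_lin[OF h(1) DP(1) w(1)] in simp_all)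
  then obtain j' where j': "j' \<in> Hom ?K w P" "j' \<cdot> aarr h = idt C (ucar P)" "aarr h \<cdot> j' = idt C (ucar w)"
    unfolding is_iso_def by auto
  let ?j = "Ar (ucar w) j' (ucar P)"
  have jl: "lin A w P ?j" using j' lin_Hom[OF w(1) DP(1)] by simp
  have "iso_ar h"
    by (rule iso_arI[of _ ?j], unfold inverses_def, intro conjI ar_eqI)
      (use linD(1-3)[OF jl] linD(1-3)[OF h(1)] j' md_simps(3)[OF w(1)] md_simps(3)[OF DP(1)] in \<open>simp_all add: aarr_comp aarr_structure del: arr_Ar\<close>)
  from colim_iso[OF DP(3) this] have "colim I (\<lambda>i. ucar (Lo i)) TL (ucar w) (\<lambda>i. h \<bullet> \<kappa> i)"
    using linD(1-3)[OF h(1)] by simp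
  then have "colim I (\<lambda>i. ucar (Lo i)) TL (ucar w) l"
    using h(2) by (subst (asm) colim_cong[of _ _ "\<lambda>i. ucar (Lo i)" _ TL _ l]) auto
  then show ?thesis unfolding mcol_def using w(1) l(1) by simp
qed

end

section \<open>Finitely generated modules\<close>

lemma quotient_map_const:
  assumes E: "E = (R \<union> R\<inverse>)\<^sup>*" and R: "\<And>p q. (p, q) \<in> R \<Longrightarrow> p \<in> S \<and> q \<in> S \<and> \<phi> p = \<phi> q" and p: "p \<in> S" "(p, q) \<in> E"
  shows "q \<in> S \<and> \<phi> q = \<phi> p"
  using p(2) unfolding E
proof (induction rule: rtrancl_induct)
  case base
  then show ?case using p(1) by simp
next
  case (step y z)
  then show ?case using R[of y z] R[of z y] by auto
qed

text \<open>\<open>set_colimit\<close> is a quotient by the equivalence relation that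
  \<open>R\<close> generates. The comparison map is induced by \<phi>, which is constant on classes
  by \<open>quotient_map_const\<close>.\<close>

lemma quotient_map_bij:
  assumes R: "\<And>p q. (p, q) \<in> R \<Longrightarrow> p \<in> S \<and> q \<in> S \<and> \<phi> p = \<phi> q"
  shows "bij_betw (\<lambda>X. the_elem (\<phi> ` X)) (S // (R \<union> R\<inverse>)\<^sup>*) H \<longleftrightarrow>
    \<phi> ` S = H \<and> (\<forall>p\<in>S. \<forall>q\<in>S. \<phi> p = \<phi> q \<longrightarrow> (p, q) \<in> (R \<union> R\<inverse>)\<^sup>*)" (is "bij_betw ?m (S // ?E) H \<longleftrightarrow> _")
proof -
  have m: "?m (?E `` {p}) = \<phi> p" if "p \<in> S" for p
  proof -
    have "\<phi> ` (?E `` {p}) = {\<phi> p}"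
    proof (intro equalityI subsetI)
      fix y assume "y \<in> \<phi> ` (?E `` {p})"
      then obtain q where q: "(p, q) \<in> ?E" "y = \<phi> q" by blast
      have "\<phi> q = \<phi> p" by (rule conjunct2[OF quotient_map_const[OF refl _ that q(1)]]) (rule R)
      then show "y \<in> {\<phi> p}" using q(2) by blast
    next
      fix y assume "y \<in> {\<phi> p}"
      then show "y \<in> \<phi> ` (?E `` {p})" by blast
    qed
    then show ?thesis by simp
  qed
  have sy: "sym ?E" by (intro sym_rtrancl sym_Un_converse)
  have cls: "?E `` {p} = ?E `` {q} \<longleftrightarrow> (p, q) \<in> ?E" for p q
  proof
    assume "?E `` {p} = ?E `` {q}"
    moreover have "q \<in> ?E `` {q}" by simp
    ultimately show "(p, q) \<in> ?E" by blast
  next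
    assume e: "(p, q) \<in> ?E"
    then have "(q, p) \<in> ?E" using symD[OF sy] by blast
    then show "?E `` {p} = ?E `` {q}" using rtrancl_trans[OF e] rtrancl_trans[of q p "R \<union> R\<inverse>"] by blast
  qed
  have "?m ` (S // ?E) = \<phi> ` S" using m by (force simp: quotient_def image_iff)
  moreover have "inj_on ?m (S // ?E) \<longleftrightarrow> (\<forall>p\<in>S. \<forall>q\<in>S. \<phi> p = \<phi> q \<longrightarrow> (p, q) \<in> ?E)"
    unfolding inj_on_def quotient_def using m cls by auto
  ultimately show ?thesis unfolding bij_betw_def by blast
qed

text \<open>Splits the comparison map into surjectivity and injectivity, which later have entirely
  different sources.\<close>

lemma (in category) hom_comparison_bij_iff:
  assumes F: "is_functor J K Fo Fa" and c: "is_cocone K J Fo Fa l c" and n: "n \<in> Ob K"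
  defines "R \<equiv> {((i, x), (j, Fa i j u \<cdot> x)) | i j u x. i \<in> Ob J \<and> j \<in> Ob J \<and> u \<in> Hom J i j \<and> x \<in> Hom K n (Fo i)}"
  shows "hom_comparison_bij K n J Fo Fa l c \<longleftrightarrow>
    (\<forall>h\<in>Hom K n l. \<exists>i\<in>Ob J. \<exists>x\<in>Hom K n (Fo i). c i \<cdot> x = h) \<and>
    (\<forall>i\<in>Ob J. \<forall>j\<in>Ob J. \<forall>x\<in>Hom K n (Fo i). \<forall>y\<in>Hom K n (Fo j). c i \<cdot> x = c j \<cdot> y \<longrightarrow> ((i, x), (j, y)) \<in> (R \<union> R\<inverse>)\<^sup>*)"
proof -
  let ?S = "SIGMA i:Ob J. Hom K n (Fo i)" and ?\<phi> = "\<lambda>(i, x). c i \<cdot> x"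
  have ob: "Fo i \<in> Ob K" if "i \<in> Ob J" for i using F that by (simp add: is_functor_def)
  have l: "l \<in> Ob K" and cH: "\<And>i. i \<in> Ob J \<Longrightarrow> c i \<in> Hom K (Fo i) l"
    and ct: "\<And>i j u. \<lbrakk>i \<in> Ob J; j \<in> Ob J; u \<in> Hom J i j\<rbrakk> \<Longrightarrow> c j \<cdot> Fa i j u = c i"
    using c unfolding is_cocone_def by auto
  have "p \<in> ?S \<and> q \<in> ?S \<and> ?\<phi> p = ?\<phi> q" if "(p, q) \<in> R" for p q
  proof -
    obtain i j u x where h: "p = (i, x)" "q = (j, Fa i j u \<cdot> x)" "i \<in> Ob J" "j \<in> Ob J" "u \<in> Hom J i j" "x \<in> Hom K n (Fo i)"
      using \<open>(p, q) \<in> R\<close> unfolding R_def by blast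
    have f: "Fa i j u \<in> Hom K (Fo i) (Fo j)" using F h by (simp add: is_functor_def)
    then have "Fa i j u \<cdot> x \<in> Hom K n (Fo j)" by (rule cmp_Hom[OF n ob[OF h(3)] ob[OF h(4)] h(6)])
    then show ?thesis using h ct[OF h(3-5)] cmp_assoc[OF n ob[OF h(3)] ob[OF h(4)] l h(6) f cH[OF h(4)]] by simp
  qed
  note B = quotient_map_bij[of R ?S ?\<phi> "Hom K n l", OF this]
  have sub: "?\<phi> ` ?S \<subseteq> Hom K n l"
  proof clarify
    fix i x assume "i \<in> Ob J" "x \<in> Hom K n (Fo i)"
    then show "c i \<cdot> x \<in> Hom K n l" using cmp_Hom[OF n ob l _ cH] by blast
  qed
  have "hom_comparison_bij K n J Fo Fa l c \<longleftrightarrow> bij_betw (\<lambda>X. the_elem (?\<phi> ` X)) (?S // (R \<union> R\<inverse>)\<^sup>*) (Hom K n l)"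
    unfolding hom_comparison_bij_def set_colimit_def Let_def R_def ..
  also have "\<dots> \<longleftrightarrow> Hom K n l \<subseteq> ?\<phi> ` ?S \<and> (\<forall>p\<in>?S. \<forall>q\<in>?S. ?\<phi> p = ?\<phi> q \<longrightarrow> (p, q) \<in> (R \<union> R\<inverse>)\<^sup>*)"
  proof -
    have e: "?\<phi> ` ?S = Hom K n l \<longleftrightarrow> Hom K n l \<subseteq> ?\<phi> ` ?S" using sub by (simp add: set_eq_subset)
    show ?thesis by (rule trans[OF B arg_cong2[OF e refl, of "(\<and>)"]])
  qed
  also have "\<dots> \<longleftrightarrow> (\<forall>h\<in>Hom K n l. \<exists>i\<in>Ob J. \<exists>x\<in>Hom K n (Fo i). c i \<cdot> x = h) \<and>
    (\<forall>i\<in>Ob J. \<forall>j\<in>Ob J. \<forall>x\<in>Hom K n (Fo i). \<forall>y\<in>Hom K n (Fo j). c i \<cdot> x = c j \<cdot> y \<longrightarrow> ((i, x), (j, y)) \<in> (R \<union> R\<inverse>)\<^sup>*)"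
  proof -
    have "h \<in> ?\<phi> ` ?S \<longleftrightarrow> (\<exists>i\<in>Ob J. \<exists>x\<in>Hom K n (Fo i). c i \<cdot> x = h)" for h by force
    moreover have "(\<forall>p\<in>?S. Q p) \<longleftrightarrow> (\<forall>i\<in>Ob J. \<forall>x\<in>Hom K n (Fo i). Q (i, x))" for Q by auto
    ultimately show ?thesis by (simp only: subset_iff) auto
  qed
  finally show ?thesis .
qed

section \<open>Filtered categories and cofinal subcategories\<close>

lemma filtered_finite:
  assumes J: "filtered_cat J" and W: "finite W" "\<And>w. w \<in> W \<Longrightarrow> \<exists>i\<in>Ob J. P w i"
    and mono: "\<And>w i j u. \<lbrakk>w \<in> W; i \<in> Ob J; j \<in> Ob J; u \<in> Hom J i j; P w i\<rbrakk> \<Longrightarrow> P w j"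
  shows "\<exists>i\<in>Ob J. \<forall>w\<in>W. P w i"
  using W mono
proof (induction W rule: finite_induct)
  case empty
  then show ?case using J by (auto simp: filtered_cat_def)
next
  case (insert w W)
  have "\<exists>i\<in>Ob J. \<forall>w\<in>W. P w i" using insert.IH insert.prems by blast
  then obtain i where i: "i \<in> Ob J" "\<forall>w\<in>W. P w i" by blast
  obtain j where j: "j \<in> Ob J" "P w j" using insert.prems(1) by blast
  obtain k u v where k: "k \<in> Ob J" "u \<in> Hom J i k" "v \<in> Hom J j k" using J i(1) j(1) unfolding filtered_cat_def by blast
  have "P w k" using insert.prems(2)[of w j k v] j k by blast
  moreover have "P w' k" if "w' \<in> W" for w' using insert.prems(2)[of w' i k u] i k that by blast
  ultimately show ?case using k(1) by blast
qed

lemma small_subset: "\<lbrakk>small U T; S \<subseteq> T\<rbrakk> \<Longrightarrow> small U S"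
  unfolding small_def using lesspoll_trans1 subset_imp_lepoll by blast

text \<open>Cofinal in \<open>J\<close> if \<open>J\<close> is filtered.\<close>

definition above :: "('u, 'u) cat \<Rightarrow> 'u \<Rightarrow> ('u, 'u) cat" where
  "above J k = J\<lparr>Ob := {i \<in> Ob J. Hom J k i \<noteq> {}}\<rparr>"

lemma above_simps [simp]: "Hom (above J k) = Hom J" "idt (above J k) = idt J" "cmp (above J k) = cmp J"
  "i \<in> Ob (above J k) \<longleftrightarrow> i \<in> Ob J \<and> Hom J k i \<noteq> {}"
  by (simp_all add: above_def)

lemma category_above: assumes "category J" shows "category (above J k)"
proof -
  interpret J: category J by (rule assms)
  show ?thesis by unfold_locales (auto intro: J.idt_Hom J.cmp_Hom J.idt_left J.idt_right J.cmp_assoc)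
qed

lemma small_cat_above: "small_cat U J \<Longrightarrow> small_cat U (above J k)"
  unfolding small_cat_def
proof (elim conjE, intro conjI ballI)
  assume J: "category J" "Ob J \<subseteq> U" "small U (Ob J)"
    and H: "\<forall>i\<in>Ob J. \<forall>j\<in>Ob J. Hom J i j \<subseteq> U \<and> small U (Hom J i j)"
  have sub: "Ob (above J k) \<subseteq> Ob J" by auto
  show "category (above J k)" by (rule category_above[OF J(1)])
  show "Ob (above J k) \<subseteq> U" using sub J(2) by (rule subset_trans)
  show "small U (Ob (above J k))" by (rule small_subset[OF J(3) sub])
  fix i j assume "i \<in> Ob (above J k)" "j \<in> Ob (above J k)"
  then show "Hom (above J k) i j \<subseteq> U" "small U (Hom (above J k) i j)" using H by simp_all
qed

lemma above_upper:
  assumes J: "category J" "filtered_cat J" and k: "k \<in> Ob J" and i: "i \<in> Ob J" "j \<in> Ob J"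
  obtains m u v where "m \<in> Ob (above J k)" "u \<in> Hom J i m" "v \<in> Hom J j m"
proof -
  interpret J: category J by (rule J)
  obtain n a b where n: "n \<in> Ob J" "a \<in> Hom J i n" "b \<in> Hom J j n" using J(2) i unfolding filtered_cat_def by blast
  obtain m u v where m: "m \<in> Ob J" "u \<in> Hom J n m" "v \<in> Hom J k m" using J(2) n(1) k unfolding filtered_cat_def by blast
  show ?thesis
    by (rule that[of m "u \<cdot>\<^bsub>J\<^esub> a" "u \<cdot>\<^bsub>J\<^esub> b"]) (use J.cmp_Hom i n m in auto)
qed

lemma above_equalize:
  assumes J: "category J" "filtered_cat J" and k: "k \<in> Ob J" and j: "i \<in> Ob J" "j \<in> Ob (above J k)" "u \<in> Hom J i j" "v \<in> Hom J i j"
  obtains m w where "m \<in> Ob (above J k)" "w \<in> Hom J j m" "w \<cdot>\<^bsub>J\<^esub> u = w \<cdot>\<^bsub>J\<^esub> v"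
proof -
  interpret J: category J by (rule J)
  have jJ: "j \<in> Ob J" using j(2) by simp
  obtain m w where m: "m \<in> Ob J" "w \<in> Hom J j m" "w \<cdot>\<^bsub>J\<^esub> u = w \<cdot>\<^bsub>J\<^esub> v"
    using J(2) j(1,3,4) jJ unfolding filtered_cat_def by blast
  have "Hom J k m \<noteq> {}" using j(2) J.cmp_Hom[OF k jJ m(1) _ m(2)] by auto
  then show ?thesis using that[of m w] m by simp
qed

lemma filtered_above: assumes J: "category J" "filtered_cat J" and k: "k \<in> Ob J"
  shows "filtered_cat (above J k)"
  unfolding filtered_cat_def
proof (intro conjI ballI)
  interpret J: category J by (rule J)
  have "k \<in> Ob (above J k)" using k J.idt_Hom by auto
  then show "Ob (above J k) \<noteq> {}" by blast
  fix i j assume ij: "i \<in> Ob (above J k)" "j \<in> Ob (above J k)"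
  then have ij': "i \<in> Ob J" "j \<in> Ob J" by auto
  obtain m u v where "m \<in> Ob (above J k)" "u \<in> Hom J i m" "v \<in> Hom J j m" by (rule above_upper[OF J k ij'])
  then show "\<exists>m\<in>Ob (above J k). Hom (above J k) i m \<noteq> {} \<and> Hom (above J k) j m \<noteq> {}" by (intro bexI[of _ m]) auto
  fix u v assume "u \<in> Hom (above J k) i j" "v \<in> Hom (above J k) i j"
  then have uv: "u \<in> Hom J i j" "v \<in> Hom J i j" by auto
  obtain m w where "m \<in> Ob (above J k)" "w \<in> Hom J j m" "w \<cdot>\<^bsub>J\<^esub> u = w \<cdot>\<^bsub>J\<^esub> v"
    by (rule above_equalize[OF J k ij'(1) ij(2) uv])
  then show "\<exists>m\<in>Ob (above J k). \<exists>w\<in>Hom (above J k) j m. w \<cdot>\<^bsub>above J k\<^esub> u = w \<cdot>\<^bsub>above J k\<^esub> v"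
    by (intro bexI[of _ m] bexI[of _ w]) auto
qed

context geometry
begin

notation comp (infixr "\<bullet>" 70)
notation tns (infixr "**" 75)

lemma msys_above: "msys A J Fo T \<Longrightarrow> msys A (above J k) Fo T"
  unfolding msys_def by simp

text \<open>Cofinality: each index has an arrow into the subcategory, and any two such arrows become
  equal further on. So a cocone on the subcategory extends to \<open>J\<close> by composition with
  chosen arrows.\<close>

lemma mcol_above:
  assumes J: "category J" "filtered_cat J" and k: "k \<in> Ob J" and s: "msys A J Fo T" and c: "mcol A J Fo T L c"
  shows "mcol A (above J k) Fo T L c"
proof -
  interpret J: category J by (rule J)
  note D = mcolD[OF c] and S = msysD[OF s]
  note C = cocD[OF colim_coc[OF D(3)]]
  let ?A = "above J k" and ?X = "\<lambda>i. ucar (Fo i)"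
  have up: "\<exists>m u. m \<in> Ob ?A \<and> u \<in> Hom J i m" if i: "i \<in> Ob J" for i
  proof -
    obtain m u v where "m \<in> Ob ?A" "u \<in> Hom J i m" "v \<in> Hom J i m" by (rule above_upper[OF J k i i])
    then show ?thesis by blast
  qed
  have "colim ?A ?X T (ucar L) c"
    unfolding colim_def
  proof (intro conjI allI impI)
    show "coc ?A ?X T (ucar L) c" using C by (simp add: coc_def)
  next
    fix m d assume d: "coc ?A ?X T m d"
    note E = cocD[OF d]
    \<comment> \<open>The composite does not depend on the arrow into the subcategory: the two
      targets are joined by going further, and the resulting parallel arrows are equalized.\<close>
    have ind: "d n \<bullet> T i n u = d n' \<bullet> T i n' u'"
      if i: "i \<in> Ob J" and n: "n \<in> Ob ?A" "u \<in> Hom J i n" "n' \<in> Ob ?A" "u' \<in> Hom J i n'" for i n u n' u'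
    proof -
      have nJ: "n \<in> Ob J" "n' \<in> Ob J" using n by auto
      obtain p a b where p: "p \<in> Ob ?A" "a \<in> Hom J n p" "b \<in> Hom J n' p" by (rule above_upper[OF J k nJ])
      have pJ: "p \<in> Ob J" using p by auto
      have au: "a \<cdot>\<^bsub>J\<^esub> u \<in> Hom J i p" "b \<cdot>\<^bsub>J\<^esub> u' \<in> Hom J i p"
        using J.cmp_Hom[OF i nJ(1) pJ n(2) p(2)] J.cmp_Hom[OF i nJ(2) pJ n(4) p(3)] .
      obtain r w where r: "r \<in> Ob ?A" "w \<in> Hom J p r" "w \<cdot>\<^bsub>J\<^esub> (a \<cdot>\<^bsub>J\<^esub> u) = w \<cdot>\<^bsub>J\<^esub> (b \<cdot>\<^bsub>J\<^esub> u')"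
        by (rule above_equalize[OF J k i p(1) au])
      have rJ: "r \<in> Ob J" using r by auto
      have "d n \<bullet> T i n u = (d r \<bullet> T p r w) \<bullet> (T n p a \<bullet> T i n u)"
        using E(5)[of n p a] E(5)[of p r w] n p r comp_reduce[of "d p" "T n p a" "d n" "T i n u"] by simp
      also have "\<dots> = d r \<bullet> T i r (w \<cdot>\<^bsub>J\<^esub> (a \<cdot>\<^bsub>J\<^esub> u))"
        using S(4)[OF i nJ(1) pJ n(2) p(2)] S(4)[OF i pJ rJ au(1) r(2)] by simp
      also have "\<dots> = (d r \<bullet> T p r w) \<bullet> (T n' p b \<bullet> T i n' u')"
        unfolding r(3) using S(4)[OF i nJ(2) pJ n(4) p(3)] S(4)[OF i pJ rJ au(2) r(2)] by simp
      also have "\<dots> = d n' \<bullet> T i n' u'"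
        using E(5)[of n' p b] E(5)[of p r w] n p r comp_reduce[of "d p" "T n' p b" "d n'" "T i n' u'"] by simp
      finally show ?thesis .
    qed
    define N where "N i = (SOME n. n \<in> Ob ?A \<and> Hom J i n \<noteq> {})" for i
    define V where "V i = (SOME u. u \<in> Hom J i (N i))" for i
    have N: "N i \<in> Ob ?A \<and> Hom J i (N i) \<noteq> {}" if "i \<in> Ob J" for i
      unfolding N_def by (rule someI_ex) (use up[OF that] in blast)
    have V: "V i \<in> Hom J i (N i)" if "i \<in> Ob J" for i
      unfolding V_def by (rule someI_ex) (use N[OF that] in blast)
    have NJ: "N i \<in> Ob J" if "i \<in> Ob J" for i using N[OF that] by simp
    define d' where "d' i = d (N i) \<bullet> T i (N i) (V i)" for i
    have "coc J ?X T m d'"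
      unfolding coc_def
    proof (intro conjI ballI)
      show "m \<in> Ob C" by (rule E)
      fix i assume i: "i \<in> Ob J"
      note [simp] = linD(1-3)[OF S(2)[OF i NJ[OF i] V[OF i]]] E(2-4)[OF conjunct1[OF N[OF i]]]
      show "arr (d' i)" "adom (d' i) = ?X i" "acod (d' i) = m" by (simp_all add: d'_def)
      fix j u assume j: "j \<in> Ob J" and u: "u \<in> Hom J i j"
      have "d' j \<bullet> T i j u = d (N j) \<bullet> T i (N j) (V j \<cdot>\<^bsub>J\<^esub> u)" using S(4)[OF i j NJ[OF j] u V[OF j]] by (simp add: d'_def)
      also have "\<dots> = d' i"
        unfolding d'_def by (rule ind[OF i _ J.cmp_Hom[OF i j NJ[OF j] u V[OF j]] _ V[OF i]]) (use N i j in auto)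
      finally show "d' j \<bullet> T i j u = d' i" .
    qed
    then obtain h where h: "arr h" "adom h = ucar L" "acod h = m" "\<forall>i\<in>Ob J. h \<bullet> c i = d' i" by (rule colim_ex[OF D(3)])
    have "d' i = d i" if i: "i \<in> Ob ?A" for i
    proof -
      have iJ: "i \<in> Ob J" using i by simp
      have "d' i = d i \<bullet> T i i (idt J i)" unfolding d'_def
        by (rule ind[OF iJ _ V[OF iJ] i J.idt_Hom[OF iJ]]) (use N[OF iJ] in simp)
      then show ?thesis using S(3)[OF iJ] E(2-4)[OF i] by simp
    qed
    then show "\<exists>h. arr h \<and> adom h = ucar L \<and> acod h = m \<and> (\<forall>i\<in>Ob ?A. h \<bullet> c i = d i)"
      using h by (intro exI[of _ h]) auto
  next
    fix h h' assume h: "arr h \<and> arr h' \<and> adom h = ucar L \<and> adom h' = ucar L \<and> acod h = acod h' \<and>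
       (\<forall>i\<in>Ob ?A. h \<bullet> c i = h' \<bullet> c i)"
    show "h = h'"
    proof (rule colim_eq[OF D(3)])
      fix i assume i: "i \<in> Ob J"
      obtain n u where n: "n \<in> Ob ?A" "u \<in> Hom J i n" using up[OF i] by blast
      have nJ: "n \<in> Ob J" using n by simp
      have "h \<bullet> c n = h' \<bullet> c n" using h n by blast
      from comp_reduce[OF this, of "T i n u"] show "h \<bullet> c i = h' \<bullet> c i" using D(4)[OF i nJ n(2)] by simp
    qed (use h in simp_all)
  qed
  then show ?thesis using D by (simp add: mcol_def)
qed

text \<open>As the transition maps are monomorphisms, parallel arrows of the filtered category \<open>J\<close>
  act by the same map. So the system under the object \<open>k\<close> receives a monomorphism from the
  constant system \<open>Fo k\<close>, and its kernel pair is computed termwise.\<close>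

lemma mono_coprojection:
  assumes A: "comm_mon C A" and J: "small_cat U J" "filtered_cat J" and s: "msys A J Fo T" and c: "mcol A J Fo T L c"
    and mono: "\<And>i j u. \<lbrakk>i \<in> Ob J; j \<in> Ob J; u \<in> Hom J i j\<rbrakk> \<Longrightarrow> tmono (T i j u)" and k: "k \<in> Ob J"
  shows "tmono (c k)"
proof -
  have cJ: "category J" using J(1) by (simp add: small_cat_def)
  interpret J: category J by (rule cJ)
  let ?A = "above J k" and ?N = "Fo k"
  note D = mcolD[OF c] and S = msysD[OF s]
  note N = S(1)[OF k]
  have indep: "T i j u = T i j v" if ij: "i \<in> Ob J" "j \<in> Ob J" and uv: "u \<in> Hom J i j" "v \<in> Hom J i j" for i j u v
  proof -
    obtain m w where m: "m \<in> Ob J" "w \<in> Hom J j m" "w \<cdot>\<^bsub>J\<^esub> u = w \<cdot>\<^bsub>J\<^esub> v"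
      using J(2) ij uv unfolding filtered_cat_def by blast
    have "T j m w \<bullet> T i j u = T j m w \<bullet> T i j v"
      using S(4)[OF ij(1,2) m(1) uv(1) m(2)] S(4)[OF ij(1,2) m(1) uv(2) m(2)] m(3) by simp
    then show ?thesis using linD(1-3)[OF S(2)[OF ij uv(1)]] linD(1-3)[OF S(2)[OF ij uv(2)]] linD(1-3)[OF S(2)[OF ij(2) m(1,2)]]
      by - (rule tmonoD[OF mono[OF ij(2) m(1,2)]], simp_all)
  qed
  define e where "e i = T k i (SOME u. u \<in> Hom J k i)" for i
  have e: "e i = T k i u" if "i \<in> Ob J" "u \<in> Hom J k i" for i u
    unfolding e_def by (rule indep[OF k that(1) someI[of "\<lambda>u. u \<in> Hom J k i"] that(2)]) (rule that(2))
  have eA: "lin A ?N (Fo i) (e i)" "tmono (e i)" "c i \<bullet> e i = c k" if i: "i \<in> Ob ?A" for i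
  proof -
    obtain u where u: "i \<in> Ob J" "u \<in> Hom J k i" using i by auto
    show "lin A ?N (Fo i) (e i)" "tmono (e i)" "c i \<bullet> e i = c k"
      using e[OF u] S(2)[OF k u] mono[OF k u] D(4)[OF k u] by simp_all
  qed
  have en: "T i j u \<bullet> e i = e j" if ij: "i \<in> Ob ?A" "j \<in> Ob ?A" "u \<in> Hom ?A i j" for i j u
  proof -
    obtain v where v: "v \<in> Hom J k i" using ij by auto
    have ij': "i \<in> Ob J" "j \<in> Ob J" "u \<in> Hom J i j" using ij by auto
    show ?thesis using e[OF ij'(1) v] e[OF ij'(2) J.cmp_Hom[OF k ij'(1,2) v ij'(3)]] S(4)[OF k ij'(1,2) v ij'(3)] by simp
  qed
  note fA = filtered_above[OF cJ J(2) k] and sA = small_cat_above[OF J(1), of k]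
  note cN = mcol_const[OF fA N]
  note ck = D(2)[OF k]
  note [simp] = md_simps[OF N] linD(1-3)[OF ck]
  \<comment> \<open>The kernel pair of \<open>c k\<close>, with diagonal \<open>l\<close>. The
    termwise kernel pairs are trivial; their colimit is the constant value \<open>Fo k\<close> and,
    by exactness, also the kernel pair of \<open>c k\<close>. So \<open>l\<close> is an isomorphism
    and \<open>p = q\<close>.\<close>
  obtain p q where pq: "pb (c k) (c k) p q" by (rule pb_exists[of "c k" "c k"]) simp_all
  obtain w where w: "md A w" "ucar w = adom p" "lin A w ?N p" "lin A w ?N q"
    by (rule pb_module[OF N N D(1) ck ck pq])
  obtain l where l: "arr l" "adom l = ucar ?N" "acod l = adom p" "p \<bullet> l = ide (ucar ?N)" "q \<bullet> l = ide (ucar ?N)"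
    by (rule pb_ex[OF pq, of "ide (ucar ?N)" "ide (ucar ?N)"]) simp_all
  have ll: "lin A ?N w l" by (rule pb_lin[OF N N w(1) N pq w(3,4) l(1)]) (use l w(2) lin_ide[OF N] in simp_all)
  have "mcol A ?A (\<lambda>_. ?N) (\<lambda>_ _ _. ide (ucar ?N)) w (\<lambda>_. l)"
  proof (rule filtered_colimit_pullback[OF A sA fA cN(1) cN(1) msys_above[OF s] cN(1) eA(1) eA(1) lin_ide[OF N] lin_ide[OF N]
        _ _ _ _ _ cN(2) cN(2) mcol_above[OF cJ J(2) k s c] ck _ ck _ w(1,3,4) pq ll])
    fix i assume i: "i \<in> Ob ?A"
    note [simp] = linD(1-3)[OF eA(1)[OF i]]
    show "pb (e i) (e i) (ide (ucar ?N)) (ide (ucar ?N))" using eA(2)[OF i] by (simp add: tmono_pb)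
    show "c k \<bullet> ide (ucar ?N) = c i \<bullet> e i" using eA(3)[OF i] by simp
    then show "c k \<bullet> ide (ucar ?N) = c i \<bullet> e i" .
    fix j u assume j: "j \<in> Ob ?A" "u \<in> Hom ?A i j"
    note [simp] = linD(1-3)[OF eA(1)[OF j(1)]]
    show "T i j u \<bullet> e i = e j \<bullet> ide (ucar ?N)" using en[OF i j] by simp
    then show "T i j u \<bullet> e i = e j \<bullet> ide (ucar ?N)" .
  qed (use l in simp_all)
  from colim_uniq[OF mcolD(3)[OF cN(2)] mcolD(3)[OF this]]
  obtain h where h: "iso_ar h" "adom h = ucar ?N" "acod h = ucar w" "\<forall>i\<in>Ob ?A. h \<bullet> ide (ucar ?N) = l" by metis
  have kA: "k \<in> Ob ?A" using k J.idt_Hom[OF k] by auto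
  have "h = l" using h kA ainv_simps(1)[OF h(1)] by auto
  then have il: "iso_ar l" using h(1) by simp
  have "p = q" by (rule iso_cancel_right[OF il]) (use l pbD(3,4,8)[OF pq] in simp_all)
  show ?thesis
  proof (rule tmonoI)
    fix g h assume gh: "arr g" "arr h" "acod g = adom (c k)" "acod h = adom (c k)" "c k \<bullet> g = c k \<bullet> h"
    obtain t where "p \<bullet> t = g" "q \<bullet> t = h" by (rule pb_ex[OF pq gh])
    then show "g = h" using \<open>p = q\<close> by simp
  qed simp
qed

text \<open>Injectivity of the comparison map is automatic: the coprojections are monomorphisms, so
  two elements with the same image agree at every common later stage. What remains is surjectivity,
  a factorization through one stage.\<close>

lemma finitely_generated_iff:
  assumes N: "md A N"
  shows "finitely_generated U (Mod_cat C A) N \<longleftrightarrow>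
    (\<forall>J Fo T L c h. small_cat U J \<and> filtered_cat J \<and> msys A J Fo T \<and>
      (\<forall>i\<in>Ob J. \<forall>j\<in>Ob J. \<forall>u\<in>Hom J i j. tmono (T i j u)) \<and> mcol A J Fo T L c \<and> lin A N L h \<longrightarrow>
      (\<exists>i\<in>Ob J. \<exists>x. lin A N (Fo i) x \<and> c i \<bullet> x = h))" (is "_ \<longleftrightarrow> ?R")
proof -
  let ?K = "Mod_cat C A"
  have A: "comm_mon C A" by (rule md_simps(1)[OF N])
  interpret K: category ?K by (rule category_Mod[OF A])
  have NK: "N \<in> Ob ?K" using N by (simp add: Ob_Mod[OF A])
  show ?thesis
  proof
    assume fg: "finitely_generated U ?K N"
    show ?R
    proof (intro allI impI, elim conjE)
      fix J Fo T L c h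
      assume J: "small_cat U J" "filtered_cat J" and s: "msys A J Fo T"
        and mono: "\<forall>i\<in>Ob J. \<forall>j\<in>Ob J. \<forall>u\<in>Hom J i j. tmono (T i j u)" and c: "mcol A J Fo T L c" and h: "lin A N L h"
      note S = msysD[OF s] and D = mcolD[OF c]
      note F = msys_functor[OF A s] and cl = mcol_is_colimit[OF J(1) s A c]
      have "is_mono ?K (Fo i) (Fo j) (aarr (T i j u))" if "i \<in> Ob J" "j \<in> Ob J" "u \<in> Hom J i j" for i j u
        using is_mono_Mod[OF S(1)[OF that(1)] S(1)[OF that(2)]] Ar_aarr[OF S(2)[OF that]] S(2)[OF that] mono that by simp
      then have "hom_comparison_bij ?K N J Fo (\<lambda>i j u. aarr (T i j u)) L (\<lambda>i. aarr (c i))"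
        using fg J F cl unfolding finitely_generated_def by blast
      then have "\<forall>h\<in>Hom ?K N L. \<exists>i\<in>Ob J. \<exists>x\<in>Hom ?K N (Fo i). aarr (c i) \<cdot> x = h"
        using K.hom_comparison_bij_iff[OF F _ NK, of L "\<lambda>i. aarr (c i)"] cl by (simp add: is_colimit_def)
      then obtain i x where i: "i \<in> Ob J" and x: "x \<in> Hom ?K N (Fo i)" "aarr (c i) \<cdot> x = aarr h"
        using Hom_lin[OF h N D(1)] by blast
      let ?x = "Ar (ucar N) x (ucar (Fo i))"
      have xl: "lin A N (Fo i) ?x" using x(1) lin_Hom[OF N S(1)[OF i]] by simp
      have "c i \<bullet> ?x = h"
        using linD(1-3)[OF xl] linD(1-3)[OF D(2)[OF i]] linD(1-3)[OF h] x(2)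
        by (intro ar_eqI) (simp_all add: aarr_comp del: arr_Ar)
      then show "\<exists>i\<in>Ob J. \<exists>x. lin A N (Fo i) x \<and> c i \<bullet> x = h" using i xl by blast
    qed
  next
    assume R: ?R
    show "finitely_generated U ?K N" unfolding finitely_generated_def
    proof (intro conjI allI impI NK)
      fix J Fo Fa L c
      assume J: "small_cat U J" "filtered_cat J" and F: "is_functor J ?K Fo Fa"
        and mono: "\<forall>i\<in>Ob J. \<forall>j\<in>Ob J. \<forall>u\<in>Hom J i j. is_mono ?K (Fo i) (Fo j) (Fa i j u)"
        and cl: "is_colimit ?K J Fo Fa L c"
      define T where "T = (\<lambda>i j u. Ar (ucar (Fo i)) (Fa i j u) (ucar (Fo j)))"
      define c' where "c' = (\<lambda>i. Ar (ucar (Fo i)) (c i) (ucar L))"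
      have s: "msys A J Fo T" using functor_msys[OF A F] by (simp add: T_def)
      note S = msysD[OF s]
      have mT: "tmono (T i j u)" if "i \<in> Ob J" "j \<in> Ob J" "u \<in> Hom J i j" for i j u
        using is_mono_Mod[OF S(1)[OF that(1)] S(1)[OF that(2)], of "Fa i j u"] mono that by (simp add: T_def)
      have cm: "mcol A J Fo T L c'"
        using is_colimit_mcol[OF J(1) s A, of L c] cl by (simp add: T_def c'_def)
      note D = mcolD[OF cm]
      note mc = mono_coprojection[OF A J s cm mT]
      define Rl where "Rl = {((i, x), (j, Fa i j u \<cdot>\<^bsub>?K\<^esub> x)) | i j u x. i \<in> Ob J \<and> j \<in> Ob J \<and> u \<in> Hom J i j \<and> x \<in> Hom ?K N (Fo i)}"
      have sur: "\<exists>i\<in>Ob J. \<exists>x\<in>Hom ?K N (Fo i). c i \<cdot>\<^bsub>?K\<^esub> x = h" if h: "h \<in> Hom ?K N L" for h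
      proof -
        have "lin A N L (Ar (ucar N) h (ucar L))" using h lin_Hom[OF N D(1)] by simp
        then have "\<exists>i\<in>Ob J. \<exists>x. lin A N (Fo i) x \<and> c' i \<bullet> x = Ar (ucar N) h (ucar L)"
          using J s mT cm by (intro R[rule_format, of J Fo T L]) blast
        then obtain i x where i: "i \<in> Ob J" and x: "lin A N (Fo i) x" "c' i \<bullet> x = Ar (ucar N) h (ucar L)" by blast
        have "aarr (c' i \<bullet> x) = h" using x(2) by simp
        then have "c i \<cdot> aarr x = h" using linD(1-3)[OF x(1)] linD(1-3)[OF D(2)[OF i]] by (simp add: aarr_comp c'_def)
        then show ?thesis using i Hom_lin[OF x(1) N S(1)[OF i]] by auto
      qed
      have inj: "((i, x), (j, y)) \<in> (Rl \<union> Rl\<inverse>)\<^sup>*"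
        if ij: "i \<in> Ob J" "j \<in> Ob J" and xy: "x \<in> Hom ?K N (Fo i)" "y \<in> Hom ?K N (Fo j)" "c i \<cdot>\<^bsub>?K\<^esub> x = c j \<cdot>\<^bsub>?K\<^esub> y" for i j x y
      proof -
        obtain m u v where m: "m \<in> Ob J" "u \<in> Hom J i m" "v \<in> Hom J j m" using J(2) ij unfolding filtered_cat_def by blast
        let ?x = "Ar (ucar N) x (ucar (Fo i))" and ?y = "Ar (ucar N) y (ucar (Fo j))"
        have xl: "lin A N (Fo i) ?x" using xy(1) lin_Hom[OF N S(1)[OF ij(1)]] by simp
        have yl: "lin A N (Fo j) ?y" using xy(2) lin_Hom[OF N S(1)[OF ij(2)]] by simp
        note di = linD(1-3)[OF D(2)[OF ij(1)]] and dj = linD(1-3)[OF D(2)[OF ij(2)]] and dm = linD(1-3)[OF D(2)[OF m(1)]]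
          and dx = linD(1-3)[OF xl] and dy = linD(1-3)[OF yl] and du = linD(1-3)[OF S(2)[OF ij(1) m(1,2)]]
          and dv = linD(1-3)[OF S(2)[OF ij(2) m(1,3)]]
        have "c' i \<bullet> ?x = c' j \<bullet> ?y"
          by (rule ar_eqI) (use di dj dx dy xy(3) in \<open>simp_all add: aarr_comp c'_def del: arr_Ar\<close>)
        then have "c' m \<bullet> (T i m u \<bullet> ?x) = c' m \<bullet> (T j m v \<bullet> ?y)"
          using comp_reduce[OF D(4)[OF ij(1) m(1,2)], of ?x] comp_reduce[OF D(4)[OF ij(2) m(1,3)], of ?y] by simp
        then have "T i m u \<bullet> ?x = T j m v \<bullet> ?y"
          by - (rule tmonoD[OF mc[OF _ _ _ m(1)]], use dm dx dy du dv in \<open>simp_all del: arr_Ar\<close>)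
        then have "aarr (T i m u \<bullet> ?x) = aarr (T j m v \<bullet> ?y)" by simp
        then have e: "Fa i m u \<cdot>\<^bsub>?K\<^esub> x = Fa j m v \<cdot>\<^bsub>?K\<^esub> y" using dx dy du dv by (simp add: aarr_comp T_def del: arr_Ar)
        have "((i, x), (m, Fa i m u \<cdot>\<^bsub>?K\<^esub> x)) \<in> Rl" "((j, y), (m, Fa j m v \<cdot>\<^bsub>?K\<^esub> y)) \<in> Rl"
          unfolding Rl_def using ij m xy by blast+
        then have "((i, x), (m, Fa i m u \<cdot>\<^bsub>?K\<^esub> x)) \<in> Rl \<union> Rl\<inverse>" "((m, Fa i m u \<cdot>\<^bsub>?K\<^esub> x), (j, y)) \<in> Rl \<union> Rl\<inverse>"
          using e by auto
        then show ?thesis by (meson r_into_rtrancl rtrancl_trans)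
      qed
      show "hom_comparison_bij ?K N J Fo Fa L c"
        using K.hom_comparison_bij_iff[OF F _ NK, of L c, folded Rl_def] cl sur inj by (simp add: is_colimit_def)
    qed
  qed
qed

end

section \<open>Noetherian monoids\<close>

lemma (in category) is_mono_tmono:
  assumes "x \<in> Ob K" "y \<in> Ob K" shows "tmono (Ar x f y) \<Longrightarrow> is_mono K x y f"
  unfolding is_mono_def
proof (intro conjI ballI impI)
  assume m: "tmono (Ar x f y)"
  show f: "f \<in> Hom K x y" using tmono_arr[OF m] by simp
  fix t g h assume t: "t \<in> Ob K" "g \<in> Hom K t x" "h \<in> Hom K t x" "f \<cdot> g = f \<cdot> h"
  have "Ar t g x = Ar t h x" by (rule tmonoD[OF m]) (use t f assms in simp_all)
  then show "g = h" by simp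
qed

context category
begin

lemma pb_ide_right: assumes "arr n" shows "pb n (ide (acod n)) (ide (adom n)) n"
  unfolding pb_def
proof (intro conjI allI impI; (elim conjE)?)
  fix r s assume h: "arr r" "arr s" "acod r = adom n" "acod s = adom (ide (acod n))" "comp n r = comp (ide (acod n)) s"
  then have "s = comp n r" by simp
  then show "\<exists>!k. arr k \<and> adom k = adom r \<and> acod k = adom (ide (adom n)) \<and> comp (ide (adom n)) k = r \<and> comp n k = s"
    using h(1,3) by (intro ex1I[of _ r]) (simp_all, metis comp_ide_left)
qed (use assms in simp_all)

lemma pb_sym: assumes "pb g h p q" shows "pb h g q p"
proof -
  note P = pbD[OF assms]
  have "\<exists>!k. arr k \<and> adom k = adom r \<and> acod k = adom q \<and> comp q k = r \<and> comp p k = s"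
    if "arr r" "arr s" "acod r = adom h" "acod s = adom g" "comp h r = comp g s" for r s
  proof -
    have "adom r = adom s" using arg_cong[OF that(5), of adom] that(1-4) P(1,2) by simp
    then show ?thesis using pb_ex1[OF assms that(2,1,4,3) that(5)[symmetric]] P(8) by (simp add: conj_commute conj_left_commute)
  qed
  then show ?thesis unfolding pb_def using P by simp
qed

end

context geometry
begin

notation comp (infixr "\<bullet>" 70)
notation tns (infixr "**" 75)

text \<open>A system of \<open>B\<close>-modules restricts to a system of \<open>A\<close>-modules
  with the same colimit and the same monomorphisms. So a map out of the base change is factored by
  factoring its composite with \<open>q\<close> and extending the result.\<close>

lemma finitely_generated_univ:
  assumes fg: "finitely_generated U (Mod_cat C A) N'" and u: "univ A B f N' N q"
  shows "finitely_generated U (Mod_cat C B) N"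
  unfolding finitely_generated_iff[OF univD(3)[OF u]]
proof (intro allI impI, elim conjE)
  note V = univD[OF u]
  note f = V(1)
  fix J Fo T L c h
  assume J: "small_cat U J" "filtered_cat J" and s: "msys B J Fo T"
    and mono: "\<forall>i\<in>Ob J. \<forall>j\<in>Ob J. \<forall>u\<in>Hom J i j. tmono (T i j u)" and c: "mcol B J Fo T L c" and h: "lin B N L h"
  note S = msysD[OF s] and D = mcolD[OF c]
  have s': "msys A J (\<lambda>i. rm f (Fo i)) T"
    unfolding msys_def using S(3,4) md_rm[OF f S(1)] lin_rm[OF f S(1) S(1) S(2)] by simp
  have c': "mcol A J (\<lambda>i. rm f (Fo i)) T (rm f L) c"
    unfolding mcol_def using md_rm[OF f D(1)] lin_rm[OF f S(1) D(1) D(2)] D(3) by simp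
  have "lin A N' (rm f L) (h \<bullet> q)"
    by (rule lin_comp[OF V(4) lin_rm[OF f V(3) D(1) h] V(2) md_rm[OF f V(3)] md_rm[OF f D(1)]])
  then have "\<exists>i\<in>Ob J. \<exists>x. lin A N' (rm f (Fo i)) x \<and> c i \<bullet> x = h \<bullet> q"
    using fg[unfolded finitely_generated_iff[OF V(2)], rule_format, of J "\<lambda>i. rm f (Fo i)" T "rm f L" c "h \<bullet> q"] J s' c' mono by blast
  then obtain i x where i: "i \<in> Ob J" and x: "lin A N' (rm f (Fo i)) x" "c i \<bullet> x = h \<bullet> q" by blast
  obtain k where k: "lin B N (Fo i) k" "k \<bullet> q = x" by (rule univ_ex[OF u S(1)[OF i] x(1)])
  have "c i \<bullet> k = h"
    by (rule univ_eq[OF u D(1) lin_comp[OF k(1) D(2)[OF i] V(3) S(1)[OF i] D(1)] h]) (simp add: k(2) x(2))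
  then show "\<exists>i\<in>Ob J. \<exists>x. lin B N (Fo i) x \<and> c i \<bullet> x = h" using i k(1) by blast
qed

lemma noetherian_fg:
  assumes A: "noetherian_monoid U C A" and N: "md A N" and m: "lin A N (self_mdl A) m" "tmono m"
  shows "finitely_generated U (Mod_cat C A) N"
proof -
  have cA: "comm_mon C A" using A by (simp add: noetherian_monoid_def)
  have "is_mono (Mod_cat C A) N (self_mdl A) (aarr m)"
    using is_mono_Mod[OF N md_self[OF cA]] Ar_aarr[OF m(1)] m by simp
  then show ?thesis using A Ob_Mod[OF cA] N unfolding noetherian_monoid_def by blast
qed

lemma noetherianI:
  assumes A: "comm_mon C A" and h: "\<And>N m. \<lbrakk>md A N; lin A N (self_mdl A) m; tmono m\<rbrakk> \<Longrightarrow> finitely_generated U (Mod_cat C A) N"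
  shows "noetherian_monoid U C A"
  unfolding noetherian_monoid_def using A h Ob_Mod[OF A] is_mono_Mod[OF _ md_self[OF A]] by blast

text \<open>A submodule of \<open>B\<close> is the base change of its preimage in \<open>A\<close>.\<close>

lemma noetherian_flat_epi:
  assumes A: "noetherian_monoid U C A" and e: "mepi A B f" and fl: "flatU A B f"
  shows "noetherian_monoid U C B"
proof (rule noetherianI)
  have f: "mh A B f" using e by (simp add: mepi_def)
  note F = mh_simps[OF f]
  show "comm_mon C B" by (rule F)
  fix N n assume N: "md B N" and n: "lin B N (self_mdl B) n" "tmono n"
  note N1 = linD(1-3)[OF n(1)] and sA = md_self[OF F(1)] and sB = md_self[OF F(2)]
  have lf: "lin A (self_mdl A) (rm f (self_mdl B)) f" by (rule lin_mh[OF f])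
  have ln: "lin A (rm f N) (rm f (self_mdl B)) n" by (rule lin_rm[OF f N sB n(1)])
  \<comment> \<open>The preimage of \<open>N\<close> under \<open>f\<close>; as a submodule of the
    Noetherian monoid \<open>A\<close> it is finitely generated.\<close>
  obtain q p where qp: "pb n f q p" by (rule pb_exists[of n f]) (use N1 F in simp_all)
  obtain N' where N': "md A N'" "ucar N' = adom q" "lin A N' (rm f N) q" "lin A N' (self_mdl A) p"
    by (rule pb_module[OF md_rm[OF f N] sA md_rm[OF f sB] ln lf qp])
  have fg: "finitely_generated U (Mod_cat C A) N'"
    by (rule noetherian_fg[OF A N'(1,4) tmono_pullback[OF qp n(2)]])
  let ?Q = "bco A B f N'" and ?u = "bcu A B f N'"
  note u = univ_bc[OF f N'(1)]
  note V = univD[OF u]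
  obtain q' where q': "lin B ?Q N q'" "q' \<bullet> ?u = q" by (rule univ_ex[OF u N N'(3)])
  note rB = md_rm[OF f sB]
  have "lin A N' (rm f (self_mdl B)) (f \<bullet> p)" by (rule lin_comp[OF N'(4) lf N'(1) sA rB])
  then obtain p' where p': "lin B ?Q (self_mdl B) p'" "p' \<bullet> ?u = f \<bullet> p" by (rule univ_ex[OF u sB])
  \<comment> \<open>Flatness is applied to the preimage square. Since \<open>f\<close> is an
    epimorphism, the restrictions of \<open>N\<close> and \<open>B\<close> have \<open>N\<close> and
    \<open>B\<close> themselves as base changes. In the resulting pullback \<open>q'\<close> lies
    opposite to an identity, hence is an isomorphism.\<close>
  have "pb n (ide (mcar B)) q' p'"
    by (rule flatUD[OF fl md_rm[OF f N] sA rB N'(1) ln lf N'(3,4) qp mepi_univ[OF e N] univ_self[OF f] mepi_univ[OF e sB] u n(1) _ q'(1) p'(1)])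
      (use N1 linD(1-3)[OF N'(3)] F q'(2) p'(2) lin_ide[OF sB] in simp_all)
  moreover have "pb n (ide (mcar B)) (ide (ucar N)) n"
    using pb_ide_right[of n] N1 by simp
  ultimately obtain k where k: "iso_ar k" "adom k = adom (ide (ucar N))" "acod k = adom q'" "q' \<bullet> k = ide (ucar N)"
    by (rule pb_uniq)
  have "q' = ainv k"
  proof (rule iso_cancel_right[OF k(1)])
    note [simp] = ainv_simps[OF k(1)]
    show "q' \<bullet> k = ainv k \<bullet> k" using k by simp
  qed (use linD(1-3)[OF q'(1)] ainv_simps[OF k(1)] k in simp_all)
  then have "iso_ar q'" using iso_ar_ainv[OF k(1)] by simp
  from univ_iso[OF u q'(1) this N] have "univ A B f N' N q" using q'(2) by simp
  from finitely_generated_univ[OF fg this] show "finitely_generated U (Mod_cat C B) N" .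
qed

section \<open>Base change of colimits and descent\<close>

lemma mcol_iso:
  assumes c: "mcol A J Fo T L c" and m: "\<And>i. i \<in> Ob J \<Longrightarrow> md A (Fo i)" and k: "lin A L L' k" "iso_ar k" and L': "md A L'"
  shows "mcol A J Fo T L' (\<lambda>i. k \<bullet> c i)"
proof -
  note D = mcolD[OF c]
  have "colim J (\<lambda>i. ucar (Fo i)) T (ucar L') (\<lambda>i. k \<bullet> c i)"
    using colim_iso[OF D(3) k(2)] linD(2,3)[OF k(1)] by simp
  then show ?thesis unfolding mcol_def using L' lin_comp[OF D(2) k(1) m D(1) L'] by simp
qed

text \<open>Base change is left adjoint to restriction, which keeps underlying colimits. The inverse
  \<psi> of the comparison map \<phi> comes from the universal properties of \<open>L\<close> and of
  its base change in turn.\<close>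

lemma mcol_base_change:
  assumes J: "small_cat U J" and f: "mh A B f" and s: "msys A J Fo T" and c: "mcol A J Fo T L c"
  shows "msys B J (\<lambda>i. bco A B f (Fo i)) (\<lambda>i j u. bca A B f (Fo i) (Fo j) (T i j u))"
    "mcol B J (\<lambda>i. bco A B f (Fo i)) (\<lambda>i j u. bca A B f (Fo i) (Fo j) (T i j u)) (bco A B f L) (\<lambda>i. bca A B f (Fo i) L (c i))"
proof -
  note S = msysD[OF s] and D = mcolD[OF c]
  let ?b = "bco A B f" and ?u = "bcu A B f" and ?T = "\<lambda>i j u. bca A B f (Fo i) (Fo j) (T i j u)" and ?c = "\<lambda>i. bca A B f (Fo i) L (c i)"
  have u: "univ A B f (Fo i) (?b (Fo i)) (?u (Fo i))" if "i \<in> Ob J" for i by (rule univ_bc[OF f S(1)[OF that]])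
  note uL = univ_bc[OF f D(1)]
  note mb = univD(3)[OF u] and mL = univD(3)[OF uL]
  note bT = bca[OF f S(1) S(1) S(2)] and bc = bca[OF f S(1) D(1) D(2)]
  show s': "msys B J (\<lambda>i. ?b (Fo i)) ?T" unfolding msys_def
  proof (intro conjI ballI)
    fix i assume i: "i \<in> Ob J"
    show "md B (?b (Fo i))" by (rule mb[OF i])
    show "?T i i (idt J i) = ide (ucar (?b (Fo i)))" using S(3)[OF i] bca_ide[OF f S(1)[OF i]] by simp
    fix j w assume j: "j \<in> Ob J" and w: "w \<in> Hom J i j"
    show "lin B (?b (Fo i)) (?b (Fo j)) (?T i j w)" by (rule bT(1)) (use i j w in simp_all)
    fix k v assume k: "k \<in> Ob J" and v: "v \<in> Hom J j k"
    show "?T i k (v \<cdot>\<^bsub>J\<^esub> w) = ?T j k v \<bullet> ?T i j w"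
      unfolding S(4)[OF i j k w v] by (rule bca_comp[OF f S(1)[OF i] S(1)[OF j] S(1)[OF k] S(2)[OF i j w] S(2)[OF j k v]])
  qed
  obtain P \<kappa> where P: "mcol B J (\<lambda>i. ?b (Fo i)) ?T P \<kappa>" by (rule mcol_ex[OF J s' mh_simps(2)[OF f]])
  note E = mcolD[OF P]
  have cl: "lin B (?b (Fo i)) (?b L) (?c i)" if "i \<in> Ob J" for i by (rule bc(1)) (use that in simp_all)
  have cT: "?c j \<bullet> ?T i j w = ?c i" if "i \<in> Ob J" "j \<in> Ob J" "w \<in> Hom J i j" for i j w
    using bca_comp[OF f S(1)[OF that(1)] S(1)[OF that(2)] D(1) S(2)[OF that] D(2)[OF that(2)]] D(4)[OF that] by simp
  obtain \<phi> where \<phi>: "lin B P (?b L) \<phi>" "\<forall>i\<in>Ob J. \<phi> \<bullet> \<kappa> i = ?c i" by (rule mcol_factor[OF J s' P mL cl cT])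
  have d1: "lin A (Fo i) (rm f P) (\<kappa> i \<bullet> ?u (Fo i))" if i: "i \<in> Ob J" for i
    by (rule lin_comp[OF univD(4)[OF u[OF i]] lin_rm[OF f mb[OF i] E(1) E(2)[OF i]] S(1)[OF i] md_rm[OF f mb[OF i]] md_rm[OF f E(1)]])
  have d2: "(\<kappa> j \<bullet> ?u (Fo j)) \<bullet> T i j w = \<kappa> i \<bullet> ?u (Fo i)" if ij: "i \<in> Ob J" "j \<in> Ob J" "w \<in> Hom J i j" for i j w
    using bca(2)[OF f S(1)[OF ij(1)] S(1)[OF ij(2)] S(2)[OF ij]] comp_reduce[OF E(4)[OF ij], of "?u (Fo i)"] by simp
  obtain \<psi>0 where \<psi>0: "lin A L (rm f P) \<psi>0" "\<forall>i\<in>Ob J. \<psi>0 \<bullet> c i = \<kappa> i \<bullet> ?u (Fo i)"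
    by (rule mcol_factor[OF J s c md_rm[OF f E(1)] d1 d2])
  obtain \<psi> where \<psi>: "lin B (?b L) P \<psi>" "\<psi> \<bullet> ?u L = \<psi>0" by (rule univ_ex[OF uL E(1) \<psi>0(1)])
  have uc: "?c i \<bullet> ?u (Fo i) = ?u L \<bullet> c i" if "i \<in> Ob J" for i by (rule bca(2)[OF f S(1) D(1) D(2)]) (use that in simp_all)
  have 1: "\<psi> \<bullet> \<phi> = ide (ucar P)"
  proof (rule colim_eq[OF E(3)])
    fix i assume i: "i \<in> Ob J"
    show "(\<psi> \<bullet> \<phi>) \<bullet> \<kappa> i = ide (ucar P) \<bullet> \<kappa> i"
    proof (rule univ_eq[OF u[OF i] E(1)])
      show "lin B (?b (Fo i)) P ((\<psi> \<bullet> \<phi>) \<bullet> \<kappa> i)"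
        by (rule lin_comp[OF E(2)[OF i] lin_comp[OF \<phi>(1) \<psi>(1) E(1) mL E(1)] mb[OF i] E(1) E(1)])
      show "lin B (?b (Fo i)) P (ide (ucar P) \<bullet> \<kappa> i)" by (rule lin_comp[OF E(2)[OF i] lin_ide[OF E(1)] mb[OF i] E(1) E(1)])
      have "((\<psi> \<bullet> \<phi>) \<bullet> \<kappa> i) \<bullet> ?u (Fo i) = \<psi> \<bullet> (?c i \<bullet> ?u (Fo i))" using comp_reduce[OF \<phi>(2)[rule_format, OF i], of "?u (Fo i)"] by simp
      also have "\<dots> = \<psi>0 \<bullet> c i" unfolding uc[OF i] using comp_reduce[OF \<psi>(2), of "c i"] by simp
      also have "\<dots> = (ide (ucar P) \<bullet> \<kappa> i) \<bullet> ?u (Fo i)" using \<psi>0(2) i linD(1-3)[OF E(2)[OF i]] by simp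
      finally show "((\<psi> \<bullet> \<phi>) \<bullet> \<kappa> i) \<bullet> ?u (Fo i) = (ide (ucar P) \<bullet> \<kappa> i) \<bullet> ?u (Fo i)" .
    qed
  qed (use linD(1-3)[OF \<phi>(1)] linD(1-3)[OF \<psi>(1)] md_simps(3)[OF E(1)] in simp_all)
  have 2: "\<phi> \<bullet> \<psi> = ide (ucar (?b L))"
  proof (rule univ_eq[OF uL mL lin_comp[OF \<psi>(1) \<phi>(1) mL E(1) mL] lin_ide[OF mL]])
    have "\<phi> \<bullet> \<psi>0 = ?u L"
    proof (rule colim_eq[OF D(3)])
      fix i assume i: "i \<in> Ob J"
      show "(\<phi> \<bullet> \<psi>0) \<bullet> c i = ?u L \<bullet> c i"
        using \<psi>0(2) i comp_reduce[OF \<phi>(2)[rule_format, OF i], of "?u (Fo i)"] uc[OF i] by simp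
    qed (use linD(1-3)[OF \<phi>(1)] linD(1-3)[OF \<psi>0(1)] univD(5-7)[OF uL] in simp_all)
    then show "(\<phi> \<bullet> \<psi>) \<bullet> ?u L = ide (ucar (?b L)) \<bullet> ?u L" using \<psi>(2) univD(5-7)[OF uL] by simp
  qed
  have "iso_ar \<phi>" by (rule iso_arI[of _ \<psi>]) (use 1 2 linD(1-3)[OF \<phi>(1)] linD(1-3)[OF \<psi>(1)] in \<open>simp add: inverses_def\<close>)
  from mcol_iso[OF P mb \<phi>(1) this mL] have m: "mcol B J (\<lambda>i. ?b (Fo i)) ?T (?b L) (\<lambda>i. \<phi> \<bullet> \<kappa> i)" by simp
  then show "mcol B J (\<lambda>i. ?b (Fo i)) ?T (?b L) ?c"
    unfolding mcol_def using \<phi>(2) by (subst (asm) colim_cong[of _ _ "\<lambda>i. ucar (?b (Fo i))" _ ?T _ ?c]) auto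
qed

text \<open>In an abelian category \<open>r\<close> is the kernel of some \<open>g\<close>. As
  \<open>g\<close> kills \<open>r\<close>, it factors through the zero cokernel and is itself zero;
  so the identity factors through \<open>r\<close>, and the one-sided inverse is two-sided because
  \<open>r\<close> is a monomorphism.\<close>

lemma iso_if_coker_null:
  assumes r: "tmono r" and q: "coeq r (zer (adom r) (acod r)) q" and n: "null (acod q)"
  shows "iso_ar r"
proof -
  interpret ab: abelian_category C by (rule abelian)
  obtain x f y where R: "r = Ar x f y" "x \<in> Ob C" "y \<in> Ob C" "f \<in> Hom C x y" using tmono_arr[OF r] by (rule arrE)
  have "is_mono C x y f" using is_mono_tmono[OF R(2,3)] r R(1) by simp
  then obtain w g where w: "w \<in> Ob C" "g \<in> Hom C y w" and k: "is_kernel C y w g x f" using ab.mono_normal[OF R(2,3)] by blast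
  let ?g = "Ar y g w"
  have "is_zero_arrow C x w (g \<cdot> f)" using k by (simp add: is_kernel_def)
  then obtain z a b where z: "is_zero C z" "a \<in> Hom C x z" "b \<in> Hom C z w" "g \<cdot> f = b \<cdot> a" unfolding is_zero_arrow_def by blast
  have zO: "z \<in> Ob C" using z(1) by (simp add: is_zero_def)
  have a: "Ar x a z = zer x z" by (rule zero_to[OF z(1)]) (use z zO R in simp_all)
  have "?g \<bullet> r = Ar z b w \<bullet> Ar x a z" using R w z zO by simp
  also have "\<dots> = zer x w" unfolding a using zer_comp[of "Ar z b w" x z] z zO w R by simp
  finally have "?g \<bullet> r = ?g \<bullet> zer (adom r) (acod r)" using zer_comp[of ?g x y] w R by simp
  then obtain h where h: "arr h" "adom h = acod q" "acod h = acod ?g" "h \<bullet> q = ?g"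
    by (rule coeq_ex[OF q, rotated 2]) (use w R in simp_all)
  note Q = coeqD(3)[OF q] coeqD(6)[OF q]
  have "h = zer (acod q) w" using n h w Q unfolding null_def by simp
  then have g0: "?g = zer y w" using h(4) comp_zer[of q w "acod q"] Q w R by simp
  then have "g = aarr (zin w \<bullet> zout y)" by (metis ar.sel(2))
  then have g1: "g = aarr (zin w) \<cdot> aarr (zout y)" using w R by (simp add: aarr_comp)
  have "is_zero_arrow C y w (g \<cdot> idt C y)"
    unfolding is_zero_arrow_def using zo g1 arr_Hom[of "zin w"] arr_Hom[of "zout y"] w R idt_right[OF R(3) w] 
    by (intro exI[of _ zo] exI[of _ "aarr (zout y)"] exI[of _ "aarr (zin w)"]) simp
  then obtain t where t: "t \<in> Hom C y x" "f \<cdot> t = idt C y"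
    using k R idt_Hom[OF R(3)] unfolding is_kernel_def by blast
  let ?t = "Ar y t x"
  have tf: "t \<cdot> f \<in> Hom C x x" by (rule cmp_Hom[OF R(2,3,2,4) t(1)])
  have rt: "r \<bullet> ?t = ide y" using R t by (simp add: ide_def)
  have "?t \<bullet> r = ide x" by (rule tmonoD[OF r]) (use R t tf comp_reduce[OF rt, of r] in simp_all)
  then show ?thesis using rt R t by (intro iso_arI[of _ ?t]) (simp add: inverses_def)
qed

text \<open>If \<open>N\<close> maps to the union of the \<open>M\<^sub>i\<close>, let \<open>N\<^sub>i\<close> be the preimage of \<open>M\<^sub>i\<close>. After base change to each
  member of the family \<open>N\<close> is finitely generated, so \<open>N\<^sub>i \<rightarrow> N\<close> has a section for large \<open>i\<close>; hence the
  cokernel of \<open>N\<^sub>i \<rightarrow> N\<close> vanishes.\<close>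

lemma noetherian_descent:
  assumes B: "comm_mon C B" and W: "finite W" and WD: "\<And>E f. (E, f) \<in> W \<Longrightarrow> flatU B E f \<and> noetherian_monoid U C E"
    and cons: "\<And>N. \<lbrakk>md B N; \<And>E f. (E, f) \<in> W \<Longrightarrow> vanish B E f N\<rbrakk> \<Longrightarrow> null (ucar N)"
  shows "noetherian_monoid U C B"
proof (rule noetherianI[OF B])
  fix N n assume N: "md B N" and n: "lin B N (self_mdl B) n" "tmono n"
  show "finitely_generated U (Mod_cat C B) N"
    unfolding finitely_generated_iff[OF N]
  proof (intro allI impI, elim conjE)
    fix J Fo T L c h
    assume J: "small_cat U J" "filtered_cat J" and s: "msys B J Fo T"
      and mono: "\<forall>i\<in>Ob J. \<forall>j\<in>Ob J. \<forall>u\<in>Hom J i j. tmono (T i j u)" and c: "mcol B J Fo T L c" and h: "lin B N L h"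
    note S = msysD[OF s] and D = mcolD[OF c]
    have mc: "tmono (c i)" if "i \<in> Ob J" for i
      by (rule mono_coprojection[OF B J s c _ that]) (use mono in blast)
    have "\<exists>M s r. md B M \<and> lin B M (Fo i) s \<and> lin B M N r \<and> pb (c i) h s r" if i: "i \<in> Ob J" for i
    proof -
      obtain s r where p: "pb (c i) h s r" by (rule pb_exists[of "c i" h]) (use linD[OF D(2)[OF i]] linD[OF h] in simp_all)
      show ?thesis using pb_module[OF S(1)[OF i] N D(1) D(2)[OF i] h p] p by metis
    qed
    then obtain No s r where "\<forall>i\<in>Ob J. md B (No i) \<and> lin B (No i) (Fo i) (s i) \<and> lin B (No i) N (r i) \<and> pb (c i) h (s i) (r i)"
      by metis
    then have No: "\<And>i. i \<in> Ob J \<Longrightarrow> md B (No i)" "\<And>i. i \<in> Ob J \<Longrightarrow> lin B (No i) (Fo i) (s i)" "\<And>i. i \<in> Ob J \<Longrightarrow> lin B (No i) N (r i)"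
      "\<And>i. i \<in> Ob J \<Longrightarrow> pb (c i) h (s i) (r i)" by blast+
    have mr: "tmono (r i)" if "i \<in> Ob J" for i by (rule tmono_pullback[OF No(4)[OF that] mc[OF that]])
    have cs: "c i \<bullet> s i = h \<bullet> r i" if "i \<in> Ob J" for i by (rule pbD(9)[OF No(4)[OF that]])
    \<comment> \<open>Transition maps between the preimages, induced by the pullback property of the
      later one.\<close>
    define Tn where "Tn i j u = (SOME t. lin B (No i) (No j) t \<and> r j \<bullet> t = r i \<and> s j \<bullet> t = T i j u \<bullet> s i)" for i j u
    have Tn: "lin B (No i) (No j) (Tn i j u) \<and> r j \<bullet> Tn i j u = r i \<and> s j \<bullet> Tn i j u = T i j u \<bullet> s i"
      if ij: "i \<in> Ob J" "j \<in> Ob J" "u \<in> Hom J i j" for i j u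
      unfolding Tn_def
    proof (rule someI_ex)
      note [simp] = linD(1-3)[OF S(2)[OF ij]] linD(1-3)[OF No(2)[OF ij(1)]] linD(1-3)[OF No(2)[OF ij(2)]]
        linD(1-3)[OF No(3)[OF ij(1)]] linD(1-3)[OF No(3)[OF ij(2)]] linD(1-3)[OF D(2)[OF ij(2)]] linD(1-3)[OF h]
      have e: "c j \<bullet> (T i j u \<bullet> s i) = h \<bullet> r i" using cs[OF ij(1)] comp_reduce[OF D(4)[OF ij], of "s i"] by simp
      obtain t where t: "arr t" "adom t = adom (T i j u \<bullet> s i)" "acod t = adom (s j)" "s j \<bullet> t = T i j u \<bullet> s i" "r j \<bullet> t = r i"
        by (rule pb_ex[OF No(4)[OF ij(2)] _ _ _ _ e]) simp_all
      have "lin B (No i) (No j) t"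
        by (rule pb_lin[OF S(1)[OF ij(2)] N No(1)[OF ij(2)] No(1)[OF ij(1)] No(4,2,3)[OF ij(2)] t(1)])
          (use t No(3)[OF ij(1)] lin_comp[OF No(2)[OF ij(1)] S(2)[OF ij] No(1)[OF ij(1)] S(1)[OF ij(1)] S(1)[OF ij(2)]] in simp_all)
      then show "\<exists>t. lin B (No i) (No j) t \<and> r j \<bullet> t = r i \<and> s j \<bullet> t = T i j u \<bullet> s i" using t by blast
    qed
    have cJ: "category J" using J(1) by (simp add: small_cat_def)
    interpret J: category J by (rule cJ)
    have sN: "msys B J No Tn" unfolding msys_def
    proof (intro conjI ballI)
      fix i assume i: "i \<in> Ob J"
      note Ti = Tn[OF i i J.idt_Hom[OF i]] and ri = linD(1-3)[OF No(3)[OF i]]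
      show "md B (No i)" by (rule No(1)[OF i])
      show "Tn i i (idt J i) = ide (ucar (No i))"
        by (rule tmonoD[OF mr[OF i]]) (use Ti linD(1-3)[OF conjunct1[OF Ti]] ri md_simps(3)[OF No(1)[OF i]] in simp_all)
      fix j u assume j: "j \<in> Ob J" "u \<in> Hom J i j"
      note Tij = Tn[OF i j]
      show "lin B (No i) (No j) (Tn i j u)" using Tij by blast
      fix k v assume k: "k \<in> Ob J" "v \<in> Hom J j k"
      note Tjk = Tn[OF j(1) k] and Tik = Tn[OF i k(1) J.cmp_Hom[OF i j(1) k(1) j(2) k(2)]]
      note d = linD(1-3)[OF conjunct1[OF Tij]] linD(1-3)[OF conjunct1[OF Tjk]] linD(1-3)[OF conjunct1[OF Tik]] linD(1-3)[OF No(3)[OF k(1)]]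
      have "r k \<bullet> (Tn j k v \<bullet> Tn i j u) = r i" using Tij Tjk comp_reduce[of "r k" "Tn j k v" "r j" "Tn i j u"] by simp
      then show "Tn i k (v \<cdot>\<^bsub>J\<^esub> u) = Tn j k v \<bullet> Tn i j u"
        by - (rule tmonoD[OF mr[OF k(1)]], use Tik d in simp_all)
    qed
    note cN = mcol_const[OF J(2) N] and cL = mcol_const[OF J(2) D(1)]
    note [simp] = linD(1-3)[OF h] md_simps(3)[OF N] md_simps(3)[OF D(1)]
    \<comment> \<open>With constant systems \<open>L\<close> and \<open>N\<close> at the other two
      corners, exactness identifies the colimit of the preimages with the pullback of the identity
      of \<open>L\<close> along \<open>h\<close>, which is \<open>N\<close>.\<close>
    have "mcol B J No Tn N r"
    proof (rule filtered_colimit_pullback[OF B J s cN(1) cL(1) sN D(2) h No(2) No(3) No(4) _ _ _ _ c cN(2) cL(2) lin_ide[OF D(1)] _ h _ N h lin_ide[OF N] _ No(3)])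
      show "pb (ide (ucar L)) h h (ide (ucar N))" using pb_sym[OF pb_ide_right[of h]] by simp
      fix i assume i: "i \<in> Ob J"
      note [simp] = linD(1-3)[OF No(3)[OF i]] linD(1-3)[OF D(2)[OF i]]
      show "ide (ucar L) \<bullet> c i = ide (ucar L) \<bullet> c i" "h \<bullet> ide (ucar N) = ide (ucar L) \<bullet> h"
        "h \<bullet> r i = c i \<bullet> s i" "ide (ucar N) \<bullet> r i = ide (ucar N) \<bullet> r i" using cs[OF i] by simp_all
      fix j u assume j: "j \<in> Ob J" "u \<in> Hom J i j"
      show "ide (ucar L) \<bullet> c i = c j \<bullet> T i j u" "ide (ucar L) \<bullet> h = h \<bullet> ide (ucar N)"
         "T i j u \<bullet> s i = s j \<bullet> Tn i j u" "ide (ucar N) \<bullet> r i = r j \<bullet> Tn i j u" using Tn[OF i j] D(4)[OF i j] by simp_all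
    qed
    note cr = this
    \<comment> \<open>After base change the inclusion \<open>r i\<close> has a section. This
      persists at later stages, so one i serves all of the finitely many members.\<close>
    let ?P = "\<lambda>(E, f) i. \<exists>x. lin E (bco B E f N) (bco B E f (No i)) x \<and> bca B E f (No i) N (r i) \<bullet> x = ide (ucar (bco B E f N))"
    have "\<exists>i\<in>Ob J. \<forall>w\<in>W. ?P w i"
    proof (rule filtered_finite[OF J(2) W])
      fix w assume w: "w \<in> W"
      obtain E f where Ef: "w = (E, f)" by (cases w)
      have fl: "flatU B E f" and E: "noetherian_monoid U C E" using WD w Ef by blast+
      have f: "mh B E f" using fl by (simp add: flatU_def)
      note uN = univ_bc[OF f N]
      note F = mh_simps[OF f] and sE = md_self[OF mh_simps(2)[OF f]] and sB = md_self[OF B]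
      have lf: "lin B (self_mdl B) (rm f (self_mdl E)) f" by (rule lin_mh[OF f])
      obtain k where k: "lin E (bco B E f N) (self_mdl E) k" "k \<bullet> bcu B E f N = f \<bullet> n"
        by (rule univ_ex[OF uN sE lin_comp[OF n(1) lf N sB md_rm[OF f sE]]])
      \<comment> \<open>By flatness the base change of the submodule \<open>N\<close> is a submodule
        of \<open>E\<close>, hence finitely generated. Its identity then factors through one term of
        the base-changed system, which is the desired section.\<close>
      have fgN: "finitely_generated U (Mod_cat C E) (bco B E f N)"
        by (rule noetherian_fg[OF E univD(3)[OF uN] k(1) flatU_mono[OF fl uN univ_self[OF f] n k]])
      note bc = mcol_base_change[OF J(1) f sN cr]
      have "tmono (bca B E f (No i) (No j) (Tn i j u))" if ij: "i \<in> Ob J" "j \<in> Ob J" "u \<in> Hom J i j" for i j u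
      proof -
        note t = Tn[OF ij]
        have "tmono (r j \<bullet> Tn i j u)" using t mr[OF ij(1)] by simp
        then have m: "tmono (Tn i j u)" by (rule tmono_of_comp)
        note b = bca[OF f No(1)[OF ij(1)] No(1)[OF ij(2)] conjunct1[OF t]]
        show ?thesis by (rule flatU_mono[OF fl univ_bc[OF f No(1)[OF ij(1)]] univ_bc[OF f No(1)[OF ij(2)]] conjunct1[OF t] m b])
      qed
      then have "\<exists>i\<in>Ob J. \<exists>x. lin E (bco B E f N) (bco B E f (No i)) x \<and> bca B E f (No i) N (r i) \<bullet> x = ide (ucar (bco B E f N))"
        using J bc lin_ide[OF univD(3)[OF uN]]
        by (intro fgN[unfolded finitely_generated_iff[OF univD(3)[OF uN]], rule_format, of J "\<lambda>i. bco B E f (No i)"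
          "\<lambda>i j u. bca B E f (No i) (No j) (Tn i j u)" "bco B E f N" "\<lambda>i. bca B E f (No i) N (r i)" "ide (ucar (bco B E f N))"]) blast
      then show "\<exists>i\<in>Ob J. ?P w i" using Ef by simp
    next
      fix w i j u assume w: "w \<in> W" and ij: "i \<in> Ob J" "j \<in> Ob J" "u \<in> Hom J i j" and p: "?P w i"
      obtain E f where Ef: "w = (E, f)" by (cases w)
      have f: "mh B E f" using WD w Ef by (simp add: flatU_def)
      obtain x where x: "lin E (bco B E f N) (bco B E f (No i)) x" "bca B E f (No i) N (r i) \<bullet> x = ide (ucar (bco B E f N))" using p Ef by auto
      note t = Tn[OF ij]
      note bt = bca[OF f No(1)[OF ij(1)] No(1)[OF ij(2)] conjunct1[OF t]]
      note m = univD(3)[OF univ_bc[OF f No(1)[OF ij(1)]]] univD(3)[OF univ_bc[OF f No(1)[OF ij(2)]]] univD(3)[OF univ_bc[OF f N]]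
      have "bca B E f (No i) N (r i) = bca B E f (No j) N (r j) \<bullet> bca B E f (No i) (No j) (Tn i j u)"
        using bca_comp[OF f No(1)[OF ij(1)] No(1)[OF ij(2)] N conjunct1[OF t] No(3)[OF ij(2)]] t by simp
      then have "bca B E f (No j) N (r j) \<bullet> (bca B E f (No i) (No j) (Tn i j u) \<bullet> x) = ide (ucar (bco B E f N))"
        using x(2) by simp
      moreover have "lin E (bco B E f N) (bco B E f (No j)) (bca B E f (No i) (No j) (Tn i j u) \<bullet> x)"
        by (rule lin_comp[OF x(1) bt(1) m(3,1,2)])
      ultimately show "?P w j" using Ef by auto
    qed
    then obtain i where i: "i \<in> Ob J" and P: "\<forall>w\<in>W. ?P w i" by blast
    note ri = linD(1-3)[OF No(3)[OF i]] and Ni = md_simps(3)[OF No(1)[OF i]]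
    \<comment> \<open>The cokernel \<open>Q\<close> of \<open>r i\<close> is formed as the
      coequalizer with the zero map.\<close>
    let ?z = "zer (ucar (No i)) (ucar N)"
    have lz: "lin B (No i) N ?z" by (rule lin_zer[OF No(1)[OF i] N])
    obtain q where q: "coeq (r i) ?z q" by (rule coeq_exists[of "r i" ?z]) (use ri linD(1-3)[OF lz] in simp_all)
    obtain Q where Q: "md B Q" "ucar Q = acod q" "lin B N Q q" by (rule coeq_module[OF No(1)[OF i] N No(3)[OF i] lz q])
    \<comment> \<open>Two maps from \<open>Q\<close> to an \<open>E\<close>-module give, through
      \<open>q\<close>, two maps from \<open>N\<close> that kill \<open>r i\<close>. Their
      extensions over \<open>E\<close> agree after the base change of \<open>r i\<close>, and the
      section \<open>x\<close> cancels it.\<close>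
    have "vanish B E f Q" if w: "(E, f) \<in> W" for E f
    proof -
      have f: "mh B E f" using WD[OF w] by (simp add: flatU_def)
      obtain x where x: "lin E (bco B E f N) (bco B E f (No i)) x" "bca B E f (No i) N (r i) \<bullet> x = ide (ucar (bco B E f N))"
        using P w by auto
      note uN = univ_bc[OF f N] and ui = univ_bc[OF f No(1)[OF i]] and b = bca[OF f No(1)[OF i] N No(3)[OF i]]
      have "null (ucar (bco B E f Q))"
      proof (rule null_univI[OF univ_bc[OF f Q(1)]])
        fix Z g g' assume Z: "md E Z" and g: "lin B Q (rm f Z) g" "lin B Q (rm f Z) g'"
        note rZ = md_rm[OF f Z]
        have z: "(g \<bullet> q) \<bullet> r i = zer (ucar (No i)) (ucar Z)" if "lin B Q (rm f Z) g" for g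
        proof -
          have "(g \<bullet> q) \<bullet> r i = (g \<bullet> q) \<bullet> ?z" using coeqD(7)[OF q] by simp
          also have "\<dots> = zer (ucar (No i)) (acod (g \<bullet> q))"
            by (rule zer_comp) (use linD(1-3)[OF that] linD(1-3)[OF Q(3)] Ni in simp_all)
          finally show ?thesis using linD(1-3)[OF that] linD(1-3)[OF Q(3)] by simp
        qed
        obtain k where k: "lin E (bco B E f N) Z k" "k \<bullet> bcu B E f N = g \<bullet> q" by (rule univ_ex[OF uN Z lin_comp[OF Q(3) g(1) N Q(1) rZ]])
        obtain k' where k': "lin E (bco B E f N) Z k'" "k' \<bullet> bcu B E f N = g' \<bullet> q" by (rule univ_ex[OF uN Z lin_comp[OF Q(3) g(2) N Q(1) rZ]])
        have "k \<bullet> bca B E f (No i) N (r i) = k' \<bullet> bca B E f (No i) N (r i)"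
        proof (rule univ_eq[OF ui Z])
          show "lin E (bco B E f (No i)) Z (k \<bullet> bca B E f (No i) N (r i))" "lin E (bco B E f (No i)) Z (k' \<bullet> bca B E f (No i) N (r i))"
            using lin_comp[OF b(1) k(1) univD(3)[OF ui] univD(3)[OF uN] Z] lin_comp[OF b(1) k'(1) univD(3)[OF ui] univD(3)[OF uN] Z] .
          show "(k \<bullet> bca B E f (No i) N (r i)) \<bullet> bcu B E f (No i) = (k' \<bullet> bca B E f (No i) N (r i)) \<bullet> bcu B E f (No i)"
            using z[OF g(1)] z[OF g(2)] comp_reduce[OF k(2), of "r i"] comp_reduce[OF k'(2), of "r i"] by (simp add: b(2))
        qed
        from comp_reduce[OF this, of x] have "k = k'" using x(2) linD(1-3)[OF k(1)] linD(1-3)[OF k'(1)] by simp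
        then have "g \<bullet> q = g' \<bullet> q" using k(2) k'(2) by simp
        then show "g = g'"
          by (rule coeq_epi[OF q, rotated 4]) (use linD(1-3)[OF g(1)] linD(1-3)[OF g(2)] Q(2) in simp_all)
      qed
      then show ?thesis by (simp add: vanish_def)
    qed
    then have "null (acod q)" using cons[OF Q(1)] Q(2) by simp
    then have iso: "iso_ar (r i)" using iso_if_coker_null[OF mr[OF i], of q] q ri by simp
    let ?x = "s i \<bullet> ainv (r i)"
    have "lin B N (Fo i) ?x" by (rule lin_comp[OF lin_ainv[OF No(3)[OF i] No(1)[OF i] N iso] No(2)[OF i] N No(1)[OF i] S(1)[OF i]])
    moreover have "c i \<bullet> ?x = h"
      using comp_reduce[OF cs[OF i], of "ainv (r i)"] ainv_simps[OF iso] ri by simp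
    ultimately show "\<exists>i\<in>Ob J. \<exists>x. lin B N (Fo i) x \<and> c i \<bullet> x = h" using i by blast
  qed
qed

end

section \<open>Sieves and the sheaf of closed sieves\<close>

context geometry
begin

notation comp (infixr "\<bullet>" 70)
notation tns (infixr "**" 75)

text \<open>Membership in \<open>Hom (Comm C) A B\<close> does not say that the ends are monoids;
  \<open>hm\<close> adds this. Sieves and sheaves refer to untagged arrows, and \<open>cm\<close>
  restores the tags.\<close>

definition hm where "hm A B = {f. comm_mon C A \<and> comm_mon C B \<and> f \<in> Hom (Comm C) A B}"

definition cm where "cm A B f = Ar (mcar A) f (mcar B)"

lemma Comm_simps [simp]: "A \<in> Ob (Comm C) \<longleftrightarrow> comm_mon C A" "idt (Comm C) A = idt C (mcar A)" "cmp (Comm C) = cmp C"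
  by (simp_all add: Comm_def)

lemma hm_iff: "f \<in> hm A B \<longleftrightarrow> mh A B (cm A B f)"
  unfolding hm_def cm_def using mh_Hom by (auto simp: mh_def)

lemma hmD: "f \<in> hm A B \<Longrightarrow> comm_mon C A" "f \<in> hm A B \<Longrightarrow> comm_mon C B" "f \<in> hm A B \<Longrightarrow> f \<in> Hom (Comm C) A B"
  "f \<in> hm A B \<Longrightarrow> mh A B (cm A B f)" "f \<in> hm A B \<Longrightarrow> f \<in> Hom C (mcar A) (mcar B)"
  using hm_iff by (auto simp: hm_def Comm_def)

lemma mh_hm: "mh A B f \<Longrightarrow> aarr f \<in> hm A B" "mh A B f \<Longrightarrow> cm A B (aarr f) = f"
proof -
  show e: "cm A B (aarr f) = f" if "mh A B f" using mh_simps[OF that] arr_eta[of f] by (simp add: cm_def)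
  show "aarr f \<in> hm A B" if "mh A B f" using that e[OF that] by (simp add: hm_iff)
qed

lemma cm_comp: assumes "f \<in> hm A B" "g \<in> hm B D" shows "cm B D g \<bullet> cm A B f = cm A D (g \<cdot> f)"
  unfolding cm_def using hmD(5)[OF assms(1)] hmD(5)[OF assms(2)] hmD(1,2)[OF assms(1)] hmD(2)[OF assms(2)] by simp

lemma hm_comp: assumes "f \<in> hm A B" "g \<in> hm B D" shows "g \<cdot> f \<in> hm A D"
  using mh_comp[OF hmD(4)[OF assms(1)] hmD(4)[OF assms(2)]] cm_comp[OF assms] by (simp add: hm_iff)

lemma hm_ide: "comm_mon C A \<Longrightarrow> idt C (mcar A) \<in> hm A A"
  using mh_ide[of A] by (simp add: hm_iff cm_def ide_def)

lemma cm_idt: "cm A A (idt C (mcar A)) = ide (mcar A)" by (simp add: cm_def ide_def)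

lemma hm_assoc: "\<lbrakk>f \<in> hm A B; g \<in> hm B D; h \<in> hm D E\<rbrakk> \<Longrightarrow> (h \<cdot> g) \<cdot> f = h \<cdot> (g \<cdot> f)"
  by (rule cmp_assoc[OF _ _ _ _ hmD(5) hmD(5) hmD(5)]) (auto dest: hmD(1,2) intro: comm_mon_simps)

lemma hm_idt: assumes "f \<in> hm A B" shows "f \<cdot> idt C (mcar A) = f" "idt C (mcar B) \<cdot> f = f"
  using idt_left[OF _ _ hmD(5)[OF assms]] idt_right[OF _ _ hmD(5)[OF assms]] comm_mon_simps(1)[OF hmD(1)[OF assms]]
    comm_mon_simps(1)[OF hmD(2)[OF assms]] by blast+

definition van where "van A B f N \<longleftrightarrow> vanish A B (cm A B f) N"

lemma van_comp: assumes f: "f \<in> hm A B" and g: "g \<in> hm B D" and N: "md A N"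
  shows "van A D (g \<cdot> f) N \<longleftrightarrow> van B D g (bco A B (cm A B f) N)"
  using vanish_comp[OF hmD(4)[OF f] hmD(4)[OF g] N] cm_comp[OF f g] by (simp add: van_def)

lemma vanish_epi: assumes e: "mepi A B f" and N: "md B N" shows "vanish A B f (rm f N) \<longleftrightarrow> null (ucar N)"
  by (rule vanish_univ[OF mepi_univ[OF e N]])

lemma zariski_immersionD: assumes "zariski_immersion U C A B f"
  shows "f \<in> hm A B" "flatU A B (cm A B f)" "mepi A B (cm A B f)"
proof -
  show f: "f \<in> hm A B" using assms by (simp add: zariski_immersion_def hm_def)
  show "flatU A B (cm A B f)" using flat_flatU[OF hmD(4)[OF f]] assms by (simp add: zariski_immersion_def cm_def)
  have e: "is_epi (Comm C) A B f" using assms by (simp add: zariski_immersion_def)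
  show "mepi A B (cm A B f)" unfolding mepi_def
  proof (intro conjI allI impI hmD(4)[OF f], elim conjE)
    fix G g h assume gh: "mh B G g" "mh B G h" "g \<bullet> cm A B f = h \<bullet> cm A B f"
    note G = mh_hm[OF gh(1)] and H = mh_hm[OF gh(2)]
    have "cm A G (aarr g \<cdot> f) = cm A G (aarr h \<cdot> f)" using gh(3) cm_comp[OF f G(1)] cm_comp[OF f H(1)] by (simp add: G(2) H(2))
    then have "aarr g \<cdot> f = aarr h \<cdot> f" by (simp add: cm_def)
    then have "aarr g = aarr h" using e hmD(2,3)[OF G(1)] hmD(3)[OF H(1)] unfolding is_epi_def by simp
    then show "g = h" using G(2) H(2) by metis
  qed
qed

section \<open>Detecting families and the topology they define\<close>

definition detects where
  "detects E R \<longleftrightarrow> (\<exists>R0\<subseteq>R. finite R0 \<and> (\<forall>N. md E N \<and> (\<forall>(G, g)\<in>R0. van E G g N) \<longrightarrow> null (ucar N)))"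

definition spull where "spull E h R = {(G, g). g \<in> hm E G \<and> (G, g \<cdot> h) \<in> R}"

text \<open>A topology finer than the Zariski topology, in which no flatness is required: \<open>R\<close> covers if after
  every base change finitely many members of \<open>R\<close> detect whether a module is zero.\<close>

definition covering where "covering A R \<longleftrightarrow> (\<forall>E h. h \<in> hm A E \<longrightarrow> detects E (spull E h R))"

lemma spull_iff [simp]: "(G, g) \<in> spull E h R \<longleftrightarrow> g \<in> hm E G \<and> (G, g \<cdot> h) \<in> R"
  by (simp add: spull_def)

lemma spull_spull: assumes "h \<in> hm A E" "k \<in> hm E G" shows "spull G k (spull E h R) = spull G (k \<cdot> h) R"
  using hm_comp[OF assms(2)] hm_assoc[OF assms] by (auto simp: spull_def)

lemma spull_idt: assumes "\<And>G g. (G, g) \<in> R \<Longrightarrow> g \<in> hm A G" shows "spull A (idt C (mcar A)) R = R"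
  using hm_idt(1) assms by (force simp: spull_def)

lemma detects_mono: "\<lbrakk>detects E R; R \<subseteq> R'\<rbrakk> \<Longrightarrow> detects E R'"
  unfolding detects_def by (meson subset_trans)

lemma covering_mono: assumes "covering A R" "\<And>G g. \<lbrakk>g \<in> hm A G; (G, g) \<in> R\<rbrakk> \<Longrightarrow> (G, g) \<in> R'" shows "covering A R'"
  unfolding covering_def
proof (intro allI impI)
  fix E h assume h: "h \<in> hm A E"
  have "spull E h R \<subseteq> spull E h R'" using assms(2) hm_comp[OF h] by (auto simp: spull_def)
  then show "detects E (spull E h R')" using detects_mono[of E "spull E h R" "spull E h R'"] assms(1) h by (simp add: covering_def)
qed

lemma covering_pull: assumes "covering A R" "h \<in> hm A E" shows "covering E (spull E h R)"
  unfolding covering_def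
proof (intro allI impI)
  fix G k assume k: "k \<in> hm E G"
  show "detects G (spull G k (spull E h R))"
    unfolding spull_spull[OF assms(2) k] using assms(1) hm_comp[OF assms(2) k] by (simp add: covering_def)
qed

text \<open>The identity alone detects, base change along it being trivial.\<close>

lemma covering_full: assumes "\<And>G g. g \<in> hm A G \<Longrightarrow> (G, g) \<in> R" shows "covering A R"
  unfolding covering_def detects_def
proof (intro allI impI)
  fix E h assume h: "h \<in> hm A E"
  note E = hmD(2)[OF h]
  let ?R0 = "{(E, idt C (mcar E))}"
  have "?R0 \<subseteq> spull E h R" using hm_ide[OF E] hm_idt(2)[OF h] assms[OF h] by simp
  moreover have "null (ucar N)" if N: "md E N" "van E E (idt C (mcar E)) N" for N
  proof -
    have e: "mepi E E (ide (mcar E))" unfolding mepi_def using mh_ide[OF E] mh_simps(3,4) by auto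
    show ?thesis using vanish_epi[OF e N(1)] N by (simp add: van_def cm_idt rm_ide)
  qed
  ultimately show "\<exists>R0\<subseteq>spull E h R. finite R0 \<and> (\<forall>N. md E N \<and> (\<forall>(G, g)\<in>R0. van E G g N) \<longrightarrow> null (ucar N))"
    by (intro exI[of _ ?R0]) auto
qed

text \<open>Finitely many members of \<open>R\<close> detect, and for each of them so do finitely
  many members of the pulled back \<open>S\<close>. The composites form the required finite family,
  by transitivity of base change.\<close>

lemma detects_trans:
  assumes R: "detects E R" and typed: "\<And>G g. (G, g) \<in> R \<Longrightarrow> g \<in> hm E G"
    and S: "\<And>G g. (G, g) \<in> R \<Longrightarrow> detects G (spull G g S)"
  shows "detects E S"
proof -
  obtain R0 where R0: "R0 \<subseteq> R" "finite R0" and R0N: "\<And>N. \<lbrakk>md E N; \<forall>(G, g)\<in>R0. van E G g N\<rbrakk> \<Longrightarrow> null (ucar N)"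
    using R unfolding detects_def by blast
  have "\<forall>x\<in>R0. \<exists>Q. Q \<subseteq> spull (fst x) (snd x) S \<and> finite Q \<and>
      (\<forall>N. md (fst x) N \<and> (\<forall>(G, g)\<in>Q. van (fst x) G g N) \<longrightarrow> null (ucar N))"
    using S R0(1) unfolding detects_def by force
  from bchoice[OF this] obtain Q where Q0: "\<forall>x\<in>R0. Q x \<subseteq> spull (fst x) (snd x) S \<and> finite (Q x) \<and>
      (\<forall>N. md (fst x) N \<and> (\<forall>(G, g)\<in>Q x. van (fst x) G g N) \<longrightarrow> null (ucar N))" by (elim exE)
  then have Q: "\<And>x. x \<in> R0 \<Longrightarrow> Q x \<subseteq> spull (fst x) (snd x) S" "\<And>x. x \<in> R0 \<Longrightarrow> finite (Q x)"
    "\<And>x N. \<lbrakk>x \<in> R0; md (fst x) N; \<forall>(G, g)\<in>Q x. van (fst x) G g N\<rbrakk> \<Longrightarrow> null (ucar N)"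
    by simp_all
  let ?S0 = "\<Union>x\<in>R0. (\<lambda>(G, g). (G, g \<cdot> snd x)) ` Q x"
  have sub: "?S0 \<subseteq> S" using Q(1) by fastforce
  have fin: "finite ?S0" using R0(2) Q(2) by simp
  have nul: "null (ucar N)" if N: "md E N" and v: "\<forall>(G, g)\<in>?S0. van E G g N" for N
  proof (rule R0N[OF N], clarify)
    fix G g assume x: "(G, g) \<in> R0"
    then have g: "g \<in> hm E G" using typed R0(1) by blast
    note u = univ_bc[OF hmD(4)[OF g] N]
    have "null (ucar (bco E G (cm E G g) N))"
    proof (rule Q(3)[OF x])
      show "md (fst (G, g)) (bco E G (cm E G g) N)" using univD(3)[OF u] by simp
      show "\<forall>(H, k)\<in>Q (G, g). van (fst (G, g)) H k (bco E G (cm E G g) N)"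
      proof clarify
        fix H k assume k: "(H, k) \<in> Q (G, g)"
        then have kh: "k \<in> hm G H" using Q(1)[OF x] by auto
        have "(H, k \<cdot> g) \<in> ?S0" using x k by force
        then have "van E H (k \<cdot> g) N" using v by blast
        then show "van (fst (G, g)) H k (bco E G (cm E G g) N)" using van_comp[OF g kh N] by simp
      qed
    qed
    then show "van E G g N" by (simp add: van_def vanish_def)
  qed
  show ?thesis unfolding detects_def
  proof (intro exI conjI allI impI)
    fix N assume "md E N \<and> (\<forall>(G, g)\<in>?S0. van E G g N)"
    then show "null (ucar N)" by (elim conjE) (rule nul)
  qed (rule sub, rule fin)
qed

text \<open>The transitivity axiom of a topology. Stability is built into \<open>covering\<close>,
  so it reduces to \<open>detects_trans\<close> after each base change.\<close>

lemma covering_trans: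
  assumes R: "covering A R" and S: "\<And>G h. \<lbrakk>h \<in> hm A G; (G, h) \<in> R\<rbrakk> \<Longrightarrow> covering G (spull G h S)"
  shows "covering A S"
  unfolding covering_def
proof (intro allI impI)
  fix E h assume h: "h \<in> hm A E"
  show "detects E (spull E h S)"
  proof (rule detects_trans)
    show "detects E (spull E h R)" using R h by (simp add: covering_def)
    fix G g assume "(G, g) \<in> spull E h R"
    then have g: "g \<in> hm E G" "(G, g \<cdot> h) \<in> R" by simp_all
    then show "g \<in> hm E G" by simp
    note gh = hm_comp[OF h g(1)]
    from S[OF gh g(2)] have "detects G (spull G (idt C (mcar G)) (spull G (g \<cdot> h) S))"
      using hm_ide[OF hmD(2)[OF g(1)]] by (simp add: covering_def)
    then show "detects G (spull G g (spull E h S))"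
      unfolding spull_spull[OF gh hm_ide[OF hmD(2)[OF g(1)]]] spull_spull[OF h g(1)] hm_idt(2)[OF gh] .
  qed
qed

lemma zariski_coverD:
  assumes "zariski_cover U C A W"
  shows "comm_mon C A" "(B, f) \<in> W \<Longrightarrow> zariski_immersion U C A B f" "(B, f) \<in> W \<Longrightarrow> f \<in> hm A B"
    "\<exists>W'\<subseteq>W. finite W' \<and> (\<forall>N. md A N \<and> (\<forall>(B, f)\<in>W'. van A B f N) \<longrightarrow> null (ucar N))"
proof -
  show A: "comm_mon C A" using assms by (simp add: zariski_cover_def)
  show z: "zariski_immersion U C A B f" if "(B, f) \<in> W" for B f using assms that by (auto simp: zariski_cover_def)
  show h: "f \<in> hm A B" if "(B, f) \<in> W" for B f using zariski_immersionD(1)[OF z[OF that]] .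
  obtain W' where W': "W' \<subseteq> W" "finite W'" "conservative_family C A W'" using assms unfolding zariski_cover_def by blast
  have "null (ucar N)" if N: "md A N" and v: "\<forall>(B, f)\<in>W'. van A B f N" for N
  proof -
    have "is_zero (Mod_cat C B) (bc_ob C A B f N)" if w: "(B, f) \<in> W'" for B f
    proof -
      have f: "f \<in> hm A B" using h W'(1) w by blast
      have "md B (bco A B (cm A B f) N)" by (rule univD(3)[OF univ_bc[OF hmD(4)[OF f] N]])
      then show ?thesis using is_zero_Mod[of B "bco A B (cm A B f) N"] v w by (auto simp: van_def vanish_def cm_def)
    qed
    then have "is_zero (Mod_cat C A) N" using W'(3) N Ob_Mod[OF A] unfolding conservative_family_def by blast
    then show ?thesis using is_zero_Mod[OF N] by simp
  qed
  then show "\<exists>W'\<subseteq>W. finite W' \<and> (\<forall>N. md A N \<and> (\<forall>(B, f)\<in>W'. van A B f N) \<longrightarrow> null (ucar N))"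
    using W'(1,2) by (intro exI[of _ W']) blast
qed

definition sieve_gen where "sieve_gen W = {(G, g \<cdot> f) | G g B f. (B, f) \<in> W \<and> g \<in> hm B G}"

text \<open>A module over \<open>E\<close> vanishes on the pushout exactly when its restriction to
  \<open>A\<close> vanishes on \<open>D\<close>. So a finite family over \<open>A\<close> that
  detects restricted \<open>E\<close>-modules is turned by pushout into one that detects over
  \<open>E\<close>.\<close>

lemma detects_pushout:
  assumes h: "h \<in> hm A E" and L: "finite L"
    and N: "\<And>N. \<lbrakk>md E N; \<forall>(D, d)\<in>L. van A D d (rm (cm A E h) N)\<rbrakk> \<Longrightarrow> null (ucar N)"
    and P: "\<And>D d. (D, d) \<in> L \<Longrightarrow> pushout A E D (cm A E h) (cm A D d) (P D d) (u D d) (v D d)"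
    and R: "\<And>D d. (D, d) \<in> L \<Longrightarrow> (P D d, aarr (u D d)) \<in> R"
  shows "detects E R"
  unfolding detects_def
proof (intro exI conjI allI impI)
  let ?R0 = "(\<lambda>(D, d). (P D d, aarr (u D d))) ` L"
  show "?R0 \<subseteq> R" using R by auto
  show "finite ?R0" using L by simp
  fix M assume M: "md E M \<and> (\<forall>(G, g)\<in>?R0. van E G g M)"
  show "null (ucar M)"
  proof (rule N, use M in blast, clarify)
    fix D d assume D: "(D, d) \<in> L"
    note p = P[OF D]
    have "(P D d, aarr (u D d)) \<in> ?R0" using D by (auto intro: rev_image_eqI)
    then have "van E (P D d) (aarr (u D d)) M" using M by blast
    then have "vanish E (P D d) (u D d) M" using mh_hm(2)[OF pushoutD(3)[OF p]] by (simp add: van_def)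
    then show "van A D d (rm (cm A E h) M)" using vanish_pushout[OF p] M by (simp add: van_def)
  qed
qed

text \<open>The finite conservative subfamily is pushed out along each base change. Hence the
  topology is finer than the Zariski topology.\<close>

lemma zariski_covering_sieve: assumes W: "zariski_cover U C A W" shows "covering A (sieve_gen W)"
  unfolding covering_def
proof (intro allI impI)
  note D = zariski_coverD[OF W]
  obtain W' where W': "W' \<subseteq> W" "finite W'" and c: "\<And>N. \<lbrakk>md A N; \<forall>(B, f)\<in>W'. van A B f N\<rbrakk> \<Longrightarrow> null (ucar N)" using D(4) by blast
  fix E h assume h: "h \<in> hm A E"
  have "\<exists>P u v. pushout A E B (cm A E h) (cm A B f) P u v" if "(B, f) \<in> W'" for B f
    using pushout_exists[OF hmD(4)[OF h] hmD(4)[OF D(3)]] that W'(1) by (metis subsetD)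
  then obtain P u v where p: "\<And>B f. (B, f) \<in> W' \<Longrightarrow> pushout A E B (cm A E h) (cm A B f) (P B f) (u B f) (v B f)" by metis
  show "detects E (spull E h (sieve_gen W))"
  proof (rule detects_pushout[OF h W'(2) _ p])
    fix B f assume w: "(B, f) \<in> W'"
    then have wW: "(B, f) \<in> W" using W'(1) by blast
    note q = pushoutD[OF p[OF w]]
    have "aarr (u B f) \<cdot> h = aarr (v B f) \<cdot> f"
      using arg_cong[OF q(5), of aarr] mh_simps[OF q(1)] mh_simps[OF q(2)] mh_simps[OF q(3)] mh_simps[OF q(4)] by (simp add: aarr_comp cm_def del: arr_Ar)
    then show "(P B f, aarr (u B f)) \<in> spull E h (sieve_gen W)"
      using mh_hm(1)[OF q(3)] mh_hm(1)[OF q(4)] wW by (auto simp: sieve_gen_def)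
  next
    fix N assume N: "md E N" "\<forall>(B, f)\<in>W'. van A B f (rm (cm A E h) N)"
    show "null (ucar N)" using c[OF md_rm[OF hmD(4)[OF h] N(1)] N(2)] by simp
  qed
qed

section \<open>Closed sieves\<close>

definition closed_sieve where
  "closed_sieve A S \<longleftrightarrow> (\<forall>(G, g)\<in>S. g \<in> hm A G \<and> (\<forall>H k. k \<in> hm G H \<longrightarrow> (H, k \<cdot> g) \<in> S)) \<and>
    (\<forall>G h. h \<in> hm A G \<and> covering G (spull G h S) \<longrightarrow> (G, h) \<in> S)"

definition closure_sieve where "closure_sieve A S = {(G, h). h \<in> hm A G \<and> covering G (spull G h S)}"

lemma closed_sieveD: assumes "closed_sieve A S"
  shows "(G, g) \<in> S \<Longrightarrow> g \<in> hm A G" "\<lbrakk>(G, g) \<in> S; k \<in> hm G H\<rbrakk> \<Longrightarrow> (H, k \<cdot> g) \<in> S"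
    "\<lbrakk>h \<in> hm A G; covering G (spull G h S)\<rbrakk> \<Longrightarrow> (G, h) \<in> S"
  using assms unfolding closed_sieve_def by blast+

lemma closed_sieve_pull: assumes S: "closed_sieve A S" and f: "f \<in> hm A B" shows "closed_sieve B (spull B f S)"
  unfolding closed_sieve_def
proof (intro conjI allI impI ballI, clarify)
  note D = closed_sieveD[OF S]
  fix G g assume g: "(G, g) \<in> spull B f S"
  then have g': "g \<in> hm B G" "(G, g \<cdot> f) \<in> S" by simp_all
  show "g \<in> hm B G \<and> (\<forall>H k. k \<in> hm G H \<longrightarrow> (H, k \<cdot> g) \<in> spull B f S)"
    using g' D(2)[OF g'(2)] hm_comp[OF g'(1)] hm_assoc[OF f g'(1)] by simp
next
  note D = closed_sieveD[OF S]
  fix G h assume h: "h \<in> hm B G \<and> covering G (spull G h (spull B f S))"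
  then have "covering G (spull G (h \<cdot> f) S)" using spull_spull[OF f, of h G S] by simp
  then show "(G, h) \<in> spull B f S" using D(3)[OF hm_comp[OF f]] h by simp
qed

lemma closure_pull: assumes f: "f \<in> hm A B" shows "spull B f (closure_sieve A S) = closure_sieve B (spull B f S)"
  using spull_spull[OF f] hm_comp[OF f] by (auto simp: closure_sieve_def)

text \<open>One step of saturation is enough, by transitivity of the topology.\<close>

lemma closed_closure: "closed_sieve A (closure_sieve A S)"
  unfolding closed_sieve_def
proof (intro conjI allI impI ballI, clarify)
  fix G g assume "(G, g) \<in> closure_sieve A S"
  then have g: "g \<in> hm A G" "covering G (spull G g S)" by (simp_all add: closure_sieve_def)
  then show "g \<in> hm A G \<and> (\<forall>H k. k \<in> hm G H \<longrightarrow> (H, k \<cdot> g) \<in> closure_sieve A S)"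
    using covering_pull[OF g(2)] spull_spull[OF g(1)] hm_comp[OF g(1)] by (simp add: closure_sieve_def)
next
  fix G h assume h: "h \<in> hm A G \<and> covering G (spull G h (closure_sieve A S))"
  have "covering G (spull G h S)"
  proof (rule covering_trans[of G "spull G h (closure_sieve A S)"])
    show "covering G (spull G h (closure_sieve A S))" using h by simp
    fix H k assume k: "k \<in> hm G H" "(H, k) \<in> spull G h (closure_sieve A S)"
    then show "covering H (spull H k (spull G h S))" using h spull_spull[of h A G k H S] by (simp add: closure_sieve_def)
  qed
  then show "(G, h) \<in> closure_sieve A S" using h by (simp add: closure_sieve_def)
qed

text \<open>The subobject classifier for the finer topology; its sections are sets of pairs, as the
  type of test sheaves demands.\<close>

definition Omega :: "('o, 'a) test_sheaf" where
  "Omega = \<lparr>sec = (\<lambda>A. {S. closed_sieve A S}), res = (\<lambda>A B f. spull B f)\<rparr>"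

lemma presheafI:
  assumes "\<And>A B f s. \<lbrakk>f \<in> hm A B; s \<in> sec F A\<rbrakk> \<Longrightarrow> res F A B f s \<in> sec F B"
    "\<And>A s. \<lbrakk>comm_mon C A; s \<in> sec F A\<rbrakk> \<Longrightarrow> res F A A (idt C (mcar A)) s = s"
    "\<And>A B D f g s. \<lbrakk>f \<in> hm A B; g \<in> hm B D; s \<in> sec F A\<rbrakk> \<Longrightarrow> res F A D (g \<cdot> f) s = res F B D g (res F A B f s)"
  shows "is_presheaf C F"
  unfolding is_presheaf_def using assms by (simp add: hm_def)

lemma presheafD: assumes "is_presheaf C F"
  shows "\<lbrakk>f \<in> hm A B; s \<in> sec F A\<rbrakk> \<Longrightarrow> res F A B f s \<in> sec F B"
    "\<lbrakk>comm_mon C A; s \<in> sec F A\<rbrakk> \<Longrightarrow> res F A A (idt C (mcar A)) s = s"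
    "\<lbrakk>f \<in> hm A B; g \<in> hm B D; s \<in> sec F A\<rbrakk> \<Longrightarrow> res F A D (g \<cdot> f) s = res F B D g (res F A B f s)"
  using assms unfolding is_presheaf_def by (simp_all add: hm_def)

lemma matchingD: assumes "matching_family C F W x" and W: "\<And>B f. (B, f) \<in> W \<Longrightarrow> f \<in> hm A B"
  shows "(B, f) \<in> W \<Longrightarrow> x (B, f) \<in> sec F B"
    "\<lbrakk>(B, f) \<in> W; (B', f') \<in> W; g \<in> hm B D; g' \<in> hm B' D; g \<cdot> f = g' \<cdot> f'\<rbrakk> \<Longrightarrow> res F B D g (x (B, f)) = res F B' D g' (x (B', f'))"
proof -
  note m = assms(1)[unfolded matching_family_def]
  show "x (B, f) \<in> sec F B" if "(B, f) \<in> W" using m that by blast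
  assume h: "(B, f) \<in> W" "(B', f') \<in> W" "g \<in> hm B D" "g' \<in> hm B' D" "g \<cdot> f = g' \<cdot> f'"
  have "D \<in> Ob (Comm C)" using hmD(2)[OF h(3)] by simp
  then show "res F B D g (x (B, f)) = res F B' D g' (x (B', f'))"
    using m[THEN conjunct2, THEN bspec, OF h(1), simplified, THEN bspec, OF h(2)] hmD(3)[OF h(3)] hmD(3)[OF h(4)] h(5) by simp
qed

lemma matchingI:
  assumes "\<And>B f. (B, f) \<in> W \<Longrightarrow> x (B, f) \<in> sec F B" and W: "\<And>B f. (B, f) \<in> W \<Longrightarrow> f \<in> hm A B"
    "\<And>B f B' f' D g g'. \<lbrakk>(B, f) \<in> W; (B', f') \<in> W; g \<in> hm B D; g' \<in> hm B' D; g \<cdot> f = g' \<cdot> f'\<rbrakk> \<Longrightarrow> res F B D g (x (B, f)) = res F B' D g' (x (B', f'))"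
  shows "matching_family C F W x"
  unfolding matching_family_def
proof (intro conjI, use assms(1) in blast, clarsimp)
  fix B f B' f' D g g' assume h: "(B, f) \<in> W" "(B', f') \<in> W" "comm_mon C D" "g \<in> Hom (Comm C) B D" "g' \<in> Hom (Comm C) B' D" "g \<cdot> f = g' \<cdot> f'"
  then have "g \<in> hm B D" "g' \<in> hm B' D" using hmD(2)[OF W(1)] by (auto simp: hm_def)
  then show "res F B D g (x (B, f)) = res F B' D g' (x (B', f'))" using W(2) h by blast
qed

lemma sheafD: assumes "is_sheaf U C F"
  shows "is_presheaf C F"
    "\<lbrakk>zariski_cover U C A W; matching_family C F W x\<rbrakk> \<Longrightarrow> \<exists>!s. s \<in> sec F A \<and> (\<forall>(B, f)\<in>W. res F A B f s = x (B, f))"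
  using assms unfolding is_sheaf_def by blast+

text \<open>Matching sieves glue to the closure of the sieve that they generate together. Uniqueness
  holds because two closed sieves that agree on a covering sieve are equal.\<close>

lemma sheaf_Omega: "is_sheaf U C Omega"
  unfolding is_sheaf_def
proof (intro conjI allI impI)
  show "is_presheaf C Omega"
  proof (rule presheafI)
    fix A s assume "comm_mon C A" "s \<in> sec Omega A"
    then show "res Omega A A (idt C (mcar A)) s = s"
      using spull_idt[of s A] closed_sieveD(1)[of A s] by (simp add: Omega_def)
  qed (simp_all add: Omega_def closed_sieve_pull spull_spull)
next
  fix A W x assume W: "zariski_cover U C A W" and "matching_family C Omega W x"
  note D = zariski_coverD[OF W]
  note m = matchingD[OF \<open>matching_family C Omega W x\<close> D(3), unfolded Omega_def, simplified]
  define S0 where "S0 = {(G, g \<cdot> f) | G g B f. (B, f) \<in> W \<and> (G, g) \<in> x (B, f)}"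
  let ?S = "closure_sieve A S0"
  have r: "spull B f ?S = x (B, f)" if w: "(B, f) \<in> W" for B f
  proof (intro equalityI subsetI; clarify)
    note f = D(3)[OF w] and xc = closed_sieveD[OF m(1)[OF w]]
    fix G g
    { assume "(G, g) \<in> x (B, f)"
      then have g: "g \<in> hm B G" "(G, g) \<in> x (B, f)" using xc(1) by blast+
      have "covering G (spull G (g \<cdot> f) S0)"
      proof (rule covering_full)
        fix H k assume k: "k \<in> hm G H"
        have "(H, k \<cdot> (g \<cdot> f)) \<in> S0"
          unfolding S0_def hm_assoc[OF f g(1) k, symmetric] using w xc(2)[OF g(2) k] by blast
        then show "(H, k) \<in> spull G (g \<cdot> f) S0" using k by simp
      qed
      then show "(G, g) \<in> spull B f ?S" using g hm_comp[OF f g(1)] by (simp add: closure_sieve_def)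
    next
      assume "(G, g) \<in> spull B f ?S"
      then have g: "g \<in> hm B G" "covering G (spull G (g \<cdot> f) S0)" by (simp_all add: closure_sieve_def)
      \<comment> \<open>An arrow of the glued sieve comes locally from some member
        \<open>(B', f')\<close>. The matching condition, applied to the commutative square that
        results, puts it into \<open>x (B, f)\<close>.\<close>
      have "covering G (spull G g (x (B, f)))"
      proof (rule covering_mono[OF g(2)])
        fix H k assume k: "k \<in> hm G H" "(H, k) \<in> spull G (g \<cdot> f) S0"
        then obtain B' f' g' where w': "(B', f') \<in> W" and g': "(H, g') \<in> x (B', f')" "k \<cdot> (g \<cdot> f) = g' \<cdot> f'" unfolding S0_def by auto
        note xc' = closed_sieveD[OF m(1)[OF w']]
        have gh: "g' \<in> hm B' H" by (rule xc'(1)[OF g'(1)])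
        note kg = hm_comp[OF g(1) k(1)] and iH = hm_ide[OF hmD(2)[OF k(1)]]
        have "spull H (k \<cdot> g) (x (B, f)) = spull H g' (x (B', f'))"
          by (rule m(2)[OF w w' kg gh]) (use g'(2) hm_assoc[OF f g(1) k(1)] in simp)
        moreover have "(H, idt C (mcar H)) \<in> spull H g' (x (B', f'))" using iH g'(1) hm_idt(2)[OF gh] by simp
        ultimately have "(H, idt C (mcar H)) \<in> spull H (k \<cdot> g) (x (B, f))" by simp
        then show "(H, k) \<in> spull G g (x (B, f))" using k(1) hm_idt(2)[OF kg] by simp
      qed
      then show "(G, g) \<in> x (B, f)" by (rule xc(3)[OF g(1)]) }
  qed
  show "\<exists>!s. s \<in> sec Omega A \<and> (\<forall>(B, f)\<in>W. res Omega A B f s = x (B, f))"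
  proof (rule ex1I[of _ ?S])
    show "?S \<in> sec Omega A \<and> (\<forall>(B, f)\<in>W. res Omega A B f ?S = x (B, f))"
      using closed_closure r by (auto simp: Omega_def)
    fix S assume "S \<in> sec Omega A \<and> (\<forall>(B, f)\<in>W. res Omega A B f S = x (B, f))"
    then have S: "closed_sieve A S" "\<And>B f. (B, f) \<in> W \<Longrightarrow> spull B f S = x (B, f)" by (auto simp: Omega_def)
    have sub: "(G, h) \<in> S2" if "closed_sieve A S1" "closed_sieve A S2" "\<And>B f. (B, f) \<in> W \<Longrightarrow> spull B f S1 = spull B f S2" "(G, h) \<in> S1"
      for S1 S2 G h
    proof -
      note c1 = closed_sieveD[OF that(1)] and c2 = closed_sieveD[OF that(2)]
      have h: "h \<in> hm A G" by (rule c1(1)[OF that(4)])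
      have "covering G (spull G h S2)"
      proof (rule covering_mono[OF covering_pull[OF zariski_covering_sieve[OF W] h]])
        fix H k assume k: "k \<in> hm G H" "(H, k) \<in> spull G h (sieve_gen W)"
        then obtain B f g where w: "(B, f) \<in> W" "g \<in> hm B H" "k \<cdot> h = g \<cdot> f" by (auto simp: sieve_gen_def)
        have "(H, g \<cdot> f) \<in> S1" using c1(2)[OF that(4) k(1)] w(3) by simp
        then have "(H, g) \<in> spull B f S1" using w(2) by simp
        then have "(H, g \<cdot> f) \<in> S2" unfolding that(3)[OF w(1)] by simp
        then show "(H, k) \<in> spull G h S2" using k(1) w(3) by simp
      qed
      then show ?thesis by (rule c2(3)[OF h])
    qed
    show "S = ?S"
      using sub[OF S(1) closed_closure[of A S0]] sub[OF closed_closure[of A S0] S(1)] S(2) r by (auto simp del: spull_iff)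
  qed
qed

lemma sheaf_morD: assumes "sheaf_mor U C F G \<phi>"
  shows "is_sheaf U C F" "is_sheaf U C G" "\<lbrakk>comm_mon C A; s \<in> sec F A\<rbrakk> \<Longrightarrow> \<phi> A s \<in> sec G A"
    "\<lbrakk>f \<in> hm A B; s \<in> sec F A\<rbrakk> \<Longrightarrow> \<phi> B (res F A B f s) = res G A B f (\<phi> A s)"
  using assms unfolding sheaf_mor_def by (simp_all add: hm_def)

lemma sheaf_morI: assumes "is_sheaf U C F" "is_sheaf U C G" "\<And>A s. \<lbrakk>comm_mon C A; s \<in> sec F A\<rbrakk> \<Longrightarrow> \<phi> A s \<in> sec G A"
    "\<And>A B f s. \<lbrakk>f \<in> hm A B; s \<in> sec F A\<rbrakk> \<Longrightarrow> \<phi> B (res F A B f s) = res G A B f (\<phi> A s)"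
  shows "sheaf_mor U C F G \<phi>"
  using assms unfolding sheaf_mor_def by (simp add: hm_def)

text \<open>The classifying map of the image of \<open>\<Coprod>\<^sub>i F\<^sub>i \<rightarrow> G\<close> agrees with the constant map to the
  maximal sieve on all \<open>F\<^sub>i\<close>.\<close>

lemma epi_locally_liftable:
  assumes X: "is_sheaf U C X" and epi: "coproduct_epi U C I Fs \<phi>s X" and B: "comm_mon C B" and s: "s \<in> sec X B"
  shows "covering B {(G, h). h \<in> hm B G \<and> (\<exists>i\<in>I. \<exists>t\<in>sec (Fs i) G. \<phi>s i G t = res X B G h s)}"
proof -
  define L where "L B s = {(G, h). h \<in> hm B G \<and> (\<exists>i\<in>I. \<exists>t\<in>sec (Fs i) G. \<phi>s i G t = res X B G h s)}" for B s
  have F: "\<And>i. i \<in> I \<Longrightarrow> sheaf_mor U C (Fs i) X (\<phi>s i)" using epi by (simp add: coproduct_epi_def)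
  note P = presheafD[OF sheafD(1)[OF X]]
  let ?g = "\<lambda>A s. closure_sieve A (L A s)" and ?h = "\<lambda>A s. closure_sieve A {(G, g). g \<in> hm A G}"
  have Lp: "spull B f (L A s) = L B (res X A B f s)" if "f \<in> hm A B" "s \<in> sec X A" for A B f s
    using P(3)[OF that(1) _ that(2)] hm_comp[OF that(1)] by (auto simp: L_def) blast+
  have g: "sheaf_mor U C X Omega ?g"
  proof (rule sheaf_morI[OF X sheaf_Omega])
    fix A B f s assume "f \<in> hm A B" "s \<in> sec X A"
    then show "closure_sieve B (L B (res X A B f s)) = res Omega A B f (closure_sieve A (L A s))"
      using closure_pull[of f A B "L A s"] Lp[of f A B s] by (simp add: Omega_def)
  qed (simp add: Omega_def closed_closure)
  have h: "sheaf_mor U C X Omega ?h"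
  proof (rule sheaf_morI[OF X sheaf_Omega])
    fix A B f s assume "f \<in> hm A B" "s \<in> sec X A"
    moreover have "spull B f {(G, g). g \<in> hm A G} = {(G, g). g \<in> hm B G}" using hm_comp[OF \<open>f \<in> hm A B\<close>] by auto
    ultimately show "closure_sieve B {(G, g). g \<in> hm B G} = res Omega A B f (closure_sieve A {(G, g). g \<in> hm A G})"
      using closure_pull[of f A B "{(G, g). g \<in> hm A G}"] by (simp add: Omega_def)
  qed (simp add: Omega_def closed_closure)
  have "mor_eq C (Fs i) (\<lambda>A s. ?g A (\<phi>s i A s)) (\<lambda>A s. ?h A (\<phi>s i A s))" if i: "i \<in> I" for i
    unfolding mor_eq_def
  proof (intro ballI)
    fix A s assume A: "A \<in> Ob (Comm C)" and s: "s \<in> sec (Fs i) A"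
    note M = sheaf_morD[OF F[OF i]]
    have "L A (\<phi>s i A s) = {(G, g). g \<in> hm A G}"
      unfolding L_def using i M(4)[OF _ s] presheafD(1)[OF sheafD(1)[OF M(1)] _ s] by auto metis
    then show "?g A (\<phi>s i A s) = ?h A (\<phi>s i A s)" by simp
  qed
  then have "mor_eq C X ?g ?h" using epi g h unfolding coproduct_epi_def by blast
  then have e: "closure_sieve B (L B s) = closure_sieve B {(G, g). g \<in> hm B G}" using B s by (simp add: mor_eq_def)
  \<comment> \<open>The maximal sieve contains the identity; hence so does the closure of the
    liftable arrows, which says that these cover.\<close>
  have "(B, idt C (mcar B)) \<in> closure_sieve B {(G, g). g \<in> hm B G}"
    unfolding closure_sieve_def using hm_ide[OF B] hm_comp[OF hm_ide[OF B]] by (auto intro!: covering_full)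
  then have "covering B (spull B (idt C (mcar B)) (L B s))" unfolding e[symmetric] by (simp add: closure_sieve_def)
  moreover have "spull B (idt C (mcar B)) (L B s) = L B s" by (rule spull_idt) (simp add: L_def)
  ultimately show ?thesis by (simp add: L_def)
qed

end

section \<open>Open immersions of affine schemes\<close>

context geometry
begin

notation comp (infixr "\<bullet>" 70)
notation tns (infixr "**" 75)

lemma Spec_simps [simp]: "sec (Spec C A) B = Hom (Comm C) A B" "res (Spec C A) B D g s = g \<cdot> s"
  by (simp_all add: Spec_def)

lemma sheaf_glue:
  assumes F: "is_sheaf U C F" and W: "zariski_cover U C A W" and m: "matching_family C F W x"
  obtains s where "s \<in> sec F A" "\<And>B f. (B, f) \<in> W \<Longrightarrow> res F A B f s = x (B, f)"
proof -
  from sheafD(2)[OF F W m] obtain s where s: "s \<in> sec F A \<and> (\<forall>(B, f)\<in>W. res F A B f s = x (B, f))" by (elim ex1E)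
  show ?thesis by (rule that[of s]) (use s in auto)
qed

lemma ex1_unique: "\<lbrakk>\<exists>!x. P x; P a; P b\<rbrakk> \<Longrightarrow> a = b" by blast

lemma sheaf_separated:
  assumes F: "is_sheaf U C F" and W: "zariski_cover U C A W" and s: "s \<in> sec F A" "t \<in> sec F A"
    and e: "\<And>B f. (B, f) \<in> W \<Longrightarrow> res F A B f s = res F A B f t"
  shows "s = t"
proof -
  note P = presheafD[OF sheafD(1)[OF F]] and Z = zariski_coverD(3)[OF W]
  have "matching_family C F W (\<lambda>(B, f). res F A B f t)"
  proof (rule matchingI)
    show "(case (B, f) of (B, f) \<Rightarrow> res F A B f t) \<in> sec F B" if "(B, f) \<in> W" for B f
      using P(1)[OF Z[OF that] s(2)] by simp
    show "f \<in> hm A B" if "(B, f) \<in> W" for B f by (rule Z[OF that])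
    fix B f B' f' D g g' assume h: "(B, f) \<in> W" "(B', f') \<in> W" "g \<in> hm B D" "g' \<in> hm B' D" "g \<cdot> f = g' \<cdot> f'"
    then show "res F B D g (case (B, f) of (B, f) \<Rightarrow> res F A B f t) = res F B' D g' (case (B', f') of (B, f) \<Rightarrow> res F A B f t)"
      using P(3)[OF Z[OF h(1)] h(3) s(2)] P(3)[OF Z[OF h(2)] h(4) s(2)] by simp
  qed
  from sheafD(2)[OF F W this] have u: "s = t"
    if "s \<in> sec F A \<and> (\<forall>(B, f)\<in>W. res F A B f s = (case (B, f) of (B, f) \<Rightarrow> res F A B f t))"
      "t \<in> sec F A \<and> (\<forall>(B, f)\<in>W. res F A B f t = (case (B, f) of (B, f) \<Rightarrow> res F A B f t))"
    by (rule ex1_unique) (rule that)+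
  show ?thesis by (rule u) (use s e in auto)
qed

text \<open>A subpresheaf of a sheaf is a sheaf as soon as membership is local; the glueing itself
  takes place in \<open>G\<close>.\<close>

lemma subsheafI:
  assumes G: "is_sheaf U C G" and sub: "\<And>A s. \<lbrakk>comm_mon C A; s \<in> S A\<rbrakk> \<Longrightarrow> s \<in> sec G A"
    and r: "\<And>A B f s. \<lbrakk>f \<in> hm A B; s \<in> S A\<rbrakk> \<Longrightarrow> res G A B f s \<in> S B"
    and loc: "\<And>A W s. \<lbrakk>zariski_cover U C A W; s \<in> sec G A; \<And>B f. (B, f) \<in> W \<Longrightarrow> res G A B f s \<in> S B\<rbrakk> \<Longrightarrow> s \<in> S A"
  shows "subsheaf U C G S"
  unfolding subsheaf_def
proof (intro conjI ballI subsetI)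
  let ?S = "\<lparr>sec = S, res = res G\<rparr>"
  note P = presheafD[OF sheafD(1)[OF G]]
  show "s \<in> sec G A" if "A \<in> Ob (Comm C)" "s \<in> S A" for A s using sub that by simp
  show "is_sheaf U C ?S" unfolding is_sheaf_def
  proof (intro conjI allI impI)
    show "is_presheaf C ?S" by (rule presheafI) (use r sub P(2,3) hmD(1) in auto)
    fix A W x assume W: "zariski_cover U C A W" and x: "matching_family C ?S W x"
    note D = zariski_coverD[OF W]
    note m = matchingD[OF x D(3), simplified]
    have "matching_family C G W x"
    proof (rule matchingI[OF _ D(3)])
      show "x (B, f) \<in> sec G B" if "(B, f) \<in> W" for B f using sub[OF hmD(2)[OF D(3)[OF that]] m(1)[OF that]] .
    qed (assumption, rule m(2))
    then obtain s where s: "s \<in> sec G A" "\<And>B f. (B, f) \<in> W \<Longrightarrow> res G A B f s = x (B, f)"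
      using sheaf_glue[OF G W] by metis
    have "s \<in> S A" by (rule loc[OF W s(1)]) (use s(2) m(1) in simp)
    then show "\<exists>!s. s \<in> sec ?S A \<and> (\<forall>(B, f)\<in>W. res ?S A B f s = x (B, f))"
    proof (intro ex1I[of _ s])
      show "s \<in> sec ?S A \<and> (\<forall>(B, f)\<in>W. res ?S A B f s = x (B, f))" using \<open>s \<in> S A\<close> s(2) by auto
      fix t assume "t \<in> sec ?S A \<and> (\<forall>(B, f)\<in>W. res ?S A B f t = x (B, f))"
      then show "t = s" using s(2) sub[OF D(1)] by (intro sheaf_separated[OF G W _ s(1)]) auto
    qed
  qed
qed

text \<open>The image is the smallest subsheaf through which all members of \<open>W\<close> factor.
  It is therefore contained in \<open>T\<close>, the sections along which finitely many members of
  \<open>W\<close> detect zero modules, once \<open>T\<close> is seen to be such a subsheaf.\<close>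

lemma zariski_open_detected:
  assumes A: "comm_mon C A" "is_sheaf U C (Spec C A)" and W: "\<And>B f. (B, f) \<in> W \<Longrightarrow> zariski_immersion U C A B f"
    and S: "coproduct_image U C W (\<lambda>(B, f). Spec C B) (\<lambda>(B, f). Spec_mor C f) (Spec C A) S"
    and g: "comm_mon C E" "g \<in> S E"
  shows "\<exists>L\<subseteq>W. finite L \<and> (\<forall>N. md E N \<and> (\<forall>(D, d)\<in>L. van A D d (rm (cm A E g) N)) \<longrightarrow> null (ucar N))"
proof -
  let ?P = "\<lambda>E g L. \<forall>N. md E N \<and> (\<forall>(D, d)\<in>L. van A D d (rm (cm A E g) N)) \<longrightarrow> null (ucar N)"
  define T where "T E = {g \<in> hm A E. \<exists>L\<subseteq>W. finite L \<and> ?P E g L}" for E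
  note Wh = zariski_immersionD[OF W]
  have "subsheaf U C (Spec C A) T"
  proof (rule subsheafI[OF A(2)])
    fix E s assume "s \<in> T E"
    then show "s \<in> sec (Spec C A) E" using hmD(3) by (auto simp: T_def)
  next
    fix E E' h s assume h: "h \<in> hm E E'" and "s \<in> T E"
    then obtain L where s: "s \<in> hm A E" and L: "L \<subseteq> W" "finite L" "?P E s L" by (auto simp: T_def)
    have "null (ucar N)" if N: "md E' N" and v: "\<forall>(D, d)\<in>L. van A D d (rm (cm A E' (h \<cdot> s)) N)" for N
    proof -
      have "rm (cm A E' (h \<cdot> s)) N = rm (cm A E s) (rm (cm E E' h) N)"
        unfolding cm_comp[OF s h, symmetric] by (rule rm_comp[OF hmD(4)[OF s] hmD(4)[OF h] N])
      then have "null (ucar (rm (cm E E' h) N))"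
        using v md_rm[OF hmD(4)[OF h] N] by (intro L(3)[rule_format]) simp
      then show ?thesis by simp
    qed
    then show "res (Spec C A) E E' h s \<in> T E'" using hm_comp[OF s h] L(1,2) unfolding T_def by auto
  next
    \<comment> \<open>Locality: the finite families belonging to finitely many members of the cover
      are united. A module killed by the union stays killed after base change to each of these
      members, by \<open>vanish_base_change\<close>.\<close>
    fix E V s assume V: "zariski_cover U C E V" and s: "s \<in> sec (Spec C A) E"
      and loc: "\<And>B f. (B, f) \<in> V \<Longrightarrow> res (Spec C A) E B f s \<in> T B"
    note D = zariski_coverD[OF V]
    have sh: "s \<in> hm A E" using s A(1) D(1) by (simp add: hm_def)
    obtain V' where V': "V' \<subseteq> V" "finite V'" and c: "\<And>N. \<lbrakk>md E N; \<forall>(B, f)\<in>V'. van E B f N\<rbrakk> \<Longrightarrow> null (ucar N)" using D(4) by blast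
    have "\<forall>x\<in>V'. \<exists>L. L \<subseteq> W \<and> finite L \<and> ?P (fst x) (snd x \<cdot> s) L"
    proof
      fix x assume "x \<in> V'"
      then have "(fst x, snd x) \<in> V" using V'(1) by auto
      from loc[OF this] show "\<exists>L. L \<subseteq> W \<and> finite L \<and> ?P (fst x) (snd x \<cdot> s) L" unfolding T_def by simp
    qed
    from bchoice[OF this] obtain L where L: "\<forall>x\<in>V'. L x \<subseteq> W \<and> finite (L x) \<and> ?P (fst x) (snd x \<cdot> s) (L x)" by (elim exE)
    let ?L = "\<Union>x\<in>V'. L x"
    have "null (ucar N)" if N: "md E N" and v: "\<forall>(D, d)\<in>?L. van A D d (rm (cm A E s) N)" for N
    proof (rule c[OF N], clarify)
      fix B f assume x: "(B, f) \<in> V'"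
      then have f: "f \<in> hm E B" using D(3) V'(1) by blast
      have "van A D d (rm (cm A B (f \<cdot> s)) (bco E B (cm E B f) N))" if "(D, d) \<in> L (B, f)" for D d
      proof -
        have "van A D d (rm (cm A E s) N)" using v x that by blast
        moreover have "d \<in> hm A D" using L x that Wh(1) by blast
        ultimately show ?thesis
          using vanish_base_change[OF hmD(4)[OF sh] hmD(4)[OF f] hmD(4) N] cm_comp[OF sh f] by (simp add: van_def)
      qed
      then have "null (ucar (bco E B (cm E B f) N))" using L[rule_format, OF x] univD(3)[OF univ_bc[OF hmD(4)[OF f] N]] by auto
      then show "van E B f N" by (simp add: van_def vanish_def)
    qed
    moreover have "?L \<subseteq> W" "finite ?L" using L V'(2) by auto
    ultimately show "s \<in> T E" unfolding T_def using sh by blast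
  qed
  moreover have "(case x of (B, f) \<Rightarrow> Spec_mor C f) D ` sec (case x of (B, f) \<Rightarrow> Spec C B) D \<subseteq> T D"
    if x: "x \<in> W" and D: "D \<in> Ob (Comm C)" for x D
  proof -
    obtain B f where xf: "x = (B, f)" by (cases x)
    note z = Wh[OF x[unfolded xf]]
    have "k \<cdot> f \<in> T D" if "k \<in> Hom (Comm C) B D" for k
    proof -
      have k: "k \<in> hm B D" using that D hmD(2)[OF z(1)] by (simp add: hm_def)
      \<comment> \<open>For a section that factors through \<open>f\<close> the single member
        \<open>(B, f)\<close> suffices: \<open>N\<close> restricts to a \<open>B\<close>-module, and
        since \<open>f\<close> is an epimorphism the base change of its restriction to
        \<open>A\<close> gives this module back.\<close>
      have "null (ucar N)" if N: "md D N" and v: "van A B f (rm (cm A D (k \<cdot> f)) N)" for N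
      proof -
        have "rm (cm A D (k \<cdot> f)) N = rm (cm A B f) (rm (cm B D k) N)"
          unfolding cm_comp[OF z(1) k, symmetric] by (rule rm_comp[OF hmD(4)[OF z(1)] hmD(4)[OF k] N])
        then show ?thesis using v vanish_epi[OF z(3) md_rm[OF hmD(4)[OF k] N]] by (simp add: van_def)
      qed
      then show ?thesis unfolding T_def using hm_comp[OF z(1) k] x xf by (auto intro!: exI[of _ "{(B, f)}"])
    qed
    then show ?thesis by (auto simp: xf Spec_mor_def)
  qed
  ultimately have "S E \<subseteq> T E" using S g(1) unfolding coproduct_image_def by simp
  then show ?thesis using g(2) unfolding T_def by blast
qed

text \<open>Transport along an injection of the values; it brings fibre products into the value type
  of the test sheaves.\<close>

lemma sheaf_encode:
  assumes F: "is_sheaf U C F" and en: "\<And>p. de (en p) = p"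
  shows "is_sheaf U C \<lparr>sec = (\<lambda>D. en ` sec F D), res = (\<lambda>D E h x. en (res F D E h (de x)))\<rparr>" (is "is_sheaf U C ?T")
  unfolding is_sheaf_def
proof (intro conjI allI impI)
  note P = presheafD[OF sheafD(1)[OF F]]
  show "is_presheaf C ?T" by (rule presheafI) (use P en in auto)
  fix A W x assume W: "zariski_cover U C A W" and x: "matching_family C ?T W x"
  note D = zariski_coverD[OF W]
  note m = matchingD[OF x D(3), simplified]
  have xe: "x (B, f) = en (de (x (B, f)))" "de (x (B, f)) \<in> sec F B" if "(B, f) \<in> W" for B f using m(1)[OF that] en by auto
  have inj: "p = q" if "en p = en q" for p q using arg_cong[OF that, of de] en by simp
  have mf: "matching_family C F W (\<lambda>w. de (x w))"
    by (rule matchingI) (use xe(2) D(3) m(2) inj in blast)+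
  obtain s where s: "s \<in> sec F A" "\<And>B f. (B, f) \<in> W \<Longrightarrow> res F A B f s = de (x (B, f))"
    using sheaf_glue[OF F W mf] by metis
  show "\<exists>!s. s \<in> sec ?T A \<and> (\<forall>(B, f)\<in>W. res ?T A B f s = x (B, f))"
  proof (rule ex1I[of _ "en s"])
    show "en s \<in> sec ?T A \<and> (\<forall>(B, f)\<in>W. res ?T A B f (en s) = x (B, f))" using s xe(1) en by auto
    fix y assume "y \<in> sec ?T A \<and> (\<forall>(B, f)\<in>W. res ?T A B f y = x (B, f))"
    then have y: "y \<in> en ` sec F A" "\<And>B f. (B, f) \<in> W \<Longrightarrow> en (res F A B f (de y)) = x (B, f)" by auto
    then obtain s' where s': "s' \<in> sec F A" "y = en s'" by blast
    have "s' = s"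
    proof (rule sheaf_separated[OF F W s'(1) s(1)])
      fix B f assume w: "(B, f) \<in> W"
      have "de (en (res F A B f (de y))) = de (x (B, f))" using y(2)[OF w] by simp
      then show "res F A B f s' = res F A B f s" using s(2)[OF w] s'(2) en by simp
    qed
    then show "y = en s" using s'(2) by simp
  qed
qed

lemma open_immersion_mor: "open_immersion U C F G \<phi> \<Longrightarrow> sheaf_mor U C F G \<phi>"
  by (simp add: open_immersion_def)

lemma open_immersion_mono:
  assumes "open_immersion U C F G \<phi>" "comm_mon C A" "sheaf_mor U C (Spec C A) G \<psi>"
  shows "sheaf_mono U C (fibre_product F (Spec C A) \<phi> \<psi>) (Spec C A) (\<lambda>_. snd)"
  using assms unfolding open_immersion_def Let_def by simp

text \<open>The test sheaf is a copy of the kernel pair of \<open>\<phi>\<close>, a pair \<open>(s, t)\<close> of sections being encoded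
  by \<open>{(\<lparr>mcar = undefined, mmul = s, muni = s\<rparr>, t)}\<close>.\<close>

lemma open_immersion_inj:
  assumes o: "open_immersion U C (Spec C A) X \<phi>" and st: "s \<in> hm A E" "t \<in> hm A E" "\<phi> E s = \<phi> E t"
  shows "s = t"
proof -
  have A: "comm_mon C A" and E: "comm_mon C E" using hmD(1,2)[OF st(1)] .
  note mor = open_immersion_mor[OF o]
  let ?P = "fibre_product (Spec C A) (Spec C A) \<phi> \<phi>"
  have mono: "sheaf_mono U C ?P (Spec C A) (\<lambda>_. snd)" by (rule open_immersion_mono[OF o A mor])
  then have P: "is_sheaf U C ?P" using sheaf_morD(1) unfolding sheaf_mono_def by blast
  define en :: "'a \<times> 'a \<Rightarrow> (('o, 'a) mon \<times> 'a) set" where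
    "en p = {(\<lparr>mcar = undefined, mmul = fst p, muni = fst p\<rparr>, snd p)}" for p
  define de :: "(('o, 'a) mon \<times> 'a) set \<Rightarrow> 'a \<times> 'a" where "de x = (mmul (fst (the_elem x)), snd (the_elem x))" for x
  have en: "de (en p) = p" for p by (simp add: de_def en_def)
  define T where "T = \<lparr>sec = (\<lambda>D. en ` sec ?P D), res = (\<lambda>D E h x. en (res ?P D E h (de x)))\<rparr>"
  have T: "is_sheaf U C T" unfolding T_def by (rule sheaf_encode[where de = de and en = en, OF P en])
  have g: "sheaf_mor U C T ?P (\<lambda>_. de)"
    by (rule sheaf_morI[OF T P]) (use en in \<open>auto simp: T_def\<close>)
  have h: "sheaf_mor U C T ?P (\<lambda>_ x. (snd (de x), snd (de x)))"
    by (rule sheaf_morI[OF T P]) (use en in \<open>auto simp: T_def fibre_product_def\<close>)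
  \<comment> \<open>The pairs (s, t) and (t, t) have the same second component, so the monomorphism
    \<open>snd\<close> cannot tell them apart.\<close>
  have "mor_eq C T (\<lambda>A s. snd (de s)) (\<lambda>A s. snd (snd (de s), snd (de s)))" by (simp add: mor_eq_def)
  then have "mor_eq C T (\<lambda>_. de) (\<lambda>_ x. (snd (de x), snd (de x)))"
    using mono g h unfolding sheaf_mono_def by blast
  moreover have "en (s, t) \<in> sec T E" using st hmD(3) by (auto simp: T_def fibre_product_def)
  ultimately have "de (en (s, t)) = (snd (de (en (s, t))), snd (de (en (s, t))))" using E unfolding mor_eq_def by simp
  then show ?thesis by (simp add: en)
qed

lemma mor_nat: assumes "sheaf_mor U C (Spec C A) X \<phi>" "s \<in> hm A D" "k \<in> hm D E" shows "\<phi> E (k \<cdot> s) = res X D E k (\<phi> D s)"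
  using sheaf_morD(4)[OF assms(1,3)] hmD(3)[OF assms(2)] by simp

lemma mor_nat_eq: assumes "sheaf_mor U C (Spec C A) X \<phi>" "sheaf_mor U C (Spec C B) X \<psi>"
    "s \<in> hm A D" "t \<in> hm B D" "k \<in> hm D E" "\<phi> D s = \<psi> D t"
  shows "\<phi> E (k \<cdot> s) = \<psi> E (k \<cdot> t)"
  using mor_nat[OF assms(1,3,5)] mor_nat[OF assms(2,4,5)] assms(6) by simp

text \<open>The Zariski open subschemes \<open>Spec D\<close> of \<open>Spec B\<close> whose union is the image of \<open>Spec A \<times>\<^sub>X Spec B\<close>.\<close>

definition image_family where
  "image_family A \<alpha> B \<beta> W \<longleftrightarrow> (\<forall>(D, d)\<in>W. zariski_immersion U C B D d \<and> (\<exists>a\<in>hm A D. \<alpha> D a = \<beta> D d)) \<and>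
    (\<forall>E h t. h \<in> hm B E \<and> t \<in> hm A E \<and> \<alpha> E t = \<beta> E h \<longrightarrow>
      (\<exists>L\<subseteq>W. finite L \<and> (\<forall>N. md E N \<and> (\<forall>(D, d)\<in>L. van B D d (rm (cm B E h) N)) \<longrightarrow> null (ucar N))))"

lemma image_familyD: assumes "image_family A \<alpha> B \<beta> W"
  shows "(D, d) \<in> W \<Longrightarrow> zariski_immersion U C B D d" "(D, d) \<in> W \<Longrightarrow> \<exists>a\<in>hm A D. \<alpha> D a = \<beta> D d"
    "\<lbrakk>h \<in> hm B E; t \<in> hm A E; \<alpha> E t = \<beta> E h\<rbrakk> \<Longrightarrow>
      \<exists>L\<subseteq>W. finite L \<and> (\<forall>N. md E N \<and> (\<forall>(D, d)\<in>L. van B D d (rm (cm B E h) N)) \<longrightarrow> null (ucar N))"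
  using assms unfolding image_family_def by blast+

text \<open>The image of \<open>Spec A \<times>\<^sub>X Spec B\<close> in \<open>Spec B\<close> is formed sectionwise, since sections over \<open>Spec A\<close>
  are determined by their images in \<open>X\<close> and hence glue.\<close>

lemma open_immersion_image:
  assumes o: "open_immersion U C (Spec C A) X \<alpha>" and A: "comm_mon C A" and \<beta>: "sheaf_mor U C (Spec C B) X \<beta>" and B: "comm_mon C B"
  shows "\<exists>W. image_family A \<alpha> B \<beta> W"
proof -
  let ?P = "fibre_product (Spec C A) (Spec C B) \<alpha> \<beta>"
  note mor = open_immersion_mor[OF o]
  note \<beta>D = sheaf_morD[OF \<beta>] and \<alpha>D = sheaf_morD[OF mor]
  obtain S where S: "sheaf_image U C ?P (Spec C B) (\<lambda>_. snd) S" and z: "zariski_open_of_affine U C B S"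
    using o \<beta> B unfolding open_immersion_def Let_def by (metis Comm_simps(1))
  obtain W where W: "\<And>D d. (D, d) \<in> W \<Longrightarrow> zariski_immersion U C B D d"
    and SW: "coproduct_image U C W (\<lambda>(B, f). Spec C B) (\<lambda>(B, f). Spec_mor C f) (Spec C B) S"
    using z unfolding zariski_open_of_affine_def by auto
  define T where "T D = {t \<in> hm B D. \<exists>s\<in>hm A D. \<alpha> D s = \<beta> D t}" for D
  have "subsheaf U C (Spec C B) T"
  proof (rule subsheafI[OF \<beta>D(1)])
    fix D t assume "t \<in> T D"
    then show "t \<in> sec (Spec C B) D" using hmD(3) by (auto simp: T_def)
  next
    fix D E k t assume k: "k \<in> hm D E" and "t \<in> T D"
    then obtain s where s: "t \<in> hm B D" "s \<in> hm A D" "\<alpha> D s = \<beta> D t" by (auto simp: T_def)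
    then show "res (Spec C B) D E k t \<in> T E"
      using mor_nat_eq[OF mor \<beta> s(2,1) k s(3)] hm_comp[OF s(1) k] hm_comp[OF s(2) k] by (auto simp: T_def)
  next
    fix D V t assume V: "zariski_cover U C D V" and t: "t \<in> sec (Spec C B) D"
      and loc: "\<And>E f. (E, f) \<in> V \<Longrightarrow> res (Spec C B) D E f t \<in> T E"
    note Z = zariski_coverD[OF V]
    have th: "t \<in> hm B D" using t B Z(1) by (simp add: hm_def)
    have "\<forall>x\<in>V. \<exists>s. s \<in> hm A (fst x) \<and> \<alpha> (fst x) s = \<beta> (fst x) (snd x \<cdot> t)" using loc unfolding T_def by fastforce
    from bchoice[OF this] obtain s where s: "\<forall>x\<in>V. s x \<in> hm A (fst x) \<and> \<alpha> (fst x) (s x) = \<beta> (fst x) (snd x \<cdot> t)" by (elim exE)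
    have sx: "s (E, f) \<in> hm A E" "\<alpha> E (s (E, f)) = \<beta> E (f \<cdot> t)" if "(E, f) \<in> V" for E f using s[rule_format, OF that] by simp_all
    have "matching_family C (Spec C A) V s"
    proof (rule matchingI)
      show "s (E, f) \<in> sec (Spec C A) E" if "(E, f) \<in> V" for E f using hmD(3)[OF sx(1)[OF that]] by simp
      show "f \<in> hm D E" if "(E, f) \<in> V" for E f by (rule Z(3)[OF that])
      fix E f E' f' H g g' assume h: "(E, f) \<in> V" "(E', f') \<in> V" "g \<in> hm E H" "g' \<in> hm E' H" "g \<cdot> f = g' \<cdot> f'"
      note f = Z(3)[OF h(1)] and f' = Z(3)[OF h(2)]
      have "\<alpha> H (g \<cdot> s (E, f)) = \<beta> H (g \<cdot> (f \<cdot> t))" by (rule mor_nat_eq[OF mor \<beta> sx(1)[OF h(1)] hm_comp[OF th f] h(3) sx(2)[OF h(1)]])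
      also have "\<dots> = \<beta> H (g' \<cdot> (f' \<cdot> t))" using hm_assoc[OF th f h(3)] hm_assoc[OF th f' h(4)] h(5) by simp
      also have "\<dots> = \<alpha> H (g' \<cdot> s (E', f'))"
        by (rule mor_nat_eq[OF mor \<beta> sx(1)[OF h(2)] hm_comp[OF th f'] h(4) sx(2)[OF h(2)], symmetric])
      finally have "g \<cdot> s (E, f) = g' \<cdot> s (E', f')"
        by (rule open_immersion_inj[OF o hm_comp[OF sx(1)[OF h(1)] h(3)] hm_comp[OF sx(1)[OF h(2)] h(4)]])
      then show "res (Spec C A) E H g (s (E, f)) = res (Spec C A) E' H g' (s (E', f'))" by simp
    qed
    then obtain r where "r \<in> sec (Spec C A) D" "\<And>E f. (E, f) \<in> V \<Longrightarrow> res (Spec C A) D E f r = s (E, f)"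
      using sheaf_glue[OF \<alpha>D(1) V] by metis
    then have r: "r \<in> Hom (Comm C) A D" "\<And>E f. (E, f) \<in> V \<Longrightarrow> f \<cdot> r = s (E, f)" by simp_all
    have rh: "r \<in> hm A D" using r(1) A Z(1) by (simp add: hm_def)
    have e: "res X D E f (\<alpha> D r) = res X D E f (\<beta> D t)" if "(E, f) \<in> V" for E f
      using mor_nat[OF mor rh Z(3)[OF that]] mor_nat[OF \<beta> th Z(3)[OF that]] sx(2)[OF that] r(2)[OF that] by simp
    have in_X: "\<alpha> D r \<in> sec X D" "\<beta> D t \<in> sec X D" using \<alpha>D(3)[OF Z(1)] \<beta>D(3)[OF Z(1)] r(1) t by simp_all
    have "\<alpha> D r = \<beta> D t" by (rule sheaf_separated[OF \<beta>D(2) V in_X e])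
    then show "t \<in> T D" using th rh by (auto simp: T_def)
  qed
  moreover have "snd ` sec ?P D \<subseteq> T D" if "D \<in> Ob (Comm C)" for D
    using that A B by (auto simp: T_def fibre_product_def hm_def)
  \<comment> \<open>Minimality of the image: every section of \<open>S\<close> lifts to
    \<open>Spec A\<close> over \<open>X\<close>.\<close>
  ultimately have ST: "S D \<subseteq> T D" if "comm_mon C D" for D using S that unfolding coproduct_image_def by simp
  have 1: "zariski_immersion U C B D d \<and> (\<exists>a\<in>hm A D. \<alpha> D a = \<beta> D d)" if d: "(D, d) \<in> W" for D d
  proof -
    note dh = zariski_immersionD(1)[OF W[OF d]]
    have "Spec_mor C d D ` sec (Spec C D) D \<subseteq> S D" using SW d hmD(2)[OF dh] unfolding coproduct_image_def by fastforce
    then have "d \<in> S D" using hmD(3)[OF hm_ide[OF hmD(2)[OF dh]]] hm_idt(2)[OF dh] by (force simp: Spec_mor_def)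
    then show "zariski_immersion U C B D d \<and> (\<exists>a\<in>hm A D. \<alpha> D a = \<beta> D d)" using W[OF d] ST[OF hmD(2)[OF dh]] by (auto simp: T_def)
  qed
  have 2: "\<exists>L\<subseteq>W. finite L \<and> (\<forall>N. md E N \<and> (\<forall>(D, d)\<in>L. van B D d (rm (cm B E h) N)) \<longrightarrow> null (ucar N))"
    if h: "h \<in> hm B E" "t \<in> hm A E" "\<alpha> E t = \<beta> E h" for E h t
  proof -
    have "(t, h) \<in> sec ?P E" using h hmD(3) by (auto simp: fibre_product_def)
    moreover have "snd ` sec ?P E \<subseteq> S E" using S hmD(2)[OF h(1)] unfolding coproduct_image_def by simp
    ultimately have "h \<in> S E" by force
    from zariski_open_detected[OF B \<beta>D(1) W SW hmD(2)[OF h(1)] this] show ?thesis .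
  qed
  show ?thesis unfolding image_family_def
  proof (rule exI[of _ W], rule conjI)
    show "\<forall>(D, d)\<in>W. zariski_immersion U C B D d \<and> (\<exists>a\<in>hm A D. \<alpha> D a = \<beta> D d)" using 1 by blast
  qed (intro allI impI, elim conjE, rule 2)
qed

text \<open>A module killed by a member of \<open>W\<close> is killed by every arrow that factors
  through it, so each arrow of the finite detecting family may be replaced by a member of
  \<open>W\<close>.\<close>

lemma detects_sieve_gen:
  assumes R: "detects A (sieve_gen W)" and W: "\<And>B f. (B, f) \<in> W \<Longrightarrow> f \<in> hm A B"
  shows "detects A W"
proof -
  obtain R0 where R0: "R0 \<subseteq> sieve_gen W" "finite R0" and N: "\<And>N. \<lbrakk>md A N; \<forall>(G, g)\<in>R0. van A G g N\<rbrakk> \<Longrightarrow> null (ucar N)"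
    using R unfolding detects_def by blast
  have "\<forall>x\<in>R0. \<exists>w. w \<in> W \<and> (\<exists>g\<in>hm (fst w) (fst x). snd x = g \<cdot> snd w)" using R0(1) unfolding sieve_gen_def by fastforce
  from bchoice[OF this] obtain w where w: "\<forall>x\<in>R0. w x \<in> W \<and> (\<exists>g\<in>hm (fst (w x)) (fst x). snd x = g \<cdot> snd (w x))" by (elim exE)
  have "null (ucar M)" if M: "md A M" and v: "\<forall>(B, f)\<in>w ` R0. van A B f M" for M
  proof (rule N[OF M], clarify)
    fix G k assume x: "(G, k) \<in> R0"
    obtain B f where wf: "w (G, k) = (B, f)" by (cases "w (G, k)")
    then obtain g where g: "(B, f) \<in> W" "g \<in> hm B G" "k = g \<cdot> f" using w x by force
    note f = W[OF g(1)]
    note m = univD(3)[OF univ_bc[OF hmD(4)[OF f] M]]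
    have "(B, f) \<in> w ` R0" using x wf by force
    then have "van A B f M" using v by blast
    then have "null (ucar (bco A B (cm A B f) M))" by (simp add: van_def vanish_def)
    then show "van A G k M" unfolding g(3) van_comp[OF f g(2) M] using vanish_null[OF hmD(4)[OF g(2)] m] by (simp add: van_def)
  qed
  then show ?thesis unfolding detects_def using w R0(2) by (intro exI[of _ "w ` R0"]) auto
qed

section \<open>Descent on an affine open subscheme\<close>

lemma noetherian_descent_family:
  assumes B: "comm_mon C B" and W: "finite L" "\<And>D d. (D, d) \<in> L \<Longrightarrow> mh B (D' D d) (d' D d)"
    "\<And>D d. (D, d) \<in> L \<Longrightarrow> flatU B (D' D d) (d' D d)" "\<And>D d. (D, d) \<in> L \<Longrightarrow> noetherian_monoid U C (D' D d)"
    and N: "\<And>N. \<lbrakk>md B N; \<And>D d. (D, d) \<in> L \<Longrightarrow> vanish B (D' D d) (d' D d) N\<rbrakk> \<Longrightarrow> null (ucar N)"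
  shows "noetherian_monoid U C B"
proof (rule noetherian_descent[OF B, of "(\<lambda>(D, d). (D' D d, d' D d)) ` L"])
  show "finite ((\<lambda>(D, d). (D' D d, d' D d)) ` L)" using W(1) by simp
  show "flatU B E f \<and> noetherian_monoid U C E" if "(E, f) \<in> (\<lambda>(D, d). (D' D d, d' D d)) ` L" for E f
    using that W(3,4) by auto
  fix M assume M: "md B M" "\<And>E f. (E, f) \<in> (\<lambda>(D, d). (D' D d, d' D d)) ` L \<Longrightarrow> vanish B E f M"
  show "null (ucar M)" by (rule N[OF M(1)], rule M(2)) force
qed

lemma noetherian_open_affine:
  assumes X: "is_sheaf U C X" and o: "\<And>i. i \<in> I \<Longrightarrow> open_immersion U C (Spec C (A i)) X (\<alpha> i)" and A: "\<And>i. i \<in> I \<Longrightarrow> noetherian_monoid U C (A i)"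
    and epi: "coproduct_epi U C I (\<lambda>i. Spec C (A i)) \<alpha> X" and B: "comm_mon C B" and \<beta>: "open_immersion U C (Spec C B) X \<beta>"
  shows "noetherian_monoid U C B"
proof -
  note mb = open_immersion_mor[OF \<beta>] and ma = open_immersion_mor[OF o]
  have cA: "comm_mon C (A i)" if "i \<in> I" for i using A[OF that] by (simp add: noetherian_monoid_def)
  have "\<forall>i\<in>I. \<exists>W. image_family (A i) (\<alpha> i) B \<beta> W" using open_immersion_image[OF o cA mb B] by blast
  from bchoice[OF this] obtain W where W0: "\<forall>i\<in>I. image_family (A i) (\<alpha> i) B \<beta> (W i)" by (elim exE)
  note W = image_familyD[OF W0[rule_format]]
  let ?W = "\<Union>i\<in>I. W i"
  note Wz = zariski_immersionD[OF W(1)]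
  \<comment> \<open>The arrows along which \<open>Spec B\<close> -> \<open>X\<close> lifts to some
    \<open>Spec (A i)\<close>. They cover because the epimorphism is locally liftable at the section
    of \<open>X\<close> given by the identity of \<open>B\<close>.\<close>
  let ?R = "{(G, h). h \<in> hm B G \<and> (\<exists>i\<in>I. \<exists>t\<in>hm (A i) G. \<alpha> i G t = \<beta> G h)}"
  let ?i = "idt C (mcar B)"
  note iB = hm_ide[OF B]
  have "covering B {(G, h). h \<in> hm B G \<and> (\<exists>i\<in>I. \<exists>t\<in>sec (Spec C (A i)) G. \<alpha> i G t = res X B G h (\<beta> B ?i))}"
    by (rule epi_locally_liftable[OF X epi B]) (use sheaf_morD(3)[OF mb B] hmD(3)[OF iB] in simp)
  then have cR: "covering B ?R"
  proof (rule covering_mono)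
    fix G h assume h: "h \<in> hm B G" "(G, h) \<in> {(G, h). h \<in> hm B G \<and> (\<exists>i\<in>I. \<exists>t\<in>sec (Spec C (A i)) G. \<alpha> i G t = res X B G h (\<beta> B ?i))}"
    then obtain i t where t: "i \<in> I" "t \<in> Hom (Comm C) (A i) G" "\<alpha> i G t = res X B G h (\<beta> B ?i)" by auto
    then have "\<alpha> i G t = \<beta> G h" using mor_nat[OF mb iB h(1)] hm_idt(1)[OF h(1)] by simp
    then show "(G, h) \<in> ?R" using h(1) t cA hmD(2)[OF h(1)] by (auto simp: hm_def)
  qed
  \<comment> \<open>The covering \<open>?R\<close> is refined by the opens in \<open>W i\<close>:
    where a lift to \<open>A i\<close> exists, finitely many members of \<open>W i\<close> detect
    zero modules, and their pushouts are arrows of the generated sieve.\<close>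
  have "detects B (sieve_gen ?W)"
  proof (rule detects_trans)
    show "detects B ?R"
      using cR[unfolded covering_def, rule_format, OF iB] spull_idt[of ?R B] by simp
    fix G h assume "(G, h) \<in> ?R"
    then obtain i t where h: "h \<in> hm B G" and i: "i \<in> I" and t: "t \<in> hm (A i) G" "\<alpha> i G t = \<beta> G h" by auto
    show "h \<in> hm B G" by (rule h)
    obtain L where L: "L \<subseteq> W i" "finite L" and N: "\<And>N. \<lbrakk>md G N; \<forall>(D, d)\<in>L. van B D d (rm (cm B G h) N)\<rbrakk> \<Longrightarrow> null (ucar N)"
      using W(3)[OF i h t] by blast
    have Lh: "d \<in> hm B D" if "(D, d) \<in> L" for D d using Wz(1)[OF i] L(1) that by blast
    have "\<exists>P u v. pushout B G D (cm B G h) (cm B D d) P u v" if "(D, d) \<in> L" for D d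
      using pushout_exists[OF hmD(4)[OF h] hmD(4)[OF Lh[OF that]]] by metis
    then obtain P u v where p: "\<And>D d. (D, d) \<in> L \<Longrightarrow> pushout B G D (cm B G h) (cm B D d) (P D d) (u D d) (v D d)" by metis
    show "detects G (spull G h (sieve_gen ?W))"
    proof (rule detects_pushout[OF h L(2) N p])
      fix D d assume d: "(D, d) \<in> L"
      note q = pushoutD[OF p[OF d]]
      have "aarr (u D d) \<cdot> h = aarr (v D d) \<cdot> d"
        using arg_cong[OF q(5), of aarr] mh_simps[OF q(1)] mh_simps[OF q(2)] mh_simps[OF q(3)] mh_simps[OF q(4)] by (simp add: aarr_comp cm_def del: arr_Ar)
      then show "(P D d, aarr (u D d)) \<in> spull G h (sieve_gen ?W)"
        using mh_hm(1)[OF q(3)] mh_hm(1)[OF q(4)] d L(1) i unfolding sieve_gen_def spull_iff by blast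
    qed
  qed
  then have "detects B ?W" by (rule detects_sieve_gen) (use Wz(1) in blast)
  then obtain L where L: "L \<subseteq> ?W" "finite L" and LN: "\<And>N. \<lbrakk>md B N; \<forall>(D, d)\<in>L. van B D d N\<rbrakk> \<Longrightarrow> null (ucar N)"
    unfolding detects_def by blast
  \<comment> \<open>The roles are exchanged: \<open>V\<close> describes the image of
    \<open>Spec B\<close> in \<open>Spec (A i)\<close>, and \<open>t\<close> lands in it because
    \<open>\<alpha> i B' t = \<beta> B' h\<close>.\<close>
  have noeth: "noetherian_monoid U C B'" if i: "i \<in> I" and h: "(B', h) \<in> W i" for i B' h
  proof -
    note z = Wz[OF i h]
    obtain t where t: "t \<in> hm (A i) B'" "\<alpha> i B' t = \<beta> B' h" using W(2)[OF i h] by blast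
    obtain V where V0: "image_family B \<beta> (A i) (\<alpha> i) V" using open_immersion_image[OF \<beta> B ma[OF i] cA[OF i]] by blast
    note V = image_familyD[OF V0]
    note Vz = zariski_immersionD[OF V(1)]
    obtain L where L: "L \<subseteq> V" "finite L" and LN: "\<And>N. \<lbrakk>md B' N; \<forall>(D, d)\<in>L. van (A i) D d (rm (cm (A i) B' t) N)\<rbrakk> \<Longrightarrow> null (ucar N)"
      using V(3)[OF t(1) z(1) t(2)[symmetric]] by blast
    have LV: "(D, d) \<in> V" if "(D, d) \<in> L" for D d using that L(1) by blast
    have "\<exists>P u v. pushout (A i) B' D (cm (A i) B' t) (cm (A i) D d) P u v" if "(D, d) \<in> L" for D d
      using pushout_exists[OF hmD(4)[OF t(1)] hmD(4)[OF Vz(1)[OF LV[OF that]]]] by metis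
    then obtain P u v where p: "\<And>D d. (D, d) \<in> L \<Longrightarrow> pushout (A i) B' D (cm (A i) B' t) (cm (A i) D d) (P D d) (u D d) (v D d)" by metis
    show ?thesis
    proof (rule noetherian_descent_family[OF hmD(2)[OF z(1)] L(2), of P u])
      fix D d assume d: "(D, d) \<in> L"
      note q = pushoutD[OF p[OF d]] and dz = Vz[OF LV[OF d]]
      show "mh B' (P D d) (u D d)" by (rule q(3))
      show "flatU B' (P D d) (u D d)" by (rule flatU_pushout[OF p[OF d] dz(2)])
      obtain b where b: "b \<in> hm B D" "\<beta> D b = \<alpha> i D d" using V(2)[OF LV[OF d]] by blast
      \<comment> \<open>Both \<open>\<alpha> i\<close> and \<beta> are injective on sections, so
        each of the two equations is equivalent to equality of the images in
        \<open>X\<close>.\<close>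
      have sq: "k \<bullet> cm B D b = l \<bullet> cm B B' h \<longleftrightarrow> l \<bullet> cm (A i) B' t = k \<bullet> cm (A i) D d" if k: "mh D G k" and l: "mh B' G l" for G k l
      proof -
        note K = mh_hm[OF k] and Lh = mh_hm[OF l]
        have e1: "\<beta> G (aarr k \<cdot> b) = \<alpha> i G (aarr k \<cdot> d)" by (rule mor_nat_eq[OF mb ma[OF i] b(1) dz(1) K(1) b(2)])
        have e2: "\<beta> G (aarr l \<cdot> h) = \<alpha> i G (aarr l \<cdot> t)" by (rule mor_nat_eq[OF mb ma[OF i] z(1) t(1) Lh(1) t(2)[symmetric]])
        have "aarr k \<cdot> b = aarr l \<cdot> h \<longleftrightarrow> aarr l \<cdot> t = aarr k \<cdot> d"
          using e1 e2 open_immersion_inj[OF \<beta> hm_comp[OF b(1) K(1)] hm_comp[OF z(1) Lh(1)]]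
            open_immersion_inj[OF o[OF i] hm_comp[OF t(1) Lh(1)] hm_comp[OF dz(1) K(1)]] by metis
        then show ?thesis
          using cm_comp[OF b(1) K(1)] cm_comp[OF z(1) Lh(1)] cm_comp[OF t(1) Lh(1)] cm_comp[OF dz(1) K(1)]
          unfolding K(2) Lh(2) by (simp add: cm_def)
      qed
      \<comment> \<open>By \<open>sq\<close> the two cospans have the same cocones. The factors are
        exchanged so that \<open>v D d\<close> becomes the base change of
        \<open>cm B B' h\<close>.\<close>
      have p': "pushout B D B' (cm B D b) (cm B B' h) (P D d) (v D d) (u D d)"
        unfolding pushout_def
      proof (intro conjI allI impI)
        show "v D d \<bullet> cm B D b = u D d \<bullet> cm B B' h" using sq[OF q(4,3)] q(5) by simp
        fix G k l assume h: "mh D G k \<and> mh B' G l \<and> k \<bullet> cm B D b = l \<bullet> cm B B' h"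
        then have "l \<bullet> cm (A i) B' t = k \<bullet> cm (A i) D d" using sq by blast
        then have "\<exists>!m. mh (P D d) G m \<and> m \<bullet> u D d = l \<and> m \<bullet> v D d = k" using p[OF d] h unfolding pushout_def by blast
        then show "\<exists>!m. mh (P D d) G m \<and> m \<bullet> v D d = k \<and> m \<bullet> u D d = l" by (simp add: conj_commute)
      qed (use hmD(4)[OF b(1)] hmD(4)[OF z(1)] q in simp_all)
      have "noetherian_monoid U C D" by (rule noetherian_flat_epi[OF A[OF i] dz(3,2)])
      then show "noetherian_monoid U C (P D d)"
        by (rule noetherian_flat_epi[OF _ mepi_pushout[OF p' z(3)] flatU_pushout[OF p' z(2)]])
    next
      fix N assume N: "md B' N" "\<And>D d. (D, d) \<in> L \<Longrightarrow> vanish B' (P D d) (u D d) N"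
      show "null (ucar N)"
      proof (rule LN[OF N(1)], clarify)
        fix D d assume d: "(D, d) \<in> L"
        show "van (A i) D d (rm (cm (A i) B' t) N)" using vanish_pushout[OF p[OF d] N(1)] N(2)[OF d] by (simp add: van_def)
      qed
    qed
  qed
  show ?thesis
  proof (rule noetherian_descent_family[OF B L(2), of "\<lambda>D d. D" "\<lambda>D d. cm B D d"])
    fix D d assume "(D, d) \<in> L"
    then obtain i where i: "i \<in> I" "(D, d) \<in> W i" using L(1) by blast
    show "mh B D (cm B D d)" by (rule hmD(4)[OF Wz(1)[OF i]])
    show "flatU B D (cm B D d)" by (rule Wz(2)[OF i])
    show "noetherian_monoid U C D" by (rule noeth[OF i])
  next
    fix N assume N: "md B N" "\<And>D d. (D, d) \<in> L \<Longrightarrow> vanish B D (cm B D d) N"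
    show "null (ucar N)" by (rule LN[OF N(1)]) (use N(2) in \<open>auto simp: van_def\<close>)
  qed
qed

end

theorem proposition3p7:
  fixes U :: "'u set"
    and C :: "('o, 'a) moncat"
    and X :: "(('o, 'a) mon, 'a, 'x) psh"
    and I :: "'i set"
    and A :: "'i \<Rightarrow> ('o, 'a) mon"
    and \<phi> :: "'i \<Rightarrow> ('o, 'a) mon \<Rightarrow> 'a \<Rightarrow> 'x"
  assumes "relative_geometry_setting U C"
    and "is_scheme U C X"
    and "\<forall>i\<in>I. A i \<in> Ob (Comm C)"
    and "zariski_covering U C I (\<lambda>i. Spec C (A i)) \<phi> X"
    and "\<forall>i\<in>I. noetherian_monoid U C (A i)"
  shows "noetherian_scheme U C X"
proof -
  interpret geometry U C
    using assms(1) relative_geometry_setting.symmetric_monoidal[OF assms(1)] by (simp add: geometry_def)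
  have "noetherian_monoid U C B" if "B \<in> Ob (Comm C)" "open_immersion U C (Spec C B) X \<beta>" for B \<beta>
    by (rule noetherian_open_affine[of X I A \<phi>]) (use assms that in \<open>simp_all add: is_scheme_def zariski_covering_def\<close>)
  then show ?thesis using assms(2) by (simp add: noetherian_scheme_def)
qed

end
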